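(* Let $p>2$ be a prime and let $C_1\neq C_2$ be two maximal cones of the tropical discriminant fan $\Delta_{p,n}\subseteq\mathbb{R}^{n+1}$ meeting in a cone $D=C_1\cap C_2$ of dimension $n-1$. Let $a_1,a_2$ be the two tropical double roots of a generic polynomial $f\in D$. Then: (1) If $a_1\neq a_2$, then $C_1$ and $C_2$ can be of any type, and $D$ is a face of exactly $4$ maximal cones of $\Delta_{p,n}$. (2) If $a_1=a_2$, then, up to order: (a) the only obstruction for the pair of types of $(C_1,C_2)$ is the pair (I, III), i.e. $C_1$ of type I and $C_2$ of type III cannot occur; (b) if both $C_1=\{i,j,k\}$ and $C_2=\{i,j,l\}$ are of type I and the residues of $i,j,k,l$ modulo $p$ are pairwise different, then $D$ is a face of exactly $4$ maximal cones of $\Delta_{p,n}$; otherwise $D$ is a face of exactly $3$ maximal cones of $\Delta_{p,n}$.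
   Context: $\mathbb{K}$ is an algebraically closed field with a nontrivial valuation $v:\mathbb{K}^*\to\mathbb{T}$, $\mathbb{Q}\subseteq\mathbb{T}\subseteq\mathbb{R}$; characteristic $p$ means both $\mathbb{K}$ and its residue field have characteristic $p$. Tropical polynomials $f=\bigoplus_{r=0}^na_rx^r$ are identified with $(a_0,\ldots,a_n)\in\mathbb{R}^{n+1}$. $f$ (with $a_r\in\mathbb{T}$) has a tropical double root at $a\in\mathbb{T}$ if there exist $F=\sum A_rX^r\in\mathbb{K}[X]$ with $v(A_r)=a_r$ and $B\in\mathbb{K}^*$ with $v(B)=a$ which is a multiple root of $F$. $\Delta_{p,n}\subseteq\mathbb{R}^{n+1}$ is the closure of the set of tropical polynomials of degree $n$ having some tropical double root; it is a rational polyhedral fan of codimension 1. $H_{p,n}$ is the closure of the set of $f$ having $0$ as tropical double root; its maximal cells are of type I $\{i,j,k\}$ (minimum of the $a_r$ attained at $i,j,k$ with pairwise distinct residues mod $p$), type II $[\{i,j\},\{k,l\}]$ (minimum attained at $i\neq j$, $i\equiv j \pmod p$, and after deleting all monomials $r\equiv i$ the minimum is attained at $k,l$ with $k\not\equiv l$) and type III $\{\{i,j\},\{k,l\}\}$ (same as II but $k\equiv l$). For $a\in\mathbb{R}$ let $f_a=(a_0,a_1+a,\ldots,a_n+na)$; $f$ has a tropical double root at $a$ iff $f_a\in H_{p,n}$. A maximal cone $C$ of $\Delta_{p,n}$ is said to be of type I, II or III, and is labelled $\{i,j,k\}$, $[\{i,j\},\{k,l\}]$ or $\{\{i,j\},\{k,l\}\}$,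 if for a generic $f\in C$ with tropical double root $a$, $f_a$ lies in the corresponding maximal cell of $H_{p,n}$. *)

theory Defs
  imports
    "HOL-Analysis.Analysis"
    "HOL-Analysis.Finite_Function_Topology"
    "HOL-Computational_Algebra.Computational_Algebra"
begin

section \<open>Valued fields\<close>

text \<open>The value at \<open>0\<close> (which is \<open>+\<infinity>\<close>) is not recorded: \<open>v 0\<close> is an arbitrary real and is
  never used.\<close>

definition valuation :: "('k::field \<Rightarrow> real) \<Rightarrow> bool" where
  "valuation v \<longleftrightarrow>
     (\<forall>x y. x \<noteq> 0 \<longrightarrow> y \<noteq> 0 \<longrightarrow> v (x * y) = v x + v y) \<and>
     (\<forall>x y. x \<noteq> 0 \<longrightarrow> y \<noteq> 0 \<longrightarrow> x + y \<noteq> 0 \<longrightarrow> min (v x) (v y) \<le> v (x + y))"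

definition value_group :: "('k::field \<Rightarrow> real) \<Rightarrow> real set" where
  "value_group v = v ` (UNIV - {0})"

section \<open>Tropical polynomials and their double roots\<close>

text \<open>The space \<open>\<real>\<^sup>n\<^sup>+\<^sup>1\<close> is the subspace of \<^typ>\<open>nat \<Rightarrow>\<^sub>0 real\<close> of vectors supported on the
  indices \<open>0, \<dots>, n\<close>. The norm of \<^typ>\<open>nat \<Rightarrow>\<^sub>0 real\<close> induces the Euclidean topology on it.\<close>

abbreviation cf :: "(nat \<Rightarrow>\<^sub>0 real) \<Rightarrow> nat \<Rightarrow> real" where
  "cf \<equiv> Poly_Mapping.lookup"

definition trop_polys :: "nat \<Rightarrow> (nat \<Rightarrow>\<^sub>0 real) set" where
  "trop_polys n = {f. Poly_Mapping.keys f \<subseteq> {..n}}"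

text \<open>The existence of the lift forces the coefficients of \<open>f\<close> and the root \<open>a\<close> to lie in the
  value group.\<close>

definition has_trop_double_root ::
  "('k::field \<Rightarrow> real) \<Rightarrow> nat \<Rightarrow> (nat \<Rightarrow>\<^sub>0 real) \<Rightarrow> real \<Rightarrow> bool" where
  "has_trop_double_root v n f a \<longleftrightarrow>
     (\<exists>F B. degree F = n \<and> (\<forall>r\<le>n. coeff F r \<noteq> 0 \<and> v (coeff F r) = cf f r) \<and>
            B \<noteq> 0 \<and> v B = a \<and> order B F \<ge> 2)"

definition trop_discriminant :: "('k::field \<Rightarrow> real) \<Rightarrow> nat \<Rightarrow> (nat \<Rightarrow>\<^sub>0 real) set" where
  "trop_discriminant v n = closure {f \<in> trop_polys n. \<exists>a. has_trop_double_root v n f a}"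

definition trop_H :: "('k::field \<Rightarrow> real) \<Rightarrow> nat \<Rightarrow> (nat \<Rightarrow>\<^sub>0 real) set" where
  "trop_H v n = closure {f \<in> trop_polys n. has_trop_double_root v n f 0}"

text \<open>\<open>translate n a f\<close> is the polynomial \<open>f\<^sub>a = (a\<^sub>0, a\<^sub>1 + a, \<dots>, a\<^sub>n + n a)\<close>.\<close>

definition translate :: "nat \<Rightarrow> real \<Rightarrow> (nat \<Rightarrow>\<^sub>0 real) \<Rightarrow> (nat \<Rightarrow>\<^sub>0 real)" where
  "translate n a f = f + (\<Sum>r\<le>n. Poly_Mapping.single r (real r * a))"

text \<open>The tropical double roots of an arbitrary real tropical polynomial, whose coefficients need
  not lie in the value group.\<close>

definition trop_double_roots :: "('k::field \<Rightarrow> real) \<Rightarrow> nat \<Rightarrow> (nat \<Rightarrow>\<^sub>0 real) \<Rightarrow> real set" where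
  "trop_double_roots v n f = {a. translate n a f \<in> trop_H v n}"

section \<open>Fans\<close>

definition rational_polyhedral_cone :: "(nat \<Rightarrow>\<^sub>0 real) set \<Rightarrow> bool" where
  "rational_polyhedral_cone C \<longleftrightarrow>
     (\<exists>S. finite S \<and> (\<forall>x\<in>S. \<forall>r. cf x r \<in> \<rat>) \<and> C = convex_cone hull S)"

text \<open>The cones need not be pointed: the tropical discriminant has a two-dimensional lineality
  space. The empty collection is a fan (it is the one on the empty discriminant of degree
  \<open>n \<le> 1\<close>).\<close>

definition rational_fan :: "(nat \<Rightarrow>\<^sub>0 real) set set \<Rightarrow> bool" where
  "rational_fan \<Sigma> \<longleftrightarrow>
     finite \<Sigma> \<and> (\<forall>C\<in>\<Sigma>. rational_polyhedral_cone C) \<and>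
     (\<forall>C\<in>\<Sigma>. \<forall>F. F face_of C \<and> F \<noteq> {} \<longrightarrow> F \<in> \<Sigma>) \<and>
     (\<forall>C\<in>\<Sigma>. \<forall>C'\<in>\<Sigma>. (C \<inter> C') face_of C \<and> (C \<inter> C') face_of C')"

definition maximal_cones :: "(nat \<Rightarrow>\<^sub>0 real) set set \<Rightarrow> (nat \<Rightarrow>\<^sub>0 real) set set" where
  "maximal_cones \<Sigma> = {C \<in> \<Sigma>. \<forall>C'\<in>\<Sigma>. C \<subseteq> C' \<longrightarrow> C' = C}"

definition regular_point :: "'a::real_normed_vector set \<Rightarrow> 'a \<Rightarrow> bool" where
  "regular_point X x \<longleftrightarrow> x \<in> X \<and> (\<exists>U A. open U \<and> x \<in> U \<and> affine A \<and> X \<inter> U = A \<inter> U)"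

text \<open>In every fan with support \<open>X\<close> the relative interior of a maximal cone consists of regular
  points of \<open>X\<close>, so the maximal cones subdivide the closures of the connected components of the
  regular locus. The last clause says that there is no superfluous subdivision: the regular points
  are exactly the relative interiors of the maximal cones. Hence the maximal cones are the closures
  of these components, so such a fan is unique and every fan with support \<open>X\<close> refines it. When
  \<open>X\<close> is a tropical hypersurface, it is the codimension-one skeleton of the normal fan of the
  Newton polytope.\<close>

definition coarsest_fan_on :: "(nat \<Rightarrow>\<^sub>0 real) set \<Rightarrow> (nat \<Rightarrow>\<^sub>0 real) set set \<Rightarrow> bool" where
  "coarsest_fan_on X \<Sigma> \<longleftrightarrow>
     rational_fan \<Sigma> \<and> \<Union>\<Sigma> = X \<and>
     (\<forall>C \<in> \<Sigma> - maximal_cones \<Sigma>. \<forall>x\<in>C. \<not> regular_point X x)"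

definition generic_on :: "'a::topological_space set \<Rightarrow> ('a \<Rightarrow> bool) \<Rightarrow> bool" where
  "generic_on D P \<longleftrightarrow> (\<exists>U. open U \<and> D \<subseteq> closure (D \<inter> U) \<and> (\<forall>f \<in> D \<inter> U. P f))"

section \<open>Labels and types of maximal cones\<close>

datatype cone_type = TypeI | TypeII | TypeIII

text \<open>\<open>LabelI i j k\<close>, \<open>LabelII i j k l\<close>, \<open>LabelIII i j k l\<close> stand for \<open>{i,j,k}\<close>,
  \<open>[{i,j},{k,l}]\<close> and \<open>{{i,j},{k,l}}\<close>; different labels may name the same cell.\<close>

datatype cell_label =
    LabelI nat nat nat
  | LabelII nat nat nat nat
  | LabelIII nat nat nat nat

fun label_type :: "cell_label \<Rightarrow> cone_type" where
  "label_type (LabelI i j k) = TypeI"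
| "label_type (LabelII i j k l) = TypeII"
| "label_type (LabelIII i j k l) = TypeIII"

fun valid_label :: "nat \<Rightarrow> nat \<Rightarrow> cell_label \<Rightarrow> bool" where
  "valid_label p n (LabelI i j k) \<longleftrightarrow>
     i \<le> n \<and> j \<le> n \<and> k \<le> n \<and> i mod p \<noteq> j mod p \<and> i mod p \<noteq> k mod p \<and> j mod p \<noteq> k mod p"
| "valid_label p n (LabelII i j k l) \<longleftrightarrow>
     i \<le> n \<and> j \<le> n \<and> k \<le> n \<and> l \<le> n \<and> i \<noteq> j \<and> i mod p = j mod p \<and>
     k mod p \<noteq> i mod p \<and> l mod p \<noteq> i mod p \<and> k mod p \<noteq> l mod p"
| "valid_label p n (LabelIII i j k l) \<longleftrightarrow>
     i \<le> n \<and> j \<le> n \<and> k \<le> n \<and> l \<le> n \<and> i \<noteq> j \<and> i mod p = j mod p \<and>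
     k mod p \<noteq> i mod p \<and> k \<noteq> l \<and> k mod p = l mod p"

definition two_step_cell :: "nat \<Rightarrow> nat \<Rightarrow> nat \<Rightarrow> nat \<Rightarrow> nat \<Rightarrow> nat \<Rightarrow> (nat \<Rightarrow>\<^sub>0 real) set" where
  "two_step_cell p n i j k l =
     {f \<in> trop_polys n.
        cf f i = cf f j \<and> (\<forall>r\<le>n. cf f i \<le> cf f r) \<and>
        cf f k = cf f l \<and> (\<forall>r\<le>n. r mod p \<noteq> i mod p \<longrightarrow> cf f k \<le> cf f r)}"

text \<open>The pairs of a type III label are unordered: the minimum may be attained at either of them.
  The two pieces meet along the common facet where all four coefficients agree, and their union is
  the convex cone \<open>a\<^sub>i = a\<^sub>j\<close>, \<open>a\<^sub>k = a\<^sub>l\<close>, \<open>a\<^sub>r \<ge> a\<^sub>i\<close> for \<open>r \<equiv> i\<close>, \<open>a\<^sub>r \<ge> a\<^sub>k\<close> for \<open>r \<equiv> k\<close>, and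
  \<open>a\<^sub>r \<ge> max a\<^sub>i a\<^sub>k\<close> for the other \<open>r\<close>.\<close>

fun label_cell :: "nat \<Rightarrow> nat \<Rightarrow> cell_label \<Rightarrow> (nat \<Rightarrow>\<^sub>0 real) set" where
  "label_cell p n (LabelI i j k) =
     {f \<in> trop_polys n. cf f i = cf f j \<and> cf f j = cf f k \<and> (\<forall>r\<le>n. cf f i \<le> cf f r)}"
| "label_cell p n (LabelII i j k l) = two_step_cell p n i j k l"
| "label_cell p n (LabelIII i j k l) = two_step_cell p n i j k l \<union> two_step_cell p n k l i j"

definition has_label ::
  "nat \<Rightarrow> ('k::field \<Rightarrow> real) \<Rightarrow> nat \<Rightarrow> (nat \<Rightarrow>\<^sub>0 real) set \<Rightarrow> cell_label \<Rightarrow> bool" where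
  "has_label p v n C L \<longleftrightarrow> valid_label p n L \<and>
     generic_on C (\<lambda>f. \<exists>a. trop_double_roots v n f = {a} \<and> translate n a f \<in> label_cell p n L)"

definition has_type ::
  "nat \<Rightarrow> ('k::field \<Rightarrow> real) \<Rightarrow> nat \<Rightarrow> (nat \<Rightarrow>\<^sub>0 real) set \<Rightarrow> cone_type \<Rightarrow> bool" where
  "has_type p v n C t \<longleftrightarrow> (\<exists>L. has_label p v n C L \<and> label_type L = t)"

section \<open>Pairs of adjacent maximal cones\<close>

definition adjacent_cones ::
  "nat \<Rightarrow> (nat \<Rightarrow>\<^sub>0 real) set set \<Rightarrow> (nat \<Rightarrow>\<^sub>0 real) set \<Rightarrow> (nat \<Rightarrow>\<^sub>0 real) set \<Rightarrow> bool" where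
  "adjacent_cones n \<Sigma> C1 C2 \<longleftrightarrow>
     C1 \<in> maximal_cones \<Sigma> \<and> C2 \<in> maximal_cones \<Sigma> \<and> C1 \<noteq> C2 \<and> dim (C1 \<inter> C2) + 1 = n"

text \<open>The two tropical double roots \<open>a\<^sub>1, a\<^sub>2\<close> of a generic \<open>f \<in> D\<close> are different, respectively
  equal.\<close>

definition distinct_double_roots ::
  "('k::field \<Rightarrow> real) \<Rightarrow> nat \<Rightarrow> (nat \<Rightarrow>\<^sub>0 real) set \<Rightarrow> bool" where
  "distinct_double_roots v n D \<longleftrightarrow>
     generic_on D (\<lambda>f. \<exists>a1 a2. trop_double_roots v n f = {a1, a2} \<and> a1 \<noteq> a2)"

definition coincident_double_roots ::
  "('k::field \<Rightarrow> real) \<Rightarrow> nat \<Rightarrow> (nat \<Rightarrow>\<^sub>0 real) set \<Rightarrow> bool" where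
  "coincident_double_roots v n D \<longleftrightarrow>
     generic_on D (\<lambda>f. \<exists>a1 a2. trop_double_roots v n f = {a1, a2} \<and> a1 = a2)"

definition num_maximal_cones_with_face :: "(nat \<Rightarrow>\<^sub>0 real) set set \<Rightarrow> (nat \<Rightarrow>\<^sub>0 real) set \<Rightarrow> nat" where
  "num_maximal_cones_with_face \<Sigma> D = card {C \<in> maximal_cones \<Sigma>. D face_of C}"

end

(* At a multiple root B of F, both F(B) and B F'(B) vanish. In characteristic p the combination
   B F'(B) - c F(B) involves only the exponents not congruent to c. Hence f has the double root a iff
   for every c the minimum of f_r + r a over the r not congruent to c is attained twice. Only two
   linear conditions are imposed on a lift, so a lift is found by solving for two coefficients and
   choosing the other units generically.

   The exponents that matter at a root support linear relations among the coefficients, and relations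
   at distinct roots are in direct sum. So a generic f of D has either two roots, each contributing one
   relation, or one root contributing two. In the first case the discriminant near f is a union of two
   crossing hyperplanes, giving four cones. In the second it is D times three rays in the plane, or
   times four rays if the minimum is attained at exactly four exponents with distinct residues. Only
   the first case has two cones on opposite sides of D spanning the same hyperplane, so the case does
   not depend on f. *)

theory Submission
  imports Defs "HOL-Number_Theory.Cong"
begin

section \<open>Convex geometry of \<open>trop_polys n\<close>: functionals, finitely generated
  cones, and fans known only through their support\<close>

section \<open>Coordinates on the space of tropical polynomials\<close>

text \<open>The fan is given only by its support and by the condition that regular points lie on no
  smaller cone. No cone is available by a formula: the maximal cones at a point have to be recovered
  from the shape of the discriminant near it. The delicate case is that of two opposite
  half-hyperplanes, which might belong to one cone; they are separated with the help of a
  transversal half-hyperplane through the same point.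

  Genericity in \<open>D\<close> becomes algebra by letting \<open>f\<close> avoid finitely many
  proper hyperplanes: every linear relation seen at a root of \<open>f\<close> then vanishes on all
  of \<open>D\<close>. As \<open>D\<close> has dimension \<open>n - 1\<close> in a space of
  dimension \<open>n + 1\<close>, at most two independent relations are possible. Since
  \<open>D\<close> lies in two maximal cones, \<open>f\<close> is not regular, which discards roots
  with two relations at which the discriminant is still a hyperplane, such as the common facet of
  the two pieces of a type III cell.

  The missing pair (I, III) comes from the number of heights. Around a single root, type I occurs
  only if all relevant exponents share one height, type III only if they have two.\<close>

lemma cf_scaleR [simp]: "cf (c *\<^sub>R x) r = c * cf x r"
  by (simp add: scaleR_poly_mapping_def)

lemma abs_cf_le_norm: "\<bar>cf x r\<bar> \<le> norm x"
proof (cases "r \<in> Poly_Mapping.keys x")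
  case True
  have "norm x = (\<Sum>k\<in>Poly_Mapping.keys x. \<bar>cf x k\<bar>)"
    by (simp add: norm_poly_mapping_def dist_poly_mapping_def)
  then show ?thesis
    using True member_le_sum[of r "Poly_Mapping.keys x" "\<lambda>k. \<bar>cf x k\<bar>"] by simp
next
  case False
  then show ?thesis by (simp add: in_keys_iff)
qed

lemma bounded_linear_cf: "bounded_linear (\<lambda>x. cf x r)"
  by (rule bounded_linear_intro[where K = 1]) (auto simp: lookup_add abs_cf_le_norm)

lemmas tendsto_cf [tendsto_intros] = bounded_linear.tendsto[OF bounded_linear_cf]
lemmas continuous_on_cf [continuous_intros] = bounded_linear.continuous_on[OF bounded_linear_cf]

lemma trop_polys_iff: "f \<in> trop_polys n \<longleftrightarrow> (\<forall>r>n. cf f r = 0)"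
  by (auto simp: trop_polys_def in_keys_iff subset_iff) (meson not_le)

lemma subspace_trop_polys: "subspace (trop_polys n)"
  by (auto simp: subspace_def trop_polys_iff lookup_add)

lemmas trop_polys_add = subspace_add[OF subspace_trop_polys]
lemmas trop_polys_diff = subspace_diff[OF subspace_trop_polys]
lemmas trop_polys_scale = subspace_scale[OF subspace_trop_polys]

lemma closed_trop_polys: "closed (trop_polys n)"
proof -
  have "trop_polys n = (\<Inter>r\<in>{n<..}. {f. cf f r = 0})"
    by (auto simp: trop_polys_iff)
  then show ?thesis
    by (auto intro!: closed_Collect_eq continuous_intros)
qed

lemma norm_le_sum_cf:
  assumes "x \<in> trop_polys n"
  shows "norm x \<le> (\<Sum>r\<le>n. \<bar>cf x r\<bar>)"
proof -
  have "norm x = (\<Sum>k\<in>Poly_Mapping.keys x. \<bar>cf x k\<bar>)"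
    by (simp add: norm_poly_mapping_def dist_poly_mapping_def)
  also have "\<dots> \<le> (\<Sum>r\<le>n. \<bar>cf x r\<bar>)"
    by (rule sum_mono2) (use assms in \<open>auto simp: trop_polys_def\<close>)
  finally show ?thesis .
qed

text \<open>A sup-norm box in the coordinates up to \<open>n\<close> only: open in the whole space
  and, within \<open>trop_polys n\<close>, a neighbourhood basis. Local statements are phrased with
  it.\<close>

definition coord_box :: "nat \<Rightarrow> (nat \<Rightarrow>\<^sub>0 real) \<Rightarrow> real \<Rightarrow> (nat \<Rightarrow>\<^sub>0 real) set" where
  "coord_box n f e = {g. \<forall>r\<le>n. \<bar>cf g r - cf f r\<bar> < e}"

lemma coord_boxI: "(\<And>r. r \<le> n \<Longrightarrow> \<bar>cf g r - cf f r\<bar> < e) \<Longrightarrow> g \<in> coord_box n f e"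
  by (simp add: coord_box_def)

lemma coord_boxD: "g \<in> coord_box n f e \<Longrightarrow> r \<le> n \<Longrightarrow> \<bar>cf g r - cf f r\<bar> < e"
  by (simp add: coord_box_def)

lemma centre_in_coord_box [simp]: "0 < e \<Longrightarrow> f \<in> coord_box n f e"
  by (simp add: coord_box_def)

lemma coord_box_mono: "d \<le> e \<Longrightarrow> coord_box n f d \<subseteq> coord_box n f e"
  by (auto simp: coord_box_def)

lemma open_coord_box: "open (coord_box n f e)"
proof -
  have "coord_box n f e = (\<Inter>r\<in>{..n}. {g. \<bar>cf g r - cf f r\<bar> < e})"
    by (auto simp: coord_box_def)
  then show ?thesis
    by (auto intro!: open_INT open_Collect_less continuous_intros)
qed

text \<open>The norm is the sum of the absolute values of the coordinates, hence the radius
  \<open>d / (n + 1)\<close>.\<close>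

lemma coord_box_basis:
  assumes "open U" "f \<in> U" "f \<in> trop_polys n"
  obtains e where "e > 0" "trop_polys n \<inter> coord_box n f e \<subseteq> U"
proof -
  obtain d where d: "d > 0" "ball f d \<subseteq> U"
    using assms openE by blast
  have "g \<in> ball f d" if "g \<in> trop_polys n" "g \<in> coord_box n f (d / (n + 1))" for g
  proof -
    have "dist f g = norm (g - f)"
      by (simp add: dist_norm norm_minus_commute)
    also have "\<dots> \<le> (\<Sum>r\<le>n. \<bar>cf (g - f) r\<bar>)"
      using norm_le_sum_cf that assms by (simp add: trop_polys_diff)
    also have "\<dots> < (\<Sum>r\<le>n. d / (n + 1))"
      by (rule sum_strict_mono) (use that in \<open>auto simp: lookup_minus coord_box_def\<close>)
    also have "\<dots> = d" by simp
    finally show ?thesis by simp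
  qed
  then show thesis using d that[of "d / (n + 1)"] by (auto simp: subset_iff)
qed

text \<open>Carries local information along short segments. The bound \<open>d < 1\<close> makes
  \<open>f + d *\<^sub>R (g - f)\<close> a proper convex combination of \<open>f\<close> and
  \<open>g\<close>.\<close>

lemma coord_box_segment:
  assumes "f \<in> trop_polys n" "e > 0"
  obtains d where "d > 0" "d < 1" "\<And>t. \<bar>t\<bar> \<le> d \<Longrightarrow> f + t *\<^sub>R x \<in> coord_box n f e"
proof -
  define d where "d = min (1/2) (e / (2 * (norm x + 1)))"
  have "d > 0" using assms by (simp add: d_def add_nonneg_pos)
  moreover have "d < 1" by (simp add: d_def)
  moreover have "f + t *\<^sub>R x \<in> coord_box n f e" if "\<bar>t\<bar> \<le> d" for t
  proof (rule coord_boxI)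
    fix r
    have "\<bar>t * cf x r\<bar> \<le> \<bar>t\<bar> * norm x"
      by (simp add: abs_mult abs_cf_le_norm mult_left_mono)
    also have "\<dots> \<le> \<bar>t\<bar> * (norm x + 1)" by (simp add: mult_left_mono)
    also have "\<dots> \<le> (e / (2 * (norm x + 1))) * (norm x + 1)"
      using that by (intro mult_right_mono) (auto simp: d_def)
    also have "\<dots> = e / 2"
    proof -
      have "norm x + 1 \<noteq> 0" using norm_ge_zero[of x] by linarith
      then show ?thesis by (simp add: field_simps)
    qed
    also have "\<dots> < e" using assms by simp
    finally show "\<bar>cf (f + t *\<^sub>R x) r - cf f r\<bar> < e"
      by (simp add: lookup_add)
  qed
  ultimately show thesis using that by blast
qed

definition of_coords :: "nat \<Rightarrow> (nat \<Rightarrow> real) \<Rightarrow> (nat \<Rightarrow>\<^sub>0 real)" where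
  "of_coords n h = (\<Sum>r\<le>n. Poly_Mapping.single r (h r))"

lemma cf_of_coords [simp]: "cf (of_coords n h) r = (if r \<le> n then h r else 0)"
  by (simp add: of_coords_def lookup_sum lookup_single when_def)

lemma of_coords_in [simp]: "of_coords n h \<in> trop_polys n"
  by (simp add: trop_polys_iff)

abbreviation unit_coord :: "nat \<Rightarrow> (nat \<Rightarrow>\<^sub>0 real)" where
  "unit_coord r \<equiv> Poly_Mapping.single r 1"

lemma unit_coord_in: "r \<le> n \<Longrightarrow> unit_coord r \<in> trop_polys n"
  by (auto simp: trop_polys_iff lookup_single)

lemma trop_polys_expansion:
  assumes "f \<in> trop_polys n" shows "f = (\<Sum>r\<le>n. cf f r *\<^sub>R unit_coord r)"
  by (rule poly_mapping_eqI)
    (use assms in \<open>auto simp: lookup_sum lookup_single when_def trop_polys_iff if_distrib cong: if_cong\<close>)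

lemma trop_polys_subset_span: "trop_polys n \<subseteq> span (unit_coord ` {..n})"
proof
  fix f assume "f \<in> trop_polys n"
  moreover have "(\<Sum>r\<le>n. cf f r *\<^sub>R unit_coord r) \<in> span (unit_coord ` {..n})"
    by (intro span_sum span_scale span_base) auto
  ultimately show "f \<in> span (unit_coord ` {..n})" using trop_polys_expansion by metis
qed

lemma independent_unit_coords: "independent (unit_coord ` {..n})"
  unfolding independent_explicit_module
proof (intro allI impI)
  fix t u v
  assume t: "finite t" "t \<subseteq> unit_coord ` {..n}" "(\<Sum>v\<in>t. u v *\<^sub>R v) = 0" "v \<in> t"
  then obtain r where r: "v = unit_coord r" by auto
  have "0 = cf (\<Sum>v\<in>t. u v *\<^sub>R v) r" using t by simp
  also have "\<dots> = (\<Sum>w\<in>t. if w = v then u v else 0)"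
    unfolding lookup_sum
  proof (rule sum.cong[OF refl])
    fix w assume "w \<in> t"
    then obtain s where s: "w = unit_coord s" using t by auto
    have "s = r \<longleftrightarrow> w = v"
      using r s by (metis lookup_single_eq lookup_single_not_eq zero_neq_one)
    then show "cf (u w *\<^sub>R w) r = (if w = v then u v else 0)"
      using r s by (auto simp: lookup_single when_def)
  qed
  also have "\<dots> = u v" using t by simp
  finally show "u v = 0" by simp
qed

lemma card_unit_coords: "card (unit_coord ` {..n}) = n + 1"
proof -
  have "inj_on unit_coord {..n}"
    by (rule inj_onI) (metis lookup_single_eq lookup_single_not_eq zero_neq_one)
  then show ?thesis by (simp add: card_image)
qed

section \<open>Linear functionals and their common kernels\<close>

text \<open>Functionals are bare coefficient sequences of which only the entries up to
  \<open>n\<close> count, so identities between them are stated for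
  \<open>r \<le> n\<close>.\<close>

definition pair :: "nat \<Rightarrow> (nat \<Rightarrow> real) \<Rightarrow> (nat \<Rightarrow>\<^sub>0 real) \<Rightarrow> real" where
  "pair n l g = (\<Sum>r\<le>n. l r * cf g r)"

lemma pair_add: "pair n l (x + y) = pair n l x + pair n l y"
  by (simp add: pair_def lookup_add algebra_simps sum.distrib)

lemma pair_diff: "pair n l (x - y) = pair n l x - pair n l y"
  by (simp add: pair_def lookup_minus algebra_simps sum_subtractf)

lemma pair_scale: "pair n l (c *\<^sub>R x) = c * pair n l x"
  by (simp add: pair_def sum_distrib_left algebra_simps)

lemma pair_0 [simp]: "pair n l 0 = 0"
  by (simp add: pair_def)

lemmas pair_simps = pair_add pair_diff pair_scale

lemma pair_lin_comb: "pair n (\<lambda>r. s * l r + t * m r) g = s * pair n l g + t * pair n m g"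
  by (simp add: pair_def sum_distrib_left algebra_simps sum.distrib)

lemma pair_unit_coord: "r \<le> n \<Longrightarrow> pair n l (unit_coord r) = l r"
  by (simp add: pair_def lookup_single when_def if_distrib cong: if_cong)

lemma subspace_pair: "subspace {g. pair n l g = 0}"
  by (auto simp: subspace_def pair_simps)

lemma continuous_on_pair [continuous_intros]: "continuous_on A (pair n l)"
  unfolding pair_def by (intro continuous_intros)

lemma pair_sum: "pair n (\<lambda>r. \<Sum>i\<in>I. c i * l i r) g = (\<Sum>i\<in>I. c i * pair n (l i) g)"
  unfolding pair_def sum_distrib_left sum_distrib_right
  by (subst sum.swap) (simp add: mult.assoc)

definition indep_family :: "nat \<Rightarrow> 'i set \<Rightarrow> ('i \<Rightarrow> nat \<Rightarrow> real) \<Rightarrow> bool" where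
  "indep_family n I l \<longleftrightarrow>
     finite I \<and> (\<forall>c. (\<forall>r\<le>n. (\<Sum>i\<in>I. c i * l i r) = 0) \<longrightarrow> (\<forall>i\<in>I. c i = 0))"

text \<open>Read through the standard inner product, the functionals are vectors orthogonal to
  \<open>D\<close>. A basis of \<open>D\<close> stays independent when they are added, and the total
  is bounded by the ambient dimension.\<close>

lemma card_indep_family_dim:
  assumes D: "D \<subseteq> trop_polys n" and ind: "indep_family n I l"
    and van: "\<And>i g. i \<in> I \<Longrightarrow> g \<in> D \<Longrightarrow> pair n (l i) g = 0"
  shows "card I + dim D \<le> n + 1"
proof -
  obtain B where B: "B \<subseteq> D" "independent B" "D \<subseteq> span B" "card B = dim D"
    using basis_exists by blast
  have fin: "finite B"
    using independent_span_bound[of "unit_coord ` {..n}" B] B D trop_polys_subset_span by blast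
  define L where "L i = of_coords n (l i)" for i
  have finI: "finite I" using ind by (simp add: indep_family_def)
  have "inj_on L J \<and> B \<inter> L ` J = {} \<and> independent (B \<union> L ` J)" if "finite J" "J \<subseteq> I" for J
    using that
  proof (induction J)
    case empty
    then show ?case using B by simp
  next
    case (insert j J)
    have IH: "inj_on L J" "B \<inter> L ` J = {}" "independent (B \<union> L ` J)"
      using insert by auto
    have notin: "L j \<notin> span (B \<union> L ` J)"
    proof
      assume "L j \<in> span (B \<union> L ` J)"
      then obtain b y where bdec: "b \<in> span B" "y \<in> span (L ` J)" "L j = b + y"
        by (auto simp: span_Un)
      then obtain u where u: "y = (\<Sum>v\<in>L ` J. u v *\<^sub>R v)"
        using span_finite[of "L ` J"] insert by auto
      define c where "c i = (if i = j then 1 else - u (L i))" for i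
      have y: "y = (\<Sum>i\<in>J. u (L i) *\<^sub>R L i)"
        using u IH by (simp add: sum.reindex)
      have bc: "cf b r = (\<Sum>i\<in>insert j J. c i * l i r)" if "r \<le> n" for r
      proof -
        have "b = L j - y" using bdec by simp
        then have "cf b r = l j r - (\<Sum>i\<in>J. u (L i) * l i r)"
          using that by (simp add: lookup_minus y lookup_sum L_def)
        also have "(\<Sum>i\<in>J. u (L i) * l i r) = - (\<Sum>i\<in>J. c i * l i r)"
          unfolding sum_negf[symmetric] using insert by (intro sum.cong) (auto simp: c_def)
        finally show ?thesis using insert by (simp add: c_def)
      qed
      have "pair n (l i) g = 0" if "i \<in> insert j J" "g \<in> B" for i g
        using that van B insert by blast
      then have "pair n (\<lambda>r. \<Sum>i\<in>insert j J. c i * l i r) g = 0" if "g \<in> B" for g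
        unfolding pair_sum using that by (intro sum.neutral) (metis mult_zero_right)
      then have "B \<subseteq> {g. pair n (\<lambda>r. \<Sum>i\<in>insert j J. c i * l i r) g = 0}" by blast
      then have "span B \<subseteq> {g. pair n (\<lambda>r. \<Sum>i\<in>insert j J. c i * l i r) g = 0}"
        by (rule span_minimal[OF _ subspace_pair])
      then have "pair n (\<lambda>r. \<Sum>i\<in>insert j J. c i * l i r) b = 0" using bdec(1) by blast
      \<comment> \<open>\<open>b\<close> lies in the span of \<open>D\<close>, and its coordinates
        are a combination of functionals vanishing there: it is orthogonal to itself.\<close>
      moreover have "pair n (\<lambda>r. \<Sum>i\<in>insert j J. c i * l i r) b = (\<Sum>r\<le>n. (cf b r)\<^sup>2)"
        unfolding pair_def
      proof (rule sum.cong[OF refl])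
        fix r assume "r \<in> {..n}"
        then show "(\<Sum>i\<in>insert j J. c i * l i r) * cf b r = (cf b r)\<^sup>2"
          using bc[of r, symmetric] by (simp only: atMost_iff power2_eq_square)
      qed
      ultimately have "(\<Sum>r\<le>n. (cf b r)\<^sup>2) = 0" by (simp only:)
      then have "cf b r = 0" if "r \<le> n" for r
        using that by (simp add: sum_nonneg_eq_0_iff)
      then have z: "(\<Sum>i\<in>insert j J. c i * l i r) = 0" if "r \<le> n" for r
        using bc[OF that] that by (simp only:)
      define c' where "c' i = (if i \<in> insert j J then c i else 0)" for i
      have "(\<Sum>i\<in>I. c' i * l i r) = 0" if "r \<le> n" for r
      proof -
        have "(\<Sum>i\<in>I. c' i * l i r) = (\<Sum>i\<in>insert j J. c' i * l i r)"
          by (rule sum.mono_neutral_right) (use insert finI in \<open>auto simp: c'_def\<close>)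
        also have "\<dots> = (\<Sum>i\<in>insert j J. c i * l i r)"
          by (rule sum.cong) (auto simp: c'_def)
        finally show ?thesis using z[OF that] by simp
      qed
      then have "\<forall>i\<in>I. c' i = 0" using ind unfolding indep_family_def by blast
      moreover have "j \<in> I" using insert.prems by auto
      ultimately have "c' j = 0" by (rule bspec)
      then show False by (simp add: c'_def c_def)
    qed
    have "L j \<notin> B \<union> L ` J" using notin by (rule contrapos_nn) (rule span_base)
    then show ?case using IH notin insert by (auto simp: independent_insert)
  qed
  then have *: "inj_on L I" "B \<inter> L ` I = {}" "independent (B \<union> L ` I)"
    using finI by auto
  have "B \<union> L ` I \<subseteq> span (unit_coord ` {..n})"
    using B D trop_polys_subset_span by (fastforce simp: L_def)
  then have "card (B \<union> L ` I) \<le> n + 1"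
    using independent_span_bound[OF _ *(3)] card_unit_coords[of n] by (metis finite_atMost finite_imageI)
  then show ?thesis
    using * fin finI B by (simp add: card_Un_disjoint card_image)
qed

text \<open>Near \<open>f\<close> the set \<open>D\<close> fills the common kernel of
  \<open>a\<close> and \<open>b\<close>, so each kernel direction is a rescaled difference of two
  points of \<open>D\<close>; together with the dual vectors \<open>u\<close>, \<open>w\<close>
  these span everything.\<close>

lemma dim_kernel_of_two:
  assumes D: "D \<subseteq> trop_polys n" "f \<in> D" and e: "e > 0"
    and uw: "u \<in> trop_polys n" "w \<in> trop_polys n"
      "pair n a u = 1" "pair n b u = 0" "pair n a w = 0" "pair n b w = 1"
    and ker: "\<And>g. g \<in> D \<Longrightarrow> pair n a g = 0 \<and> pair n b g = 0"
    and nbhd: "\<And>g. g \<in> trop_polys n \<Longrightarrow> g \<in> coord_box n f e \<Longrightarrow> pair n a g = 0 \<Longrightarrow> pair n b g = 0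
      \<Longrightarrow> g \<in> D"
  shows "dim D + 1 = n"
proof -
  define l where "l i = (if i then a else b)" for i
  have "indep_family n UNIV l"
    unfolding indep_family_def
  proof (intro conjI allI impI)
    fix c
    assume c: "\<forall>r\<le>n. (\<Sum>i\<in>UNIV. c i * l i r) = 0"
    have "0 = pair n (\<lambda>r. \<Sum>i\<in>UNIV. c i * l i r) g" for g
      using c by (simp add: pair_def)
    then have *: "0 = c True * pair n a g + c False * pair n b g" for g
      unfolding pair_sum UNIV_bool by (simp add: l_def add.commute)
    show "\<forall>i\<in>UNIV. c i = 0"
      using *[of u] *[of w] uw by (auto simp: all_bool_eq)
  qed auto
  then have "card (UNIV :: bool set) + dim D \<le> n + 1"
    using ker D by (intro card_indep_family_dim) (auto simp: l_def)
  then have upper: "dim D + 2 \<le> n + 1" by simp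
  have fV: "f \<in> trop_polys n" using D by auto
  have kerD: "x \<in> span D" if x: "x \<in> trop_polys n" "pair n a x = 0" "pair n b x = 0" for x
  proof -
    obtain d where d: "d > 0" "d < 1" "\<And>t. \<bar>t\<bar> \<le> d \<Longrightarrow> f + t *\<^sub>R x \<in> coord_box n f e"
      using coord_box_segment[OF fV e] by metis
    have "f + d *\<^sub>R x \<in> D"
      using d ker[OF \<open>f \<in> D\<close>] x fV by (intro nbhd) (auto simp: pair_simps trop_polys_add trop_polys_scale)
    then have "(1/d) *\<^sub>R ((f + d *\<^sub>R x) - f) \<in> span D"
      using D by (intro span_scale span_diff span_base)
    then show ?thesis using d by simp
  qed
  obtain B where B: "B \<subseteq> D" "independent B" "D \<subseteq> span B" "card B = dim D"
    using basis_exists by blast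
  have fin: "finite B"
    using independent_span_bound[of "unit_coord ` {..n}" B] B D trop_polys_subset_span by blast
  have DB: "span D \<subseteq> span B" using B by (metis span_mono span_span)
  have "trop_polys n \<subseteq> span (B \<union> {u, w})"
  proof
    fix g assume g: "g \<in> trop_polys n"
    let ?k = "g - pair n a g *\<^sub>R u - pair n b g *\<^sub>R w"
    have "?k \<in> span D"
      using g uw by (intro kerD) (auto simp: pair_simps trop_polys_diff trop_polys_scale)
    then have "?k \<in> span (B \<union> {u, w})" using DB span_mono[OF Un_upper1, of B "{u, w}"] by (meson subsetD)
    then have "?k + pair n a g *\<^sub>R u + pair n b g *\<^sub>R w \<in> span (B \<union> {u, w})"
      by (rule span_add[OF span_add[OF _ span_scale[OF span_base]] span_scale[OF span_base]]) auto
    then show "g \<in> span (B \<union> {u, w})" by simp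
  qed
  then have "unit_coord ` {..n} \<subseteq> span (B \<union> {u, w})"
    using unit_coord_in by blast
  then have "n + 1 \<le> card (B \<union> {u, w})"
    using independent_span_bound[OF _ independent_unit_coords, of "B \<union> {u, w}" n] fin
    by (simp add: card_unit_coords del: One_nat_def)
  also have "\<dots> \<le> card B + card {u, w}" by (rule card_Un_le)
  also have "\<dots> \<le> dim D + 2" using B by (simp add: card_insert_if)
  finally show ?thesis using upper by simp
qed

text \<open>Cramer's rule: on the coordinates \<open>r\<close> and \<open>s\<close>, the vectors
  \<open>u\<close> and \<open>w\<close> are the columns of the inverse of the matrix with rows
  \<open>a\<close> and \<open>b\<close>.\<close>

lemma dual_pair_exists:
  assumes "r \<le> n" "s \<le> n" "a r * b s - a s * b r \<noteq> (0::real)"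
  obtains u w where "u \<in> trop_polys n" "w \<in> trop_polys n"
      "pair n a u = 1" "pair n b u = 0" "pair n a w = 0" "pair n b w = 1"
proof -
  let ?d = "a r * b s - a s * b r"
  let ?u = "(b s / ?d) *\<^sub>R unit_coord r - (b r / ?d) *\<^sub>R unit_coord s"
  let ?w = "(a r / ?d) *\<^sub>R unit_coord s - (a s / ?d) *\<^sub>R unit_coord r"
  show thesis
  proof
    show "?u \<in> trop_polys n" "?w \<in> trop_polys n"
      using assms by (auto intro!: trop_polys_diff trop_polys_scale unit_coord_in)
    have "b s * a r / ?d - b r * a s / ?d = ?d / ?d"
      unfolding diff_divide_distrib[symmetric] by (simp add: algebra_simps)
    then show "pair n a ?u = 1" using assms(3) by (simp add: pair_simps pair_unit_coord assms(1,2))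
    show "pair n b ?u = 0" "pair n a ?w = 0"
      by (simp_all add: pair_simps pair_unit_coord assms(1,2))
    have "a r * b s / ?d - a s * b r / ?d = ?d / ?d"
      unfolding diff_divide_distrib[symmetric] by simp
    then show "pair n b ?w = 1" using assms(3) by (simp add: pair_simps pair_unit_coord assms(1,2))
  qed
qed

lemma indep_pair_minor:
  assumes ind: "\<And>s t. (\<And>r. r \<le> n \<Longrightarrow> s * a r + t * b r = (0::real)) \<Longrightarrow> s = 0 \<and> t = 0"
  shows "\<exists>r s. r \<le> n \<and> s \<le> n \<and> a r * b s - a s * b r \<noteq> 0"
proof (rule ccontr)
  assume nt: "\<nexists>r s. r \<le> n \<and> s \<le> n \<and> a r * b s - a s * b r \<noteq> 0"
  have *: "a r * b s = a s * b r" if "r \<le> n" "s \<le> n" for r s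
    using nt that by (metis diff_self eq_iff_diff_eq_0)
  have "\<exists>r\<le>n. a r \<noteq> 0"
  proof (rule ccontr)
    assume "\<nexists>r. r \<le> n \<and> a r \<noteq> 0"
    then have "1 * a r + 0 * b r = 0" if "r \<le> n" for r using that by simp
    from ind[OF this] show False by simp
  qed
  then obtain r where r: "r \<le> n" "a r \<noteq> 0" by blast
  have "b r * a s + (- a r) * b s = 0" if "s \<le> n" for s
    using *[OF r(1) that] by (simp add: algebra_simps)
  from ind[OF this] r show False by simp
qed

section \<open>Finitely generated cones\<close>

lemma convex_cone_hull_finite:
  fixes S :: "'a::real_vector set"
  assumes "finite S"
  shows "convex_cone hull S = {\<Sum>s\<in>S. t s *\<^sub>R s | t. \<forall>s\<in>S. 0 \<le> t s}"
proof
  have cc: "convex_cone {\<Sum>s\<in>S. t s *\<^sub>R s | t. \<forall>s\<in>S. (0::real) \<le> t s}"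
    unfolding convex_cone_iff
  proof (intro conjI ballI allI impI)
    show "0 \<in> {\<Sum>s\<in>S. t s *\<^sub>R s | t. \<forall>s\<in>S. (0::real) \<le> t s}"
      by (auto intro!: exI[of _ "\<lambda>_. 0"])
  next
    fix x y
    assume "x \<in> {\<Sum>s\<in>S. t s *\<^sub>R s | t. \<forall>s\<in>S. (0::real) \<le> t s}"
      and "y \<in> {\<Sum>s\<in>S. t s *\<^sub>R s | t. \<forall>s\<in>S. (0::real) \<le> t s}"
    then obtain t t' where "x = (\<Sum>s\<in>S. t s *\<^sub>R s)" "\<forall>s\<in>S. 0 \<le> t s"
        "y = (\<Sum>s\<in>S. t' s *\<^sub>R s)" "\<forall>s\<in>S. 0 \<le> t' s" by blast
    then show "x + y \<in> {\<Sum>s\<in>S. t s *\<^sub>R s | t. \<forall>s\<in>S. (0::real) \<le> t s}"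
      by (auto intro!: exI[of _ "\<lambda>s. t s + t' s"] simp: scaleR_add_left sum.distrib)
  next
    fix x and c :: real
    assume "x \<in> {\<Sum>s\<in>S. t s *\<^sub>R s | t. \<forall>s\<in>S. (0::real) \<le> t s}" "0 \<le> c"
    then obtain t where "x = (\<Sum>s\<in>S. t s *\<^sub>R s)" "\<forall>s\<in>S. 0 \<le> t s" by blast
    then show "c *\<^sub>R x \<in> {\<Sum>s\<in>S. t s *\<^sub>R s | t. \<forall>s\<in>S. (0::real) \<le> t s}"
      using \<open>0 \<le> c\<close> by (auto intro!: exI[of _ "\<lambda>s. c * t s"] simp: scaleR_sum_right)
  qed
  show "convex_cone hull S \<subseteq> {\<Sum>s\<in>S. t s *\<^sub>R s | t. \<forall>s\<in>S. 0 \<le> t s}"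
  proof (rule hull_minimal[where S = convex_cone, OF _ cc], rule subsetI)
    fix s assume s: "s \<in> S"
    have "s = (\<Sum>r\<in>S. (if r = s then 1 else 0) *\<^sub>R r)"
      using assms s by (simp add: if_distrib[of "\<lambda>c. c *\<^sub>R _"] cong: if_cong)
    then show "s \<in> {\<Sum>s\<in>S. t s *\<^sub>R s | t. \<forall>s\<in>S. (0::real) \<le> t s}"
      by (intro CollectI exI[of _ "\<lambda>r. if r = s then 1 else 0"]) auto
  qed
  show "{\<Sum>s\<in>S. t s *\<^sub>R s | t. \<forall>s\<in>S. 0 \<le> t s} \<subseteq> convex_cone hull S"
  proof clarify
    fix t :: "'a \<Rightarrow> real" assume t: "\<forall>s\<in>S. 0 \<le> t s"
    have "(\<Sum>s\<in>T. t s *\<^sub>R s) \<in> convex_cone hull S" if "finite T" "T \<subseteq> S" for T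
      using that
    proof (induction T)
      case empty
      then show ?case by (simp add: convex_cone_hull_contains_0)
    next
      case (insert s T)
      then show ?case using t
        by (auto intro!: convex_cone_hull_add convex_cone_hull_mul intro: hull_inc)
    qed
    then show "(\<Sum>s\<in>S. t s *\<^sub>R s) \<in> convex_cone hull S" using assms by blast
  qed
qed

text \<open>Coefficients are moved along a linear relation until the first one reaches zero, and
  that generator is dropped. This writes a finitely generated cone as a finite union of simplicial
  ones, from which closedness follows.\<close>

lemma caratheodory_cone:
  fixes S :: "'a::real_vector set"
  assumes "finite S" "\<forall>s\<in>S. 0 \<le> t s"
  shows "\<exists>B t'. B \<subseteq> S \<and> independent B \<and> (\<forall>s\<in>B. 0 \<le> t' s) \<and>
    (\<Sum>s\<in>S. t s *\<^sub>R s) = (\<Sum>s\<in>B. t' s *\<^sub>R s)"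
  using assms
proof (induction "card S" arbitrary: S t rule: less_induct)
  case less
  show ?case
  proof (cases "independent S")
    case True
    then show ?thesis using less.prems by blast
  next
    case False
    then obtain c0 v0 where c0: "v0 \<in> S" "c0 v0 \<noteq> 0" "(\<Sum>v\<in>S. c0 v *\<^sub>R v) = 0"
      using less.prems by (auto simp: dependent_finite)
    \<comment> \<open>The sign is chosen so that one coefficient is positive and \<open>P\<close>
      below is not empty.\<close>
    define c where "c v = sgn (c0 v0) * c0 v" for v
    have c: "c v0 > 0" "(\<Sum>v\<in>S. c v *\<^sub>R v) = 0"
    proof -
      show "c v0 > 0" using c0 by (simp add: c_def sgn_if)
      have "(\<Sum>v\<in>S. c v *\<^sub>R v) = sgn (c0 v0) *\<^sub>R (\<Sum>v\<in>S. c0 v *\<^sub>R v)"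
        by (simp add: c_def scaleR_sum_right)
      then show "(\<Sum>v\<in>S. c v *\<^sub>R v) = 0" using c0 by simp
    qed
    define P where "P = {v\<in>S. c v > 0}"
    have P: "finite P" "v0 \<in> P" using less.prems c c0 by (auto simp: P_def)
    \<comment> \<open>The largest step along \<open>c\<close> that keeps all coefficients
      nonnegative.\<close>
    define m where "m = Min ((\<lambda>v. t v / c v) ` P)"
    have "m \<in> (\<lambda>v. t v / c v) ` P" unfolding m_def using P by (intro Min_in) auto
    then obtain s1 where s1: "s1 \<in> P" "m = t s1 / c s1" by blast
    have mle: "m \<le> t v / c v" if "v \<in> P" for v
      unfolding m_def using P that by (intro Min_le) auto
    have m0: "0 \<le> m" using s1 less.prems by (auto simp: P_def)
    define t1 where "t1 v = t v - m * c v" for v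
    have t1: "0 \<le> t1 v" if "v \<in> S" for v
    proof (cases "c v > 0")
      case True
      then show ?thesis using mle[of v] that by (simp add: P_def t1_def field_simps)
    next
      case False
      then have "m * c v \<le> 0" using m0 by (simp add: mult_nonneg_nonpos)
      then show ?thesis using less.prems that by (fastforce simp: t1_def)
    qed
    have t1s: "t1 s1 = 0" "s1 \<in> S" using s1 by (auto simp: t1_def P_def)
    have "(\<Sum>s\<in>S. t1 s *\<^sub>R s) = (\<Sum>s\<in>S. t s *\<^sub>R s) - m *\<^sub>R (\<Sum>s\<in>S. c s *\<^sub>R s)"
      by (simp add: t1_def scaleR_diff_left sum_subtractf scaleR_sum_right)
    then have "(\<Sum>s\<in>S. t s *\<^sub>R s) = (\<Sum>s\<in>S. t1 s *\<^sub>R s)" using c by simp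
    also have "\<dots> = (\<Sum>s\<in>S - {s1}. t1 s *\<^sub>R s)"
      using t1s less.prems by (simp add: sum.remove)
    finally have eq: "(\<Sum>s\<in>S. t s *\<^sub>R s) = (\<Sum>s\<in>S - {s1}. t1 s *\<^sub>R s)" .
    have "card (S - {s1}) < card S" using t1s less.prems by (intro psubset_card_mono) auto
    moreover have "finite (S - {s1})" "\<forall>s\<in>S - {s1}. 0 \<le> t1 s" using less.prems t1 by auto
    ultimately obtain B t' where "B \<subseteq> S - {s1}" "independent B" "\<forall>s\<in>B. 0 \<le> t' s"
      "(\<Sum>s\<in>S - {s1}. t1 s *\<^sub>R s) = (\<Sum>s\<in>B. t' s *\<^sub>R s)"
      using less.hyps[of "S - {s1}" t1] by blast
    then show ?thesis unfolding eq by (intro exI[of _ B] exI[of _ t']) auto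
  qed
qed

lemma closed_independent_cone:
  assumes B: "B \<subseteq> trop_polys n" "independent B"
  shows "closed {\<Sum>s\<in>B. t s *\<^sub>R s | t. \<forall>s\<in>B. 0 \<le> t s}"
proof -
  have fin: "finite B"
    using independent_span_bound[of "unit_coord ` {..n}" B] B trop_polys_subset_span by blast
  have "\<exists>g. linear g \<and> (\<forall>x\<in>B. g x = (if x = b then 1 else 0 :: real))" for b
    by (rule linear_independent_extend[OF B(2)])
  then obtain g where g: "linear (g b)" "\<And>x. x \<in> B \<Longrightarrow> g b x = (if x = b then 1 else 0 :: real)" for b
    by metis
  define l where "l b r = g b (unit_coord r)" for b r
  have gl: "g b x = pair n (l b) x" if "x \<in> trop_polys n" for b x
  proof -
    have "g b x = g b (\<Sum>r\<le>n. cf x r *\<^sub>R unit_coord r)"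
      using trop_polys_expansion[OF that] by simp
    also have "\<dots> = (\<Sum>r\<le>n. cf x r * g b (unit_coord r))"
      by (simp add: linear_sum[OF g(1)] linear_cmul[OF g(1)])
    finally show ?thesis by (simp add: pair_def l_def mult.commute)
  qed
  have comb: "pair n (l b) (\<Sum>s\<in>B. t s *\<^sub>R s) = t b" if "b \<in> B" for b t
  proof -
    have "(\<Sum>s\<in>B. t s *\<^sub>R s) \<in> trop_polys n"
      using B by (intro subspace_sum[OF subspace_trop_polys] trop_polys_scale) auto
    then have "pair n (l b) (\<Sum>s\<in>B. t s *\<^sub>R s) = (\<Sum>s\<in>B. t s * g b s)"
      by (simp add: gl[symmetric] linear_sum[OF g(1)] linear_cmul[OF g(1)])
    also have "\<dots> = (\<Sum>s\<in>B. if s = b then t b else 0)"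
      by (intro sum.cong) (auto simp: g)
    finally show ?thesis using fin that by simp
  qed
  \<comment> \<open>The second set is the span of \<open>B\<close>, described as the points that
    their dual coordinates reconstruct; in this form it is visibly closed.\<close>
  have eq: "{\<Sum>s\<in>B. t s *\<^sub>R s | t. \<forall>s\<in>B. 0 \<le> t s} =
     (\<Inter>b\<in>B. {x. 0 \<le> pair n (l b) x}) \<inter> {x. x = (\<Sum>b\<in>B. pair n (l b) x *\<^sub>R b)}"
    (is "?C = ?K")
  proof
    show "?C \<subseteq> ?K" using comb by auto
    show "?K \<subseteq> ?C"
    proof
      fix x assume "x \<in> ?K"
      then show "x \<in> ?C" by (intro CollectI exI[of _ "\<lambda>b. pair n (l b) x"]) auto
    qed
  qed
  show ?thesis
    unfolding eq by (auto intro!: closed_Int closed_Collect_le closed_Collect_eq continuous_intros)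
qed

lemma closed_convex_cone_hull_finite:
  assumes "finite S" "S \<subseteq> trop_polys n"
  shows "closed (convex_cone hull S)"
proof -
  have "convex_cone hull S =
    (\<Union>B\<in>{B. B \<subseteq> S \<and> independent B}. {\<Sum>s\<in>B. t s *\<^sub>R s | t. \<forall>s\<in>B. 0 \<le> t s})" (is "?L = ?R")
  proof
    show "?L \<subseteq> ?R"
      unfolding convex_cone_hull_finite[OF assms(1)]
    proof clarify
      fix t assume "\<forall>s\<in>S. (0::real) \<le> t s"
      from caratheodory_cone[OF assms(1) this]
      obtain B t' where "B \<subseteq> S" "independent B" "\<forall>s\<in>B. 0 \<le> t' s"
        "(\<Sum>s\<in>S. t s *\<^sub>R s) = (\<Sum>s\<in>B. t' s *\<^sub>R s)" by blast
      then show "(\<Sum>s\<in>S. t s *\<^sub>R s) \<in> ?R" by fastforce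
    qed
    have "{\<Sum>s\<in>B. t s *\<^sub>R s | t. \<forall>s\<in>B. 0 \<le> t s} \<subseteq> ?L" if "B \<subseteq> S" for B
      using convex_cone_hull_finite[OF finite_subset[OF that assms(1)]] hull_mono[OF that, of convex_cone]
      by auto
    then show "?R \<subseteq> ?L" by blast
  qed
  moreover have "closed ?R"
    by (intro closed_UN ballI closed_independent_cone[of _ n]) (use assms in \<open>auto intro: finite_subset[of _ "Pow S"]\<close>)
  ultimately show ?thesis by simp
qed

text \<open>An algebraic form of relative interior points; the sum of the generators is one.\<close>

lemma finitely_generated_core_point:
  fixes S :: "'a::real_vector set"
  assumes "finite S"
  obtains c where "c \<in> convex_cone hull S"
    "\<And>y. y \<in> convex_cone hull S \<Longrightarrow> \<exists>e>0. c + e *\<^sub>R (c - y) \<in> convex_cone hull S"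
proof -
  let ?C = "convex_cone hull S"
  define c where "c = (\<Sum>s\<in>S. s)"
  have cC: "c \<in> ?C"
    unfolding c_def convex_cone_hull_finite[OF assms] by (auto intro!: exI[of _ "\<lambda>_. 1"])
  have *: "\<exists>e>0. c - e *\<^sub>R y \<in> ?C" if y: "y \<in> ?C" for y
  proof -
    obtain t where t: "y = (\<Sum>s\<in>S. t s *\<^sub>R s)" "\<forall>s\<in>S. 0 \<le> t s"
      using y unfolding convex_cone_hull_finite[OF assms] by blast
    define e where "e = 1 / (1 + (\<Sum>s\<in>S. t s))"
    have pos: "0 \<le> (\<Sum>s\<in>S. t s)" using t by (simp add: sum_nonneg)
    then have "e > 0" by (simp add: e_def)
    have le: "0 \<le> 1 - e * t s" if "s \<in> S" for s
    proof -
      have "t s \<le> (\<Sum>s\<in>S. t s)" using that t assms by (intro member_le_sum) auto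
      then have "t s / (1 + (\<Sum>s\<in>S. t s)) \<le> 1" using pos by (simp add: divide_le_eq)
      then show ?thesis by (simp add: e_def)
    qed
    have "c - e *\<^sub>R y = (\<Sum>s\<in>S. (1 - e * t s) *\<^sub>R s)"
      by (simp add: c_def t scaleR_sum_right scaleR_diff_left sum_subtractf)
    then have "c - e *\<^sub>R y \<in> ?C"
      unfolding convex_cone_hull_finite[OF assms] using le by (intro CollectI exI[of _ "\<lambda>s. 1 - e * t s"]) auto
    with \<open>e > 0\<close> show ?thesis by blast
  qed
  show thesis
  proof (rule that[OF cC])
    fix y assume "y \<in> ?C"
    then obtain e where e: "e > 0" "c - e *\<^sub>R y \<in> ?C" using * by blast
    have "c + e *\<^sub>R (c - y) = (c - e *\<^sub>R y) + e *\<^sub>R c" by (simp add: algebra_simps)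
    moreover have "(c - e *\<^sub>R y) + e *\<^sub>R c \<in> ?C"
      using e cC by (intro convex_cone_hull_add convex_cone_hull_mul) auto
    ultimately have "c + e *\<^sub>R (c - y) \<in> ?C" by (simp only:)
    then show "\<exists>e>0. c + e *\<^sub>R (c - y) \<in> ?C" using e by blast
  qed
qed

text \<open>\<open>c\<close> lies strictly inside the segment from \<open>y\<close> to the point
  \<open>c + e *\<^sub>R (c - y)\<close> beyond it, and a face containing such a point contains both
  ends.\<close>

lemma face_of_core:
  assumes "F face_of D" "c \<in> F" "e > 0" "c + e *\<^sub>R (c - y) \<in> D" "y \<in> D"
  shows "y \<in> F"
proof (cases "y = c")
  case False
  have seg: "c \<in> open_segment y (c + e *\<^sub>R (c - y))"
    unfolding in_segment
  \<comment> \<open>The position of \<open>c\<close> measured from \<open>y\<close>: the whole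
    segment is \<open>1 + e\<close> times as long as its part from \<open>y\<close> to
    \<open>c\<close>.\<close>
  proof (intro conjI exI[of _ "1 / (1 + e)"])
    show "y \<noteq> c + e *\<^sub>R (c - y)"
    proof
      assume "y = c + e *\<^sub>R (c - y)"
      then have "(1 + e) *\<^sub>R (c - y) = 0" by (simp add: algebra_simps)
      then show False using False assms(3) by simp
    qed
    have "(1 - 1 / (1 + e)) = e / (1 + e)" using assms(3) by (simp add: field_simps)
    moreover have "(e / (1 + e)) *\<^sub>R y + (1 / (1 + e)) *\<^sub>R (c + e *\<^sub>R (c - y)) =
      (1 / (1 + e) + e / (1 + e)) *\<^sub>R c + (e / (1 + e) - e / (1 + e)) *\<^sub>R y"
      by (simp add: algebra_simps)
    moreover have "1 / (1 + e) + e / (1 + e) = 1" using assms(3) by (simp add: add_divide_distrib[symmetric])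
    ultimately show "c = (1 - 1 / (1 + e)) *\<^sub>R y + (1 / (1 + e)) *\<^sub>R (c + e *\<^sub>R (c - y))"
      by (simp only: diff_self scaleR_zero_left scaleR_one add_0_right)
  qed (use assms in auto)
  then show ?thesis using assms unfolding face_of_def by blast
qed (use assms in auto)

section \<open>Generic points\<close>

text \<open>Relatively nowhere dense. \<open>N\<close> is closed in the whole space because its
  complement serves as the open set of \<open>generic_on\<close>.\<close>

definition thin_in :: "'a::topological_space set \<Rightarrow> 'a set \<Rightarrow> bool" where
  "thin_in D N \<longleftrightarrow> closed N \<and> D \<subseteq> closure (D - N)"

lemma dense_open_Int:
  assumes "open U" "D \<subseteq> closure (D \<inter> U)" "D \<subseteq> closure (D \<inter> W)"
  shows "D \<subseteq> closure (D \<inter> (U \<inter> W))"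
proof
  fix x assume x: "x \<in> D"
  show "x \<in> closure (D \<inter> (U \<inter> W))"
    unfolding closure_iff_nhds_not_empty
  proof (intro allI impI)
    fix A O' assume A: "O' \<subseteq> A" "open O'" "x \<in> O'"
    have "x \<in> closure (D \<inter> U)" using x assms by blast
    then have "D \<inter> U \<inter> O' \<noteq> {}" using A unfolding closure_iff_nhds_not_empty by blast
    then obtain y where y: "y \<in> D" "y \<in> U" "y \<in> O'" by blast
    have "y \<in> closure (D \<inter> W)" using y assms by blast
    moreover have "open (U \<inter> O')" "y \<in> U \<inter> O'" using y A assms by auto
    ultimately have "D \<inter> W \<inter> (U \<inter> O') \<noteq> {}" unfolding closure_iff_nhds_not_empty by blast
    then show "D \<inter> (U \<inter> W) \<inter> A \<noteq> {}" using A by blast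
  qed
qed

lemma generic_on_conj:
  assumes "generic_on D P" "generic_on D Q"
  shows "generic_on D (\<lambda>f. P f \<and> Q f)"
proof -
  obtain U W where "open U" "D \<subseteq> closure (D \<inter> U)" "\<forall>f\<in>D \<inter> U. P f"
    "open W" "D \<subseteq> closure (D \<inter> W)" "\<forall>f\<in>D \<inter> W. Q f"
    using assms unfolding generic_on_def by blast
  then show ?thesis
    unfolding generic_on_def by (intro exI[of _ "U \<inter> W"]) (auto simp: dense_open_Int)
qed

lemma generic_on_mono:
  "generic_on D P \<Longrightarrow> (\<And>f. f \<in> D \<Longrightarrow> P f \<Longrightarrow> Q f) \<Longrightarrow> generic_on D Q"
  unfolding generic_on_def by blast

lemma generic_on_witness:
  assumes "generic_on D P" "D \<noteq> {}"
  obtains f where "f \<in> D" "P f"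
  using assms unfolding generic_on_def by (metis IntE closure_empty ex_in_conv subset_empty)

text \<open>Used to extend linear equations from generic points to a whole cone.\<close>

lemma generic_on_imp_closed:
  assumes "generic_on D P" "closed K" "\<And>f. f \<in> D \<Longrightarrow> P f \<Longrightarrow> f \<in> K"
  shows "D \<subseteq> K"
proof -
  obtain U where U: "open U" "D \<subseteq> closure (D \<inter> U)" "\<forall>f\<in>D \<inter> U. P f"
    using assms(1) unfolding generic_on_def by blast
  have "closure (D \<inter> U) \<subseteq> K" using U assms by (intro closure_minimal) auto
  then show ?thesis using U by blast
qed

lemma generic_on_thin:
  assumes "finite \<N>" "\<And>N. N \<in> \<N> \<Longrightarrow> thin_in D N"
  shows "generic_on D (\<lambda>f. f \<notin> \<Union>\<N>)"
  using assms
proof (induction \<N>)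
  case empty
  then show ?case unfolding generic_on_def by (intro exI[of _ UNIV]) (simp add: closure_subset)
next
  case (insert N \<N>)
  have "generic_on D (\<lambda>f. f \<notin> N)"
    unfolding generic_on_def
    by (rule exI[of _ "- N"]) (use insert in \<open>auto simp: thin_in_def Diff_eq\<close>)
  then have "generic_on D (\<lambda>f. f \<notin> N \<and> f \<notin> \<Union>\<N>)"
    using insert by (intro generic_on_conj) auto
  then show ?case by (rule generic_on_mono) auto
qed

text \<open>A bad point \<open>x\<close> is a limit of points on the segment towards
  \<open>c\<close>, and these have already left \<open>N\<close>.\<close>

lemma thin_inI_segments:
  fixes D :: "'a::real_normed_vector set"
  assumes "closed N" "convex D" "c \<in> D"
    "\<And>x t. x \<in> D \<Longrightarrow> x \<in> N \<Longrightarrow> 0 < t \<Longrightarrow> t \<le> 1 \<Longrightarrow> x + t *\<^sub>R (c - x) \<notin> N"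
  shows "thin_in D N"
  unfolding thin_in_def
proof (intro conjI subsetI)
  fix x assume x: "x \<in> D"
  show "x \<in> closure (D - N)"
  proof (cases "x \<in> N")
    case False
    then show ?thesis using x by (intro subsetD[OF closure_subset]) simp
  next
    case True
    define y where "y k = x + (1 / real (Suc k)) *\<^sub>R (c - x)" for k
    have "y k \<in> D - N" for k
    proof -
      have "y k = (1 - 1 / real (Suc k)) *\<^sub>R x + (1 / real (Suc k)) *\<^sub>R c"
        by (simp add: y_def algebra_simps)
      then have "y k \<in> D" using assms(2,3) x by (simp only:) (rule convexD, auto)
      moreover have "y k \<notin> N" unfolding y_def by (rule assms(4)) (use x True in auto)
      ultimately show ?thesis by simp
    qed
    moreover have "y \<longlonglongrightarrow> x + 0 *\<^sub>R (c - x)"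
      unfolding y_def by (intro tendsto_intros LIMSEQ_Suc[OF lim_1_over_n])
    ultimately show ?thesis
      unfolding closure_sequential by (intro exI[of _ y]) auto
  qed
qed (use assms in auto)

lemma thin_in_pair_kernel:
  assumes "convex D" "c \<in> D" "pair n l c \<noteq> 0"
  shows "thin_in D {g. pair n l g = 0}"
proof (rule thin_inI_segments[OF _ assms(1,2)])
  show "closed {g. pair n l g = 0}" by (intro closed_Collect_eq continuous_intros)
qed (use assms in \<open>auto simp: pair_simps\<close>)

text \<open>The core point of \<open>D\<close> is outside \<open>C\<close>, since a face through it
  would be all of \<open>D\<close>. A segment from a point of \<open>D \<inter> C\<close> to the
  core point leaves \<open>C\<close> at once, as the face would otherwise contain its far
  end.\<close>

lemma thin_in_face:
  fixes D :: "'a::real_normed_vector set"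
  assumes fg: "finite S" "D = convex_cone hull S" and C: "closed C" "(D \<inter> C) face_of D" "\<not> D \<subseteq> C"
  shows "thin_in D C"
proof -
  obtain c where c: "c \<in> D" "\<And>y. y \<in> D \<Longrightarrow> \<exists>e>0. c + e *\<^sub>R (c - y) \<in> D"
    using finitely_generated_core_point[OF fg(1)] fg(2) by metis
  have cnot: "c \<notin> C"
  proof
    assume "c \<in> C"
    then have "y \<in> C" if "y \<in> D" for y
      using c(2)[OF that] face_of_core[OF C(2), of c _ y] c(1) that by auto
    then show False using C by blast
  qed
  show ?thesis
  proof (rule thin_inI_segments)
    show "closed C" by fact
    show "convex D" using fg by (simp add: convex_convex_cone_hull)
    show "c \<in> D" by fact
    fix x and t :: real
    assume x: "x \<in> D" "x \<in> C" "0 < t" "t \<le> 1"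
    show "x + t *\<^sub>R (c - x) \<notin> C"
    proof
      assume a: "x + t *\<^sub>R (c - x) \<in> C"
      have eq: "x + t *\<^sub>R (c - x) = (1 - t) *\<^sub>R x + t *\<^sub>R c" by (simp add: algebra_simps)
      show False
      proof (cases "t = 1")
        case True
        then show ?thesis using a cnot by simp
      next
        case False
        have "x + t *\<^sub>R (c - x) \<in> open_segment x c"
          unfolding in_segment eq using x cnot False by auto
        moreover have "x + t *\<^sub>R (c - x) \<in> D"
          using \<open>convex D\<close> x c unfolding eq by (intro convexD) auto
        ultimately have "c \<in> D \<inter> C" using C(2) a x c unfolding face_of_def by blast
        then show False using cnot by blast
      qed
    qed
  qed
qed

section \<open>Local structure of a coarsest fan\<close>

lemma convex_coord_box: "convex (coord_box n f e)"
proof -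
  have "coord_box n f e = (\<Inter>r\<in>{..n}. {g. cf g r < cf f r + e} \<inter> {g. cf f r - e < cf g r})"
    by (auto simp: coord_box_def abs_diff_less_iff)
  moreover have "convex {g. cf g r < k}" "convex {g. k < cf g r}" for r k
    using convex_linear_vimage[OF bounded_linear.linear[OF bounded_linear_cf], of "{..<k}" r]
      convex_linear_vimage[OF bounded_linear.linear[OF bounded_linear_cf], of "{k<..}" r]
    by (simp_all add: vimage_def)
  ultimately show ?thesis by (auto intro!: convex_INT convex_Int)
qed

locale coarsest_fan =
  fixes n :: nat and X :: "(nat \<Rightarrow>\<^sub>0 real) set" and \<Sigma> :: "(nat \<Rightarrow>\<^sub>0 real) set set"
  assumes fan: "coarsest_fan_on X \<Sigma>" and X_sub: "X \<subseteq> trop_polys n"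
begin

lemma finite_fan: "finite \<Sigma>"
  using fan by (auto simp: coarsest_fan_on_def rational_fan_def)

lemma Union_fan: "\<Union>\<Sigma> = X"
  using fan by (auto simp: coarsest_fan_on_def)

lemma cone_sub: "C \<in> \<Sigma> \<Longrightarrow> C \<subseteq> X"
  using Union_fan by auto

lemma cone_fg:
  assumes "C \<in> \<Sigma>"
  obtains S where "finite S" "C = convex_cone hull S" "S \<subseteq> trop_polys n"
proof -
  obtain S where S: "finite S" "C = convex_cone hull S"
    using fan assms by (auto simp: coarsest_fan_on_def rational_fan_def rational_polyhedral_cone_def)
  moreover have "S \<subseteq> trop_polys n"
    using hull_subset[of S convex_cone] S cone_sub[OF assms] X_sub by blast
  ultimately show thesis using that by blast
qed

lemma cone_closed: "C \<in> \<Sigma> \<Longrightarrow> closed C"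
  by (metis cone_fg closed_convex_cone_hull_finite)

lemma cone_convex: "C \<in> \<Sigma> \<Longrightarrow> convex C"
  by (metis cone_fg convex_convex_cone_hull)

lemma cone_0: "C \<in> \<Sigma> \<Longrightarrow> 0 \<in> C"
  by (metis cone_fg convex_cone_hull_contains_0)

lemma face_in_fan: "C \<in> \<Sigma> \<Longrightarrow> F face_of C \<Longrightarrow> F \<noteq> {} \<Longrightarrow> F \<in> \<Sigma>"
  using fan by (auto simp: coarsest_fan_on_def rational_fan_def)

lemma Int_face: "C \<in> \<Sigma> \<Longrightarrow> C' \<in> \<Sigma> \<Longrightarrow> (C \<inter> C') face_of C"
  using fan by (auto simp: coarsest_fan_on_def rational_fan_def)

lemma Int_in_fan: "C \<in> \<Sigma> \<Longrightarrow> C' \<in> \<Sigma> \<Longrightarrow> C \<inter> C' \<in> \<Sigma>"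
  by (metis Int_face face_in_fan cone_0 IntI empty_iff)

lemma maximal_in_fan: "C \<in> maximal_cones \<Sigma> \<Longrightarrow> C \<in> \<Sigma>"
  by (simp add: maximal_cones_def)

lemma regular_cone_maximal: "regular_point X x \<Longrightarrow> x \<in> C \<Longrightarrow> C \<in> \<Sigma> \<Longrightarrow> C \<in> maximal_cones \<Sigma>"
  using fan by (auto simp: coarsest_fan_on_def)

text \<open>The intersection of the two cones is again a cone of the fan through a regular point,
  hence maximal, hence equal to both.\<close>

lemma regular_cone_unique:
  assumes "regular_point X x" "x \<in> C" "C \<in> \<Sigma>" "x \<in> C'" "C' \<in> \<Sigma>"
  shows "C = C'"
proof -
  have "C \<inter> C' \<in> maximal_cones \<Sigma>"
    using assms by (intro regular_cone_maximal[of x]) (auto intro: Int_in_fan)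
  then have "\<forall>K\<in>\<Sigma>. C \<inter> C' \<subseteq> K \<longrightarrow> K = C \<inter> C'"
    by (auto simp: maximal_cones_def)
  then show ?thesis using assms by (metis inf_le1 inf_le2)
qed

text \<open>On \<open>Y\<close> the cone through \<open>y\<close> and the union of the other cones
  are closed and disjoint, and a convex set is connected.\<close>

lemma regular_convex_in_cone:
  assumes "convex Y" "y \<in> Y" "Y \<subseteq> X" "\<And>x. x \<in> Y \<Longrightarrow> regular_point X x"
  obtains C where "C \<in> maximal_cones \<Sigma>" "Y \<subseteq> C"
proof -
  obtain C where C: "C \<in> \<Sigma>" "y \<in> C" using assms Union_fan by blast
  have "closed (\<Union>(\<Sigma> - {C}))"
    using finite_fan cone_closed by (intro closed_Union) auto
  moreover have "C \<inter> \<Union>(\<Sigma> - {C}) \<inter> Y = {}"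
    using regular_cone_unique assms(4) C(1) by blast
  moreover have "Y \<subseteq> C \<union> \<Union>(\<Sigma> - {C})" using assms(3) Union_fan by blast
  ultimately have "C \<inter> Y = {} \<or> \<Union>(\<Sigma> - {C}) \<inter> Y = {}"
    by (intro connected_closedD[OF convex_connected[OF assms(1)]] cone_closed[OF C(1)])
  then have "\<Union>(\<Sigma> - {C}) \<inter> Y = {}" using C assms(2) by blast
  then have "Y \<subseteq> C" using \<open>Y \<subseteq> C \<union> \<Union>(\<Sigma> - {C})\<close> by blast
  moreover have "C \<in> maximal_cones \<Sigma>"
    using regular_cone_maximal[OF assms(4)[OF assms(2)] C(2,1)] .
  ultimately show thesis using that by blast
qed

text \<open>The segment from \<open>g\<close> to any point of \<open>C\<close> starts inside the
  box; a linear function vanishing on its initial piece vanishes at its end.\<close>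

lemma cone_in_local_hyperplane:
  assumes "C \<in> \<Sigma>" "g \<in> C" "e > 0"
    "\<And>x. x \<in> X \<Longrightarrow> x \<in> coord_box n g e \<Longrightarrow> pair n l x = 0"
  shows "\<forall>x\<in>C. pair n l x = 0"
proof
  fix x assume x: "x \<in> C"
  have gV: "g \<in> trop_polys n" using assms cone_sub X_sub by blast
  obtain d where d: "d > 0" "d < 1" "\<And>t. \<bar>t\<bar> \<le> d \<Longrightarrow> g + t *\<^sub>R (x - g) \<in> coord_box n g e"
    using coord_box_segment[OF gV assms(3)] by metis
  have "g + d *\<^sub>R (x - g) = (1 - d) *\<^sub>R g + d *\<^sub>R x" by (simp add: algebra_simps)
  also have "\<dots> \<in> C" using cone_convex[OF assms(1)] d x assms(2) by (intro convexD) auto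
  finally have "g + d *\<^sub>R (x - g) \<in> C" .
  then have "pair n l (g + d *\<^sub>R (x - g)) = 0"
    using d assms(4) cone_sub[OF assms(1)] by auto
  moreover have "pair n l g = 0"
    using assms cone_sub[OF assms(1)] by auto
  ultimately show "pair n l x = 0" using d by (simp add: pair_simps)
qed

text \<open>Turns the global count of cones with face \<open>D\<close> into a count of maximal cones
  through one point, which the local shape of \<open>X\<close> decides.\<close>

lemma card_cones_with_face:
  assumes "D \<in> \<Sigma>" "\<And>C. C \<in> maximal_cones \<Sigma> \<Longrightarrow> f \<in> C \<Longrightarrow> D \<subseteq> C" "f \<in> D"
  shows "{C \<in> maximal_cones \<Sigma>. D face_of C} = {C \<in> maximal_cones \<Sigma>. f \<in> C}"
proof -
  have "D face_of C" if "C \<in> maximal_cones \<Sigma>" "f \<in> C" for C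
  proof -
    have "(C \<inter> D) face_of C" using that assms(1) by (intro Int_face) (auto intro: maximal_in_fan)
    moreover have "C \<inter> D = D" using assms(2)[OF that] by auto
    ultimately show ?thesis by simp
  qed
  moreover have "f \<in> C" if "D face_of C" for C
    using face_of_imp_subset[OF that] assms(3) by auto
  ultimately show ?thesis by auto
qed

text \<open>The finitely many maximal cones not containing \<open>D\<close> meet it in proper faces,
  which are thin.\<close>

lemma generic_in_every_cone:
  assumes "D \<in> \<Sigma>"
  shows "generic_on D (\<lambda>f. \<forall>C \<in> maximal_cones \<Sigma>. f \<in> C \<longrightarrow> D \<subseteq> C)"
proof -
  obtain S where S: "finite S" "D = convex_cone hull S" using cone_fg[OF assms] by metis
  have "generic_on D (\<lambda>f. f \<notin> \<Union>{C \<in> maximal_cones \<Sigma>. \<not> D \<subseteq> C})"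
  proof (rule generic_on_thin)
    show "finite {C \<in> maximal_cones \<Sigma>. \<not> D \<subseteq> C}"
      using finite_fan by (rule finite_subset[rotated]) (auto simp: maximal_cones_def)
    fix N assume "N \<in> {C \<in> maximal_cones \<Sigma>. \<not> D \<subseteq> C}"
    then show "thin_in D N"
      using thin_in_face[OF S, of N] cone_closed Int_face assms maximal_in_fan by auto
  qed
  then show ?thesis by (rule generic_on_mono) blast
qed

end

section \<open>Books of half-hyperplanes\<close>

text \<open>For \<open>u \<noteq> (0, 0)\<close>: \<open>(x, y)\<close> is a nonnegative multiple of
  \<open>u\<close>, expressed by cross and dot product. The conditions are closed, and the origin is
  on every ray.\<close>

definition on_ray :: "real \<times> real \<Rightarrow> real \<Rightarrow> real \<Rightarrow> bool" where
  "on_ray u x y \<longleftrightarrow> snd u * x = fst u * y \<and> 0 \<le> fst u * x + snd u * y"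

definition cross :: "real \<times> real \<Rightarrow> real \<times> real \<Rightarrow> real" where
  "cross u w = fst u * snd w - snd u * fst w"

definition dot :: "real \<times> real \<Rightarrow> real \<times> real \<Rightarrow> real" where
  "dot u w = fst u * fst w + snd u * snd w"

text \<open>Rays sharing a point other than the origin have the same direction. In the parallel case
  the product of the two dot products is \<open>dot u w\<close> times the squared length of
  \<open>(x, y)\<close>, which settles the sign.\<close>

lemma on_ray_two_rays:
  assumes "on_ray u x y" "on_ray w x y" "u \<noteq> (0,0)" "w \<noteq> (0,0)" "cross u w \<noteq> 0 \<or> dot u w < 0"
  shows "x = 0 \<and> y = 0"
proof -
  obtain s t s' t' where u: "u = (s, t)" and w: "w = (s', t')" by (metis surj_pair)
  have 1: "t * x = s * y" "0 \<le> s * x + t * y" "t' * x = s' * y" "0 \<le> s' * x + t' * y"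
    using assms(1,2) by (auto simp: on_ray_def u w)
  have c: "(s * t' - t * s') * x = 0" "(s * t' - t * s') * y = 0"
    using 1 by algebra+
  show ?thesis
  proof (cases "s * t' - t * s' = 0")
    case False
    then show ?thesis using c by simp
  next
    case True
    have d: "s * s' + t * t' < 0" using assms(5) True by (simp add: cross_def dot_def u w)
    have "(s * x + t * y) * (s' * x + t' * y) = (s * s' + t * t') * (x\<^sup>2 + y\<^sup>2)"
      using 1 True by algebra
    moreover have "0 \<le> (s * x + t * y) * (s' * x + t' * y)" using 1 by simp
    ultimately have "x\<^sup>2 + y\<^sup>2 \<le> 0" using d by (simp add: zero_le_mult_iff)
    then show ?thesis by (simp add: sum_power2_le_zero_iff)
  qed
qed

text \<open>Near \<open>f\<close> the set \<open>X\<close> is the preimage of the finite union of rays \<open>R\<close> in the plane under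
  \<open>(a, b)\<close>.\<close>

definition book_at ::
  "nat \<Rightarrow> (nat \<Rightarrow>\<^sub>0 real) set \<Rightarrow> (nat \<Rightarrow>\<^sub>0 real) \<Rightarrow> (nat \<Rightarrow> real) \<Rightarrow> (nat \<Rightarrow> real) \<Rightarrow> (real \<times> real) set \<Rightarrow> bool"
  where
  "book_at n X f a b R \<longleftrightarrow>
     finite R \<and> f \<in> trop_polys n \<and> pair n a f = 0 \<and> pair n b f = 0 \<and> (0, 0) \<notin> R \<and>
     (\<exists>u w. u \<in> trop_polys n \<and> w \<in> trop_polys n \<and>
        pair n a u = 1 \<and> pair n b u = 0 \<and> pair n a w = 0 \<and> pair n b w = 1) \<and>
     (\<forall>u\<in>R. \<forall>w\<in>R. u \<noteq> w \<longrightarrow> cross u w \<noteq> 0 \<or> dot u w < 0) \<and>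
     (\<forall>u\<in>R. \<exists>w\<in>R. cross u w \<noteq> 0) \<and>
     (\<exists>e>0. \<forall>g \<in> trop_polys n \<inter> coord_box n f e.
        g \<in> X \<longleftrightarrow> (\<exists>u\<in>R. on_ray u (pair n a g) (pair n b g)))"

text \<open>Cuts out the hyperplane containing the page over \<open>u\<close> and the spine, the
  common kernel of \<open>a\<close> and \<open>b\<close>.\<close>

definition ray_normal :: "(nat \<Rightarrow> real) \<Rightarrow> (nat \<Rightarrow> real) \<Rightarrow> real \<times> real \<Rightarrow> nat \<Rightarrow> real" where
  "ray_normal a b u = (\<lambda>r. snd u * a r + (- fst u) * b r)"

lemma pair_ray_normal: "pair n (ray_normal a b u) g = snd u * pair n a g - fst u * pair n b g"
  unfolding ray_normal_def pair_lin_comb by simp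

text \<open>The open page over a ray is convex and consists of regular points, so it lies in a
  single maximal cone \<open>K u\<close>. Transversal pages span different hyperplanes, hence give
  different cones; opposite pages need a third page. A cone through \<open>f\<close> that met no
  open page would lie in the spine near \<open>f\<close> and be swallowed by some
  \<open>K u\<close>.\<close>

lemma (in coarsest_fan) book_cones:
  assumes "book_at n X f a b R"
  obtains K where
    "\<And>u. u \<in> R \<Longrightarrow> K u \<in> maximal_cones \<Sigma>" "\<And>u. u \<in> R \<Longrightarrow> f \<in> K u" "inj_on K R"
    "\<And>C. C \<in> maximal_cones \<Sigma> \<Longrightarrow> f \<in> C \<Longrightarrow> \<exists>u\<in>R. C = K u"
    "\<And>u g. u \<in> R \<Longrightarrow> g \<in> K u \<Longrightarrow> pair n (ray_normal a b u) g = 0"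
    "\<And>u m. u \<in> R \<Longrightarrow> (\<And>g. g \<in> K u \<Longrightarrow> pair n m g = 0) \<Longrightarrow> \<exists>k. \<forall>r\<le>n. m r = k * ray_normal a b u r"
    "\<exists>e>0. \<forall>u\<in>R. \<forall>g\<in>trop_polys n \<inter> coord_box n f e. pair n a g = 0 \<longrightarrow> pair n b g = 0 \<longrightarrow> g \<in> K u"
proof -
  let ?V = "trop_polys n"
  have finR: "finite R" and fV: "f \<in> ?V" and af: "pair n a f = 0" and bf: "pair n b f = 0"
    and R0: "(0, 0) \<notin> R"
    and sep: "\<And>u w. u \<in> R \<Longrightarrow> w \<in> R \<Longrightarrow> u \<noteq> w \<Longrightarrow> cross u w \<noteq> 0 \<or> dot u w < 0"
    and transv: "\<And>u. u \<in> R \<Longrightarrow> \<exists>w\<in>R. cross u w \<noteq> 0"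
    using assms unfolding book_at_def by blast+
  obtain x y where xy: "x \<in> ?V" "y \<in> ?V" "pair n a x = 1" "pair n b x = 0" "pair n a y = 0" "pair n b y = 1"
    using assms unfolding book_at_def by blast
  obtain e where e: "e > 0" and loc: "\<And>g. g \<in> ?V \<Longrightarrow> g \<in> coord_box n f e \<Longrightarrow>
      g \<in> X \<longleftrightarrow> (\<exists>u\<in>R. on_ray u (pair n a g) (pair n b g))"
    using assms unfolding book_at_def by blast
  \<comment> \<open>Strict positivity removes the spine, where different pages meet.\<close>
  define pg where "pg u = {g. g \<in> ?V \<and> g \<in> coord_box n f e \<and> snd u * pair n a g = fst u * pair n b g
    \<and> 0 < fst u * pair n a g + snd u * pair n b g}" for u
  define dir where "dir u = fst u *\<^sub>R x + snd u *\<^sub>R y" for u :: "real \<times> real"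
  have dir: "dir u \<in> ?V" "pair n a (dir u) = fst u" "pair n b (dir u) = snd u" for u
    using xy by (auto simp: dir_def pair_simps trop_polys_add trop_polys_scale)
  have nz: "0 < fst u * fst u + snd u * snd u" if "u \<in> R" for u
  proof -
    have "u \<noteq> (0,0)" using that R0 by metis
    then show ?thesis by (cases u) (auto simp: sum_squares_gt_zero_iff)
  qed
  have reg: "\<exists>e'>0. \<forall>h\<in>X. h \<in> coord_box n g e' \<longrightarrow> pair n (ray_normal a b u) h = 0"
     and regp: "regular_point X g" and pgX: "g \<in> X" if u: "u \<in> R" and g: "g \<in> pg u" for u g
  proof -
    have gV: "g \<in> ?V" and gb: "g \<in> coord_box n f e" using g by (auto simp: pg_def)
    have gr: "on_ray u (pair n a g) (pair n b g)" using g by (auto simp: pg_def on_ray_def)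
    have gpos: "0 < fst u * pair n a g + snd u * pair n b g" using g by (auto simp: pg_def)
    show gX: "g \<in> X" using loc[OF gV gb] gr u by blast
    \<comment> \<open>Away from the other rays and from the spine only the page over
      \<open>u\<close> is left, so inside \<open>U\<close> the set \<open>X\<close> is one
      hyperplane.\<close>
    define U where "U = coord_box n f e \<inter> - (\<Union>w\<in>R - {u}. {h. on_ray w (pair n a h) (pair n b h)})
      \<inter> {h. 0 < fst u * pair n a h + snd u * pair n b h}"
    have cl: "closed {h. on_ray w (pair n a h) (pair n b h)}" for w
      unfolding on_ray_def Collect_conj_eq
      by (intro closed_Int closed_Collect_eq closed_Collect_le continuous_intros)
    have oU: "open U"
      unfolding U_def using finR cl
      by (intro open_Int open_coord_box open_Compl closed_UN open_Collect_less continuous_intros) auto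
    have "\<not> on_ray w (pair n a g) (pair n b g)" if "w \<in> R - {u}" for w
    proof
      assume "on_ray w (pair n a g) (pair n b g)"
      then have "pair n a g = 0 \<and> pair n b g = 0"
        using on_ray_two_rays[OF gr, of w] sep[OF u, of w] that u R0 by auto
      then show False using gpos by simp
    qed
    then have gU: "g \<in> U" unfolding U_def using gb gpos by auto
    have XU: "h \<in> X \<longleftrightarrow> pair n (ray_normal a b u) h = 0" if "h \<in> ?V" "h \<in> U" for h
    proof -
      have "h \<in> X \<longleftrightarrow> (\<exists>u\<in>R. on_ray u (pair n a h) (pair n b h))"
        using loc that by (auto simp: U_def)
      also have "\<dots> \<longleftrightarrow> on_ray u (pair n a h) (pair n b h)"
        using that u by (auto simp: U_def)
      also have "\<dots> \<longleftrightarrow> pair n (ray_normal a b u) h = 0"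
        using that by (auto simp: U_def on_ray_def pair_ray_normal)
      finally show ?thesis .
    qed
    have aff: "affine (?V \<inter> {h. pair n (ray_normal a b u) h = 0})"
      by (intro subspace_imp_affine subspace_inter subspace_trop_polys subspace_pair)
    have eqU: "X \<inter> U = (?V \<inter> {h. pair n (ray_normal a b u) h = 0}) \<inter> U"
      using XU X_sub by auto
    show "regular_point X g"
      unfolding regular_point_def using gX oU gU aff eqU by blast
    obtain e' where e': "e' > 0" "?V \<inter> coord_box n g e' \<subseteq> U"
      using coord_box_basis[OF oU gU gV] by blast
    have "\<forall>h\<in>X. h \<in> coord_box n g e' \<longrightarrow> pair n (ray_normal a b u) h = 0"
      using e' XU X_sub by blast
    then show "\<exists>e'>0. \<forall>h\<in>X. h \<in> coord_box n g e' \<longrightarrow> pair n (ray_normal a b u) h = 0"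
      using e'(1) by blast
  qed
  have cvx: "convex (pg u)" for u
  proof -
    have "pg u = ?V \<inter> coord_box n f e \<inter> {g. pair n (ray_normal a b u) g = 0}
        \<inter> {g. 0 < pair n (\<lambda>r. fst u * a r + snd u * b r) g}"
      by (auto simp: pg_def pair_ray_normal pair_lin_comb)
    moreover have "convex {g. 0 < pair n l g}" for l
    proof (rule convexI)
      fix g h and s t :: real
      assume "g \<in> {g. 0 < pair n l g}" "h \<in> {g. 0 < pair n l g}" "0 \<le> s" "0 \<le> t" "s + t = 1"
      then show "s *\<^sub>R g + t *\<^sub>R h \<in> {g. 0 < pair n l g}"
        by (cases "s = 0") (simp_all add: pair_simps add_pos_nonneg)
    qed
    ultimately show ?thesis
      by (simp add: convex_Int convex_coord_box subspace_imp_convex[OF subspace_trop_polys]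
          subspace_imp_convex[OF subspace_pair])
  qed
  have spine_seg: "\<exists>d>0. \<forall>t. 0 < t \<and> t \<le> d \<longrightarrow> g + t *\<^sub>R dir u \<in> pg u"
    if u: "u \<in> R" and g: "g \<in> ?V" "g \<in> coord_box n f e" "pair n a g = 0" "pair n b g = 0" for g u
  proof -
    obtain e1 where e1: "e1 > 0" "?V \<inter> coord_box n g e1 \<subseteq> coord_box n f e"
      using coord_box_basis[OF open_coord_box g(2,1)] by blast
    obtain d where d: "d > 0" "\<And>t. \<bar>t\<bar> \<le> d \<Longrightarrow> g + t *\<^sub>R dir u \<in> coord_box n g e1"
      using coord_box_segment[OF g(1) e1(1)] by metis
    have "g + t *\<^sub>R dir u \<in> pg u" if "0 < t" "t \<le> d" for t
    proof -
      have V: "g + t *\<^sub>R dir u \<in> ?V" using g dir by (intro trop_polys_add trop_polys_scale)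
      have "fst u * (t * fst u) + snd u * (t * snd u) = t * (fst u * fst u + snd u * snd u)"
        by (simp add: algebra_simps)
      then have "0 < fst u * (t * fst u) + snd u * (t * snd u)" using that nz[OF u] by simp
      then show ?thesis using V d(2)[of t] that e1(2) g dir
        by (auto simp: pg_def pair_simps)
    qed
    then show ?thesis using d by blast
  qed
  have "\<exists>C. C \<in> maximal_cones \<Sigma> \<and> pg u \<subseteq> C" if u: "u \<in> R" for u
  proof -
    obtain d where d: "d > 0" "\<forall>t. 0 < t \<and> t \<le> d \<longrightarrow> f + t *\<^sub>R dir u \<in> pg u"
      using spine_seg[OF u fV _ af bf] e by auto
    then have "f + d *\<^sub>R dir u \<in> pg u" by auto
    moreover have "pg u \<subseteq> X" using pgX[OF u] by (rule subsetI)
    ultimately obtain C where "C \<in> maximal_cones \<Sigma>" "pg u \<subseteq> C"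
      using regp[OF u] by (rule regular_convex_in_cone[OF cvx[of u]])
    then show ?thesis by (intro exI conjI)
  qed
  then obtain K where K: "\<And>u. u \<in> R \<Longrightarrow> K u \<in> maximal_cones \<Sigma>" "\<And>u. u \<in> R \<Longrightarrow> pg u \<subseteq> K u" by metis
  have K\<Sigma>: "K u \<in> \<Sigma>" if "u \<in> R" for u using K(1)[OF that] by (rule maximal_in_fan)
  \<comment> \<open>Spine points are limits of points of the open page, and cones are
    closed.\<close>
  have spine: "g \<in> K u"
    if u: "u \<in> R" and g: "g \<in> ?V" "g \<in> coord_box n f e" "pair n a g = 0" "pair n b g = 0" for g u
  proof -
    obtain d where d: "d > 0" "\<And>t. 0 < t \<Longrightarrow> t \<le> d \<Longrightarrow> g + t *\<^sub>R dir u \<in> pg u"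
      using spine_seg[OF u g] by metis
    define z where "z k = g + (d * (1 / real (Suc k))) *\<^sub>R dir u" for k
    have "z k \<in> K u" for k
    proof -
      have "d * (1 / real (Suc k)) \<le> d * 1" using d(1) by (intro mult_left_mono) auto
      then have "z k \<in> pg u" unfolding z_def using d(1) by (intro d(2)) auto
      then show ?thesis using K(2)[OF u] by auto
    qed
    moreover have "z \<longlonglongrightarrow> g + (d * 0) *\<^sub>R dir u"
      unfolding z_def by (intro tendsto_intros LIMSEQ_Suc[OF lim_1_over_n])
    ultimately show ?thesis
      using closed_sequentially[OF cone_closed[OF K\<Sigma>[OF u]], of z] by simp
  qed
  have fK: "f \<in> K u" if "u \<in> R" for u using spine[OF that fV _ af bf] e by simp
  have hyper: "pair n (ray_normal a b u) g = 0" if u: "u \<in> R" and g: "g \<in> K u" for u g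
  proof -
    obtain d where d: "d > 0" "\<forall>t. 0 < t \<and> t \<le> d \<longrightarrow> f + t *\<^sub>R dir u \<in> pg u"
      using spine_seg[OF u fV _ af bf] e by auto
    then have p: "f + d *\<^sub>R dir u \<in> pg u" by auto
    obtain e' where "e' > 0" "\<forall>h\<in>X. h \<in> coord_box n (f + d *\<^sub>R dir u) e' \<longrightarrow> pair n (ray_normal a b u) h = 0"
      using reg[OF u p] by blast
    then show ?thesis
      using cone_in_local_hyperplane[OF K\<Sigma>[OF u], of "f + d *\<^sub>R dir u" e'] p K(2)[OF u] g by blast
  qed
  have transK: "K u \<noteq> K w" if u: "u \<in> R" and w: "w \<in> R" and c: "cross u w \<noteq> 0" for u w
  proof
    assume eq: "K u = K w"
    obtain d where d: "d > 0" "\<forall>t. 0 < t \<and> t \<le> d \<longrightarrow> f + t *\<^sub>R dir w \<in> pg w"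
      using spine_seg[OF w fV _ af bf] e by auto
    then have "f + d *\<^sub>R dir w \<in> K u" using K(2)[OF w] eq by auto
    then have "pair n (ray_normal a b u) (f + d *\<^sub>R dir w) = 0" by (rule hyper[OF u])
    then have "d * (snd u * fst w - fst u * snd w) = 0"
      by (simp add: pair_ray_normal pair_simps af bf dir algebra_simps)
    then show False using d(1) c by (simp add: cross_def)
  qed
  have inj: "inj_on K R"
  proof (rule inj_onI, rule ccontr)
    fix u w assume u: "u \<in> R" and w: "w \<in> R" and eq: "K u = K w" and ne: "u \<noteq> w"
    have c: "cross u w = 0" using transK[OF u w] eq by blast
    then have dt: "dot u w < 0" using sep[OF u w ne] by blast
    obtain d1 where d1: "d1 > 0" "\<forall>t. 0 < t \<and> t \<le> d1 \<longrightarrow> f + t *\<^sub>R dir u \<in> pg u"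
      using spine_seg[OF u fV _ af bf] e by auto
    obtain d2 where d2: "d2 > 0" "\<forall>t. 0 < t \<and> t \<le> d2 \<longrightarrow> f + t *\<^sub>R dir w \<in> pg w"
      using spine_seg[OF w fV _ af bf] e by auto
    obtain v where v: "v \<in> R" "cross u v \<noteq> 0" using transv[OF u] by blast
    define g where "g = f + d1 *\<^sub>R dir u"
    define h where "h = f + d2 *\<^sub>R dir w"
    have g: "g \<in> pg u" and h: "h \<in> pg w" using d1 d2 by (auto simp: g_def h_def)
    have gh: "g \<in> K u" "h \<in> K u" using g h K(2)[OF u] K(2)[OF w] eq by auto
    \<comment> \<open>For antiparallel \<open>u\<close> and \<open>w\<close>, adding
      \<open>- dot u w\<close> times \<open>u\<close> and \<open>dot u u\<close> times
      \<open>w\<close> gives zero. With the step lengths \<open>d1\<close> and \<open>d2\<close>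
      this yields the weights that make \<open>f\<close> a convex combination of \<open>g\<close>
      and \<open>h\<close>.\<close>
    define c1 where "c1 = d1 * (fst u * fst u + snd u * snd u)"
    define c2 where "c2 = - d2 * dot u w"
    have pos: "c1 > 0" "c2 > 0" using d1 d2 nz[OF u] dt by (auto simp: c1_def c2_def mult_pos_neg)
    have z: "c2 *\<^sub>R (d1 *\<^sub>R dir u) + c1 *\<^sub>R (d2 *\<^sub>R dir w) = 0"
    proof -
      have s1: "c2 * d1 * fst u + c1 * d2 * fst w = d1 * d2 * (- snd u) * cross u w"
        and s2: "c2 * d1 * snd u + c1 * d2 * snd w = d1 * d2 * fst u * cross u w"
        by (simp_all add: c1_def c2_def dot_def cross_def algebra_simps)
      have "c2 *\<^sub>R (d1 *\<^sub>R dir u) + c1 *\<^sub>R (d2 *\<^sub>R dir w) =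
        (c2 * d1 * fst u + c1 * d2 * fst w) *\<^sub>R x + (c2 * d1 * snd u + c1 * d2 * snd w) *\<^sub>R y"
        by (simp add: dir_def algebra_simps)
      then show ?thesis by (simp add: s1 s2 c)
    qed
    have fseg: "f = (1 - c1 / (c1 + c2)) *\<^sub>R g + (c1 / (c1 + c2)) *\<^sub>R h"
    proof -
      have q: "1 - c1 / (c1 + c2) = c2 / (c1 + c2)" using pos by (simp add: field_simps)
      have q1: "c2 / (c1 + c2) + c1 / (c1 + c2) = 1" using pos by (simp add: add_divide_distrib[symmetric])
      have "(1 - c1 / (c1 + c2)) *\<^sub>R g + (c1 / (c1 + c2)) *\<^sub>R h =
        (c2 / (c1 + c2) + c1 / (c1 + c2)) *\<^sub>R f
          + (1 / (c1 + c2)) *\<^sub>R (c2 *\<^sub>R (d1 *\<^sub>R dir u) + c1 *\<^sub>R (d2 *\<^sub>R dir w))"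
        unfolding q g_def h_def by (simp add: algebra_simps)
      then show ?thesis unfolding q1 z by simp
    qed
    have "g \<noteq> h"
    proof
      assume "g = h"
      then have "pair n (\<lambda>r. fst u * a r + snd u * b r) g = pair n (\<lambda>r. fst u * a r + snd u * b r) h" by simp
      then have "d1 * (fst u * fst u + snd u * snd u) = d2 * dot u w"
        by (simp add: pair_lin_comb g_def h_def pair_simps af bf dir dot_def algebra_simps)
      then show False using pos by (simp add: c1_def c2_def)
    qed
    moreover have "0 < c1 / (c1 + c2)" "c1 / (c1 + c2) < 1" using pos by auto
    \<comment> \<open>If one cone contained both pages, \<open>f\<close> would be inside the segment
      from \<open>g\<close> to \<open>h\<close>. The transversal cone \<open>K v\<close> meets it in
      a face through \<open>f\<close>, which then contains the regular point \<open>g\<close>; so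
      the two cones coincide, against \<open>transK\<close>.\<close>
    ultimately have "f \<in> open_segment g h" using fseg unfolding in_segment by blast
    moreover have "(K u \<inter> K v) face_of K u" using Int_face K\<Sigma> u v by blast
    ultimately have "g \<in> K u \<inter> K v"
      using gh fK[OF u] fK[OF v(1)] unfolding face_of_def by blast
    then have "K u = K v"
      using regular_cone_unique[OF regp[OF u g]] K\<Sigma> u v by blast
    then show False using transK[OF u v] by blast
  qed
  \<comment> \<open>If \<open>C\<close> misses all open pages, it lies in the spine near
    \<open>f\<close>. Its intersection with \<open>K u\<close> is then a face containing inner
    points of segments from \<open>f\<close>, so all of \<open>C\<close> is in
    \<open>K u\<close>.\<close>
  have exh: "\<exists>u\<in>R. C = K u" if C: "C \<in> maximal_cones \<Sigma>" "f \<in> C" for C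
  proof (cases "\<exists>u\<in>R. pg u \<inter> C \<noteq> {}")
    case True
    then obtain u g where "u \<in> R" "g \<in> pg u" "g \<in> C" by blast
    then show ?thesis
      using regular_cone_unique[OF regp] K(2) K\<Sigma> maximal_in_fan[OF C(1)] by blast
  next
    case False
    have C\<Sigma>: "C \<in> \<Sigma>" using C(1) by (rule maximal_in_fan)
    have sp: "pair n a g = 0 \<and> pair n b g = 0" if g: "g \<in> C" "g \<in> coord_box n f e" for g
    proof -
      have gX: "g \<in> X" and gV: "g \<in> ?V" using g cone_sub[OF C\<Sigma>] X_sub by auto
      obtain u where u: "u \<in> R" "on_ray u (pair n a g) (pair n b g)" using loc[OF gV g(2)] gX by blast
      have "g \<notin> pg u" using False u g by blast
      then have z: "fst u * pair n a g + snd u * pair n b g = 0"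
        using u g gV by (auto simp: pg_def on_ray_def)
      have z2: "snd u * pair n a g = fst u * pair n b g" using u by (simp add: on_ray_def)
      have "(fst u * fst u + snd u * snd u) * pair n a g = 0"
        "(fst u * fst u + snd u * snd u) * pair n b g = 0" using z z2 by algebra+
      then show ?thesis using nz[OF u(1)] by (metis less_irrefl mult_eq_0_iff)
    qed
    have "R \<noteq> {}"
    proof
      assume "R = {}"
      then show False using loc[OF fV] e C cone_sub[OF C\<Sigma>] by auto
    qed
    then obtain u where u: "u \<in> R" by blast
    have "g \<in> K u" if g: "g \<in> C" for g
    proof (cases "g = f")
      case True
      then show ?thesis using fK[OF u] by simp
    next
      case False
      obtain d where d: "d > 0" "d < 1" "\<And>t. \<bar>t\<bar> \<le> d \<Longrightarrow> f + t *\<^sub>R (g - f) \<in> coord_box n f e"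
        using coord_box_segment[OF fV e] by metis
      have eq: "f + d *\<^sub>R (g - f) = (1 - d) *\<^sub>R f + d *\<^sub>R g" by (simp add: algebra_simps)
      have inC: "f + d *\<^sub>R (g - f) \<in> C"
        unfolding eq using cone_convex[OF C\<Sigma>] d C(2) g by (intro convexD) auto
      moreover have inb: "f + d *\<^sub>R (g - f) \<in> coord_box n f e" using d by auto
      ultimately have "f + d *\<^sub>R (g - f) \<in> K u"
        using sp[OF inC inb] cone_sub[OF C\<Sigma>] X_sub by (intro spine[OF u]) auto
      then have "f + d *\<^sub>R (g - f) \<in> C \<inter> K u" using inC by blast
      moreover have "f + d *\<^sub>R (g - f) \<in> open_segment f g"
        unfolding in_segment eq using d False by auto
      moreover have "(C \<inter> K u) face_of C" using Int_face[OF C\<Sigma> K\<Sigma>[OF u]] .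
      ultimately have "g \<in> C \<inter> K u" using g C(2) unfolding face_of_def by blast
      then show ?thesis by blast
    qed
    then have "C \<subseteq> K u" by blast
    then have "K u = C" using C(1) K\<Sigma>[OF u] by (auto simp: maximal_cones_def)
    then show ?thesis using u by blast
  qed
  \<comment> \<open>A functional vanishing on \<open>K u\<close> vanishes on the spine and on the
    direction of \<open>u\<close>, which fixes it up to a factor.\<close>
  have ann: "\<exists>k. \<forall>r\<le>n. m r = k * ray_normal a b u r"
    if u: "u \<in> R" and m: "\<And>g. g \<in> K u \<Longrightarrow> pair n m g = 0" for u m
  proof -
    have mspine: "pair n m g = 0" if g: "g \<in> ?V" "pair n a g = 0" "pair n b g = 0" for g
    proof -
      obtain d where d: "d > 0" "\<And>t. \<bar>t\<bar> \<le> d \<Longrightarrow> f + t *\<^sub>R g \<in> coord_box n f e"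
        using coord_box_segment[OF fV e] by metis
      have "f + d *\<^sub>R g \<in> K u"
        using d g af bf fV by (intro spine[OF u]) (auto simp: pair_simps trop_polys_add trop_polys_scale)
      then have "pair n m (f + d *\<^sub>R g) = 0" "pair n m f = 0" using m fK[OF u] by auto
      then show ?thesis using d by (simp add: pair_simps)
    qed
    have dec: "pair n m g = pair n a g * pair n m x + pair n b g * pair n m y" if "g \<in> ?V" for g
    proof -
      have "pair n m (g - pair n a g *\<^sub>R x - pair n b g *\<^sub>R y) = 0"
        using that xy by (intro mspine) (auto simp: pair_simps trop_polys_diff trop_polys_scale)
      then show ?thesis by (simp add: pair_simps)
    qed
    obtain d where d: "d > 0" "\<forall>t. 0 < t \<and> t \<le> d \<longrightarrow> f + t *\<^sub>R dir u \<in> pg u"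
      using spine_seg[OF u fV _ af bf] e by auto
    then have "f + d *\<^sub>R dir u \<in> K u" using K(2)[OF u] by auto
    then have "pair n m (f + d *\<^sub>R dir u) = 0" "pair n m f = 0" using m fK[OF u] by auto
    then have "pair n m (dir u) = 0" using d by (simp add: pair_simps)
    then have rel: "fst u * pair n m x + snd u * pair n m y = 0" using dec[OF dir(1)] dir by simp
    let ?N = "fst u * fst u + snd u * snd u"
    define k where "k = (snd u * pair n m x - fst u * pair n m y) / ?N"
    have N: "?N \<noteq> 0" using nz[OF u] by (metis less_irrefl)
    have k1: "pair n m x = k * snd u" "pair n m y = - k * fst u"
    proof -
      have "pair n m x * ?N = (snd u * pair n m x - fst u * pair n m y) * snd u"
        "pair n m y * ?N = - (snd u * pair n m x - fst u * pair n m y) * fst u"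
        using rel by algebra+
      then show "pair n m x = k * snd u" "pair n m y = - k * fst u"
        using N unfolding k_def by (simp_all add: field_simps)
    qed
    have "m r = k * ray_normal a b u r" if "r \<le> n" for r
    proof -
      have "m r = pair n m (unit_coord r)" using that by (simp add: pair_unit_coord)
      also have "\<dots> = a r * (k * snd u) + b r * (- k * fst u)"
        using dec[OF unit_coord_in[OF that]] that by (simp add: pair_unit_coord k1)
      finally show ?thesis by (simp add: ray_normal_def algebra_simps)
    qed
    then show ?thesis by blast
  qed
  show thesis
    by (rule that[of K]) (use K fK inj exh hyper ann spine e in auto)
qed

section \<open>Combinatorics of double roots: heights, relations, labels and the local shape of the
  discriminant\<close>

section \<open>Double roots in terms of coefficient heights\<close>

definition ht :: "(nat \<Rightarrow>\<^sub>0 real) \<Rightarrow> real \<Rightarrow> nat \<Rightarrow> real" where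
  "ht f a r = cf f r + real r * a"

text \<open>\<open>c\<close> runs over all natural numbers. For \<open>c \<ge> p\<close> nothing is
  removed, which makes the condition coming from \<open>F(B) = 0\<close> one of the
  instances.\<close>

definition off_class :: "nat \<Rightarrow> nat \<Rightarrow> nat \<Rightarrow> nat set" where
  "off_class p n c = {r. r \<le> n \<and> r mod p \<noteq> c}"

definition min_twice :: "nat set \<Rightarrow> (nat \<Rightarrow> real) \<Rightarrow> bool" where
  "min_twice S k \<longleftrightarrow> (\<exists>r\<in>S. \<exists>s\<in>S. r \<noteq> s \<and> k r = k s \<and> (\<forall>q\<in>S. k r \<le> k q))"

definition root_heights :: "nat \<Rightarrow> nat \<Rightarrow> (nat \<Rightarrow> real) \<Rightarrow> bool" where
  "root_heights p n k \<longleftrightarrow> (\<forall>c. min_twice (off_class p n c) k)"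

abbreviation is_root :: "nat \<Rightarrow> nat \<Rightarrow> (nat \<Rightarrow>\<^sub>0 real) \<Rightarrow> real \<Rightarrow> bool" where
  "is_root p n f a \<equiv> root_heights p n (ht f a)"

definition disc_set :: "nat \<Rightarrow> nat \<Rightarrow> (nat \<Rightarrow>\<^sub>0 real) set" where
  "disc_set p n = {f \<in> trop_polys n. \<exists>a. is_root p n f a}"

definition argmin_set :: "nat set \<Rightarrow> (nat \<Rightarrow> real) \<Rightarrow> nat set" where
  "argmin_set S k = {r\<in>S. \<forall>q\<in>S. k r \<le> k q}"

lemma min_twice_cong: "(\<And>r. r \<in> S \<Longrightarrow> k r = k' r) \<Longrightarrow> min_twice S k = min_twice S k'"
  unfolding min_twice_def by auto

lemma root_heights_cong: "(\<And>r. r \<le> n \<Longrightarrow> k r = k' r) \<Longrightarrow> root_heights p n k = root_heights p n k'"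
  unfolding root_heights_def
  by (intro all_cong1 min_twice_cong) (auto simp: off_class_def)

text \<open>\<open>k'\<close> keeps every strict inequality of \<open>k\<close>, so its minimum is
  decided among the minimisers of \<open>k\<close>.\<close>

lemma min_twice_refine:
  assumes "\<And>q r. q \<in> S \<Longrightarrow> r \<in> S \<Longrightarrow> k q < k r \<Longrightarrow> k' q < k' r"
    and ne: "argmin_set S k \<noteq> {}"
  shows "min_twice S k' \<longleftrightarrow> min_twice (argmin_set S k) k'"
proof
  assume "min_twice S k'"
  then obtain r s where rs: "r \<in> S" "s \<in> S" "r \<noteq> s" "k' r = k' s" "\<forall>q\<in>S. k' r \<le> k' q"
    unfolding min_twice_def by blast
  have "k r \<le> k q" "k s \<le> k q" if "q \<in> S" for q
    using assms(1)[OF that rs(1)] assms(1)[OF that rs(2)] rs(4,5) that by (metis not_le)+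
  then have "r \<in> argmin_set S k" "s \<in> argmin_set S k" using rs by (auto simp: argmin_set_def)
  moreover have "\<forall>q\<in>argmin_set S k. k' r \<le> k' q" using rs(5) by (simp add: argmin_set_def)
  ultimately show "min_twice (argmin_set S k) k'"
    unfolding min_twice_def using rs(3,4) by blast
next
  assume "min_twice (argmin_set S k) k'"
  then obtain r s where rs: "r \<in> argmin_set S k" "s \<in> argmin_set S k" "r \<noteq> s" "k' r = k' s"
      "\<forall>q\<in>argmin_set S k. k' r \<le> k' q"
    unfolding min_twice_def by blast
  have "k' r \<le> k' q" if q: "q \<in> S" for q
  proof (cases "q \<in> argmin_set S k")
    case False
    then have "k r < k q" using rs(1) q unfolding argmin_set_def by (auto simp: not_le intro: le_less_trans)
    then show ?thesis using assms(1)[of r q] rs(1) q by (auto simp: argmin_set_def)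
  qed (use rs in auto)
  moreover have "r \<in> S" "s \<in> S" using rs(1,2) by (auto simp: argmin_set_def)
  ultimately show "min_twice S k'" unfolding min_twice_def using rs(3,4) by blast
qed

lemma finite_off_class: "finite (off_class p n c)"
  by (simp add: off_class_def)

text \<open>The star of the root condition at \<open>k\<close>: strict inequalities of
  \<open>k\<close> count as settled, and \<open>k'\<close> only decides between ties.\<close>

definition local_root :: "nat \<Rightarrow> nat \<Rightarrow> (nat \<Rightarrow> real) \<Rightarrow> (nat \<Rightarrow> real) \<Rightarrow> bool" where
  "local_root p n k k' \<longleftrightarrow> (\<forall>c. min_twice (argmin_set (off_class p n c) k) k')"

lemma argmin_nonempty_if_min_twice: "min_twice S k \<Longrightarrow> argmin_set S k \<noteq> {}"
  unfolding min_twice_def argmin_set_def by blast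

lemma root_heights_refine:
  assumes "root_heights p n k" "\<And>q r. q \<le> n \<Longrightarrow> r \<le> n \<Longrightarrow> k q < k r \<Longrightarrow> k' q < k' r"
  shows "root_heights p n k' \<longleftrightarrow> local_root p n k k'"
proof -
  have "min_twice (off_class p n c) k' \<longleftrightarrow> min_twice (argmin_set (off_class p n c) k) k'" for c
  proof (rule min_twice_refine)
    show "argmin_set (off_class p n c) k \<noteq> {}"
      using assms(1) by (auto simp: root_heights_def intro!: argmin_nonempty_if_min_twice)
  qed (use assms(2) in \<open>auto simp: off_class_def\<close>)
  then show ?thesis by (simp add: root_heights_def local_root_def)
qed

lemma local_root_self: "root_heights p n k \<Longrightarrow> local_root p n k k"
  using root_heights_refine[of p n k k] by simp

text \<open>With \<open>m\<close> the smallest positive difference of heights, each height must move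
  by less than \<open>m / 2\<close>. A change of coefficients and root by less than \<open>d\<close>
  moves a height by less than \<open>d + n * d\<close>, hence
  \<open>d = m / (2 * (n + 1))\<close>.\<close>

lemma heights_gap:
  obtains d where "d > 0" "\<And>g b q r. g \<in> coord_box n f d \<Longrightarrow> \<bar>b - a\<bar> < d \<Longrightarrow> q \<le> n \<Longrightarrow> r \<le> n
    \<Longrightarrow> ht f a q < ht f a r \<Longrightarrow> ht g b q < ht g b r"
proof -
  \<comment> \<open>The element \<open>1\<close> keeps \<open>P\<close> nonempty when all heights
    agree.\<close>
  define P where "P = insert 1 {ht f a r - ht f a q | q r. q \<le> n \<and> r \<le> n \<and> ht f a q < ht f a r}"
  have "finite {ht f a r - ht f a q | q r. q \<le> n \<and> r \<le> n \<and> ht f a q < ht f a r}"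
    by (rule finite_subset[of _ "(\<lambda>(q, r). ht f a r - ht f a q) ` ({..n} \<times> {..n})"]) auto
  then have fin: "finite P" "P \<noteq> {}" by (auto simp: P_def)
  define m where "m = Min P"
  have "m \<in> P" unfolding m_def using fin by (rule Min_in)
  then have m0: "m > 0" by (auto simp: P_def)
  define d where "d = m / (2 * (real n + 1))"
  have d0: "d > 0" using m0 by (simp add: d_def)
  have near: "\<bar>ht g b r - ht f a r\<bar> < m / 2" if "g \<in> coord_box n f d" "\<bar>b - a\<bar> < d" "r \<le> n" for g b r
  proof -
    have "ht g b r - ht f a r = (cf g r - cf f r) + real r * (b - a)"
      by (simp add: ht_def algebra_simps)
    then have "\<bar>ht g b r - ht f a r\<bar> \<le> \<bar>cf g r - cf f r\<bar> + real r * \<bar>b - a\<bar>"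
      by (metis abs_mult abs_of_nat abs_triangle_ineq)
    also have "\<dots> < d + real r * d"
      using coord_boxD[OF that(1,3)] that(2) by (intro add_less_le_mono mult_left_mono) auto
    also have "\<dots> \<le> d + real n * d" using that(3) d0 by simp
    also have "\<dots> = m / 2"
    proof -
      have "d * (2 * (real n + 1)) = m" by (simp add: d_def add_eq_0_iff)
      then show ?thesis by (simp add: algebra_simps)
    qed
    finally show ?thesis .
  qed
  have "ht g b q < ht g b r"
    if h: "g \<in> coord_box n f d" "\<bar>b - a\<bar> < d" "q \<le> n" "r \<le> n" "ht f a q < ht f a r" for g b q r
  proof -
    have "ht f a r - ht f a q \<in> P" using h by (auto simp: P_def)
    then have "m \<le> ht f a r - ht f a q" unfolding m_def using fin by (intro Min_le)
    then show ?thesis using near[OF h(1,2,3)] near[OF h(1,2,4)] by linarith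
  qed
  then show thesis using d0 that by blast
qed

text \<open>Minus the slope of the line through \<open>(i, cf g i)\<close> and
  \<open>(j, cf g j)\<close>, the only candidate for a root at which \<open>i\<close> and
  \<open>j\<close> tie. Candidates become continuous functions of \<open>g\<close>; for
  \<open>i = j\<close> the value is \<open>0\<close>.\<close>

definition slope :: "nat \<Rightarrow> nat \<Rightarrow> (nat \<Rightarrow>\<^sub>0 real) \<Rightarrow> real" where
  "slope i j g = - (cf g i - cf g j) / (real i - real j)"

lemma ht_eq_iff_slope: "i \<noteq> j \<Longrightarrow> ht g b i = ht g b j \<longleftrightarrow> b = slope i j g"
proof -
  assume "i \<noteq> j"
  then have "real i - real j \<noteq> 0" by simp
  then have "b = slope i j g \<longleftrightarrow> b * (real i - real j) = - (cf g i - cf g j)"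
    unfolding slope_def by (simp add: eq_divide_eq)
  then show ?thesis by (auto simp: ht_def algebra_simps)
qed

lemma slope_near:
  assumes "i \<noteq> j" "i \<le> n" "j \<le> n" "g \<in> coord_box n f (e / 2)"
  shows "\<bar>slope i j g - slope i j f\<bar> < e"
proof -
  have "\<bar>real i - real j\<bar> \<ge> 1" using assms(1) by linarith
  moreover have "slope i j g - slope i j f = - ((cf g i - cf f i) - (cf g j - cf f j)) / (real i - real j)"
    by (simp add: slope_def diff_divide_distrib[symmetric])
  ultimately have "\<bar>slope i j g - slope i j f\<bar> \<le> \<bar>(cf g i - cf f i) - (cf g j - cf f j)\<bar> / 1"
    using divide_left_mono[of 1 "\<bar>real i - real j\<bar>" "\<bar>(cf g i - cf f i) - (cf g j - cf f j)\<bar>"]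
    by (simp only: abs_divide abs_minus_cancel) simp
  also have "\<dots> \<le> \<bar>cf g i - cf f i\<bar> + \<bar>cf g j - cf f j\<bar>"
    using abs_triangle_ineq4[of "cf g i - cf f i" "cf g j - cf f j"] by simp
  also have "\<dots> < e / 2 + e / 2"
    using coord_boxD[OF assms(4,2)] coord_boxD[OF assms(4,3)] by (intro add_strict_mono)
  finally show ?thesis by simp
qed

text \<open>No residue equals \<open>p\<close>, so removing the class \<open>p\<close> removes
  nothing: the minimum over all exponents is attained twice, and two heights meet at the
  root.\<close>

lemma root_is_slope:
  assumes "root_heights p n (ht f a)" "p > 0"
  obtains r s where "r \<le> n" "s \<le> n" "r \<noteq> s" "a = slope r s f"
proof -
  have "off_class p n p = {..n}"
    using mod_less_divisor[OF assms(2)] less_irrefl unfolding off_class_def atMost_def by metis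
  then have "min_twice {..n} (ht f a)" using assms(1) by (metis root_heights_def)
  then show thesis using that unfolding min_twice_def by (metis ht_eq_iff_slope atMost_iff)
qed

lemma finite_roots:
  assumes "p > 0" shows "finite {a. is_root p n f a}"
proof (rule finite_subset)
  show "{a. is_root p n f a} \<subseteq> (\<lambda>(r, s). slope r s f) ` ({..n} \<times> {..n})"
  proof
    fix a assume "a \<in> {a. is_root p n f a}"
    then obtain r s where "r \<le> n" "s \<le> n" "a = slope r s f"
      using assms by (auto elim: root_is_slope[of p n f a])
    then show "a \<in> (\<lambda>(r, s). slope r s f) ` ({..n} \<times> {..n})" by (auto intro: rev_image_eqI[of "(r, s)"])
  qed
qed auto

lemma continuous_on_ht_slope [continuous_intros]: "continuous_on A (\<lambda>g. ht g (slope r s g) q)"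
  unfolding ht_def slope_def by (cases "r = s") (auto intro!: continuous_intros)

lemma closed_min_twice:
  assumes "finite S" "\<And>q. q \<in> S \<Longrightarrow> continuous_on UNIV (\<lambda>g. k g q)"
  shows "closed {g :: 'a::t2_space. min_twice S (k g)}"
proof -
  have "{g. min_twice S (k g)} =
    (\<Union>r\<in>S. \<Union>s\<in>S - {r}. {g. k g r = k g s} \<inter> (\<Inter>q\<in>S. {g. k g r \<le> k g q}))"
    by (rule set_eqI) (simp only: min_twice_def mem_Collect_eq UN_iff INT_iff Int_iff Diff_iff singleton_iff Bex_def Ball_def, metis)
  moreover have "closed ({g. k g r = k g s} \<inter> (\<Inter>q\<in>S. {g. k g r \<le> k g q}))"
    if "r \<in> S" "s \<in> S" for r s
    using that assms(2)
    by (intro closed_Int closed_INT ballI closed_Collect_eq closed_Collect_le) auto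
  ultimately show ?thesis
    using assms(1) by (simp only:) (intro closed_UN ballI, auto)
qed

lemma closed_root_heights:
  assumes "\<And>q. continuous_on UNIV (\<lambda>g. k g q)"
  shows "closed {g :: 'a::t2_space. root_heights p n (k g)}"
  unfolding root_heights_def
  by (intro closed_Collect_all closed_min_twice finite_off_class assms)

text \<open>The polynomials for which the slope of \<open>(r, s)\<close> is a root form a closed set
  \<open>Z r s\<close>. Near \<open>f\<close> only pairs with \<open>f \<in> Z r s\<close> can
  occur, and slopes vary continuously.\<close>

lemma roots_near:
  assumes p: "p > 0" and fV: "f \<in> trop_polys n" and d: "d > 0"
  obtains e where "e > 0" "\<And>g b. g \<in> trop_polys n \<Longrightarrow> g \<in> coord_box n f e \<Longrightarrow> is_root p n g b
     \<Longrightarrow> \<exists>a. is_root p n f a \<and> \<bar>b - a\<bar> < d"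
proof -
  define Z where "Z r s = {g. root_heights p n (ht g (slope r s g))}" for r s
  define I where "I = {(r, s). r \<le> n \<and> s \<le> n \<and> f \<notin> Z r s}"
  have "finite I" by (rule finite_subset[of _ "{..n} \<times> {..n}"]) (auto simp: I_def)
  then have "open (\<Inter>(r, s)\<in>I. - Z r s)"
    unfolding Z_def by (auto intro!: open_INT open_Compl closed_root_heights continuous_intros)
  moreover have "f \<in> (\<Inter>(r, s)\<in>I. - Z r s)" by (auto simp: I_def)
  ultimately obtain e1 where e1: "e1 > 0" "trop_polys n \<inter> coord_box n f e1 \<subseteq> (\<Inter>(r, s)\<in>I. - Z r s)"
    using coord_box_basis fV by metis
  show thesis
  proof (rule that)
    show "min e1 (d / 2) > 0" using e1 d by simp
    fix g b assume g: "g \<in> trop_polys n" "g \<in> coord_box n f (min e1 (d / 2))" and b: "is_root p n g b"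
    obtain r s where rs: "r \<le> n" "s \<le> n" "r \<noteq> s" "b = slope r s g" using root_is_slope[OF b p] .
    have "g \<in> Z r s" using b rs by (simp add: Z_def)
    moreover have "g \<in> coord_box n f e1" using g coord_box_mono[of "min e1 (d/2)" e1] by auto
    ultimately have "f \<in> Z r s" using e1(2) g(1) rs by (auto simp: I_def)
    then have "is_root p n f (slope r s f)" by (simp add: Z_def)
    moreover have "\<bar>b - slope r s f\<bar> < d"
      unfolding rs(4) using rs by (intro slope_near[of _ _ n] subsetD[OF coord_box_mono g(2)]) auto
    ultimately show "\<exists>a. is_root p n f a \<and> \<bar>b - a\<bar> < d" by blast
  qed
qed

text \<open>Roots of nearby polynomials stay near roots of \<open>f\<close>, where the star
  condition is exact; finiteness of the roots gives one radius for all of them.\<close>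

lemma disc_set_local:
  assumes p: "p > 0" and fV: "f \<in> trop_polys n"
  obtains e where "e > 0" "\<And>g. g \<in> trop_polys n \<Longrightarrow> g \<in> coord_box n f e \<Longrightarrow>
     g \<in> disc_set p n \<longleftrightarrow> (\<exists>a. is_root p n f a \<and> (\<exists>b. local_root p n (ht f a) (ht g b)))"
proof -
  define A where "A = {a. is_root p n f a}"
  have finA: "finite A" unfolding A_def by (rule finite_roots[OF p])
  have "\<exists>d. d > 0 \<and> (\<forall>g b q r. g \<in> coord_box n f d \<longrightarrow> \<bar>b - a\<bar> < d \<longrightarrow> q \<le> n \<longrightarrow> r \<le> n
    \<longrightarrow> ht f a q < ht f a r \<longrightarrow> ht g b q < ht g b r)" for a
    using heights_gap[of n f a] by metis
  then obtain d where d: "\<And>a. d a > 0" "\<And>a g b q r. g \<in> coord_box n f (d a) \<Longrightarrow> \<bar>b - a\<bar> < d a \<Longrightarrow>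
      q \<le> n \<Longrightarrow> r \<le> n \<Longrightarrow> ht f a q < ht f a r \<Longrightarrow> ht g b q < ht g b r" by metis
  define m where "m = Min (insert 1 (d ` A))"
  have m: "m > 0" "\<And>a. a \<in> A \<Longrightarrow> m \<le> d a"
    using finA d(1) by (auto simp: m_def)
  obtain e1 where e1: "e1 > 0" "\<And>g b. g \<in> trop_polys n \<Longrightarrow> g \<in> coord_box n f e1 \<Longrightarrow> is_root p n g b
     \<Longrightarrow> \<exists>a. is_root p n f a \<and> \<bar>b - a\<bar> < m"
    using roots_near[OF p fV m(1)] by metis
  have loc: "is_root p n g b \<longleftrightarrow> local_root p n (ht f a) (ht g b)"
    if "a \<in> A" "g \<in> coord_box n f m" "\<bar>b - a\<bar> < m" for a b g
  proof (rule root_heights_refine)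
    show "is_root p n f a" using that by (simp add: A_def)
    have "g \<in> coord_box n f (d a)" using coord_box_mono[OF m(2)] that by blast
    then show "ht g b q < ht g b r" if "q \<le> n" "r \<le> n" "ht f a q < ht f a r" for q r
      using d(2)[of g a b q r] that m(2)[OF \<open>a \<in> A\<close>] \<open>\<bar>b - a\<bar> < m\<close> by auto
  qed
  \<comment> \<open>The star condition puts no explicit bound on \<open>b\<close>, but it contains a
    tie of two minimisers, which makes \<open>b\<close> a slope of \<open>g\<close> and hence close
    to \<open>a\<close>.\<close>
  have near: "\<bar>b - a\<bar> < m"
    if "a \<in> A" "g \<in> coord_box n f (m / 2)" "local_root p n (ht f a) (ht g b)" for a b g
  proof -
    have "min_twice (argmin_set (off_class p n 0) (ht f a)) (ht g b)"
      using that(3) by (simp add: local_root_def)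
    then obtain r s where rs: "r \<noteq> s" "ht g b r = ht g b s" "r \<in> argmin_set (off_class p n 0) (ht f a)"
        "s \<in> argmin_set (off_class p n 0) (ht f a)"
      unfolding min_twice_def by blast
    then have "r \<le> n" "s \<le> n" "ht f a r = ht f a s"
      by (auto simp: argmin_set_def off_class_def intro: antisym)
    then show ?thesis
      using slope_near[OF rs(1) _ _ that(2)] ht_eq_iff_slope[OF rs(1)] rs(2) by metis
  qed
  show thesis
  proof (rule that)
    show "min e1 (m / 2) > 0" using e1 m by simp
    fix g assume g: "g \<in> trop_polys n" "g \<in> coord_box n f (min e1 (m / 2))"
    have g1: "g \<in> coord_box n f e1" "g \<in> coord_box n f m" "g \<in> coord_box n f (m / 2)"
      using m(1) by (auto intro!: subsetD[OF coord_box_mono g(2)])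
    show "g \<in> disc_set p n \<longleftrightarrow> (\<exists>a. is_root p n f a \<and> (\<exists>b. local_root p n (ht f a) (ht g b)))"
    proof
      assume "g \<in> disc_set p n"
      then obtain b where b: "is_root p n g b" by (auto simp: disc_set_def)
      then obtain a where a: "is_root p n f a" "\<bar>b - a\<bar> < m" using e1(2)[OF g(1) g1(1)] by blast
      then show "\<exists>a. is_root p n f a \<and> (\<exists>b. local_root p n (ht f a) (ht g b))"
        using loc[OF _ g1(2)] b by (auto simp: A_def)
    next
      assume "\<exists>a. is_root p n f a \<and> (\<exists>b. local_root p n (ht f a) (ht g b))"
      then obtain a b where ab: "a \<in> A" "local_root p n (ht f a) (ht g b)" by (auto simp: A_def)
      then have "is_root p n g b" using loc[OF ab(1) g1(2) near[OF ab(1) g1(3) ab(2)]] by simp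
      then show "g \<in> disc_set p n" using g by (auto simp: disc_set_def)
    qed
  qed
qed

section \<open>The shape of the minimum at a double root\<close>

abbreviation min_set :: "nat \<Rightarrow> (nat \<Rightarrow> real) \<Rightarrow> nat set" where
  "min_set n k \<equiv> argmin_set {..n} k"

definition monochrome :: "nat \<Rightarrow> nat set \<Rightarrow> bool" where
  "monochrome p M \<longleftrightarrow> (\<exists>c. \<forall>r\<in>M. r mod p = c)"

lemma min_set_nonempty: "min_set n k \<noteq> {}"
proof -
  have "Min (k ` {..n}) \<in> k ` {..n}" by (intro Min_in) auto
  then obtain r where "r \<le> n" "k r = Min (k ` {..n})" by (metis imageE atMost_iff)
  then have "r \<in> min_set n k" by (auto simp: argmin_set_def)
  then show ?thesis by blast
qed

lemma argmin_off_class: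
  assumes "\<exists>r\<in>min_set n k. r mod p \<noteq> c"
  shows "argmin_set (off_class p n c) k = {r \<in> min_set n k. r mod p \<noteq> c}"
  using assms by (auto simp: argmin_set_def off_class_def intro: order_trans)

lemma local_root_polychrome:
  assumes "\<not> monochrome p (min_set n k)"
  shows "local_root p n k k' \<longleftrightarrow> (\<forall>c. min_twice {r \<in> min_set n k. r mod p \<noteq> c} k')"
  using argmin_off_class[of n k p] assms by (auto simp: local_root_def monochrome_def)

text \<open>Removing a class other than \<open>c\<close> keeps all lowest exponents, so these
  conditions are all the same one.\<close>

lemma local_root_monochrome:
  assumes "\<And>r. r \<in> min_set n k \<Longrightarrow> r mod p = c"
  shows "local_root p n k k' \<longleftrightarrow> min_twice (min_set n k) k' \<and> min_twice (argmin_set (off_class p n c) k) k'"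
proof -
  have "argmin_set (off_class p n c') k = min_set n k" if "c' \<noteq> c" for c'
    using argmin_off_class[of n k p c'] assms that min_set_nonempty[of n k] by fastforce
  then show ?thesis
    unfolding local_root_def by (metis n_not_Suc_n)
qed

text \<open>The union of the minimisers over all classes, see \<open>relevant_eq\<close>. This form
  constrains the exponents that lie lower, which is what allows different roots to be
  compared.\<close>

definition relevant :: "nat \<Rightarrow> nat \<Rightarrow> (nat \<Rightarrow> real) \<Rightarrow> nat set" where
  "relevant p n k = {r. r \<le> n \<and> (\<exists>c. r mod p \<noteq> c \<and> (\<forall>q\<le>n. k q < k r \<longrightarrow> q mod p = c))}"

lemma relevant_eq: "relevant p n k = (\<Union>c. argmin_set (off_class p n c) k)"
proof -
  have "r \<in> relevant p n k \<longleftrightarrow> (\<exists>c. r \<in> argmin_set (off_class p n c) k)" for r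
    unfolding relevant_def argmin_set_def off_class_def by (auto simp: not_le[symmetric])
  then show ?thesis by blast
qed

lemma finite_relevant: "finite (relevant p n k)"
  by (rule finite_subset[of _ "{..n}"]) (auto simp: relevant_def)

lemma relevant_polychrome:
  assumes "\<not> monochrome p (min_set n k)"
  shows "relevant p n k = min_set n k"
proof -
  have "relevant p n k = (\<Union>c. {r \<in> min_set n k. r mod p \<noteq> c})"
    using argmin_off_class[of n k p] assms by (simp add: relevant_eq monochrome_def)
  also have "\<dots> = min_set n k" by auto (metis n_not_Suc_n)
  finally show ?thesis .
qed

lemma relevant_monochrome:
  assumes "\<And>r. r \<in> min_set n k \<Longrightarrow> r mod p = c"
  shows "relevant p n k = min_set n k \<union> argmin_set (off_class p n c) k"
proof -
  have *: "argmin_set (off_class p n c') k = min_set n k" if "c' \<noteq> c" for c'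
    using argmin_off_class[of n k p c'] assms that min_set_nonempty[of n k] by fastforce
  have "relevant p n k = argmin_set (off_class p n c) k \<union> (\<Union>c'\<in>-{c}. argmin_set (off_class p n c') k)"
    unfolding relevant_eq by auto
  also have "(\<Union>c'\<in>-{c}. argmin_set (off_class p n c') k) = min_set n k"
  proof -
    have "Suc c \<in> -{c}" by simp
    then have "-{c} \<noteq> {}" by blast
    then show ?thesis using * by auto
  qed
  finally show ?thesis by auto
qed

lemma min_twice_card: "min_twice S k \<Longrightarrow> finite S \<Longrightarrow> 2 \<le> card S"
  unfolding min_twice_def by (metis card_2_iff card_mono empty_subsetI insert_subset)

lemma min_twice_two: "i \<noteq> j \<Longrightarrow> min_twice {i, j} k \<longleftrightarrow> k i = k j"
  unfolding min_twice_def by auto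

section \<open>Linear relations at a double root\<close>

text \<open>The level sums kill vectors constant on each height level, and the weighted sum kills
  arithmetic progressions. Such a functional vanishes on every \<open>g\<close> that for some
  \<open>b\<close> has heights constant on each level of the relevant exponents.\<close>

definition root_relation :: "nat \<Rightarrow> nat \<Rightarrow> (nat \<Rightarrow> real) \<Rightarrow> (nat \<Rightarrow> real) \<Rightarrow> bool" where
  "root_relation p n k l \<longleftrightarrow>
     (\<forall>r. l r \<noteq> 0 \<longrightarrow> r \<in> relevant p n k) \<and> (\<forall>t. (\<Sum>r | r \<le> n \<and> k r = t. l r) = 0) \<and>
     (\<Sum>r\<le>n. real r * l r) = 0"

lemma relevantD:
  assumes "r \<in> relevant p n k"
  obtains c where "r mod p \<noteq> c" "\<And>q. q \<le> n \<Longrightarrow> k q < k r \<Longrightarrow> q mod p = c"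
  using assms unfolding relevant_def by blast

text \<open>Relations at distinct roots are in direct sum. At a smaller root the larger indices become
  lower. Hence an index \<open>r\<close> supporting the relation at the largest root and also one at a smaller
  root sees only one residue class, different from its own, among the larger indices that are not
  above it.\<close>

lemma root_relations_independent:
  assumes fin: "finite A" and rel: "\<And>a. a \<in> A \<Longrightarrow> root_relation p n (ht f a) (l a)"
    and sum0: "\<And>r. r \<le> n \<Longrightarrow> (\<Sum>a\<in>A. l a r) = 0"
    and a: "a \<in> A" and r: "r \<le> n"
  shows "l a r = 0"
proof (rule ccontr)
  assume nz: "l a r \<noteq> 0"
  define A' where "A' = {a\<in>A. \<exists>r\<le>n. l a r \<noteq> 0}"
  have A': "finite A'" "A' \<noteq> {}" using fin a r nz by (auto simp: A'_def)
  define a1 where "a1 = Max A'"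
  have a1: "a1 \<in> A'" "\<And>b. b \<in> A' \<Longrightarrow> b \<le> a1"
    using A' by (auto simp: a1_def)
  have a1A: "a1 \<in> A" using a1 by (simp add: A'_def)
  define k where "k = ht f a1"
  define S where "S = {r. r \<le> n \<and> l a1 r \<noteq> 0}"
  have finS: "finite S" by (simp add: S_def)
  have Sne: "S \<noteq> {}" using a1 by (auto simp: S_def A'_def)
  have rel1: "root_relation p n k (l a1)" using rel[OF a1A] by (simp add: k_def)
  have later: "\<exists>c. r mod p \<noteq> c \<and> (\<forall>q. r < q \<longrightarrow> q \<le> n \<longrightarrow> k q \<le> k r \<longrightarrow> q mod p = c)" if "r \<in> S" for r
  proof -
    have r: "r \<le> n" "l a1 r \<noteq> 0" using that by (auto simp: S_def)
    have "(\<Sum>a\<in>A - {a1}. l a r) \<noteq> 0"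
      using sum0[OF r(1)] r(2) sum.remove[OF fin a1A, of "\<lambda>a. l a r"] by simp
    then obtain b where b: "b \<in> A - {a1}" "l b r \<noteq> 0" by (meson sum.neutral)
    then have bA: "b \<in> A" and "b \<in> A'" using r by (auto simp: A'_def)
    then have ba: "b < a1" using a1(2)[of b] b by auto
    have "r \<in> relevant p n (ht f b)" using rel[OF bA] b by (auto simp: root_relation_def)
    then obtain c where c: "r mod p \<noteq> c" "\<And>q. q \<le> n \<Longrightarrow> ht f b q < ht f b r \<Longrightarrow> q mod p = c"
      by (rule relevantD) blast
    have "q mod p = c" if q: "r < q" "q \<le> n" "k q \<le> k r" for q
    proof (rule c(2)[OF q(2)])
      have "(real q - real r) * (a1 - b) > 0" using q ba by simp
      then show "ht f b q < ht f b r" using q(3) by (simp add: k_def ht_def algebra_simps)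
    qed
    then show ?thesis using c(1) by blast
  qed
  have relS: "r \<in> relevant p n k" if "r \<in> S" for r
    using rel1 that by (auto simp: root_relation_def S_def)
  define r0 where "r0 = Min S"
  have r0: "r0 \<in> S" "\<And>r. r \<in> S \<Longrightarrow> r0 \<le> r" using finS Sne by (auto simp: r0_def)
  have lev: "(\<Sum>r | r \<le> n \<and> k r = k r0. l a1 r) = 0" using rel1 by (simp add: root_relation_def)
  have r0lev: "r0 \<in> {r. r \<le> n \<and> k r = k r0}" using r0 by (simp add: S_def)
  have "(\<Sum>r\<in>{r. r \<le> n \<and> k r = k r0} - {r0}. l a1 r) \<noteq> 0"
    using lev sum.remove[OF _ r0lev, of "l a1"] r0(1) by (simp add: S_def)
  then obtain r1 where r1: "r1 \<in> {r. r \<le> n \<and> k r = k r0} - {r0}" "l a1 r1 \<noteq> 0" by (meson sum.neutral)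
  then have r1S: "r1 \<in> S" and r1n: "r1 \<le> n" and r1k: "k r1 = k r0" and r1ne: "r1 \<noteq> r0"
    by (auto simp: S_def)
  have r01: "r0 < r1" using r0(2)[OF r1S] r1ne by simp
  obtain c0 where c0: "r0 mod p \<noteq> c0" "\<And>q. r0 < q \<Longrightarrow> q \<le> n \<Longrightarrow> k q \<le> k r0 \<Longrightarrow> q mod p = c0"
    using later[OF r0(1)] by blast
  have r1c: "r1 mod p = c0" using c0(2)[OF r01 r1n] r1k by simp
  \<comment> \<open>Of two exponents with equal height and residue, the smaller one would contradict
    \<open>later\<close>.\<close>
  have same: "x = y" if "x \<in> S" "y \<in> S" "k x = k y" "x mod p = y mod p" for x y
  proof (rule ccontr)
    assume ne: "x \<noteq> y"
    have *: False if xy: "x < y" "x \<in> S" "y \<in> S" "k x = k y" "x mod p = y mod p" for x y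
      using later[OF xy(2)] xy by (auto simp: S_def)
    show False using *[of x y] *[of y x] ne that by (metis linorder_neqE_nat)
  qed
  \<comment> \<open>A further exponent at the height of \<open>r0\<close> repeats the residue of
    \<open>r1\<close>; a lower one has the residue of \<open>r1\<close> as well, although
    \<open>r1\<close> is relevant; a higher one has both residues of \<open>r0\<close> and
    \<open>r1\<close> below it. On two exponents, the vanishing level sum and weighted sum leave
    only the zero relation.\<close>
  have S2: "S = {r0, r1}"
  proof
    show "S \<subseteq> {r0, r1}"
    proof (rule subsetI, rule ccontr)
      fix q assume q: "q \<in> S" "q \<notin> {r0, r1}"
      then have qr: "r0 < q" using r0(2)[OF q(1)] by auto
      have qn: "q \<le> n" using q by (simp add: S_def)
      consider "k q = k r0" | "k q < k r0" | "k r0 < k q" by linarith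
      then show False
      proof cases
        case 1
        then have "q mod p = c0" using c0(2)[OF qr qn] by simp
        then show False using same[OF q(1) r1S] 1 r1k r1c q by simp
      next
        case 2
        then have qc: "q mod p = c0" using c0(2)[OF qr qn] by simp
        obtain c where "r1 mod p \<noteq> c" "\<And>q. q \<le> n \<Longrightarrow> k q < k r1 \<Longrightarrow> q mod p = c"
          using relevantD[OF relS[OF r1S]] by blast
        then show False using 2 r1k r1c qc qn by auto
      next
        case 3
        obtain c where "\<And>q'. q' \<le> n \<Longrightarrow> k q' < k q \<Longrightarrow> q' mod p = c"
          using relevantD[OF relS[OF q(1)]] by blast
        then have "r0 mod p = c" "r1 mod p = c" using 3 r1k r1n r0(1) by (auto simp: S_def)
        then show False using c0(1) r1c by simp
      qed
    qed
  qed (use r0 r1S in auto)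
  have "(\<Sum>r | r \<le> n \<and> k r = k r0. l a1 r) = (\<Sum>r\<in>{r0, r1}. l a1 r)"
    by (rule sum.mono_neutral_right) (use r0lev r1 S2 in \<open>auto simp: S_def\<close>)
  then have l01: "l a1 r0 + l a1 r1 = 0" using lev r1ne by simp
  have "(\<Sum>r\<le>n. real r * l a1 r) = (\<Sum>r\<in>{r0, r1}. real r * l a1 r)"
    by (rule sum.mono_neutral_right) (use r0lev r1 S2 in \<open>auto simp: S_def\<close>)
  then have "real r0 * l a1 r0 + real r1 * l a1 r1 = 0"
    using rel1 r1ne by (simp add: root_relation_def)
  then have "(real r1 - real r0) * l a1 r1 = 0" using l01 by algebra
  then show False using r01 r1(2) by simp
qed

text \<open>The difference of the heights of \<open>q\<close> and \<open>b\<close> at the slope through \<open>i\<close> and \<open>j\<close>.\<close>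

definition gap :: "nat \<Rightarrow> nat \<Rightarrow> nat \<Rightarrow> nat \<Rightarrow> nat \<Rightarrow> real" where
  "gap i j q b r = of_bool (r = q) - of_bool (r = b)
     - (real q - real b) / (real i - real j) * (of_bool (r = i) - of_bool (r = j))"

lemma sum_of_bool_eq:
  fixes n :: nat
  shows "q \<le> n \<Longrightarrow> (\<Sum>r\<le>n. of_bool (r = q) * h r) = (h q :: real)"
proof -
  assume q: "q \<le> n"
  have "(\<Sum>r\<le>n. of_bool (r = q) * h r) = (\<Sum>r\<in>{q}. of_bool (r = q) * h r)"
    by (rule sum.mono_neutral_right) (use q in auto)
  then show ?thesis by simp
qed

lemma pair_gap:
  assumes "i \<le> n" "j \<le> n" "q \<le> n" "b \<le> n"
  shows "pair n (gap i j q b) g = ht g (slope i j g) q - ht g (slope i j g) b"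
proof -
  have "pair n (gap i j q b) g = cf g q - cf g b
      - (real q - real b) / (real i - real j) * (cf g i - cf g j)"
    unfolding pair_def gap_def left_diff_distrib sum_subtractf mult.assoc sum_distrib_left[symmetric]
    using assms by (simp add: sum_of_bool_eq)
  also have "\<dots> = cf g q - cf g b + (real q - real b) * slope i j g"
    by (simp add: slope_def minus_mult_right[symmetric] del: minus_diff_eq)
  finally show ?thesis by (simp add: ht_def algebra_simps)
qed

text \<open>Two differences within height levels, the second scaled so that the weighted sum
  vanishes.\<close>

lemma gap_relation:
  assumes "i \<in> relevant p n k" "j \<in> relevant p n k" "q \<in> relevant p n k" "b \<in> relevant p n k"
    "i \<noteq> j" "k i = k j" "k q = k b"
  shows "root_relation p n k (gap i j q b)"
  unfolding root_relation_def
proof (intro conjI allI impI)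
  have le: "i \<le> n" "j \<le> n" "q \<le> n" "b \<le> n" using assms by (auto simp: relevant_def)
  fix r assume "gap i j q b r \<noteq> 0"
  then show "r \<in> relevant p n k" using assms(1-4)
    by (cases "r = q"; cases "r = b"; cases "r = i"; cases "r = j"; simp add: gap_def)
next
  have le: "i \<le> n" "j \<le> n" "q \<le> n" "b \<le> n" using assms by (auto simp: relevant_def)
  fix t
  have *: "(\<Sum>r | r \<le> n \<and> k r = t. of_bool (r = x)) = (of_bool (k x = t) :: real)" if "x \<le> n" for x
  proof -
    have "(\<Sum>r | r \<le> n \<and> k r = t. of_bool (r = x)) = (\<Sum>r\<le>n. if r = x then of_bool (k r = t) else 0 :: real)"
      by (rule sum.mono_neutral_cong_left) auto
    then show ?thesis using that by simp
  qed
  show "(\<Sum>r | r \<le> n \<and> k r = t. gap i j q b r) = 0"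
    unfolding gap_def sum_subtractf sum_distrib_left[symmetric]
    by (simp only: *[OF le(1)] *[OF le(2)] *[OF le(3)] *[OF le(4)] assms(6,7)) simp
next
  have le: "i \<le> n" "j \<le> n" "q \<le> n" "b \<le> n" using assms by (auto simp: relevant_def)
  have "(\<Sum>r\<le>n. real r * gap i j q b r) = (\<Sum>r\<le>n. gap i j q b r * real r)"
    by (simp add: mult.commute)
  also have "\<dots> = real q - real b - (real q - real b) / (real i - real j) * (real i - real j)"
    unfolding gap_def left_diff_distrib sum_subtractf mult.assoc sum_distrib_left[symmetric]
    using le by (simp add: sum_of_bool_eq)
  also have "\<dots> = 0" using assms(5) by simp
  finally show "(\<Sum>r\<le>n. real r * gap i j q b r) = 0" .
qed

text \<open>The algebraic content of \<open>f\<close> being generic in \<open>D\<close>: equations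
  forced by a root of \<open>f\<close> hold throughout \<open>D\<close>.\<close>

definition relations_vanish :: "nat \<Rightarrow> nat \<Rightarrow> (nat \<Rightarrow>\<^sub>0 real) set \<Rightarrow> (nat \<Rightarrow>\<^sub>0 real) \<Rightarrow> bool" where
  "relations_vanish p n D f \<longleftrightarrow>
     (\<forall>a l g. is_root p n f a \<longrightarrow> root_relation p n (ht f a) l \<longrightarrow> g \<in> D \<longrightarrow> pair n l g = 0)"

lemma root_has_base:
  assumes "root_heights p n k"
  obtains i j where "i \<in> relevant p n k" "j \<in> relevant p n k" "i \<noteq> j" "k i = k j"
proof -
  have "min_twice (argmin_set (off_class p n 0) k) k"
    using local_root_self[OF assms] by (simp add: local_root_def)
  then show thesis using that by (auto simp: min_twice_def relevant_eq)
qed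

text \<open>It suffices to avoid the kernels of the finitely many \<open>gap\<close> functionals
  that do not vanish on \<open>D\<close>. For \<open>g\<close> in \<open>D\<close> the heights at
  \<open>slope i j g\<close> are then constant on each relevant level of \<open>f\<close>, and a
  root relation tests nothing more.\<close>

lemma generic_relations_vanish:
  assumes cD: "convex D"
  shows "generic_on D (relations_vanish p n D)"
proof -
  define \<Phi> where "\<Phi> = {l. \<exists>i\<le>n. \<exists>j\<le>n. \<exists>q\<le>n. \<exists>b\<le>n. l = gap i j q b}"
  have "\<Phi> = (\<lambda>(i, j, q, b). gap i j q b) ` ({..n} \<times> {..n} \<times> {..n} \<times> {..n})"
    by (auto simp: \<Phi>_def image_iff) blast
  then have fin: "finite \<Phi>" by simp
  define \<N> where "\<N> = (\<lambda>l. {g. pair n l g = 0}) ` {l\<in>\<Phi>. \<exists>g\<in>D. pair n l g \<noteq> 0}"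
  have "generic_on D (\<lambda>f. f \<notin> \<Union>\<N>)"
    by (rule generic_on_thin) (use fin cD thin_in_pair_kernel in \<open>auto simp: \<N>_def\<close>)
  then show ?thesis
  proof (rule generic_on_mono)
    fix f assume "f \<notin> \<Union>\<N>"
    then have f: "pair n l g = 0" if "l \<in> \<Phi>" "pair n l f = 0" "g \<in> D" for l g
      using that by (auto simp: \<N>_def)
    show "relations_vanish p n D f"
      unfolding relations_vanish_def
    proof (intro allI impI)
      fix a l g
      assume root: "is_root p n f a" and rel: "root_relation p n (ht f a) l" and g: "g \<in> D"
      let ?k = "ht f a"
      obtain i j where ij: "i \<in> relevant p n ?k" "j \<in> relevant p n ?k" "i \<noteq> j" "?k i = ?k j"
        using root_has_base[OF root] .
      have le: "r \<le> n" if "r \<in> relevant p n ?k" for r using that by (simp add: relevant_def)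
      have s: "slope i j f = a" using ht_eq_iff_slope[OF ij(3)] ij(4) by metis
      define h where "h = ht g (slope i j g)"
      have const: "h q = h b" if "q \<in> relevant p n ?k" "b \<in> relevant p n ?k" "?k q = ?k b" for q b
      proof -
        have "pair n (gap i j q b) f = 0" using that le ij by (simp add: pair_gap s)
        moreover have "gap i j q b \<in> \<Phi>"
          unfolding \<Phi>_def using le[OF that(1)] le[OF that(2)] le[OF ij(1)] le[OF ij(2)] by blast
        ultimately have "pair n (gap i j q b) g = 0" using f g by blast
        then show ?thesis using that le ij by (simp add: pair_gap h_def)
      qed
      have supp: "r \<in> relevant p n ?k" if "l r \<noteq> 0" for r using rel that by (simp add: root_relation_def)
      \<comment> \<open>\<open>h\<close> is constant on the part of the support of \<open>l\<close>
        in this level, so the vanishing level sum of \<open>l\<close> factors out.\<close>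
      have lev: "(\<Sum>r | r \<le> n \<and> ?k r = t. l r * h r) = 0" for t
      proof (cases "\<exists>r0. r0 \<le> n \<and> ?k r0 = t \<and> l r0 \<noteq> 0")
        case True
        then obtain r0 where r0: "r0 \<le> n" "?k r0 = t" "l r0 \<noteq> 0" by blast
        have "(\<Sum>r | r \<le> n \<and> ?k r = t. l r * h r) = (\<Sum>r | r \<le> n \<and> ?k r = t. l r * h r0)"
        proof (rule sum.cong[OF refl])
          fix r assume "r \<in> {r. r \<le> n \<and> ?k r = t}"
          then show "l r * h r = l r * h r0"
            using const[OF supp supp[OF r0(3)], of r] r0 by (cases "l r = 0") auto
        qed
        also have "\<dots> = 0" using rel by (simp add: root_relation_def sum_distrib_right[symmetric])
        finally show ?thesis .
      qed (auto intro!: sum.neutral)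
      have "(\<Sum>r\<le>n. l r * h r) = (\<Sum>t\<in>?k ` {..n}. \<Sum>r | r \<in> {..n} \<and> ?k r = t. l r * h r)"
        by (rule sum.group[symmetric]) auto
      also have "\<dots> = 0" using lev by (intro sum.neutral) simp
      finally have "(\<Sum>r\<le>n. l r * h r) = 0" .
      moreover have "(\<Sum>r\<le>n. l r * h r) = pair n l g + slope i j g * (\<Sum>r\<le>n. real r * l r)"
        by (simp add: h_def ht_def pair_def algebra_simps sum.distrib sum_distrib_left)
      ultimately show "pair n l g = 0" using rel by (simp add: root_relation_def)
    qed
  qed
qed

text \<open>Bounds the codimension of \<open>D\<close> through functionals. The index type is fixed
  because the main family is indexed by a root and a pivot exponent.\<close>

definition indep_bound :: "nat \<Rightarrow> (nat \<Rightarrow>\<^sub>0 real) set \<Rightarrow> nat \<Rightarrow> bool" where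
  "indep_bound n D m \<longleftrightarrow> (\<forall>(I :: (real \<times> nat) set) l.
     indep_family n I l \<longrightarrow> (\<forall>i\<in>I. \<forall>g\<in>D. pair n (l i) g = 0) \<longrightarrow> card I \<le> m)"

lemma indep_bound_dim: "D \<subseteq> trop_polys n \<Longrightarrow> n + 1 \<le> dim D + m \<Longrightarrow> indep_bound n D m"
  unfolding indep_bound_def using card_indep_family_dim[of D n] by fastforce

lemma indep_bound_line:
  assumes "\<And>m. (\<And>g. g \<in> D \<Longrightarrow> pair n m g = 0) \<Longrightarrow> \<exists>k. \<forall>r\<le>n. m r = k * v r"
  shows "indep_bound n D 1"
  unfolding indep_bound_def
proof (intro allI impI, rule ccontr)
  fix I :: "(real \<times> nat) set" and l
  assume ind: "indep_family n I l" and van: "\<forall>i\<in>I. \<forall>g\<in>D. pair n (l i) g = 0" and "\<not> card I \<le> 1"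
  then obtain i j where ij: "i \<in> I" "j \<in> I" "i \<noteq> j" by (metis One_nat_def card_le_Suc0_iff_eq indep_family_def)
  have fin: "finite I" using ind by (simp add: indep_family_def)
  obtain k where k: "\<forall>r\<le>n. l i r = k * v r" using assms van ij by meson
  obtain k' where k': "\<forall>r\<le>n. l j r = k' * v r" using assms van ij by meson
  have comb: "s = 0 \<and> t = 0" if "\<And>r. r \<le> n \<Longrightarrow> s * l i r + t * l j r = 0" for s t
  proof -
    define c where "c x = (if x = i then s else if x = j then t else 0)" for x
    have "(\<Sum>x\<in>I. c x * l x r) = 0" if "r \<le> n" for r
    proof -
      have "(\<Sum>x\<in>I. c x * l x r) = (\<Sum>x\<in>{i, j}. c x * l x r)"
        by (rule sum.mono_neutral_right) (use fin ij in \<open>auto simp: c_def\<close>)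
      then show ?thesis using ij \<open>\<And>r. r \<le> n \<Longrightarrow> s * l i r + t * l j r = 0\<close>[OF that] by (simp add: c_def)
    qed
    then have "\<forall>x\<in>I. c x = 0" using ind by (simp add: indep_family_def)
    then have "c i = 0" "c j = 0" using ij by auto
    then show ?thesis using ij(3) by (simp add: c_def)
  qed
  have "k' * l i r + (- k) * l j r = 0" if "r \<le> n" for r using k k' that by simp
  then have "k' = 0 \<and> - k = 0" by (rule comb)
  then have "1 * l i r + 0 * l j r = 0" if "r \<le> n" for r using k that by simp
  then have "(1::real) = 0 \<and> (0::real) = 0" by (rule comb)
  then show False by simp
qed

text \<open>The number of relevant exponents minus the free parameters: the position of the root and
  one height per level. There are two levels exactly when the lowest exponents are
  congruent.\<close>

definition root_corank :: "nat \<Rightarrow> nat \<Rightarrow> (nat \<Rightarrow> real) \<Rightarrow> nat" where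
  "root_corank p n k =
     (if monochrome p (min_set n k) then card (relevant p n k) - 3 else card (relevant p n k) - 2)"

lemma min_twice_argmin_card: "min_twice (argmin_set S k) k' \<Longrightarrow> finite S \<Longrightarrow> 2 \<le> card (argmin_set S k)"
  by (rule min_twice_card) (auto simp: argmin_set_def)

lemma argmin_const: "r \<in> argmin_set S k \<Longrightarrow> s \<in> argmin_set S k \<Longrightarrow> k r = k s"
  by (auto simp: argmin_set_def intro: antisym)

text \<open>Two exponents \<open>i\<close>, \<open>j\<close> of one level fix the root and each
  level keeps one base exponent; the rest are the pivots \<open>P\<close>. The relation
  \<open>gap i j q (b q)\<close> involves no pivot other than \<open>q\<close>.\<close>

lemma pivot_family:
  assumes "root_heights p n k"
  shows "\<exists>P i j b. i \<noteq> j \<and> k i = k j \<and> i \<in> relevant p n k - P \<and> j \<in> relevant p n k - P \<and>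
    P \<subseteq> relevant p n k \<and> card P = root_corank p n k \<and>
    (\<forall>q\<in>P. b q \<in> relevant p n k - P \<and> k (b q) = k q)"
proof (cases "monochrome p (min_set n k)")
  case False
  have "min_twice {r \<in> min_set n k. r mod p \<noteq> 0} k"
    using local_root_self[OF assms] local_root_polychrome[OF False] by blast
  then obtain i j where ij: "i \<in> min_set n k" "j \<in> min_set n k" "i \<noteq> j" unfolding min_twice_def by auto
  have R: "relevant p n k = min_set n k" by (rule relevant_polychrome[OF False])
  have card: "card (relevant p n k - {i, j}) = root_corank p n k"
    using ij False finite_relevant[of p n k] by (simp add: root_corank_def R card_Diff_subset)
  have k1: "k i = k q" if "q \<in> min_set n k" for q using argmin_const[OF ij(1) that] .
  show ?thesis
  proof (intro exI conjI ballI)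
    show "i \<noteq> j" by fact
    show "k i = k j" using k1 ij by blast
    show "i \<in> relevant p n k - (relevant p n k - {i, j})" "j \<in> relevant p n k - (relevant p n k - {i, j})"
      using ij R by auto
    show "card (relevant p n k - {i, j}) = root_corank p n k" by fact
    fix q assume q: "q \<in> relevant p n k - {i, j}"
    show "i \<in> relevant p n k - (relevant p n k - {i, j})" using ij R by auto
    show "k i = k q" using k1 q R by blast
  qed auto
next
  case True
  then obtain c where c: "\<And>r. r \<in> min_set n k \<Longrightarrow> r mod p = c" unfolding monochrome_def by blast
  let ?N = "argmin_set (off_class p n c) k"
  have tw: "min_twice (min_set n k) k" "min_twice ?N k"
    using local_root_self[OF assms] local_root_monochrome[OF c] by blast+
  obtain i j where ij: "i \<in> min_set n k" "j \<in> min_set n k" "i \<noteq> j" using tw(1) unfolding min_twice_def by auto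
  obtain m where m: "m \<in> ?N" using tw(2) unfolding min_twice_def by auto
  have mo: "m \<notin> min_set n k" using m c[of m] by (auto simp: argmin_set_def off_class_def)
  have R: "relevant p n k = min_set n k \<union> ?N" by (rule relevant_monochrome[OF c])
  have "card (relevant p n k - {i, j, m}) = card (relevant p n k) - card {i, j, m}"
    using ij m by (intro card_Diff_subset) (auto simp: R)
  also have "card {i, j, m} = 3"
  proof -
    have "i \<noteq> m" "j \<noteq> m" using ij mo by blast+
    then show ?thesis using ij(3) by simp
  qed
  finally have card: "card (relevant p n k - {i, j, m}) = root_corank p n k"
    using True by (simp add: root_corank_def)
  have k1: "k i = k q" if "q \<in> min_set n k" for q using argmin_const[OF ij(1) that] .
  have k2: "k m = k q" if "q \<in> ?N" for q using argmin_const[OF m that] .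
  show ?thesis
  proof (intro exI conjI ballI)
    show "i \<noteq> j" by fact
    show "k i = k j" using k1 ij by blast
    show "i \<in> relevant p n k - (relevant p n k - {i, j, m})" "j \<in> relevant p n k - (relevant p n k - {i, j, m})"
      using ij R by auto
    show "card (relevant p n k - {i, j, m}) = root_corank p n k" by fact
    fix q assume q: "q \<in> relevant p n k - {i, j, m}"
    show "(if q \<in> min_set n k then i else m) \<in> relevant p n k - (relevant p n k - {i, j, m})"
      using ij m R by auto
    show "k (if q \<in> min_set n k then i else m) = k q"
      using k1 k2 q unfolding R by (cases "q \<in> min_set n k") simp_all
  qed auto
qed

text \<open>The pivot relations of all roots vanish on \<open>D\<close> and form one independent
  family: at one root because each has its own pivot, across roots by
  \<open>root_relations_independent\<close>.\<close>

lemma sum_root_corank_le: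
  assumes p: "p > 0" and van: "relations_vanish p n D f" and ib: "indep_bound n D m"
  shows "(\<Sum>a | is_root p n f a. root_corank p n (ht f a)) \<le> m"
proof -
  define A where "A = {a. is_root p n f a}"
  have finA: "finite A" unfolding A_def by (rule finite_roots[OF p])
  define pv where "pv a P i j b \<longleftrightarrow> i \<noteq> j \<and> ht f a i = ht f a j \<and> i \<in> relevant p n (ht f a) - P \<and>
    j \<in> relevant p n (ht f a) - P \<and> P \<subseteq> relevant p n (ht f a) \<and> card P = root_corank p n (ht f a) \<and>
    (\<forall>q\<in>P. b q \<in> relevant p n (ht f a) - P \<and> ht f a (b q) = ht f a q)" for a P i j b
  have "\<forall>a\<in>A. \<exists>P i j b. pv a P i j b"
    unfolding pv_def using pivot_family by (simp add: A_def)
  then obtain P i j b where pv: "\<And>a. a \<in> A \<Longrightarrow> pv a (P a) (i a) (j a) (b a)" by metis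
  have piv: "i a \<noteq> j a" "ht f a (i a) = ht f a (j a)"
     "i a \<in> relevant p n (ht f a) - P a" "j a \<in> relevant p n (ht f a) - P a"
     "P a \<subseteq> relevant p n (ht f a)" "card (P a) = root_corank p n (ht f a)"
     "\<And>q. q \<in> P a \<Longrightarrow> b a q \<in> relevant p n (ht f a) - P a"
     "\<And>q. q \<in> P a \<Longrightarrow> ht f a (b a q) = ht f a q" if "a \<in> A" for a
    using pv[OF that] unfolding pv_def by simp_all
  define I where "I = Sigma A P"
  define l where "l x = gap (i (fst x)) (j (fst x)) (snd x) (b (fst x) (snd x))" for x :: "real \<times> nat"
  have finP: "finite (P a)" if "a \<in> A" for a using piv(5)[OF that] finite_relevant finite_subset by blast
  have finI: "finite I" unfolding I_def using finA finP by auto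
  have relq: "root_relation p n (ht f a) (l (a, q))" if "a \<in> A" "q \<in> P a" for a q
    unfolding l_def fst_conv snd_conv
    using piv(1-5,7,8)[OF that(1)] that by (intro gap_relation) auto
  have diag: "l (a, q) q' = of_bool (q = q')" if "a \<in> A" "q \<in> P a" "q' \<in> P a" for a q q'
  proof -
    have "q' \<noteq> i a" "q' \<noteq> j a" "q' \<noteq> b a q" using piv(3,4,7)[OF that(1)] that by auto
    then show ?thesis by (auto simp: l_def gap_def)
  qed
  have "indep_family n I l"
    unfolding indep_family_def
  proof (intro conjI allI impI ballI finI)
    fix c x assume c: "\<forall>r\<le>n. (\<Sum>i\<in>I. c i * l i r) = 0" and x: "x \<in> I"
    \<comment> \<open>The part of the combination belonging to one root; as a sum of relations at
      that root it is again one.\<close>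
    define L where "L a r = (\<Sum>q\<in>P a. c (a, q) * l (a, q) r)" for a r
    have sumL: "(\<Sum>a\<in>A. L a r) = 0" if "r \<le> n" for r
    proof -
      have "(\<Sum>a\<in>A. L a r) = (\<Sum>x\<in>I. c x * l x r)"
        unfolding L_def I_def using finA finP by (subst sum.Sigma) (auto simp: case_prod_unfold)
      then show ?thesis using c that by simp
    qed
    have relL: "root_relation p n (ht f a) (L a)" if a: "a \<in> A" for a
      unfolding root_relation_def
    proof (intro conjI allI impI)
      fix r assume "L a r \<noteq> 0"
      then have "\<not> (\<forall>q\<in>P a. l (a, q) r = 0)" unfolding L_def by (auto intro: sum.neutral)
      then obtain q where "q \<in> P a" "l (a, q) r \<noteq> 0" by blast
      then show "r \<in> relevant p n (ht f a)" using relq[OF a] by (auto simp: root_relation_def)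
    next
      fix t
      have "(\<Sum>r | r \<le> n \<and> ht f a r = t. L a r) = (\<Sum>q\<in>P a. c (a, q) * (\<Sum>r | r \<le> n \<and> ht f a r = t. l (a, q) r))"
        unfolding L_def sum_distrib_left by (rule sum.swap)
      also have "\<dots> = 0" using relq[OF a] by (intro sum.neutral) (auto simp: root_relation_def)
      finally show "(\<Sum>r | r \<le> n \<and> ht f a r = t. L a r) = 0" .
    next
      have "(\<Sum>r\<le>n. real r * L a r) = (\<Sum>q\<in>P a. c (a, q) * (\<Sum>r\<le>n. real r * l (a, q) r))"
        unfolding L_def sum_distrib_left by (subst sum.swap) (simp add: mult.left_commute)
      also have "\<dots> = 0" using relq[OF a] by (intro sum.neutral) (auto simp: root_relation_def)
      finally show "(\<Sum>r\<le>n. real r * L a r) = 0" .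
    qed
    obtain a q where aq: "x = (a, q)" "a \<in> A" "q \<in> P a" using x by (auto simp: I_def)
    have qn: "q \<le> n" using piv(5)[OF aq(2)] aq(3) by (auto simp: relevant_def)
    have "L a q = 0" using root_relations_independent[OF finA relL sumL aq(2) qn] .
    moreover have "L a q = (\<Sum>q'\<in>P a. if q' = q then c (a, q) else 0)"
      unfolding L_def by (rule sum.cong) (use diag[OF aq(2)] aq(3) in auto)
    ultimately show "c x = 0" using finP[OF aq(2)] aq by simp
  qed
  moreover have "\<forall>x\<in>I. \<forall>g\<in>D. pair n (l x) g = 0"
    using van relq by (auto simp: relations_vanish_def I_def A_def)
  ultimately have "card I \<le> m" using ib unfolding indep_bound_def by blast
  moreover have "card I = (\<Sum>a\<in>A. root_corank p n (ht f a))"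
    unfolding I_def using finA finP piv(6) by (simp add: card_SigmaI)
  ultimately show ?thesis by (simp add: A_def)
qed

section \<open>Labels as linear relations\<close>

fun label_support :: "cell_label \<Rightarrow> nat set" where
  "label_support (LabelI i j k) = {i, j, k}"
| "label_support (LabelII i j k l) = {i, j, k, l}"
| "label_support (LabelIII i j k l) = {i, j, k, l}"

text \<open>The equation left after the root is eliminated through \<open>i\<close> and
  \<open>j\<close>. For type I the two ties share the exponent \<open>j\<close>.\<close>

fun label_relation :: "cell_label \<Rightarrow> nat \<Rightarrow> real" where
  "label_relation (LabelI i j k) = gap i j k j"
| "label_relation (LabelII i j k l) = gap i j k l"
| "label_relation (LabelIII i j k l) = gap i j k l"

text \<open>Makes the exponents of a label recoverable from its equation. Only the coefficient at
  \<open>j\<close> in type I is in doubt: it is \<open>(k - j) / (i - j) - 1\<close>, nonzero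
  because \<open>k \<noteq> i\<close>.\<close>

lemma label_relation_support:
  assumes "valid_label p n L"
  shows "label_relation L r \<noteq> 0 \<longleftrightarrow> r \<in> label_support L"
proof (cases L)
  case (LabelI i j k)
  then have d: "i \<noteq> j" "i \<noteq> k" "j \<noteq> k" using assms by auto
  have "label_relation L j \<noteq> 0"
  proof
    assume "label_relation L j = 0"
    then have "(real k - real j) / (real i - real j) = 1" using d LabelI by (simp add: gap_def)
    then have "real k - real j = real i - real j" using d by (simp add: field_simps)
    then show False using d by simp
  qed
  then show ?thesis using d LabelI by (cases "r = j") (auto simp: gap_def)
next
  case (LabelII i j k l)
  then have "i \<noteq> j" "i \<noteq> k" "i \<noteq> l" "j \<noteq> k" "j \<noteq> l" "k \<noteq> l" using assms by auto
  then show ?thesis using LabelII by (auto simp: gap_def)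
next
  case (LabelIII i j k l)
  then have "i \<noteq> j" "i \<noteq> k" "i \<noteq> l" "j \<noteq> k" "j \<noteq> l" "k \<noteq> l" using assms by auto
  then show ?thesis using LabelIII by (auto simp: gap_def)
qed

lemma label_support_le: "valid_label p n L \<Longrightarrow> r \<in> label_support L \<Longrightarrow> r \<le> n"
  by (cases L) auto

text \<open>An exponent in only one of the supports would make the two functionals independent,
  while at most one independent functional vanishes on \<open>C\<close>.\<close>

lemma label_supports_eq:
  assumes ib: "indep_bound n C 1" and L: "valid_label p n L" and L': "valid_label p n L'"
    and van: "\<And>g. g \<in> C \<Longrightarrow> pair n (label_relation L) g = 0"
    and van': "\<And>g. g \<in> C \<Longrightarrow> pair n (label_relation L') g = 0"
  shows "label_support L = label_support L'"
proof -
  have *: "label_support L \<subseteq> label_support L'"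
    if L: "valid_label p n L" and L': "valid_label p n L'"
    and van: "\<And>g. g \<in> C \<Longrightarrow> pair n (label_relation L) g = 0"
    and van': "\<And>g. g \<in> C \<Longrightarrow> pair n (label_relation L') g = 0" for L L'
  proof (rule subsetI, rule ccontr)
    fix r assume r: "r \<in> label_support L" "r \<notin> label_support L'"
    obtain s where s: "s \<in> label_support L'" by (cases L') auto
    define l where "l x = (if snd x = 0 then label_relation L else label_relation L')" for x :: "real \<times> nat"
    have "indep_family n {(0, 0), (0, 1)} l"
      unfolding indep_family_def
    proof (intro conjI allI impI)
      fix c :: "real \<times> nat \<Rightarrow> real"
      assume "\<forall>r\<le>n. (\<Sum>i\<in>{(0, 0), (0, 1)}. c i * l i r) = 0"
      then have c: "c (0, 0) * label_relation L r + c (0, 1) * label_relation L' r = 0" if "r \<le> n" for r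
        using that by (simp add: l_def)
      have "c (0, 0) = 0"
        using c[OF label_support_le[OF L r(1)]] label_relation_support[OF L, of r]
          label_relation_support[OF L', of r] r by simp
      moreover from this have "c (0, 1) = 0"
        using c[OF label_support_le[OF L' s]] label_relation_support[OF L', of s] s by simp
      ultimately show "\<forall>i\<in>{(0, 0), (0, 1)}. c i = 0" by simp
    qed simp
    moreover have "\<forall>x\<in>{(0, 0), (0, 1)}. \<forall>g\<in>C. pair n (l x) g = 0" using van van' by (simp add: l_def)
    ultimately have "card {(0 :: real, 0 :: nat), (0, 1)} \<le> 1" using ib unfolding indep_bound_def by blast
    then show False by simp
  qed
  show ?thesis using *[OF L L' van van'] *[OF L' L van' van] by blast
qed

lemma label_support_cards:
  assumes "valid_label p n L"
  shows "card (label_support L) = (if label_type L = TypeI then 3 else 4)"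
    "card ((\<lambda>r. r mod p) ` label_support L) = (if label_type L = TypeIII then 2 else 3)"
  using assms by (cases L; auto simp: card_insert_if)+

text \<open>For types I, II, III the support has 3, 4, 4 elements and 3, 3, 2 residues.\<close>

lemma label_type_eq:
  assumes "valid_label p n L" "valid_label p n L'" "label_support L = label_support L'"
  shows "label_type L = label_type L'"
  using label_support_cards[OF assms(1)] label_support_cards[OF assms(2)] assms(3)
  by (cases "label_type L"; cases "label_type L'") auto

text \<open>The pair \<open>{i, j}\<close> consists of all elements of one residue class in the set.
  The roles of the pairs can be exchanged only if both are congruent, as in type III.\<close>

lemma congruent_pair_unique:
  fixes p :: nat
  assumes "{i, j, k, l} = {i', j', k', l'}" "i mod p = j mod p" "k mod p \<noteq> i mod p" "l mod p \<noteq> i mod p"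
    "i \<noteq> j" "i' mod p = j' mod p" "k' mod p \<noteq> i' mod p" "l' mod p \<noteq> i' mod p" "i' \<noteq> j'" "k \<noteq> l" "k' \<noteq> l'"
  shows "{i, j} = {i', j'} \<and> {k, l} = {k', l'} \<or>
    {i, j} = {k', l'} \<and> {k, l} = {i', j'} \<and> k mod p = l mod p \<and> k' mod p = l' mod p"
proof -
  let ?E = "{i, j, k, l}"
  have 1: "{r \<in> ?E. r mod p = i mod p} = {i, j}" "{r \<in> ?E. r mod p \<noteq> i mod p} = {k, l}"
    using assms(2-5) by auto
  have "{r \<in> {i', j', k', l'}. r mod p = i' mod p} = {i', j'}"
    "{r \<in> {i', j', k', l'}. r mod p \<noteq> i' mod p} = {k', l'}"
    using assms(6-9) by auto
  then have 2: "{r \<in> ?E. r mod p = i' mod p} = {i', j'}" "{r \<in> ?E. r mod p \<noteq> i' mod p} = {k', l'}"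
    by (simp_all only: assms(1)[symmetric])
  show ?thesis
  proof (cases "i mod p = i' mod p")
    case True
    then show ?thesis using 1 2 by simp
  next
    case False
    have "{r \<in> ?E. r mod p = i' mod p} \<subseteq> {r \<in> ?E. r mod p \<noteq> i mod p}" using False by auto
    then have "{i', j'} \<subseteq> {k, l}" by (simp only: 1 2)
    then have a: "{i', j'} = {k, l}" using assms(9,10) by (metis card_2_iff card_subset_eq finite.emptyI finite_insert)
    have "{r \<in> ?E. r mod p = i mod p} \<subseteq> {r \<in> ?E. r mod p \<noteq> i' mod p}" using False by auto
    then have "{i, j} \<subseteq> {k', l'}" by (simp only: 1 2)
    then have b: "{i, j} = {k', l'}" using assms(5,11) by (metis card_2_iff card_subset_eq finite.emptyI finite_insert)
    show ?thesis using a b assms(2,6) by (auto simp: doubleton_eq_iff)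
  qed
qed

lemma two_step_cell_swap:
  "two_step_cell p n i j k l \<subseteq> two_step_cell p n i j l k"
  "i mod p = j mod p \<Longrightarrow> two_step_cell p n i j k l \<subseteq> two_step_cell p n j i k l"
  by (auto simp: two_step_cell_def)

lemma two_step_cell_cong:
  assumes "{i, j} = {i', j'}" "{k, l} = {k', l'}" "i mod p = j mod p"
  shows "two_step_cell p n i j k l = two_step_cell p n i' j' k' l'"
proof -
  have 1: "two_step_cell p n i j k l = two_step_cell p n i j l k" for i j k l
    using two_step_cell_swap(1) by blast
  have 2: "i mod p = j mod p \<Longrightarrow> two_step_cell p n i j k l = two_step_cell p n j i k l" for i j k l
    using two_step_cell_swap(2)[of i p j n k l] two_step_cell_swap(2)[of j p i n k l] by auto
  have "i = i' \<and> j = j' \<or> i = j' \<and> j = i'" "k = k' \<and> l = l' \<or> k = l' \<and> l = k'"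
    using assms(1,2) by (auto simp: doubleton_eq_iff)
  then show ?thesis using 1[of i j k l] 2[OF assms(3), of k l] 1[of j i k l] by auto
qed

text \<open>Types agree by \<open>label_type_eq\<close>, and within a type the support determines
  the pairs up to order. This lets a cone carry every valid label whose equation vanishes on
  it.\<close>

lemma label_cell_eq:
  assumes "valid_label p n L" "valid_label p n L'" "label_support L = label_support L'"
  shows "label_cell p n L = label_cell p n L'"
proof -
  have ty: "label_type L = label_type L'" by (rule label_type_eq[OF assms])
  show ?thesis
  proof (cases L)
    case (LabelI i j k)
    obtain i' j' k' where L': "L' = LabelI i' j' k'" using ty LabelI by (cases L') auto
    have cell: "label_cell p n (LabelI i j k) =
      {f \<in> trop_polys n. \<forall>s\<in>{i, j, k}. \<forall>r\<le>n. cf f s \<le> cf f r}" if "valid_label p n (LabelI i j k)" for i j k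
      using that by (auto intro: antisym)
    have "label_cell p n L = {f \<in> trop_polys n. \<forall>s\<in>label_support L. \<forall>r\<le>n. cf f s \<le> cf f r}"
      using cell[of i j k] assms(1) unfolding LabelI by (simp only: label_support.simps)
    moreover have "label_cell p n L' = {f \<in> trop_polys n. \<forall>s\<in>label_support L'. \<forall>r\<le>n. cf f s \<le> cf f r}"
      using cell[of i' j' k'] assms(2) unfolding L' by (simp only: label_support.simps)
    ultimately show ?thesis by (simp only: assms(3))
  next
    case (LabelII i j k l)
    obtain i' j' k' l' where L': "L' = LabelII i' j' k' l'" using ty LabelII by (cases L') auto
    have v: "i \<noteq> j" "i mod p = j mod p" "k mod p \<noteq> i mod p" "l mod p \<noteq> i mod p" "k mod p \<noteq> l mod p"
      and v': "i' \<noteq> j'" "i' mod p = j' mod p" "k' mod p \<noteq> i' mod p" "l' mod p \<noteq> i' mod p" "k' mod p \<noteq> l' mod p"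
      using assms(1,2) LabelII L' by auto
    have "k \<noteq> l" "k' \<noteq> l'" using v v' by blast+
    moreover have "{i, j, k, l} = {i', j', k', l'}" using assms(3) LabelII L' by simp
    ultimately have "{i, j} = {i', j'} \<and> {k, l} = {k', l'}"
      using congruent_pair_unique[of i j k l i' j' k' l' p] v v' by argo
    then show ?thesis using two_step_cell_cong v(2) LabelII L' by (simp only: label_cell.simps)
  next
    case (LabelIII i j k l)
    obtain i' j' k' l' where L': "L' = LabelIII i' j' k' l'" using ty LabelIII by (cases L') auto
    have v: "i mod p = j mod p" "k mod p = l mod p" "i \<noteq> j" "k mod p \<noteq> i mod p" "l mod p \<noteq> i mod p" "k \<noteq> l"
      and v': "i' \<noteq> j'" "i' mod p = j' mod p" "k' mod p \<noteq> i' mod p" "l' mod p \<noteq> i' mod p" "k' \<noteq> l'"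
      using assms(1,2) LabelIII L' by auto
    have "{i, j, k, l} = {i', j', k', l'}" using assms(3) LabelIII L' by simp
    then have "{i, j} = {i', j'} \<and> {k, l} = {k', l'} \<or> {i, j} = {k', l'} \<and> {k, l} = {i', j'}"
      using congruent_pair_unique[of i j k l i' j' k' l' p] v v' by argo
    then show ?thesis
    proof
      assume "{i, j} = {i', j'} \<and> {k, l} = {k', l'}"
      then have "two_step_cell p n i j k l = two_step_cell p n i' j' k' l'"
        "two_step_cell p n k l i j = two_step_cell p n k' l' i' j'"
        using v(1,2) by (simp_all add: two_step_cell_cong)
      then show ?thesis using LabelIII L' by simp
    next
      assume "{i, j} = {k', l'} \<and> {k, l} = {i', j'}"
      then have "two_step_cell p n i j k l = two_step_cell p n k' l' i' j'"
        "two_step_cell p n k l i j = two_step_cell p n i' j' k' l'"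
        using v(1,2) by (simp_all add: two_step_cell_cong)
      then show ?thesis using LabelIII L' by auto
    qed
  qed
qed

section \<open>Classification of the double roots of small corank\<close>

lemma min_twice_three:
  assumes "i \<noteq> j" "i \<noteq> k" "j \<noteq> k"
  shows "min_twice {i, j, k} h \<longleftrightarrow>
    h i = h j \<and> h i \<le> h k \<or> h i = h k \<and> h i \<le> h j \<or> h j = h k \<and> h j \<le> h i"
proof -
  have "min_twice {i, j, k} h \<longleftrightarrow> (\<exists>r\<in>{i, j, k}. \<exists>s\<in>{i, j, k}. r \<noteq> s \<and> h r = h s \<and> h r \<le> h i \<and> h r \<le> h j \<and> h r \<le> h k)"
    by (simp add: min_twice_def)
  also have "\<dots> \<longleftrightarrow> h i = h j \<and> h i \<le> h k \<or> h i = h k \<and> h i \<le> h j \<or> h j = h k \<and> h j \<le> h i"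
    using assms by (simp add: assms[symmetric]) argo
  finally show ?thesis .
qed

text \<open>One tie fixes the root and the other is a linear equation: near such a root the
  discriminant is a hyperplane.\<close>

definition flat_root :: "nat \<Rightarrow> nat \<Rightarrow> (nat \<Rightarrow> real) \<Rightarrow> nat \<Rightarrow> nat \<Rightarrow> nat \<Rightarrow> nat \<Rightarrow> bool" where
  "flat_root p n k i j q b \<longleftrightarrow> i \<noteq> j \<and> q \<noteq> b \<and> i \<in> relevant p n k \<and> j \<in> relevant p n k \<and>
     q \<in> relevant p n k \<and> b \<in> relevant p n k \<and> q \<notin> {i, j} \<and> k i = k j \<and> k q = k b \<and>
     (\<forall>k'. local_root p n k k' \<longleftrightarrow> k' i = k' j \<and> k' q = k' b)"

text \<open>The tie of \<open>i\<close> and \<open>j\<close> fixes the root, and \<open>x\<close>,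
  \<open>y\<close>, \<open>z\<close> form a tropical line, which gives three half-hyperplanes. Here
  \<open>z\<close> may coincide with \<open>i\<close> or \<open>j\<close>.\<close>

definition tripod_root ::
  "nat \<Rightarrow> nat \<Rightarrow> (nat \<Rightarrow> real) \<Rightarrow> nat \<Rightarrow> nat \<Rightarrow> nat \<Rightarrow> nat \<Rightarrow> nat \<Rightarrow> bool" where
  "tripod_root p n k i j x y z \<longleftrightarrow> i \<noteq> j \<and> x \<noteq> y \<and> x \<noteq> z \<and> y \<noteq> z \<and> x \<notin> {i, j} \<and> y \<notin> {i, j} \<and>
     {i, j, x, y, z} \<subseteq> {..n} \<and> k i = k j \<and> k x = k z \<and> k y = k z \<and>
     (\<forall>k'. local_root p n k k' \<longleftrightarrow> k' i = k' j \<and> min_twice {x, y, z} k')"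

text \<open>The four conditions together say that the minimum over the four exponents is attained at
  least three times. No tie is common to all cases, so no fixed pair determines the root.\<close>

definition tetrapod_root :: "nat \<Rightarrow> nat \<Rightarrow> (nat \<Rightarrow> real) \<Rightarrow> nat \<Rightarrow> nat \<Rightarrow> nat \<Rightarrow> nat \<Rightarrow> bool" where
  "tetrapod_root p n k i j x y \<longleftrightarrow> {i, j, x, y} \<subseteq> {..n} \<and>
     distinct [i mod p, j mod p, x mod p, y mod p] \<and> k i = k j \<and> k x = k j \<and> k y = k j \<and>
     (\<forall>k'. local_root p n k k' \<longleftrightarrow> min_twice {j, x, y} k' \<and> min_twice {i, x, y} k' \<and>
        min_twice {i, j, y} k' \<and> min_twice {i, j, x} k')"

text \<open>Symmetric in the pairs \<open>{i, j}\<close> and \<open>{q, b}\<close>, so a tripod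
  whose root is fixed by one pair can be labelled with the other pair as base.\<close>

lemma pair_gap_eq_0_iff:
  assumes "i \<le> n" "j \<le> n" "q \<le> n" "b \<le> n" "q \<noteq> b"
  shows "pair n (gap i j q b) g = 0 \<longleftrightarrow> slope i j g = slope q b g"
  using assms ht_eq_iff_slope[OF assms(5), of g "slope i j g"] by (simp add: pair_gap)

text \<open>What has to be known about the cones around a tripod: no pair (I, III), and no labels on
  four exponents with different residues, the mark of the four-cone case.\<close>

definition compatible_labels :: "nat \<Rightarrow> cell_label \<Rightarrow> cell_label \<Rightarrow> bool" where
  "compatible_labels p L L' \<longleftrightarrow> {label_type L, label_type L'} \<noteq> {TypeI, TypeIII} \<and>
     \<not> (inj_on (\<lambda>r. r mod p) (label_support L \<union> label_support L') \<and>
        card (label_support L \<union> label_support L') = 4)"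

text \<open>\<open>L1\<close>, \<open>L2\<close>, \<open>L3\<close> belong to the pages on which
  \<open>x\<close> and \<open>z\<close>, \<open>y\<close> and \<open>z\<close>, \<open>x\<close> and
  \<open>y\<close> tie.\<close>

definition tripod_labels ::
  "nat \<Rightarrow> nat \<Rightarrow> nat \<Rightarrow> nat \<Rightarrow> nat \<Rightarrow> nat \<Rightarrow> nat \<Rightarrow> cell_label \<Rightarrow> cell_label \<Rightarrow> cell_label \<Rightarrow> bool" where
  "tripod_labels p n i j x y z L1 L2 L3 \<longleftrightarrow>
     (\<forall>L\<in>{L1, L2, L3}. valid_label p n L) \<and> (\<forall>L\<in>{L1, L2, L3}. \<forall>L'\<in>{L1, L2, L3}. compatible_labels p L L') \<and>
     (\<forall>g. pair n (gap i j x z) g = 0 \<longrightarrow> pair n (label_relation L1) g = 0) \<and>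
     (\<forall>g. pair n (gap i j y z) g = 0 \<longrightarrow> pair n (label_relation L2) g = 0) \<and>
     (\<forall>g. pair n (gap i j x y) g = 0 \<longrightarrow> pair n (label_relation L3) g = 0)"

definition two_step_label :: "nat \<Rightarrow> nat \<Rightarrow> nat \<Rightarrow> nat \<Rightarrow> nat \<Rightarrow> cell_label" where
  "two_step_label p i j k l =
     (if k mod p = l mod p then LabelIII i j k l else LabelII i j k l)"

lemma two_step_label_simps [simp]:
  "label_support (two_step_label p i j k l) = {i, j, k, l}"
  "label_relation (two_step_label p i j k l) = gap i j k l"
  "label_type (two_step_label p i j k l) \<noteq> TypeI"
  by (auto simp: two_step_label_def)

lemma valid_two_step_label:
  assumes "{i, j, k, l} \<subseteq> {..n}" "i \<noteq> j" "k \<noteq> l" "i mod p = j mod p" "k mod p \<noteq> i mod p" "l mod p \<noteq> i mod p"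
  shows "valid_label p n (two_step_label p i j k l)"
  using assms by (auto simp: two_step_label_def)

lemma compatible_two_step:
  assumes "i \<noteq> j" "i mod p = j mod p"
  shows "compatible_labels p (two_step_label p i j k l) (two_step_label p i' j' k' l')"
proof -
  have "\<not> inj_on (\<lambda>r. r mod p) ({i, j, k, l} \<union> {i', j', k', l'})"
    using assms by (auto simp: inj_on_def)
  moreover have "TypeI \<notin> {label_type (two_step_label p i j k l), label_type (two_step_label p i' j' k' l')}"
    by (auto simp: two_step_label_def)
  then have "{label_type (two_step_label p i j k l), label_type (two_step_label p i' j' k' l')} \<noteq> {TypeI, TypeIII}"
    by (simp add: doubleton_eq_iff)
  ultimately show ?thesis
    unfolding compatible_labels_def two_step_label_simps by argo
qed

lemma polychrome_two_off:
  assumes "root_heights p n k" "\<not> monochrome p (min_set n k)"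
  obtains r s where "r \<in> min_set n k" "s \<in> min_set n k" "r \<noteq> s" "r mod p \<noteq> c" "s mod p \<noteq> c"
proof -
  have "min_twice {r \<in> min_set n k. r mod p \<noteq> c} k"
    using local_root_self[OF assms(1)] local_root_polychrome[OF assms(2)] by blast
  then show thesis using that unfolding min_twice_def by blast
qed

lemma min_set_le: "r \<in> min_set n k \<Longrightarrow> r \<le> n"
  by (simp add: argmin_set_def)

lemma monochrome_min_sets:
  assumes root: "root_heights p n k" and c: "\<And>r. r \<in> min_set n k \<Longrightarrow> r mod p = c"
  shows "2 \<le> card (min_set n k)" "2 \<le> card (argmin_set (off_class p n c) k)"
    "card (relevant p n k) = card (min_set n k) + card (argmin_set (off_class p n c) k)"
proof -
  let ?N = "argmin_set (off_class p n c) k"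
  have tw: "min_twice (min_set n k) k" "min_twice ?N k"
    using local_root_self[OF root] local_root_monochrome[OF c] by blast+
  then show "2 \<le> card (min_set n k)" "2 \<le> card ?N"
    by (auto intro: min_twice_argmin_card finite_off_class)
  have "min_set n k \<inter> ?N = {}" using c by (auto simp: argmin_set_def off_class_def)
  moreover have "finite (min_set n k)" "finite ?N"
    by (auto simp: argmin_set_def off_class_def)
  ultimately show "card (relevant p n k) = card (min_set n k) + card ?N"
    using relevant_monochrome[of n k p c, OF c] by (simp add: card_Un_disjoint)
qed

text \<open>Removing the class of a lowest exponent \<open>r\<close> must leave two more of
  them.\<close>

lemma polychrome_card:
  assumes root: "root_heights p n k" and poly: "\<not> monochrome p (min_set n k)"
  shows "3 \<le> card (min_set n k)"
proof -
  obtain r s where 1: "r \<in> min_set n k" "s \<in> min_set n k" "r \<noteq> s" using polychrome_two_off[OF assms] .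
  obtain r' s' where 2: "r' \<in> min_set n k" "s' \<in> min_set n k" "r' \<noteq> s'" "r' mod p \<noteq> r mod p" "s' mod p \<noteq> r mod p"
    using polychrome_two_off[OF assms] .
  have "r' \<noteq> r" "s' \<noteq> r" using 2 by auto
  then have "{r, r', s'} \<subseteq> min_set n k" "card {r, r', s'} = 3" using 1 2 by auto
  then show ?thesis using card_mono[of "min_set n k" "{r, r', s'}"] by (simp add: argmin_set_def)
qed

lemma root_corank_pos: "root_heights p n k \<Longrightarrow> 1 \<le> root_corank p n k"
proof (cases "monochrome p (min_set n k)")
  case True
  assume root: "root_heights p n k"
  obtain c where c: "\<And>r. r \<in> min_set n k \<Longrightarrow> r mod p = c" using True unfolding monochrome_def by blast
  show ?thesis using monochrome_min_sets[OF root c] True by (simp add: root_corank_def)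
next
  case False
  assume root: "root_heights p n k"
  show ?thesis using polychrome_card[OF root False] False by (simp add: root_corank_def relevant_polychrome)
qed

lemma flat_root_I:
  assumes "min_set n k = {i, j, x}" "i mod p \<noteq> j mod p" "i mod p \<noteq> x mod p" "j mod p \<noteq> x mod p"
  shows "flat_root p n k i j x j"
proof -
  have poly: "\<not> monochrome p (min_set n k)" using assms by (auto simp: monochrome_def)
  have R: "relevant p n k = {i, j, x}" using relevant_polychrome[OF poly] assms by simp
  have d: "i \<noteq> j" "i \<noteq> x" "j \<noteq> x" using assms by auto
  have eq: "k i = k j" "k x = k j" using argmin_const[of _ "{..n}" k] assms(1) by auto
  have "local_root p n k k' \<longleftrightarrow> k' i = k' j \<and> k' x = k' j" for k'
  proof
    assume "local_root p n k k'"
    then have *: "min_twice {r \<in> {i, j, x}. r mod p \<noteq> c} k'" for c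
      unfolding local_root_polychrome[OF poly] assms(1) by blast
    have "{r \<in> {i, j, x}. r mod p \<noteq> i mod p} = {j, x}" "{r \<in> {i, j, x}. r mod p \<noteq> x mod p} = {i, j}"
      using assms by auto
    then show "k' i = k' j \<and> k' x = k' j"
      using *[of "i mod p"] *[of "x mod p"] d by (simp add: min_twice_two)
  next
    assume h: "k' i = k' j \<and> k' x = k' j"
    have "min_twice {r \<in> {i, j, x}. r mod p \<noteq> c} k'" for c
    proof -
      have "\<exists>r\<in>{i, j, x}. \<exists>s\<in>{i, j, x}. r \<noteq> s \<and> r mod p \<noteq> c \<and> s mod p \<noteq> c"
        using assms(2-4) d by auto
      then show ?thesis using h unfolding min_twice_def by fastforce
    qed
    then show "local_root p n k k'" unfolding local_root_polychrome[OF poly] assms(1) by blast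
  qed
  then show ?thesis using d eq by (simp add: flat_root_def R)
qed

lemma flat_root_two_step:
  assumes "min_set n k = {i, j}" "i \<noteq> j" "i mod p = j mod p"
    "argmin_set (off_class p n (i mod p)) k = {x, y}" "x \<noteq> y"
  shows "flat_root p n k i j x y"
proof -
  have c: "\<And>r. r \<in> min_set n k \<Longrightarrow> r mod p = i mod p" using assms by auto
  have R: "relevant p n k = {i, j} \<union> {x, y}"
    using relevant_monochrome[of n k p "i mod p", OF c] unfolding assms(1,4) by simp
  have "x \<in> argmin_set (off_class p n (i mod p)) k" using assms(4) by simp
  then have "x mod p \<noteq> i mod p" by (simp add: argmin_set_def off_class_def)
  then have "x \<notin> {i, j}" using assms by auto
  moreover have "k i = k j" "k x = k y"
    using argmin_const[of _ "{..n}" k] argmin_const[of _ "off_class p n (i mod p)" k] assms(1,4) by auto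
  moreover have "local_root p n k k' \<longleftrightarrow> k' i = k' j \<and> k' x = k' y" for k'
    using local_root_monochrome[of n k p "i mod p" k', OF c] unfolding assms(1,4)
    by (simp add: min_twice_two[OF assms(2)] min_twice_two[OF assms(5)])
  ultimately show ?thesis using assms by (simp add: flat_root_def R)
qed

text \<open>Four exponents at one height in two congruent pairs give two relations, yet no wall:
  whichever pair is lower, the same two ties are required. Here the two pieces of a type III cell
  meet.\<close>

lemma flat_root_two_pairs:
  assumes "min_set n k = {i, j, x, y}" "i \<noteq> j" "x \<noteq> y" "i mod p = j mod p" "x mod p = y mod p" "i mod p \<noteq> x mod p"
  shows "flat_root p n k i j x y"
proof -
  have poly: "\<not> monochrome p (min_set n k)" using assms by (auto simp: monochrome_def)
  have R: "relevant p n k = {i, j, x, y}" using relevant_polychrome[OF poly] assms by simp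
  have eq: "k i = k j" "k x = k y" using argmin_const[of _ "{..n}" k] assms(1) by auto
  have x: "x \<notin> {i, j}" using assms by auto
  have "local_root p n k k' \<longleftrightarrow> k' i = k' j \<and> k' x = k' y" for k'
  proof
    assume "local_root p n k k'"
    then have *: "min_twice {r \<in> {i, j, x, y}. r mod p \<noteq> c} k'" for c
      unfolding local_root_polychrome[OF poly] assms(1) by blast
    have "{r \<in> {i, j, x, y}. r mod p \<noteq> i mod p} = {x, y}" "{r \<in> {i, j, x, y}. r mod p \<noteq> x mod p} = {i, j}"
      using assms by auto
    then show "k' i = k' j \<and> k' x = k' y"
      using *[of "i mod p"] *[of "x mod p"] assms by (simp add: min_twice_two)
  next
    assume h: "k' i = k' j \<and> k' x = k' y"
    have "min_twice {r \<in> {i, j, x, y}. r mod p \<noteq> c} k'" for c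
    proof -
      consider "c = i mod p" | "c \<noteq> i mod p" "c = x mod p" | "c \<noteq> i mod p" "c \<noteq> x mod p" by blast
      then show ?thesis
      proof cases
        case 1
        then have "{r \<in> {i, j, x, y}. r mod p \<noteq> c} = {x, y}" using assms by auto
        then show ?thesis using h assms by (simp add: min_twice_two)
      next
        case 2
        then have "{r \<in> {i, j, x, y}. r mod p \<noteq> c} = {i, j}" using assms by auto
        then show ?thesis using h assms by (simp add: min_twice_two)
      next
        case 3
        then have S: "{r \<in> {i, j, x, y}. r mod p \<noteq> c} = {i, j, x, y}" using assms by auto
        show ?thesis
        proof (cases "k' i \<le> k' x")
          case True
          then show ?thesis unfolding S min_twice_def using h assms(2)
            by (intro bexI[of _ i] bexI[of _ j]) auto
        next
          case False
          then show ?thesis unfolding S min_twice_def using h assms(3)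
            by (intro bexI[of _ x] bexI[of _ y]) auto
        qed
      qed
    qed
    then show "local_root p n k k'" unfolding local_root_polychrome[OF poly] assms(1) by blast
  qed
  then show ?thesis using assms x eq by (simp add: flat_root_def R)
qed

text \<open>Removing the class of \<open>i\<close> leaves \<open>x\<close> and \<open>y\<close>,
  whose tie fixes the root; the minimum over \<open>i\<close>, \<open>j\<close>, \<open>y\<close>
  selects the page. Two pages are of type I and one is of type II, and the congruent pair
  \<open>i\<close>, \<open>j\<close> makes the labels compatible.\<close>

lemma tripod_root_one_level:
  assumes "min_set n k = {i, j, x, y}" "i \<noteq> j" "i mod p = j mod p" "x mod p \<noteq> i mod p" "y mod p \<noteq> i mod p"
    "x mod p \<noteq> y mod p"
  shows "tripod_root p n k x y i j y"
    "tripod_labels p n x y i j y (LabelI x y i) (LabelI x y j) (LabelII i j x y)"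
proof -
  have poly: "\<not> monochrome p (min_set n k)" using assms by (auto simp: monochrome_def)
  have d: "x \<noteq> y" "i \<noteq> x" "i \<noteq> y" "j \<noteq> x" "j \<noteq> y" using assms by auto
  have le: "i \<le> n" "j \<le> n" "x \<le> n" "y \<le> n" using min_set_le assms(1) by blast+
  have eq: "k x = k y" "k i = k y" "k j = k y" using argmin_const[of _ "{..n}" k] assms(1) by auto
  have "local_root p n k k' \<longleftrightarrow> k' x = k' y \<and> min_twice {i, j, y} k'" for k'
  proof
    assume "local_root p n k k'"
    then have *: "min_twice {r \<in> {i, j, x, y}. r mod p \<noteq> c} k'" for c
      unfolding local_root_polychrome[OF poly] assms(1) by blast
    have "{r \<in> {i, j, x, y}. r mod p \<noteq> i mod p} = {x, y}" "{r \<in> {i, j, x, y}. r mod p \<noteq> x mod p} = {i, j, y}"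
      using assms by auto
    then show "k' x = k' y \<and> min_twice {i, j, y} k'"
      using *[of "i mod p"] *[of "x mod p"] d by (simp add: min_twice_two)
  next
    assume h: "k' x = k' y \<and> min_twice {i, j, y} k'"
    then have h3: "k' i = k' j \<and> k' i \<le> k' y \<or> k' i = k' y \<and> k' i \<le> k' j \<or> k' j = k' y \<and> k' j \<le> k' i"
      using min_twice_three[of i j y k'] d assms(2) by simp
    have "min_twice {r \<in> {i, j, x, y}. r mod p \<noteq> c} k'" for c
    proof -
      consider "c = i mod p" | "c = x mod p" "c \<noteq> i mod p" | "c = y mod p" "c \<noteq> i mod p"
        | "c \<noteq> i mod p" "c \<noteq> x mod p" "c \<noteq> y mod p" by blast
      then show ?thesis
      proof cases
        case 1
        then have "{r \<in> {i, j, x, y}. r mod p \<noteq> c} = {x, y}" using assms by auto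
        then show ?thesis using h d by (simp add: min_twice_two)
      next
        case 2
        then have "{r \<in> {i, j, x, y}. r mod p \<noteq> c} = {i, j, y}" using assms by auto
        then show ?thesis using h by simp
      next
        case 3
        then have "{r \<in> {i, j, x, y}. r mod p \<noteq> c} = {i, j, x}" using assms by auto
        then show ?thesis using h h3 min_twice_three[of i j x k'] d assms(2) by simp
      next
        case 4
        then have S: "{r \<in> {i, j, x, y}. r mod p \<noteq> c} = {i, j, x, y}" using assms by auto
        from h3 show ?thesis
        proof (elim disjE)
          assume "k' i = k' j \<and> k' i \<le> k' y"
          then show ?thesis unfolding S min_twice_def using h assms(2)
            by (intro bexI[of _ i] bexI[of _ j]) auto
        next
          assume "k' i = k' y \<and> k' i \<le> k' j"
          then show ?thesis unfolding S min_twice_def using h d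
            by (intro bexI[of _ i] bexI[of _ y]) auto
        next
          assume "k' j = k' y \<and> k' j \<le> k' i"
          then show ?thesis unfolding S min_twice_def using h d
            by (intro bexI[of _ j] bexI[of _ y]) auto
        qed
      qed
    qed
    then show "local_root p n k k'" unfolding local_root_polychrome[OF poly] assms(1) by blast
  qed
  then show "tripod_root p n k x y i j y" using assms(2) d le eq by (simp add: tripod_root_def)
  have "compatible_labels p L L'" if LL: "L \<in> {LabelI x y i, LabelI x y j, LabelII i j x y}"
    "L' \<in> {LabelI x y i, LabelI x y j, LabelII i j x y}" for L L'
  proof -
    have "label_type L \<noteq> TypeIII" "label_type L' \<noteq> TypeIII" using that by auto
    then have t: "{label_type L, label_type L'} \<noteq> {TypeI, TypeIII}" by (simp add: doubleton_eq_iff)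
    have "L = L' \<and> card (label_support L) = 3 \<or>
      i \<in> label_support L \<union> label_support L' \<and> j \<in> label_support L \<union> label_support L'"
    proof -
      have c3: "card {x, y, i} = 3" "card {x, y, j} = 3" using d by auto
      consider "L = L'" "L = LabelI x y i \<or> L = LabelI x y j" | "L = LabelII i j x y \<or> L' = LabelII i j x y"
        | "L = LabelI x y i" "L' = LabelI x y j" | "L = LabelI x y j" "L' = LabelI x y i"
        using LL by blast
      then show ?thesis by cases (use c3 in auto)
    qed
    then show ?thesis
    proof
      assume "L = L' \<and> card (label_support L) = 3"
      then show ?thesis using t by (elim conjE) (simp add: compatible_labels_def)
    next
      assume "i \<in> label_support L \<union> label_support L' \<and> j \<in> label_support L \<union> label_support L'"
      then have "\<not> inj_on (\<lambda>r. r mod p) (label_support L \<union> label_support L')"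
        using assms(2,3) inj_onD by metis
      then show ?thesis using t by (simp add: compatible_labels_def)
    qed
  qed
  moreover have "\<forall>g. pair n (gap x y i j) g = 0 \<longrightarrow> pair n (gap i j x y) g = 0"
    using le assms(2) d by (simp add: pair_gap_eq_0_iff)
  ultimately show "tripod_labels p n x y i j y (LabelI x y i) (LabelI x y j) (LabelII i j x y)"
    unfolding tripod_labels_def using assms le by auto
qed

text \<open>Of three congruent lowest exponents two stay lowest, while \<open>i\<close> and
  \<open>j\<close> above fix the root. All labels contain the pair \<open>i\<close>,
  \<open>j\<close>, so they share one type, II or III.\<close>

lemma tripod_root_below:
  assumes "min_set n k = {x, y, z}" "x \<noteq> y" "x \<noteq> z" "y \<noteq> z" "x mod p = y mod p" "x mod p = z mod p"
    "argmin_set (off_class p n (x mod p)) k = {i, j}" "i \<noteq> j"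
  shows "tripod_root p n k i j x y z"
    "tripod_labels p n i j x y z (two_step_label p x z i j) (two_step_label p y z i j) (two_step_label p x y i j)"
proof -
  have c: "\<And>r. r \<in> min_set n k \<Longrightarrow> r mod p = x mod p" using assms by auto
  have "i \<in> argmin_set (off_class p n (x mod p)) k" "j \<in> argmin_set (off_class p n (x mod p)) k"
    using assms(7) by auto
  then have ij: "i mod p \<noteq> x mod p" "j mod p \<noteq> x mod p" "i \<le> n" "j \<le> n"
    by (auto simp: argmin_set_def off_class_def)
  have le: "x \<le> n" "y \<le> n" "z \<le> n" using min_set_le assms(1) by blast+
  have "k i = k j" "k x = k z" "k y = k z"
    using argmin_const[of _ "{..n}" k] argmin_const[of _ "off_class p n (x mod p)" k] assms(1,7) by auto
  moreover have "local_root p n k k' \<longleftrightarrow> k' i = k' j \<and> min_twice {x, y, z} k'" for k'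
    using local_root_monochrome[of n k p "x mod p" k', OF c] unfolding assms(1,7)
    by (simp add: min_twice_two[OF assms(8)] conj_commute)
  moreover have "x \<notin> {i, j}" "y \<notin> {i, j}" using ij assms by auto
  ultimately show "tripod_root p n k i j x y z" using assms ij le by (simp add: tripod_root_def)
  have "\<forall>g. pair n (gap i j u v) g = 0 \<longrightarrow> pair n (gap u v i j) g = 0" if "u \<noteq> v" "u \<le> n" "v \<le> n" for u v
    using that ij assms(8) by (simp add: pair_gap_eq_0_iff)
  then show "tripod_labels p n i j x y z (two_step_label p x z i j) (two_step_label p y z i j) (two_step_label p x y i j)"
    unfolding tripod_labels_def using assms ij le
    by (auto intro!: compatible_two_step valid_two_step_label)
qed

text \<open>The lowest pair fixes the root, and two of the three exponents above stay tied. Types II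
  and III can be neighbours here, depending on which of \<open>x\<close>, \<open>y\<close>,
  \<open>z\<close> are congruent.\<close>

lemma tripod_root_above:
  assumes "min_set n k = {i, j}" "i \<noteq> j" "i mod p = j mod p"
    "argmin_set (off_class p n (i mod p)) k = {x, y, z}" "x \<noteq> y" "x \<noteq> z" "y \<noteq> z"
  shows "tripod_root p n k i j x y z"
    "tripod_labels p n i j x y z (two_step_label p i j x z) (two_step_label p i j y z) (two_step_label p i j x y)"
proof -
  have c: "\<And>r. r \<in> min_set n k \<Longrightarrow> r mod p = i mod p" using assms by auto
  have "{x, y, z} \<subseteq> off_class p n (i mod p)" unfolding assms(4)[symmetric] by (auto simp: argmin_set_def)
  then have xyz: "x mod p \<noteq> i mod p" "y mod p \<noteq> i mod p" "z mod p \<noteq> i mod p" "x \<le> n" "y \<le> n" "z \<le> n"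
    by (auto simp: off_class_def)
  have le: "i \<le> n" "j \<le> n" using min_set_le assms(1) by blast+
  have "k i = k j" "k x = k z" "k y = k z"
    using argmin_const[of _ "{..n}" k] argmin_const[of _ "off_class p n (i mod p)" k] assms(1,4) by auto
  moreover have "local_root p n k k' \<longleftrightarrow> k' i = k' j \<and> min_twice {x, y, z} k'" for k'
    using local_root_monochrome[of n k p "i mod p" k', OF c] unfolding assms(1,4)
    by (simp add: min_twice_two[OF assms(2)])
  moreover have "x \<notin> {i, j}" "y \<notin> {i, j}" using xyz assms by auto
  ultimately show "tripod_root p n k i j x y z" using assms xyz le by (simp add: tripod_root_def)
  show "tripod_labels p n i j x y z (two_step_label p i j x z) (two_step_label p i j y z) (two_step_label p i j x y)"
    unfolding tripod_labels_def using assms xyz le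
    by (auto intro!: compatible_two_step valid_two_step_label)
qed

text \<open>Each of the four classes leaves a triple. Any other class keeps all four exponents, a
  condition that follows from the triples.\<close>

lemma tetrapod_rootI:
  assumes "min_set n k = {i, j, x, y}" "distinct [i mod p, j mod p, x mod p, y mod p]"
  shows "tetrapod_root p n k i j x y"
proof -
  have poly: "\<not> monochrome p (min_set n k)" using assms by (auto simp: monochrome_def)
  have m: "i mod p \<noteq> j mod p" "i mod p \<noteq> x mod p" "i mod p \<noteq> y mod p" "j mod p \<noteq> x mod p"
    "j mod p \<noteq> y mod p" "x mod p \<noteq> y mod p" using assms(2) by auto
  have d: "i \<noteq> j" "i \<noteq> x" "i \<noteq> y" "j \<noteq> x" "j \<noteq> y" "x \<noteq> y" using m by auto
  have le: "i \<le> n" "j \<le> n" "x \<le> n" "y \<le> n" using min_set_le assms(1) by blast+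
  have eq: "k i = k j" "k x = k j" "k y = k j" using argmin_const[of _ "{..n}" k] assms(1) by auto
  have sets: "{r \<in> {i, j, x, y}. r mod p \<noteq> i mod p} = {j, x, y}" "{r \<in> {i, j, x, y}. r mod p \<noteq> j mod p} = {i, x, y}"
    "{r \<in> {i, j, x, y}. r mod p \<noteq> x mod p} = {i, j, y}" "{r \<in> {i, j, x, y}. r mod p \<noteq> y mod p} = {i, j, x}"
    using m by auto
  have "local_root p n k k' \<longleftrightarrow> min_twice {j, x, y} k' \<and> min_twice {i, x, y} k' \<and>
        min_twice {i, j, y} k' \<and> min_twice {i, j, x} k'" (is "_ \<longleftrightarrow> ?Q k'") for k'
  proof
    assume "local_root p n k k'"
    then have *: "min_twice {r \<in> {i, j, x, y}. r mod p \<noteq> c} k'" for c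
      unfolding local_root_polychrome[OF poly] assms(1) by blast
    show "?Q k'" using *[of "i mod p"] *[of "j mod p"] *[of "x mod p"] *[of "y mod p"] unfolding sets by blast
  next
    assume h: "?Q k'"
    have "min_twice {r \<in> {i, j, x, y}. r mod p \<noteq> c} k'" for c
    proof (cases "c \<in> {i mod p, j mod p, x mod p, y mod p}")
      case True
      then show ?thesis using h by (elim insertE emptyE) (simp_all only: sets)
    next
      case False
      then have S: "{r \<in> {i, j, x, y}. r mod p \<noteq> c} = {i, j, x, y}" by auto
      have h': "min_twice {i, j, x} k'" "min_twice {i, x, y} k'" "min_twice {i, j, y} k'" "min_twice {j, x, y} k'"
        using h by auto
      from h'(1) d consider "k' i = k' j" "k' i \<le> k' x" | "k' i = k' x" "k' i \<le> k' j" | "k' j = k' x" "k' j \<le> k' i"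
        unfolding min_twice_three[OF d(1,2,4)] by blast
      then show ?thesis
      proof cases
        case 1
        then have "k' i \<le> k' y" using h'(3) unfolding min_twice_three[OF d(1,3,5)]
          using h'(2) unfolding min_twice_three[OF d(2,3,6)] by linarith
        then show ?thesis unfolding S min_twice_def using 1 d by (intro bexI[of _ i] bexI[of _ j]) auto
      next
        case 2
        then have "k' i \<le> k' y" using h'(3) unfolding min_twice_three[OF d(1,3,5)]
          using h'(2) unfolding min_twice_three[OF d(2,3,6)] by linarith
        then show ?thesis unfolding S min_twice_def using 2 d by (intro bexI[of _ i] bexI[of _ x]) auto
      next
        case 3
        then have "k' j \<le> k' y" using h'(3) unfolding min_twice_three[OF d(1,3,5)]
          using h'(4) unfolding min_twice_three[OF d(4,5,6)] by linarith
        then show ?thesis unfolding S min_twice_def using 3 d by (intro bexI[of _ j] bexI[of _ x]) auto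
      qed
    qed
    then show "local_root p n k k'" unfolding local_root_polychrome[OF poly] assms(1) by blast
  qed
  then show ?thesis using assms(2) le eq by (simp add: tetrapod_root_def)
qed

text \<open>Corank one leaves either three lowest exponents, with different residues because
  removing any class must leave two, or two congruent lowest ones with two on the next level. These
  configurations are the labels.\<close>

lemma corank_1_root:
  assumes root: "root_heights p n k" and co: "root_corank p n k = 1"
  obtains L i j q b where "valid_label p n L" "label_relation L = gap i j q b" "flat_root p n k i j q b"
    "\<forall>f\<in>trop_polys n. (\<forall>r\<le>n. cf f r = k r) \<longrightarrow> f \<in> label_cell p n L"
proof (cases "monochrome p (min_set n k)")
  case False
  then have "card (min_set n k) = 3"
    using co polychrome_card[OF root False] by (simp add: root_corank_def relevant_polychrome)
  then obtain i j x where M: "min_set n k = {i, j, x}" and d: "i \<noteq> j" "j \<noteq> x" "i \<noteq> x"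
    by (auto simp: card_3_iff)
  have off: "\<exists>r s. r \<in> {i, j, x} \<and> s \<in> {i, j, x} \<and> r \<noteq> s \<and> r mod p \<noteq> c \<and> s mod p \<noteq> c" for c
    using polychrome_two_off[OF root False] unfolding M by metis
  have m: "i mod p \<noteq> j mod p" "i mod p \<noteq> x mod p" "j mod p \<noteq> x mod p"
    using off[of "i mod p"] off[of "j mod p"] off[of "x mod p"] by auto
  have le: "i \<le> n" "j \<le> n" "x \<le> n" using min_set_le M by blast+
  show thesis
  proof (rule that)
    show "valid_label p n (LabelI i j x)" using m le by simp
    show "label_relation (LabelI i j x) = gap i j x j" by simp
    show "flat_root p n k i j x j" by (rule flat_root_I[OF M m])
    show "\<forall>f\<in>trop_polys n. (\<forall>r\<le>n. cf f r = k r) \<longrightarrow> f \<in> label_cell p n (LabelI i j x)"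
    proof (intro ballI impI)
    fix f assume f: "f \<in> trop_polys n" "\<forall>r\<le>n. cf f r = k r"
    have "k i \<le> k r" if "r \<le> n" for r
    proof -
      have "i \<in> min_set n k" using M by simp
      then show ?thesis using that by (simp add: argmin_set_def)
    qed
    moreover have "k i = k j" "k j = k x" using argmin_const[of _ "{..n}" k] M by auto
    ultimately show "f \<in> label_cell p n (LabelI i j x)" using f le by simp
    qed
  qed
next
  case True
  then obtain c where c: "\<And>r. r \<in> min_set n k \<Longrightarrow> r mod p = c" unfolding monochrome_def by blast
  note cards = monochrome_min_sets[OF root c]
  have "card (min_set n k) = 2" "card (argmin_set (off_class p n c) k) = 2"
    using co cards True by (simp_all add: root_corank_def)
  then obtain i j x y where M: "min_set n k = {i, j}" "i \<noteq> j"
    and N: "argmin_set (off_class p n c) k = {x, y}" "x \<noteq> y" by (auto simp: card_2_iff)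
  have ci: "c = i mod p" "i mod p = j mod p" using c[of i] c[of j] M by auto
  have xy: "x \<in> argmin_set (off_class p n c) k" "y \<in> argmin_set (off_class p n c) k" using N by auto
  have ij: "i \<in> min_set n k" "j \<in> min_set n k" using M by auto
  have le: "i \<le> n" "j \<le> n" "x \<le> n" "y \<le> n" "x mod p \<noteq> i mod p" "y mod p \<noteq> i mod p"
    using min_set_le ij xy ci by (auto simp: argmin_set_def off_class_def)
  show thesis
  proof (rule that)
    show "valid_label p n (two_step_label p i j x y)"
      using le ci M N by (intro valid_two_step_label) auto
    show "label_relation (two_step_label p i j x y) = gap i j x y" by simp
    show "flat_root p n k i j x y" using M N ci by (intro flat_root_two_step) auto
    show "\<forall>f\<in>trop_polys n. (\<forall>r\<le>n. cf f r = k r) \<longrightarrow> f \<in> label_cell p n (two_step_label p i j x y)"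
    proof (intro ballI impI)
    fix f assume f: "f \<in> trop_polys n" "\<forall>r\<le>n. cf f r = k r"
    have "k i = k j" "k x = k y" using argmin_const[OF ij] argmin_const[OF xy] by auto
    moreover have "\<forall>r\<le>n. k i \<le> k r" using ij by (simp add: argmin_set_def)
    moreover have "\<forall>r\<le>n. r mod p \<noteq> i mod p \<longrightarrow> k x \<le> k r"
      using xy ci by (simp add: argmin_set_def off_class_def)
    ultimately have "f \<in> two_step_cell p n i j x y"
      using f le by (simp add: two_step_cell_def)
    then show "f \<in> label_cell p n (two_step_label p i j x y)" by (simp add: two_step_label_def)
    qed
  qed
qed

text \<open>Corank two means four exponents on one level, or two levels of sizes 3 and 2, or 2 and
  3. With four on one level, a congruent pair keeps the other two out of its class, since two
  exponents must survive its removal.\<close>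

lemma corank_2_root:
  assumes root: "root_heights p n k" and co: "root_corank p n k = 2"
  shows "(\<exists>i j q b. flat_root p n k i j q b) \<or>
    (\<exists>i j x y z L1 L2 L3. tripod_root p n k i j x y z \<and> tripod_labels p n i j x y z L1 L2 L3) \<or>
    (\<exists>i j x y. tetrapod_root p n k i j x y)"
proof (cases "monochrome p (min_set n k)")
  case False
  then have "card (min_set n k) = 4"
    using co polychrome_card[OF root False] by (simp add: root_corank_def relevant_polychrome)
  then have "card (min_set n k) = Suc 3" by simp
  then have "\<exists>a B. min_set n k = insert a B \<and> a \<notin> B \<and> card B = 3 \<and> (3 = (0::nat) \<longrightarrow> B = {})"
    by (rule card_Suc_eq[THEN iffD1])
  then obtain a B where aB: "min_set n k = insert a B" "a \<notin> B" "card B = 3" by (elim exE conjE)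
  obtain b c d where bcd: "B = {b, c, d}" "b \<noteq> c" "c \<noteq> d" "b \<noteq> d" using aB(3) by (auto simp: card_3_iff)
  have "min_set n k = {a, b, c, d} \<and> distinct [a, b, c, d]" using aB(1,2) bcd by simp
  then obtain a b c d where M: "min_set n k = {a, b, c, d}" and dis: "distinct [a, b, c, d]" by blast
  have off: "\<exists>r s. r \<in> min_set n k \<and> s \<in> min_set n k \<and> r \<noteq> s \<and> r mod p \<noteq> c \<and> s mod p \<noteq> c" for c
    using polychrome_two_off[OF root False] by metis
  have pair: ?thesis
    if M: "min_set n k = {i, j, x, y}" and dis: "distinct [i, j, x, y]" and ij: "i mod p = j mod p" for i j x y
  proof -
    have xy: "x mod p \<noteq> i mod p" "y mod p \<noteq> i mod p" using off[of "i mod p"] ij dis unfolding M by auto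
    show ?thesis
    proof (cases "x mod p = y mod p")
      case True
      then have "flat_root p n k i j x y" using M dis ij xy by (intro flat_root_two_pairs) auto
      then show ?thesis by blast
    next
      case False
      have "i \<noteq> j" using dis by simp
      show ?thesis using tripod_root_one_level[OF M \<open>i \<noteq> j\<close> ij xy False] by blast
    qed
  qed
  show ?thesis
  proof (cases "distinct [a mod p, b mod p, c mod p, d mod p]")
    case True
    then show ?thesis using tetrapod_rootI[OF M] by blast
  next
    case False
    then consider "a mod p = b mod p" | "a mod p = c mod p" | "a mod p = d mod p" | "b mod p = c mod p"
      | "b mod p = d mod p" | "c mod p = d mod p" by auto
    then show ?thesis
    proof cases
      case 1 then show ?thesis using pair[of a b c d] M dis by auto
    next
      case 2 then show ?thesis using pair[of a c b d] M dis by (auto simp: insert_commute)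
    next
      case 3 then show ?thesis using pair[of a d b c] M dis by (auto simp: insert_commute)
    next
      case 4 then show ?thesis using pair[of b c a d] M dis by (auto simp: insert_commute)
    next
      case 5 then show ?thesis using pair[of b d a c] M dis by (auto simp: insert_commute)
    next
      case 6 then show ?thesis using pair[of c d a b] M dis by (auto simp: insert_commute)
    qed
  qed
next
  case True
  then obtain c where c: "\<And>r. r \<in> min_set n k \<Longrightarrow> r mod p = c" unfolding monochrome_def by blast
  note cards = monochrome_min_sets[OF root c]
  have "card (min_set n k) = 3 \<and> card (argmin_set (off_class p n c) k) = 2 \<or>
    card (min_set n k) = 2 \<and> card (argmin_set (off_class p n c) k) = 3"
    using co cards True unfolding root_corank_def by auto
  then show ?thesis
  proof
    assume "card (min_set n k) = 3 \<and> card (argmin_set (off_class p n c) k) = 2"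
    then obtain x y z i j where M: "min_set n k = {x, y, z}" "x \<noteq> y" "y \<noteq> z" "x \<noteq> z"
      and N: "argmin_set (off_class p n c) k = {i, j}" "i \<noteq> j" by (auto simp: card_2_iff card_3_iff)
    have ci: "c = x mod p" "x mod p = y mod p" "x mod p = z mod p" using c[of x] c[of y] c[of z] M by auto
    show ?thesis using tripod_root_below[OF M(1,2,4,3) ci(2,3) _ N(2)] N(1) ci(1) by blast
  next
    assume "card (min_set n k) = 2 \<and> card (argmin_set (off_class p n c) k) = 3"
    then obtain x y z i j where M: "min_set n k = {i, j}" "i \<noteq> j"
      and N: "argmin_set (off_class p n c) k = {x, y, z}" "x \<noteq> y" "y \<noteq> z" "x \<noteq> z"
      by (auto simp: card_2_iff card_3_iff)
    have ci: "c = i mod p" "i mod p = j mod p" using c[of i] c[of j] M by auto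
    show ?thesis using tripod_root_above[OF M ci(2) _ N(2,4,3)] N(1) ci(1) by blast
  qed
qed

section \<open>The discriminant near polynomials with double roots of corank at most two\<close>

lemma disc_set_sub: "disc_set p n \<subseteq> trop_polys n"
  by (auto simp: disc_set_def)

lemma disc_set_near:
  assumes "p > 0" "f \<in> trop_polys n" "{a. is_root p n f a} = A"
    "\<And>a g. a \<in> A \<Longrightarrow> (\<exists>b. local_root p n (ht f a) (ht g b)) \<longleftrightarrow> P a g"
  shows "\<exists>e>0. \<forall>g \<in> trop_polys n \<inter> coord_box n f e. g \<in> disc_set p n \<longleftrightarrow> (\<exists>a\<in>A. P a g)"
proof -
  obtain e where "e > 0" and e: "\<And>g. g \<in> trop_polys n \<Longrightarrow> g \<in> coord_box n f e \<Longrightarrow>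
     g \<in> disc_set p n \<longleftrightarrow> (\<exists>a. is_root p n f a \<and> (\<exists>b. local_root p n (ht f a) (ht g b)))"
    using disc_set_local[OF assms(1,2)] by metis
  have "(\<exists>a. is_root p n f a \<and> (\<exists>b. local_root p n (ht f a) (ht g b))) \<longleftrightarrow> (\<exists>a\<in>A. P a g)" for g
    using assms(3,4) by blast
  then show ?thesis using \<open>e > 0\<close> e by (intro exI[of _ e] conjI ballI) simp_all
qed

lemma flat_root_local:
  assumes "flat_root p n k i j q b"
  shows "(\<exists>b'. local_root p n k (ht g b')) \<longleftrightarrow> pair n (gap i j q b) g = 0"
proof -
  have ij: "i \<noteq> j" and le: "i \<le> n" "j \<le> n" "q \<le> n" "b \<le> n"
    and loc: "\<And>k'. local_root p n k k' \<longleftrightarrow> k' i = k' j \<and> k' q = k' b"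
    using assms by (auto simp: flat_root_def relevant_def)
  show ?thesis
    unfolding loc ht_eq_iff_slope[OF ij] pair_gap[OF le] by auto
qed

lemma flat_root_zero:
  assumes "flat_root p n (ht f a) i j q b"
  shows "pair n (gap i j q b) f = 0"
proof -
  have ij: "i \<noteq> j" and le: "i \<le> n" "j \<le> n" "q \<le> n" "b \<le> n" and k: "ht f a i = ht f a j" "ht f a q = ht f a b"
    using assms by (auto simp: flat_root_def relevant_def)
  then have "a = slope i j f" using ht_eq_iff_slope by blast
  then show ?thesis using k(2) by (simp add: pair_gap[OF le])
qed

lemma flat_root_relation:
  assumes "flat_root p n k i j q b"
  shows "root_relation p n k (gap i j q b)" "gap i j q b q = 1" "q \<le> n"
proof -
  show "root_relation p n k (gap i j q b)" using assms unfolding flat_root_def by (intro gap_relation) blast+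
  show "gap i j q b q = 1" "q \<le> n" using assms by (simp_all add: flat_root_def gap_def relevant_def)
qed

lemma regular_if_flat:
  assumes p: "p > 0" and fV: "f \<in> trop_polys n" and roots: "{a. is_root p n f a} = {a}"
    and flat: "flat_root p n (ht f a) i j q b"
  shows "regular_point (disc_set p n) f"
proof -
  obtain e where e: "e > 0" "\<forall>g \<in> trop_polys n \<inter> coord_box n f e. g \<in> disc_set p n \<longleftrightarrow>
      (\<exists>a'\<in>{a}. pair n (gap i j q b) g = 0)"
    using disc_set_near[OF p fV roots, of "\<lambda>_ g. pair n (gap i j q b) g = 0"] flat_root_local[OF flat] by auto
  let ?A = "trop_polys n \<inter> {g. pair n (gap i j q b) g = 0}"
  have "affine ?A"
    by (intro subspace_imp_affine subspace_inter subspace_trop_polys subspace_pair)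
  moreover have "disc_set p n \<inter> coord_box n f e = ?A \<inter> coord_box n f e"
    using e(2) disc_set_sub by auto
  moreover have "f \<in> disc_set p n" using fV roots by (auto simp: disc_set_def)
  ultimately show ?thesis
    unfolding regular_point_def using e(1)
    by (intro conjI exI[of _ "coord_box n f e"] exI[of _ ?A]) (simp_all add: open_coord_box)
qed

text \<open>Each root contributes one hyperplane, and the normals are independent because relations
  at distinct roots are in direct sum. In the plane these are the two axes.\<close>

lemma book_crossing:
  assumes p: "p > 0" and fV: "f \<in> trop_polys n" and roots: "{a. is_root p n f a} = {a1, a2}" "a1 \<noteq> a2"
    and flat1: "flat_root p n (ht f a1) i j q b" and flat2: "flat_root p n (ht f a2) i' j' q' b'"
  shows "book_at n (disc_set p n) f (gap i j q b) (gap i' j' q' b') {(1, 0), (-1, 0), (0, 1), (0, -1)}"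
proof -
  let ?l = "gap i j q b" and ?m = "gap i' j' q' b'" and ?R = "{(1, 0), (-1, 0), (0, 1), (0, -1)} :: (real \<times> real) set"
  obtain e where e: "e > 0" "\<forall>g \<in> trop_polys n \<inter> coord_box n f e. g \<in> disc_set p n \<longleftrightarrow>
      (\<exists>a\<in>{a1, a2}. pair n (if a = a1 then ?l else ?m) g = 0)"
  proof -
    have "(\<exists>b. local_root p n (ht f a) (ht g b)) \<longleftrightarrow> pair n (if a = a1 then ?l else ?m) g = 0"
      if "a \<in> {a1, a2}" for a g
      using that flat_root_local[OF flat1] flat_root_local[OF flat2] roots(2) by auto
    from disc_set_near[OF p fV roots(1) this] show thesis using that by blast
  qed
  have ray: "(\<exists>u\<in>?R. on_ray u x y) \<longleftrightarrow> x = 0 \<or> y = 0" for x y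
    by (auto simp: on_ray_def)
  have near: "\<exists>e>0. \<forall>g \<in> trop_polys n \<inter> coord_box n f e.
      g \<in> disc_set p n \<longleftrightarrow> (\<exists>u\<in>?R. on_ray u (pair n ?l g) (pair n ?m g))"
    unfolding ray using e roots(2) by auto
  have "s = 0 \<and> t = 0" if st: "\<And>r. r \<le> n \<Longrightarrow> s * ?l r + t * ?m r = 0" for s t
  proof -
    define l where "l a = (\<lambda>r. if a = a1 then s * ?l r else t * ?m r)" for a
    have scale: "root_relation p n k (\<lambda>r. c * l r)" if "root_relation p n k l" for k c l
      using that unfolding root_relation_def by (auto simp: sum_distrib_left[symmetric] mult.left_commute)
    have z: "l a r = 0" if "a \<in> {a1, a2}" "r \<le> n" for a r
    proof (rule root_relations_independent[where A = "{a1, a2}" and p = p and f = f and l = l and n = n])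
      show "root_relation p n (ht f a) (l a)" if "a \<in> {a1, a2}" for a
        using that roots(2) scale[OF flat_root_relation(1)[OF flat1]] scale[OF flat_root_relation(1)[OF flat2]]
        by (auto simp: l_def)
      show "(\<Sum>a\<in>{a1, a2}. l a r) = 0" if "r \<le> n" for r
        using st[OF that] roots(2) by (simp add: l_def)
    qed (use that in auto)
    show ?thesis
      using z[of a1 q] z[of a2 q'] roots(2) flat_root_relation(2,3)[OF flat1] flat_root_relation(2,3)[OF flat2]
      by (simp add: l_def)
  qed
  from indep_pair_minor[OF this] obtain r s where "r \<le> n" "s \<le> n" "?l r * ?m s - ?l s * ?m r \<noteq> 0" by blast
  from dual_pair_exists[OF this] have "\<exists>u w. u \<in> trop_polys n \<and> w \<in> trop_polys n \<and>
        pair n ?l u = 1 \<and> pair n ?m u = 0 \<and> pair n ?l w = 0 \<and> pair n ?m w = 1" by metis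
  then show ?thesis
    unfolding book_at_def using fV flat_root_zero[OF flat1] flat_root_zero[OF flat2] near
    by (auto simp: cross_def dot_def)
qed

text \<open>With the root fixed by \<open>i\<close> and \<open>j\<close>, the coordinates
  \<open>A\<close>, \<open>B\<close> are the heights of \<open>x\<close> and \<open>y\<close>
  relative to \<open>z\<close>. The minimum of \<open>A\<close>, \<open>B\<close>, \<open>0\<close>
  is attained twice exactly on the three rays of a tropical line.\<close>

lemma book_tripod:
  assumes p: "p > 0" and fV: "f \<in> trop_polys n" and roots: "{a. is_root p n f a} = {a}"
    and tri: "tripod_root p n (ht f a) i j x y z"
  shows "book_at n (disc_set p n) f (gap i j x z) (gap i j y z) {(1, 0), (0, 1), (-1, -1)}"
proof -
  let ?l = "gap i j x z" and ?m = "gap i j y z" and ?R = "{(1, 0), (0, 1), (-1, -1)} :: (real \<times> real) set"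
  have d: "i \<noteq> j" "x \<noteq> y" "x \<noteq> z" "y \<noteq> z" "x \<noteq> i" "x \<noteq> j" "y \<noteq> i" "y \<noteq> j"
    and le: "i \<le> n" "j \<le> n" "x \<le> n" "y \<le> n" "z \<le> n"
    and k: "ht f a i = ht f a j" "ht f a x = ht f a z" "ht f a y = ht f a z"
    and loc: "\<And>k'. local_root p n (ht f a) k' \<longleftrightarrow> k' i = k' j \<and> min_twice {x, y, z} k'"
    using tri by (auto simp: tripod_root_def)
  have "(\<exists>b. local_root p n (ht f a) (ht g b)) \<longleftrightarrow> min_twice {x, y, z} (ht g (slope i j g))" for g
    unfolding loc ht_eq_iff_slope[OF d(1)] by auto
  also have "min_twice {x, y, z} (ht g (slope i j g)) \<longleftrightarrow> (\<exists>u\<in>?R. on_ray u (pair n ?l g) (pair n ?m g))" for g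
    unfolding min_twice_three[OF d(2-4)] pair_gap[OF le(1,2,3,5)] pair_gap[OF le(1,2,4,5)]
    by (auto simp: on_ray_def)
  finally have near: "\<exists>e>0. \<forall>g \<in> trop_polys n \<inter> coord_box n f e.
      g \<in> disc_set p n \<longleftrightarrow> (\<exists>u\<in>?R. on_ray u (pair n ?l g) (pair n ?m g))"
    using disc_set_near[OF p fV roots, of "\<lambda>_ g. \<exists>u\<in>?R. on_ray u (pair n ?l g) (pair n ?m g)"] by auto
  have "a = slope i j f" using k(1) ht_eq_iff_slope[OF d(1)] by blast
  then have zero: "pair n ?l f = 0" "pair n ?m f = 0" using k by (simp_all add: pair_gap le)
  have "?l x = 1" "?m x = 0" "?l y = 0" "?m y = 1" using d by (auto simp: gap_def)
  then have "pair n ?l (unit_coord x) = 1" "pair n ?m (unit_coord x) = 0"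
    "pair n ?l (unit_coord y) = 0" "pair n ?m (unit_coord y) = 1"
    using le by (simp_all add: pair_unit_coord)
  then have "\<exists>u w. u \<in> trop_polys n \<and> w \<in> trop_polys n \<and>
        pair n ?l u = 1 \<and> pair n ?m u = 0 \<and> pair n ?l w = 0 \<and> pair n ?m w = 1"
    using unit_coord_in le by blast
  then show ?thesis
    unfolding book_at_def using fV zero near by (auto simp: cross_def dot_def)
qed

lemma four_values_min_thrice:
  fixes a b c d :: real
  assumes "b = c \<and> b \<le> d \<or> b = d \<and> b \<le> c \<or> c = d \<and> c \<le> b"
    "a = c \<and> a \<le> d \<or> a = d \<and> a \<le> c \<or> c = d \<and> c \<le> a"
    "a = b \<and> a \<le> d \<or> a = d \<and> a \<le> b \<or> b = d \<and> b \<le> a"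
    "a = b \<and> a \<le> c \<or> a = c \<and> a \<le> b \<or> b = c \<and> b \<le> a"
  shows "a = b \<and> a = c \<and> a \<le> d \<or> a = b \<and> a = d \<and> a \<le> c \<or> a = c \<and> a = d \<and> a \<le> b \<or> b = c \<and> b = d \<and> b \<le> a"
  using assms by argo

text \<open>The direction in which \<open>w\<close> is one above the three other exponents, which
  tie. For \<open>w = j\<close> the root moves by \<open>t = 1 / (j - i)\<close> and the coordinates
  become \<open>t * (i - x)\<close> and \<open>t * (i - y)\<close>.\<close>

definition tetrapod_rays :: "nat \<Rightarrow> nat \<Rightarrow> nat \<Rightarrow> nat \<Rightarrow> nat \<Rightarrow> real \<times> real" where
  "tetrapod_rays i j x y w =
     (if w = y then (0, 1) else if w = x then (1, 0)
      else if w = j then ((real i - real x) / (real j - real i), (real i - real y) / (real j - real i))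
      else ((real j - real x) / (real i - real j), (real j - real y) / (real i - real j)))"

text \<open>No two pages are coplanar, which distinguishes these four cones from those of a
  crossing.\<close>

lemma cross_tetrapod_rays:
  assumes "distinct [i, j, x, y]" "w \<in> {i, j, x, y}" "w' \<in> {i, j, x, y}" "w \<noteq> w'"
  shows "cross (tetrapod_rays i j x y w) (tetrapod_rays i j x y w') \<noteq> 0"
proof -
  have d: "i \<noteq> j" "i \<noteq> x" "i \<noteq> y" "j \<noteq> x" "j \<noteq> y" "x \<noteq> y" using assms(1) by auto
  define s where "s = 1 / (real j - real i)"
  have s: "s \<noteq> 0" using d by (simp add: s_def)
  have rays: "tetrapod_rays i j x y y = (0, 1)" "tetrapod_rays i j x y x = (1, 0)"
    "tetrapod_rays i j x y j = (s * (real i - real x), s * (real i - real y))"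
    "tetrapod_rays i j x y i = (- s * (real j - real x), - s * (real j - real y))"
    using d by (auto simp: tetrapod_rays_def s_def divide_simps) (simp_all add: algebra_simps)
  have "cross (tetrapod_rays i j x y j) (tetrapod_rays i j x y i) = - s * s * (real i - real j) * (real x - real y)"
    unfolding rays cross_def by (simp add: algebra_simps)
  then have ij: "cross (tetrapod_rays i j x y j) (tetrapod_rays i j x y i) \<noteq> 0" using s d by simp
  have others: "cross (tetrapod_rays i j x y y) (tetrapod_rays i j x y x) \<noteq> 0"
    "cross (tetrapod_rays i j x y y) (tetrapod_rays i j x y i) \<noteq> 0"
    "cross (tetrapod_rays i j x y y) (tetrapod_rays i j x y j) \<noteq> 0"
    "cross (tetrapod_rays i j x y x) (tetrapod_rays i j x y i) \<noteq> 0"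
    "cross (tetrapod_rays i j x y x) (tetrapod_rays i j x y j) \<noteq> 0"
    unfolding rays cross_def using s d by simp_all
  have sym: "cross u v \<noteq> 0" if "cross v u \<noteq> 0" for u v using that by (simp add: cross_def algebra_simps)
  show ?thesis
    using assms(2-4) ij others sym by (elim insertE emptyE) simp_all
qed

text \<open>No tie holds on all four pages, so no slope gives the root. It is written
  \<open>b0 + t\<close> with \<open>b0 = slope i j g\<close>, and the shift \<open>t\<close> is
  eliminated for each choice of the exponent left out.\<close>

lemma book_tetrapod:
  assumes p: "p > 0" and fV: "f \<in> trop_polys n" and roots: "{a. is_root p n f a} = {a}"
    and tet: "tetrapod_root p n (ht f a) i j x y"
  shows "book_at n (disc_set p n) f (gap i j x j) (gap i j y j) (tetrapod_rays i j x y ` {i, j, x, y})"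
proof -
  let ?l = "gap i j x j" and ?m = "gap i j y j" and ?u = "tetrapod_rays i j x y"
  have d: "i \<noteq> j" "i \<noteq> x" "i \<noteq> y" "j \<noteq> x" "j \<noteq> y" "x \<noteq> y"
    and le: "i \<le> n" "j \<le> n" "x \<le> n" "y \<le> n"
    and k: "ht f a i = ht f a j" "ht f a x = ht f a j" "ht f a y = ht f a j"
    and loc: "\<And>k'. local_root p n (ht f a) k' \<longleftrightarrow> min_twice {j, x, y} k' \<and> min_twice {i, x, y} k' \<and>
        min_twice {i, j, y} k' \<and> min_twice {i, j, x} k'"
    using tet by (auto simp: tetrapod_root_def)
  \<comment> \<open>Over the pages of \<open>j\<close> and \<open>i\<close> the point
    \<open>(A, B)\<close> is \<open>t / s\<close>, respectively \<open>- t / s\<close>, times the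
    ray, so the sign of \<open>s * t\<close> decides the side.\<close>
  define s where "s = 1 / (real j - real i)"
  have s: "s * (real j - real i) = 1" using d by (simp add: s_def)
  have rays: "?u y = (0, 1)" "?u x = (1, 0)"
    "?u j = (s * (real i - real x), s * (real i - real y))"
    "?u i = (- s * (real j - real x), - s * (real j - real y))"
    using d by (auto simp: tetrapod_rays_def s_def divide_simps) (simp_all add: algebra_simps)
  have eqv: "(\<exists>b. local_root p n (ht f a) (ht g b)) \<longleftrightarrow> (\<exists>u\<in>?u ` {i, j, x, y}. on_ray u (pair n ?l g) (pair n ?m g))"
    (is "?L \<longleftrightarrow> ?R") for g
  proof -
    define b0 where "b0 = slope i j g"
    define H where "H = ht g b0 j"
    define A where "A = pair n ?l g"
    define B where "B = pair n ?m g"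
    have H: "ht g b0 i = H" "ht g b0 j = H" "ht g b0 x = H + A" "ht g b0 y = H + B"
      using ht_eq_iff_slope[OF d(1), of g b0] by (auto simp: b0_def H_def A_def B_def pair_gap le)
    have sh: "ht g (b0 + t) r = ht g b0 r + real r * t" for t r by (simp add: ht_def algebra_simps)
    have R: "?R \<longleftrightarrow> A = 0 \<and> 0 \<le> B \<or> B = 0 \<and> 0 \<le> A
      \<or> s * (real i - real y) * A = s * (real i - real x) * B \<and> 0 \<le> s * (real i - real x) * A + s * (real i - real y) * B
      \<or> s * (real j - real y) * A = s * (real j - real x) * B \<and> 0 \<le> - s * (real j - real x) * A - s * (real j - real y) * B"
      unfolding A_def[symmetric] B_def[symmetric]
      by (simp add: rays on_ray_def) argo
    have three: "min_twice {j, x, y} (ht g (b0 + t)) \<and> min_twice {i, x, y} (ht g (b0 + t)) \<and>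
        min_twice {i, j, y} (ht g (b0 + t)) \<and> min_twice {i, j, x} (ht g (b0 + t)) \<longleftrightarrow>
        (let vi = real i * t; vj = real j * t; vx = A + real x * t; vy = B + real y * t in
         vi = vj \<and> vi = vx \<and> vi \<le> vy \<or> vi = vj \<and> vi = vy \<and> vi \<le> vx \<or> vi = vx \<and> vi = vy \<and> vi \<le> vj
         \<or> vj = vx \<and> vj = vy \<and> vj \<le> vi)" (is "?M \<longleftrightarrow> ?T") for t
    proof
      assume ?M
      then show ?T
        unfolding min_twice_three[OF d(4,5,6)] min_twice_three[OF d(2,3,6)] min_twice_three[OF d(1,3,5)]
          min_twice_three[OF d(1,2,4)] sh H Let_def
        using four_values_min_thrice[of "H + real j * t" "H + A + real x * t" "H + B + real y * t" "H + real i * t"]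
        by argo
    next
      assume ?T
      then show ?M
        unfolding min_twice_three[OF d(4,5,6)] min_twice_three[OF d(2,3,6)] min_twice_three[OF d(1,3,5)]
          min_twice_three[OF d(1,2,4)] sh H Let_def
        by argo
    qed
    have "?L \<longleftrightarrow> (\<exists>t. local_root p n (ht f a) (ht g (b0 + t)))"
      by (metis add.commute diff_add_cancel)
    also have "\<dots> \<longleftrightarrow> (\<exists>t. let vi = real i * t; vj = real j * t; vx = A + real x * t; vy = B + real y * t in
         vi = vj \<and> vi = vx \<and> vi \<le> vy \<or> vi = vj \<and> vi = vy \<and> vi \<le> vx \<or> vi = vx \<and> vi = vy \<and> vi \<le> vj
         \<or> vj = vx \<and> vj = vy \<and> vj \<le> vi)"
      unfolding loc three ..
    also have "\<dots> \<longleftrightarrow> ?R"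
    proof
      assume "\<exists>t. let vi = real i * t; vj = real j * t; vx = A + real x * t; vy = B + real y * t in
         vi = vj \<and> vi = vx \<and> vi \<le> vy \<or> vi = vj \<and> vi = vy \<and> vi \<le> vx \<or> vi = vx \<and> vi = vy \<and> vi \<le> vj
         \<or> vj = vx \<and> vj = vy \<and> vj \<le> vi"
      then obtain t where t: "real i * t = real j * t \<and> real i * t = A + real x * t \<and> real i * t \<le> B + real y * t
        \<or> real i * t = real j * t \<and> real i * t = B + real y * t \<and> real i * t \<le> A + real x * t
        \<or> real i * t = A + real x * t \<and> real i * t = B + real y * t \<and> real i * t \<le> real j * t
        \<or> real j * t = A + real x * t \<and> real j * t = B + real y * t \<and> real j * t \<le> real i * t"
        unfolding Let_def by blast
      have ss: "0 \<le> s * s" by simp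
      from t show ?R
      proof (elim disjE conjE)
        assume "real i * t = real j * t" "real i * t = A + real x * t" "real i * t \<le> B + real y * t"
        then show ?thesis unfolding R using d by auto
      next
        assume "real i * t = real j * t" "real i * t = B + real y * t" "real i * t \<le> A + real x * t"
        then show ?thesis unfolding R using d by auto
      next
        assume h: "real i * t = A + real x * t" "real i * t = B + real y * t" "real i * t \<le> real j * t"
        then have AB: "A = (real i - real x) * t" "B = (real i - real y) * t" by (simp_all add: algebra_simps)
        have "0 \<le> (real j - real i) * t" using h by (simp add: algebra_simps)
        then have "0 \<le> (s * s) * ((real j - real i) * t)" using ss by (rule mult_nonneg_nonneg[rotated])
        also have "(s * s) * ((real j - real i) * t) = s * t" using s by algebra
        finally have "0 \<le> (s * t) * ((real i - real x)\<^sup>2 + (real i - real y)\<^sup>2)" by simp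
        then have "0 \<le> s * (real i - real x) * A + s * (real i - real y) * B"
          unfolding AB by (simp add: power2_eq_square algebra_simps)
        moreover have "s * (real i - real y) * A = s * (real i - real x) * B" unfolding AB by simp
        ultimately show ?thesis unfolding R by blast
      next
        assume h: "real j * t = A + real x * t" "real j * t = B + real y * t" "real j * t \<le> real i * t"
        then have AB: "A = (real j - real x) * t" "B = (real j - real y) * t" by (simp_all add: algebra_simps)
        have "0 \<le> - ((real j - real i) * t)" using h by (simp add: algebra_simps)
        then have "0 \<le> (s * s) * - ((real j - real i) * t)" using ss by (rule mult_nonneg_nonneg[rotated])
        also have "(s * s) * - ((real j - real i) * t) = - s * t" using s by algebra
        finally have "0 \<le> (- s * t) * ((real j - real x)\<^sup>2 + (real j - real y)\<^sup>2)"
          by (rule mult_nonneg_nonneg) simp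
        then have "0 \<le> - s * (real j - real x) * A - s * (real j - real y) * B"
          unfolding AB by (simp add: power2_eq_square algebra_simps)
        moreover have "s * (real j - real y) * A = s * (real j - real x) * B" unfolding AB by simp
        ultimately show ?thesis unfolding R by blast
      qed
    next
      assume ?R
      then have "\<exists>t. real i * t = real j * t \<and> real i * t = A + real x * t \<and> real i * t \<le> B + real y * t
        \<or> real i * t = real j * t \<and> real i * t = B + real y * t \<and> real i * t \<le> A + real x * t
        \<or> real i * t = A + real x * t \<and> real i * t = B + real y * t \<and> real i * t \<le> real j * t
        \<or> real j * t = A + real x * t \<and> real j * t = B + real y * t \<and> real j * t \<le> real i * t"
        unfolding R
      proof (elim disjE conjE)
        assume "A = 0" "0 \<le> B"
        then show ?thesis by (intro exI[of _ 0]) simp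
      next
        assume "B = 0" "0 \<le> A"
        then show ?thesis by (intro exI[of _ 0]) simp
      next
        assume h: "s * (real i - real y) * A = s * (real i - real x) * B"
          "0 \<le> s * (real i - real x) * A + s * (real i - real y) * B"
        define t where "t = A / (real i - real x)"
        have A: "A = (real i - real x) * t" using d by (simp add: t_def)
        have "(real j - real i) * (s * (real i - real y) * A) = (real j - real i) * (s * (real i - real x) * B)"
          using h(1) by simp
        then have "(real i - real x) * ((real i - real y) * t) = (real i - real x) * B" unfolding A using s by algebra
        then have B: "B = (real i - real y) * t" using d by simp
        have "s * (real i - real x) * A + s * (real i - real y) * B = (s * t) * ((real i - real x)\<^sup>2 + (real i - real y)\<^sup>2)"
          unfolding A B by (simp add: power2_eq_square algebra_simps)
        moreover have "0 < (real i - real x)\<^sup>2 + (real i - real y)\<^sup>2" using d by (simp add: add_pos_nonneg)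
        ultimately have "0 \<le> s * t" using h(2) by (simp add: zero_le_mult_iff)
        then have "0 \<le> (s * t) * (real j - real i)\<^sup>2" by simp
        also have "(s * t) * (real j - real i)\<^sup>2 = (real j - real i) * t" using s by algebra
        finally show ?thesis using A B by (intro exI[of _ t]) (simp add: algebra_simps)
      next
        assume h: "s * (real j - real y) * A = s * (real j - real x) * B"
          "0 \<le> - s * (real j - real x) * A - s * (real j - real y) * B"
        define t where "t = A / (real j - real x)"
        have A: "A = (real j - real x) * t" using d by (simp add: t_def)
        have "(real j - real i) * (s * (real j - real y) * A) = (real j - real i) * (s * (real j - real x) * B)"
          using h(1) by simp
        then have "(real j - real x) * ((real j - real y) * t) = (real j - real x) * B" unfolding A using s by algebra
        then have B: "B = (real j - real y) * t" using d by simp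
        have "- s * (real j - real x) * A - s * (real j - real y) * B = (- s * t) * ((real j - real x)\<^sup>2 + (real j - real y)\<^sup>2)"
          unfolding A B by (simp add: power2_eq_square algebra_simps)
        moreover have "0 < (real j - real x)\<^sup>2 + (real j - real y)\<^sup>2" using d by (simp add: add_pos_nonneg)
        ultimately have "0 \<le> - s * t"
          using h(2) zero_le_mult_iff[of "- s * t" "(real j - real x)\<^sup>2 + (real j - real y)\<^sup>2"] by linarith
        then have "0 \<le> (- s * t) * (real j - real i)\<^sup>2" by (rule mult_nonneg_nonneg) simp
        also have "(- s * t) * (real j - real i)\<^sup>2 = (real i - real j) * t" using s by algebra
        finally show ?thesis using A B by (intro exI[of _ t]) (simp add: algebra_simps)
      qed
      then show "\<exists>t. let vi = real i * t; vj = real j * t; vx = A + real x * t; vy = B + real y * t in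
         vi = vj \<and> vi = vx \<and> vi \<le> vy \<or> vi = vj \<and> vi = vy \<and> vi \<le> vx \<or> vi = vx \<and> vi = vy \<and> vi \<le> vj
         \<or> vj = vx \<and> vj = vy \<and> vj \<le> vi"
        unfolding Let_def .
    qed
    finally show ?thesis .
  qed
  have near: "\<exists>e>0. \<forall>g \<in> trop_polys n \<inter> coord_box n f e.
      g \<in> disc_set p n \<longleftrightarrow> (\<exists>u\<in>?u ` {i, j, x, y}. on_ray u (pair n ?l g) (pair n ?m g))"
  proof -
    have "(\<exists>b. local_root p n (ht f a') (ht g b)) \<longleftrightarrow> (\<exists>u\<in>?u ` {i, j, x, y}. on_ray u (pair n ?l g) (pair n ?m g))"
      if "a' \<in> {a}" for a' g using that eqv by blast
    from disc_set_near[OF p fV roots this] show ?thesis by blast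
  qed
  have "a = slope i j f" using k(1) ht_eq_iff_slope[OF d(1)] by blast
  then have zero: "pair n ?l f = 0" "pair n ?m f = 0" using k by (simp_all add: pair_gap le)
  have "?l x = 1" "?m x = 0" "?l y = 0" "?m y = 1" using d by (auto simp: gap_def)
  then have "pair n ?l (unit_coord x) = 1" "pair n ?m (unit_coord x) = 0"
    "pair n ?l (unit_coord y) = 0" "pair n ?m (unit_coord y) = 1"
    using le by (simp_all add: pair_unit_coord)
  then have duals: "\<exists>u w. u \<in> trop_polys n \<and> w \<in> trop_polys n \<and>
        pair n ?l u = 1 \<and> pair n ?m u = 0 \<and> pair n ?l w = 0 \<and> pair n ?m w = 1"
    using unit_coord_in le by blast
  have dist: "distinct [i, j, x, y]" using d by simp
  note cr = cross_tetrapod_rays[OF dist]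
  define W where "W = {i, j, x, y}"
  have crW: "cross (?u w) (?u w') \<noteq> 0" if "w \<in> W" "w' \<in> W" "w \<noteq> w'" for w w'
    using cr that by (simp only: W_def)
  have sep: "\<forall>u\<in>?u ` W. \<forall>w\<in>?u ` W. u \<noteq> w \<longrightarrow> cross u w \<noteq> 0 \<or> dot u w < 0"
  proof (intro ballI impI disjI1)
    fix u w assume "u \<in> ?u ` W" "w \<in> ?u ` W" "u \<noteq> w"
    then show "cross u w \<noteq> 0" using crW by (elim imageE) blast
  qed
  have other: "\<exists>w'\<in>W. w' \<noteq> w" for w using d unfolding W_def by auto
  have tr: "\<forall>u\<in>?u ` W. \<exists>w\<in>?u ` W. cross u w \<noteq> 0"
  proof
    fix u assume "u \<in> ?u ` W"
    then obtain w where w: "w \<in> W" "u = ?u w" by (elim imageE)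
    obtain w' where "w' \<in> W" "w' \<noteq> w" using other by blast
    then show "\<exists>w\<in>?u ` W. cross u w \<noteq> 0" using crW[OF w(1)] w(2) by blast
  qed
  have c0: "cross (0, 0) w = 0" for w by (simp add: cross_def)
  have n0: "(0, 0) \<notin> ?u ` W" using tr c0 by blast
  have "finite (?u ` W)" by (simp add: W_def)
  note near = near[folded W_def]
  show ?thesis
    unfolding book_at_def W_def[symmetric]
    using fV zero duals sep tr n0 near \<open>finite (?u ` W)\<close> by (intro conjI)
qed

section \<open>Valuations: from multiple roots to ties of heights, and back by lifting\<close>

section \<open>Lifting to the valued field\<close>

locale valued_field =
  fixes v :: "'k::alg_closed_field \<Rightarrow> real" and p :: nat
  assumes val: "valuation v" and prime_p: "prime p" and p_gt_2: "p > 2" and char_p: "CHAR('k) = p"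
    and rat_values: "\<rat> \<subseteq> value_group v"
begin

lemma p_pos: "p > 0" using p_gt_2 by simp

lemma v_mult: "x \<noteq> 0 \<Longrightarrow> y \<noteq> 0 \<Longrightarrow> v (x * y) = v x + v y"
  using val by (simp add: valuation_def)

lemma v_add: "x \<noteq> 0 \<Longrightarrow> y \<noteq> 0 \<Longrightarrow> x + y \<noteq> 0 \<Longrightarrow> min (v x) (v y) \<le> v (x + y)"
  using val by (simp add: valuation_def)

lemma v_1 [simp]: "v 1 = 0" using v_mult[of 1 1] by simp

lemma v_minus [simp]: "v (- x) = v x"
proof (cases "x = 0")
  case False
  have "v (- 1) = 0" using v_mult[of "-1" "-1"] by simp
  then show ?thesis using v_mult[of "-1" x] False by simp
qed simp

lemma v_inverse: "x \<noteq> 0 \<Longrightarrow> v (inverse x) = - v x"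
  using v_mult[of x "inverse x"] by simp

lemma v_divide: "x \<noteq> 0 \<Longrightarrow> y \<noteq> 0 \<Longrightarrow> v (x / y) = v x - v y"
  using v_mult[of x "inverse y"] by (simp add: divide_inverse v_inverse)

lemma v_power: "x \<noteq> 0 \<Longrightarrow> v (x ^ m) = real m * v x"
  by (induction m) (auto simp: v_mult algebra_simps)

lemma v_add_less:
  assumes "x \<noteq> 0" "y \<noteq> 0" "v x < v y"
  shows "x + y \<noteq> 0 \<and> v (x + y) = v x"
proof
  show nz: "x + y \<noteq> 0"
  proof
    assume "x + y = 0"
    then have "x = - y" by (simp add: eq_neg_iff_add_eq_0)
    then show False using assms by simp
  qed
  have "v x \<le> v (x + y)" using v_add[OF assms(1,2) nz] assms(3) by simp
  moreover have "min (v (x + y)) (v (- y)) \<le> v (x + y + - y)"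
    using assms nz by (intro v_add) auto
  ultimately show "v (x + y) = v x" using assms(3) by (simp add: min_def split: if_splits)
qed

text \<open>\<open>v 0\<close> carries no information, so each bound has to allow the sum to
  vanish.\<close>

lemma v_sum_greater:
  assumes "finite T" "\<And>r. r \<in> T \<Longrightarrow> x r = 0 \<or> c < v (x r)"
  shows "(\<Sum>r\<in>T. x r) = 0 \<or> c < v (\<Sum>r\<in>T. x r)"
  using assms
proof (induction T)
  case (insert s T)
  have IH: "(\<Sum>r\<in>T. x r) = 0 \<or> c < v (\<Sum>r\<in>T. x r)" using insert by blast
  have s: "x s = 0 \<or> c < v (x s)" using insert by blast
  show ?case
  proof (cases "x s = 0 \<or> (\<Sum>r\<in>T. x r) = 0 \<or> x s + (\<Sum>r\<in>T. x r) = 0")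
    case True
    then show ?thesis using IH s insert.hyps by auto
  next
    case False
    then have "min (v (x s)) (v (\<Sum>r\<in>T. x r)) \<le> v (x s + (\<Sum>r\<in>T. x r))" by (intro v_add) auto
    then show ?thesis using IH s insert.hyps False by (simp add: min_def split: if_splits)
  qed
qed simp

text \<open>A term of strictly smallest value would be minus a sum of terms of larger value.\<close>

lemma min_twice_if_sum_0:
  assumes "finite S" "S \<noteq> {}" "\<And>r. r \<in> S \<Longrightarrow> x r \<noteq> 0" "(\<Sum>r\<in>S. x r) = 0"
  shows "min_twice S (\<lambda>r. v (x r))"
proof (rule ccontr)
  assume no: "\<not> min_twice S (\<lambda>r. v (x r))"
  have "Min ((\<lambda>r. v (x r)) ` S) \<in> (\<lambda>r. v (x r)) ` S" using assms by (intro Min_in) auto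
  then obtain s where s: "s \<in> S" "v (x s) = Min ((\<lambda>r. v (x r)) ` S)" by auto
  have le: "v (x s) \<le> v (x q)" if "q \<in> S" for q
    unfolding s(2) using assms(1) that by (intro Min_le) auto
  have gt: "v (x s) < v (x q)" if "q \<in> S - {s}" for q
  proof (rule ccontr)
    assume "\<not> v (x s) < v (x q)"
    then have "v (x s) = v (x q)" using le[of q] that by auto
    then have "min_twice S (\<lambda>r. v (x r))"
      unfolding min_twice_def using s(1) that le by (intro bexI[of _ s] bexI[of _ q]) auto
    then show False using no by simp
  qed
  have "x s = - (\<Sum>r\<in>S - {s}. x r)"
    using assms(4) sum.remove[OF assms(1) s(1), of x] by (simp add: eq_neg_iff_add_eq_0)
  moreover have "(\<Sum>r\<in>S - {s}. x r) = 0 \<or> v (x s) < v (\<Sum>r\<in>S - {s}. x r)"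
    by (rule v_sum_greater) (use assms(1) gt in auto)
  ultimately have "x s = 0 \<or> v (x s) < v (x s)" by auto
  then show False using assms(3)[OF s(1)] by simp
qed

lemma v_of_nat_ge_0: "(of_nat m :: 'k) \<noteq> 0 \<Longrightarrow> 0 \<le> v (of_nat m)"
proof (induction m)
  case (Suc m)
  show ?case
  proof (cases "(of_nat m :: 'k) = 0")
    case False
    then have "min (v 1) (v (of_nat m)) \<le> v (1 + of_nat m)" using Suc by (intro v_add) auto
    then show ?thesis using Suc.IH[OF False] by simp
  qed simp
qed simp

text \<open>An inverse modulo \<open>p\<close> is again a natural number, and natural numbers have
  nonnegative values: two such values with sum zero vanish.\<close>

lemma v_of_nat:
  assumes "\<not> p dvd m"
  shows "(of_nat m :: 'k) \<noteq> 0" "v (of_nat m) = 0"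
proof -
  show nz: "(of_nat m :: 'k) \<noteq> 0" using assms by (simp add: of_nat_eq_0_iff_char_dvd char_p)
  have "coprime m p" using assms prime_p by (metis coprime_commute prime_imp_coprime)
  then obtain m' where "[m * m' = 1] (mod p)" using cong_solve_coprime_nat[of m p] by auto
  then have "(of_nat (m * m') :: 'k) = of_nat 1" by (simp only: of_nat_eq_iff_cong_CHAR char_p)
  then have one: "(of_nat m :: 'k) * of_nat m' = 1" by simp
  then have nz': "(of_nat m' :: 'k) \<noteq> 0" by auto
  have "v (of_nat m) + v (of_nat m') = 0" using v_mult[OF nz nz'] one by simp
  then show "v (of_nat m) = 0" using v_of_nat_ge_0[OF nz] v_of_nat_ge_0[OF nz'] by simp
qed

lemma of_nat_diff_eq_0_iff: "(of_nat r - of_nat c :: 'k) = 0 \<longleftrightarrow> r mod p = c mod p"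
  using of_nat_eq_iff_cong_CHAR[of r c, where 'a = 'k] by (simp add: char_p cong_def)

lemma v_of_nat_diff:
  assumes "r mod p \<noteq> c mod p" shows "v (of_nat r - of_nat c) = 0"
proof -
  have *: "v (of_nat r - of_nat c) = 0" if "c \<le> r" "r mod p \<noteq> c mod p" for r c
  proof -
    have "\<not> p dvd r - c" using that by (metis mod_eq_dvd_iff_nat)
    then show ?thesis using v_of_nat(2)[of "r - c"] that(1) by (simp add: of_nat_diff)
  qed
  show ?thesis
  proof (cases "c \<le> r")
    case True
    then show ?thesis using * assms by blast
  next
    case False
    then have "v (- (of_nat r - of_nat c)) = 0" using *[of r c] assms by simp
    then show ?thesis by (simp only: v_minus)
  qed
qed

text \<open>The factor \<open>x\<close> restores the exponents, so that the result can be combined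
  with \<open>F\<close> termwise.\<close>

lemma mult_poly_pderiv:
  fixes F :: "'k poly"
  assumes "degree F \<le> n"
  shows "x * poly (pderiv F) x = (\<Sum>r\<le>n. of_nat r * (coeff F r * x ^ r))"
proof -
  have "F = (\<Sum>r\<le>n. monom (coeff F r) r)" using poly_as_sum_of_monoms'[OF assms] by simp
  then have "poly (pderiv F) x = poly (pderiv (\<Sum>r\<le>n. monom (coeff F r) r)) x" by simp
  also have "\<dots> = (\<Sum>r\<le>n. of_nat r * coeff F r * x ^ (r - 1))"
  proof -
    have "pderiv (\<Sum>r\<in>A. g r) = (\<Sum>r\<in>A. pderiv (g r))" for A :: "nat set" and g :: "nat \<Rightarrow> 'k poly"
      by (induction A rule: infinite_finite_induct) (simp_all add: pderiv_add)
    then show ?thesis by (simp add: pderiv_monom poly_sum poly_monom)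
  qed
  finally have "x * poly (pderiv F) x = (\<Sum>r\<le>n. x * (of_nat r * coeff F r * x ^ (r - 1)))"
    by (simp add: sum_distrib_left)
  also have "\<dots> = (\<Sum>r\<le>n. of_nat r * (coeff F r * x ^ r))"
  proof (rule sum.cong[OF refl])
    fix r
    show "x * (of_nat r * coeff F r * x ^ (r - 1)) = of_nat r * (coeff F r * x ^ r)"
      by (cases r) (simp_all add: algebra_simps)
  qed
  finally show ?thesis .
qed

lemma order_ge_2_iff:
  fixes F :: "'k poly"
  assumes "F \<noteq> 0"
  shows "2 \<le> order B F \<longleftrightarrow> poly F B = 0 \<and> poly (pderiv F) B = 0"
proof
  assume "2 \<le> order B F"
  then have "[:- B, 1:] ^ 2 dvd F" by (simp add: order_divides)
  then obtain G where "F = [:- B, 1:] ^ 2 * G" by (rule dvdE)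
  then have "F = [:- B, 1:] * ([:- B, 1:] * G)" by (simp only: power2_eq_square mult.assoc)
  moreover have "poly [:- B, 1:] B = 0" by simp
  ultimately show "poly F B = 0 \<and> poly (pderiv F) B = 0"
    by (simp only: pderiv_mult poly_add poly_mult) simp
next
  assume h: "poly F B = 0 \<and> poly (pderiv F) B = 0"
  then obtain G where G: "F = [:- B, 1:] * G" by (metis poly_eq_0_iff_dvd dvdE)
  have "poly [:- B, 1:] B = 0" "poly (pderiv [:- B, 1:]) B = 1" by (simp_all add: pderiv_pCons)
  then have "poly (pderiv F) B = poly G B" unfolding G pderiv_mult poly_add poly_mult by simp
  then obtain G' where "G = [:- B, 1:] * G'" using h by (metis poly_eq_0_iff_dvd dvdE)
  then have "F = [:- B, 1:] ^ 2 * G'" using G by (simp only: power2_eq_square mult.assoc)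
  then have "[:- B, 1:] ^ 2 dvd F" by (rule dvdI)
  then show "2 \<le> order B F" using assms by (simp add: order_divides)
qed

lemma double_root_is_root:
  assumes "has_trop_double_root v n f a"
  shows "is_root p n f a"
proof -
  obtain F B where F: "degree F = n" "\<And>r. r \<le> n \<Longrightarrow> coeff F r \<noteq> 0 \<and> v (coeff F r) = cf f r"
    and B: "B \<noteq> 0" "v B = a" "order B F \<ge> 2"
    using assms unfolding has_trop_double_root_def by blast
  have F0: "F \<noteq> 0" using F(2)[of 0] by auto
  have n2: "2 \<le> n" using order_degree[OF F0, of B] B F by simp
  define T where "T r = coeff F r * B ^ r" for r
  have T0: "T r \<noteq> 0" "v (T r) = ht f a r" if "r \<le> n" for r
    using F(2)[OF that] B by (auto simp: T_def v_mult v_power ht_def)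
  have roots: "poly F B = 0" "poly (pderiv F) B = 0" using B(3) order_ge_2_iff[OF F0] by auto
  have s1: "(\<Sum>r\<le>n. T r) = 0" using roots(1) F(1) by (simp add: poly_altdef T_def)
  have s2: "(\<Sum>r\<le>n. of_nat r * T r) = 0"
    using mult_poly_pderiv[of F n B] roots(2) F(1) by (simp add: T_def)
  show ?thesis
    unfolding root_heights_def
  proof
    fix c
    show "min_twice (off_class p n c) (ht f a)"
    proof (cases "c < p")
      case True
      \<comment> \<open>A double root needs degree at least 2, so 0 and 1 are exponents; being
        incongruent, they do not both lie in one class.\<close>
      have "1 mod p = 1" "0 mod p = 0" using p_gt_2 by auto
      then have ne: "off_class p n c \<noteq> {}" using n2 by (cases "c = 0") (auto simp: off_class_def intro: exI[of _ 1] exI[of _ 0])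
      define x where "x r = (of_nat r - of_nat c) * T r" for r
      have cd: "(of_nat r - of_nat c :: 'k) = 0 \<longleftrightarrow> r mod p = c" for r
        using of_nat_diff_eq_0_iff[of r c] True by simp
      have x: "x r \<noteq> 0" "v (x r) = ht f a r" if "r \<in> off_class p n c" for r
      proof -
        have r: "r \<le> n" "r mod p \<noteq> c" using that by (auto simp: off_class_def)
        then have "(of_nat r - of_nat c :: 'k) \<noteq> 0" "v (of_nat r - of_nat c) = 0"
          using cd v_of_nat_diff[of r c] True by auto
        then show "x r \<noteq> 0" "v (x r) = ht f a r" using T0[OF r(1)] by (auto simp: x_def v_mult)
      qed
      have "(\<Sum>r\<in>off_class p n c. x r) = (\<Sum>r\<le>n. x r)"
        by (rule sum.mono_neutral_left) (use cd in \<open>auto simp: off_class_def x_def\<close>)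
      also have "\<dots> = (\<Sum>r\<le>n. of_nat r * T r) - of_nat c * (\<Sum>r\<le>n. T r)"
        by (simp add: x_def left_diff_distrib sum_subtractf sum_distrib_left)
      also have "\<dots> = 0" using s1 s2 by simp
      finally have "min_twice (off_class p n c) (\<lambda>r. v (x r))"
        using ne x(1) by (intro min_twice_if_sum_0 finite_off_class)
      then show ?thesis using min_twice_cong[of "off_class p n c" "\<lambda>r. v (x r)" "ht f a"] x(2) by simp
    next
      case False
      \<comment> \<open>No residue equals such a \<open>c\<close>; the condition is the one from
        \<open>F(B) = 0\<close> alone.\<close>
      have "r mod p \<noteq> c" for r using False mod_less_divisor[OF p_pos, of r] by linarith
      then have all: "off_class p n c = {..n}" by (auto simp: off_class_def)
      have "min_twice {..n} (\<lambda>r. v (T r))" using T0(1) s1 by (intro min_twice_if_sum_0) auto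
      then show ?thesis using min_twice_cong[of "{..n}" "\<lambda>r. v (T r)" "ht f a"] T0(2) by (simp add: all)
    qed
  qed
qed

subsection \<open>Generic lifts\<close>

text \<open>Three units with unit differences. Such a triple avoids two residue classes at once; the third
  unit is needed because the prime field may have only two units.\<close>

lemma three_units:
  obtains u1 u2 u3 :: 'k where "u1 \<noteq> 0" "u2 \<noteq> 0" "u3 \<noteq> 0" "v u1 = 0" "v u2 = 0" "v u3 = 0"
    "u1 \<noteq> u2" "u1 \<noteq> u3" "u2 \<noteq> u3" "v (u1 - u2) = 0" "v (u1 - u3) = 0" "v (u2 - u3) = 0"
proof -
  \<comment> \<open>A root of \<open>X^3 - X - 1\<close>, so
    \<open>\<theta> * (\<theta> - 1) * (\<theta> + 1) = 1\<close> forces all three factors to have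
    value 0. They are, up to sign, \<open>\<theta>\<close> and its differences from \<open>1\<close>
    and \<open>- 1\<close>, the other two units, whose own difference is \<open>2\<close>.\<close>
  obtain \<theta> :: 'k where "poly [:- 1, - 1, 0, 1:] \<theta> = 0"
    using alg_closed_imp_poly_has_root[of "[:- 1, - 1, 0, 1 :: 'k:]"] by auto
  then have e: "\<theta> * ((\<theta> - 1) * (\<theta> + 1)) = 1" by (simp add: algebra_simps)
  then have nz: "\<theta> \<noteq> 0" "\<theta> - 1 \<noteq> 0" "\<theta> + 1 \<noteq> 0" by auto
  have s: "v \<theta> + (v (\<theta> - 1) + v (\<theta> + 1)) = 0"
    using v_mult[of \<theta> "(\<theta> - 1) * (\<theta> + 1)"] v_mult[of "\<theta> - 1" "\<theta> + 1"] nz e by simp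
  have th: "0 \<le> v \<theta>"
  proof (rule ccontr)
    assume "\<not> 0 \<le> v \<theta>"
    then have "v (\<theta> + 1) = v \<theta>" "v (\<theta> + - 1) = v \<theta>"
      using v_add_less[of \<theta> 1] v_add_less[of \<theta> "-1"] nz by auto
    then show False using s \<open>\<not> 0 \<le> v \<theta>\<close> by simp
  qed
  have "0 \<le> v (\<theta> + 1)" "0 \<le> v (\<theta> - 1)"
    using v_add[of \<theta> 1] v_add[of \<theta> "-1"] nz th by auto
  then have vs: "v \<theta> = 0" "v (\<theta> + 1) = 0" "v (\<theta> - 1) = 0" using s th by auto
  have "\<not> p dvd 2" using p_gt_2 by (auto dest: dvd_imp_le)
  then have two: "(2 :: 'k) \<noteq> 0" "v 2 = 0" using v_of_nat[of 2] by simp_all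
  have "v (1 - \<theta>) = v (\<theta> - 1)" "v (- 1 - \<theta>) = v (\<theta> + 1)"
    using v_minus[of "\<theta> - 1"] v_minus[of "\<theta> + 1"] by (simp_all add: algebra_simps)
  moreover have "(1 :: 'k) \<noteq> - 1" using two(1) by (metis add_neg_numeral_special(8) eq_neg_iff_add_eq_0 one_add_one)
  moreover have "\<theta> \<noteq> - 1" using nz(3) by (simp only: eq_neg_iff_add_eq_0 not_False_eq_True)
  moreover from this have "- 1 \<noteq> \<theta>" by (rule not_sym)
  ultimately show thesis
    using nz vs two that[of 1 "-1" \<theta>] \<open>\<theta> \<noteq> - 1\<close> \<open>- 1 \<noteq> \<theta>\<close> by auto
qed

text \<open>For each index at most one of the three units is bad: two bad ones would give
  \<open>w i * (u - u')\<close>, whose value is \<open>c\<close>, a value larger than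
  \<open>c\<close>. Two indices spoil at most two units.\<close>

lemma generic_unit:
  assumes "\<And>i. i \<in> {1, 2::nat} \<Longrightarrow> w i \<noteq> 0" "\<And>i. i \<in> {1, 2} \<Longrightarrow> v (w i) = c"
    "\<And>i. i \<in> {1, 2} \<Longrightarrow> s i = 0 \<or> c \<le> v (s i)"
  obtains u where "u \<noteq> 0" "v u = 0" "\<And>i. i \<in> {1, 2} \<Longrightarrow> s i + w i * u \<noteq> 0 \<and> v (s i + w i * u) = c"
proof -
  have one: False
    if i: "i \<in> {1, 2}" and u: "u \<noteq> 0" "v u = 0" "u' \<noteq> 0" "v u' = 0" "u \<noteq> u'" "v (u - u') = 0"
      and bad: "\<not> (s i + w i * u \<noteq> 0 \<and> v (s i + w i * u) = c)" "\<not> (s i + w i * u' \<noteq> 0 \<and> v (s i + w i * u') = c)"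
    for i u u'
  proof -
    have gt: "s i + w i * u = 0 \<or> c < v (s i + w i * u)"
      if "u \<noteq> 0" "v u = 0" "\<not> (s i + w i * u \<noteq> 0 \<and> v (s i + w i * u) = c)" for u
    proof (rule disjCI)
      assume "\<not> c < v (s i + w i * u)"
      then have lt: "s i + w i * u = 0 \<or> v (s i + w i * u) < c" using that by fastforce
      have wu: "w i * u \<noteq> 0" "v (w i * u) = c" using that assms(1,2)[OF i] by (auto simp: v_mult)
      show "s i + w i * u = 0"
      proof (rule ccontr)
        assume nz: "s i + w i * u \<noteq> 0"
        then have "s i \<noteq> 0" using lt wu by auto
        then show False using v_add[OF _ wu(1) nz] assms(3)[OF i] wu lt nz by auto
      qed
    qed
    have d: "(s i + w i * u) + - (s i + w i * u') = w i * (u - u')" by (simp add: algebra_simps)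
    have nz: "w i * (u - u') \<noteq> 0" "v (w i * (u - u')) = c"
      using assms(1,2)[OF i] u by (auto simp: v_mult)
    have "c < v (w i * (u - u'))"
    proof (cases "s i + w i * u = 0 \<or> s i + w i * u' = 0")
      case True
      then show ?thesis using gt[OF u(1,2) bad(1)] gt[OF u(3,4) bad(2)] nz(1) d v_minus by (metis add.right_neutral add_0 neg_equal_0_iff_equal)
    next
      case False
      then have "s i + w i * u \<noteq> 0" "- (s i + w i * u') \<noteq> 0" unfolding neg_equal_0_iff_equal by blast+
      then have "min (v (s i + w i * u)) (v (- (s i + w i * u'))) \<le> v (w i * (u - u'))"
        using v_add[of "s i + w i * u" "- (s i + w i * u')"] nz(1) by (simp only: d simp_thms)
      then show ?thesis using gt[OF u(1,2) bad(1)] gt[OF u(3,4) bad(2)] False by (simp only: v_minus) linarith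
    qed
    then show False using nz(2) by simp
  qed
  obtain u1 u2 u3 where u: "u1 \<noteq> 0" "u2 \<noteq> 0" "u3 \<noteq> 0" "v u1 = 0" "v u2 = 0" "v u3 = 0"
    "u1 \<noteq> u2" "u1 \<noteq> u3" "u2 \<noteq> u3" "v (u1 - u2) = 0" "v (u1 - u3) = 0" "v (u2 - u3) = 0"
    using three_units .
  define good where "good u i \<longleftrightarrow> s i + w i * u \<noteq> 0 \<and> v (s i + w i * u) = c" for u i
  have "good u1 i \<or> good u2 i" "good u1 i \<or> good u3 i" "good u2 i \<or> good u3 i" if "i \<in> {1, 2}" for i
    using one[OF that, of u1 u2] one[OF that, of u1 u3] one[OF that, of u2 u3] u unfolding good_def by blast+
  then have "\<exists>u\<in>{u1, u2, u3}. good u 1 \<and> good u 2" by blast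
  then obtain u' where u': "u' \<in> {u1, u2, u3}" "good u' 1" "good u' 2" by blast
  show thesis
    by (rule that[of u']) (use u' u in \<open>auto simp: good_def\<close>)
qed

text \<open>Coefficients are chosen one at a time, and a unit factor on the new one prevents
  cancellation in both linear forms at once. The sums thus have exactly the values predicted by the
  heights.\<close>

lemma generic_lift:
  assumes "finite S" "\<And>r. r \<in> S \<Longrightarrow> h r \<in> value_group v"
    "\<And>i r. i \<in> {1, 2::nat} \<Longrightarrow> r \<in> S \<Longrightarrow> w i r = 0 \<or> v (w i r) = 0"
  shows "\<exists>A. (\<forall>r\<in>S. A r \<noteq> 0 \<and> v (A r) = h r) \<and>
    (\<forall>i\<in>{1, 2}. (\<forall>r\<in>S. w i r = 0) \<or> (\<Sum>r\<in>S. w i r * A r) \<noteq> 0 \<and>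
       (\<exists>r\<in>S. w i r \<noteq> 0 \<and> v (\<Sum>r\<in>S. w i r * A r) = h r \<and> (\<forall>q\<in>S. w i q \<noteq> 0 \<longrightarrow> h r \<le> h q)))"
  using assms
proof (induction S)
  case (insert s S)
  obtain A where A: "\<And>r. r \<in> S \<Longrightarrow> A r \<noteq> 0 \<and> v (A r) = h r"
    and Ai: "\<And>i. i \<in> {1, 2} \<Longrightarrow> (\<forall>r\<in>S. w i r = 0) \<or> (\<Sum>r\<in>S. w i r * A r) \<noteq> 0 \<and>
       (\<exists>r\<in>S. w i r \<noteq> 0 \<and> v (\<Sum>r\<in>S. w i r * A r) = h r \<and> (\<forall>q\<in>S. w i q \<noteq> 0 \<longrightarrow> h r \<le> h q))"
  proof -
    have "\<exists>A. (\<forall>r\<in>S. A r \<noteq> 0 \<and> v (A r) = h r) \<and>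
      (\<forall>i\<in>{1, 2}. (\<forall>r\<in>S. w i r = 0) \<or> (\<Sum>r\<in>S. w i r * A r) \<noteq> 0 \<and>
       (\<exists>r\<in>S. w i r \<noteq> 0 \<and> v (\<Sum>r\<in>S. w i r * A r) = h r \<and> (\<forall>q\<in>S. w i q \<noteq> 0 \<longrightarrow> h r \<le> h q)))"
      by (rule insert.IH) (use insert.prems in simp_all)
    then obtain A where "\<forall>r\<in>S. A r \<noteq> 0 \<and> v (A r) = h r"
      "\<forall>i\<in>{1, 2}. (\<forall>r\<in>S. w i r = 0) \<or> (\<Sum>r\<in>S. w i r * A r) \<noteq> 0 \<and>
       (\<exists>r\<in>S. w i r \<noteq> 0 \<and> v (\<Sum>r\<in>S. w i r * A r) = h r \<and> (\<forall>q\<in>S. w i q \<noteq> 0 \<longrightarrow> h r \<le> h q))"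
      by (elim exE conjE)
    note AA = this
    show thesis by (rule that[of A, OF bspec[OF AA(1)] bspec[OF AA(2)]])
  qed
  have "h s \<in> v ` (UNIV - {0})" using insert.prems(1)[of s] by (simp add: value_group_def)
  then obtain x where x: "v x = h s" "x \<noteq> 0" by (elim imageE) simp
  define \<sigma> where "\<sigma> i = (\<Sum>r\<in>S. w i r * A r)" for i
  \<comment> \<open>Only when both terms have the same value can cancellation occur.\<close>
  define crit where "crit i \<longleftrightarrow> w i s \<noteq> 0 \<and> \<sigma> i \<noteq> 0 \<and> v (\<sigma> i) = h s" for i
  obtain u where u: "u \<noteq> 0" "v u = 0" and gu: "\<And>i. i \<in> {1, 2} \<Longrightarrow>
    (if crit i then \<sigma> i else 0) + (if crit i then w i s * x else x) * u \<noteq> 0 \<and>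
    v ((if crit i then \<sigma> i else 0) + (if crit i then w i s * x else x) * u) = h s"
  \<comment> \<open>For an index where no cancellation threatens, the harmless data \<open>0\<close>
    and \<open>x\<close> are supplied, so that both indices are treated alike.\<close>
  proof (rule generic_unit[of "\<lambda>i. if crit i then w i s * x else x" "h s" "\<lambda>i. if crit i then \<sigma> i else 0"])
    fix i :: nat assume i: "i \<in> {1, 2}"
    show "(if crit i then w i s * x else x) \<noteq> 0" using x by (simp add: crit_def)
    show "v (if crit i then w i s * x else x) = h s"
      using x insert.prems(2)[OF i, of s] by (auto simp: crit_def v_mult)
    show "(if crit i then \<sigma> i else 0) = 0 \<or> h s \<le> v (if crit i then \<sigma> i else 0)"
      by (simp add: crit_def)
  qed blast
  define A' where "A' = A(s := x * u)"
  have sums: "(\<Sum>r\<in>insert s S. w i r * A' r) = \<sigma> i + w i s * x * u" for i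
  proof -
    have "(\<Sum>r\<in>S. w i r * A' r) = \<sigma> i"
      unfolding \<sigma>_def by (rule sum.cong) (use insert.hyps in \<open>auto simp: A'_def\<close>)
    then show ?thesis using insert.hyps by (simp add: A'_def algebra_simps)
  qed
  have "(\<forall>r\<in>insert s S. w i r = 0) \<or> \<sigma> i + w i s * x * u \<noteq> 0 \<and>
       (\<exists>r\<in>insert s S. w i r \<noteq> 0 \<and> v (\<sigma> i + w i s * x * u) = h r \<and> (\<forall>q\<in>insert s S. w i q \<noteq> 0 \<longrightarrow> h r \<le> h q))"
    if i: "i \<in> {1, 2}" for i
  proof (cases "w i s = 0")
    case True
    then show ?thesis using Ai[OF i] by (simp add: \<sigma>_def)
  next
    case False
    have wxu: "w i s * x * u \<noteq> 0" "v (w i s * x * u) = h s"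
      using False x u insert.prems(2)[OF i, of s] by (auto simp: v_mult)
    show ?thesis
    proof (cases "\<forall>r\<in>S. w i r = 0")
      case True
      then have "\<sigma> i = 0" by (simp add: \<sigma>_def)
      then show ?thesis using True False wxu by auto
    next
      case nz: False
      then obtain r where r: "r \<in> S" "w i r \<noteq> 0" "v (\<sigma> i) = h r" "\<And>q. q \<in> S \<Longrightarrow> w i q \<noteq> 0 \<Longrightarrow> h r \<le> h q"
        and \<sigma>0: "\<sigma> i \<noteq> 0" using Ai[OF i] by (auto simp: \<sigma>_def)
      consider "h r < h s" | "h s < h r" | "h r = h s" by linarith
      then show ?thesis
      proof cases
        case 1
        then have "\<sigma> i + w i s * x * u \<noteq> 0 \<and> v (\<sigma> i + w i s * x * u) = h r"
          using v_add_less[OF \<sigma>0 wxu(1)] wxu(2) r(3) by simp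
        then show ?thesis using r(1,2,4) 1 by (intro disjI2 conjI bexI[of _ r]) auto
      next
        case 2
        then have "w i s * x * u + \<sigma> i \<noteq> 0 \<and> v (w i s * x * u + \<sigma> i) = h s"
          using v_add_less[OF wxu(1) \<sigma>0] wxu(2) r(3) by simp
        then have "\<sigma> i + w i s * x * u \<noteq> 0 \<and> v (\<sigma> i + w i s * x * u) = h s" by (simp add: add.commute)
        moreover have "\<forall>q\<in>insert s S. w i q \<noteq> 0 \<longrightarrow> h s \<le> h q" using 2 r(4) by fastforce
        ultimately show ?thesis using False by blast
      next
        case 3
        then have "crit i" using False \<sigma>0 r(3) by (simp add: crit_def)
        then have "\<sigma> i + w i s * x * u \<noteq> 0 \<and> v (\<sigma> i + w i s * x * u) = h s" using gu[OF i] by simp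
        moreover have "\<forall>q\<in>insert s S. w i q \<noteq> 0 \<longrightarrow> h s \<le> h q" using 3 r(4) by fastforce
        ultimately show ?thesis using False by blast
      qed
    qed
  qed
  moreover have "A' r \<noteq> 0 \<and> v (A' r) = h r" if "r \<in> insert s S" for r
    using that A x u by (auto simp: A'_def v_mult)
  ultimately show ?case unfolding sums[symmetric] by blast
qed simp

text \<open>The two equations are solved for the coefficients at a lowest exponent \<open>s\<close>
  and at \<open>t\<close>, lowest outside the class of \<open>s\<close>. The determinant
  \<open>s - t\<close> is a unit, so it remains to give the eliminated sums the values
  \<open>h s\<close> and \<open>h t\<close>; the second minimisers in the root condition provide
  them.\<close>

lemma lift_heights:
  assumes root: "root_heights p n h" and rat: "\<And>r. r \<le> n \<Longrightarrow> h r \<in> value_group v"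
  obtains A where "\<And>r. r \<le> n \<Longrightarrow> A r \<noteq> 0 \<and> v (A r) = h r"
    "(\<Sum>r\<le>n. A r) = 0" "(\<Sum>r\<le>n. of_nat r * A r) = 0"
proof -
  have "r mod p \<noteq> p" for r using mod_less_divisor[OF p_pos, of r] by linarith
  then have "off_class p n p = {..n}" by (auto simp: off_class_def)
  then have "min_twice {..n} h" using root by (metis root_heights_def)
  then obtain s where s: "s \<le> n" "\<And>q. q \<le> n \<Longrightarrow> h s \<le> h q" unfolding min_twice_def by auto
  have "min_twice (off_class p n (s mod p)) h" using root by (simp add: root_heights_def)
  then obtain t t' where t: "t \<in> off_class p n (s mod p)" "t' \<in> off_class p n (s mod p)" "t \<noteq> t'" "h t = h t'"
    "\<And>q. q \<in> off_class p n (s mod p) \<Longrightarrow> h t \<le> h q" unfolding min_twice_def by blast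
  have tn: "t \<le> n" "t' \<le> n" "t mod p \<noteq> s mod p" "t' mod p \<noteq> s mod p" using t by (auto simp: off_class_def)
  \<comment> \<open>Removing the class of \<open>t\<close> keeps \<open>s\<close>, so the minimum is
    still \<open>h s\<close> and is attained at a further exponent.\<close>
  have "min_twice (off_class p n (t mod p)) h" using root by (simp add: root_heights_def)
  then obtain r0 r1 where r01: "r0 \<in> off_class p n (t mod p)" "r1 \<in> off_class p n (t mod p)" "r0 \<noteq> r1" "h r0 = h r1"
    "\<And>q. q \<in> off_class p n (t mod p) \<Longrightarrow> h r0 \<le> h q" unfolding min_twice_def by blast
  have "s \<in> off_class p n (t mod p)" using s tn by (auto simp: off_class_def)
  then have "h r0 \<le> h s" by (rule r01(5))
  moreover have "h s \<le> h r0" using r01(1) s(2) by (simp add: off_class_def)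
  ultimately have "h r0 = h s" "h r1 = h s" using r01(4) by auto
  then obtain r where r: "r \<noteq> s" "r \<in> off_class p n (t mod p)" "h r = h s" using r01 by metis
  have rn: "r \<le> n" "r mod p \<noteq> t mod p" "r \<noteq> t" using r by (auto simp: off_class_def)
  define S where "S = {..n} - {s, t}"
  \<comment> \<open>Subtracting \<open>t\<close> times, or \<open>s\<close> times, the plain sum
    from the weighted sum eliminates the unknown at \<open>t\<close>, or at
    \<open>s\<close>.\<close>
  define w :: "nat \<Rightarrow> nat \<Rightarrow> 'k" where "w i x = (if i = 1 then of_nat x - of_nat t else of_nat x - of_nat s)" for i x
  have w0: "w 1 x = 0 \<longleftrightarrow> x mod p = t mod p" "w 2 x = 0 \<longleftrightarrow> x mod p = s mod p" for x
    using of_nat_diff_eq_0_iff by (simp_all add: w_def)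
  have "w i x = 0 \<or> v (w i x) = 0" for i x
    using v_of_nat_diff[of x t] v_of_nat_diff[of x s] of_nat_diff_eq_0_iff[of x t] of_nat_diff_eq_0_iff[of x s]
    by (auto simp: w_def)
  then have "\<exists>A. (\<forall>r\<in>S. A r \<noteq> 0 \<and> v (A r) = h r) \<and>
    (\<forall>i\<in>{1, 2}. (\<forall>r\<in>S. w i r = 0) \<or> (\<Sum>r\<in>S. w i r * A r) \<noteq> 0 \<and>
       (\<exists>r\<in>S. w i r \<noteq> 0 \<and> v (\<Sum>r\<in>S. w i r * A r) = h r \<and> (\<forall>q\<in>S. w i q \<noteq> 0 \<longrightarrow> h r \<le> h q)))"
    by (intro generic_lift) (auto simp: S_def rat)
  then obtain A where A: "\<forall>r\<in>S. A r \<noteq> 0 \<and> v (A r) = h r"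
    and Ai: "\<forall>i\<in>{1, 2}. (\<forall>r\<in>S. w i r = 0) \<or> (\<Sum>r\<in>S. w i r * A r) \<noteq> 0 \<and>
       (\<exists>r\<in>S. w i r \<noteq> 0 \<and> v (\<Sum>r\<in>S. w i r * A r) = h r \<and> (\<forall>q\<in>S. w i q \<noteq> 0 \<longrightarrow> h r \<le> h q))"
    by (elim exE conjE)
  define \<sigma> where "\<sigma> i = (\<Sum>r\<in>S. w i r * A r)" for i
  have rS: "r \<in> S" "w 1 r \<noteq> 0" using rn r unfolding S_def w0 by auto
  have tS: "t' \<in> S" "w 2 t' \<noteq> 0" using t tn unfolding S_def w0 by auto
  have A1: "(\<forall>r\<in>S. w 1 r = 0) \<or> \<sigma> 1 \<noteq> 0 \<and>
       (\<exists>r\<in>S. w 1 r \<noteq> 0 \<and> v (\<sigma> 1) = h r \<and> (\<forall>q\<in>S. w 1 q \<noteq> 0 \<longrightarrow> h r \<le> h q))"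
    using Ai unfolding \<sigma>_def by simp
  have A2: "(\<forall>r\<in>S. w 2 r = 0) \<or> \<sigma> 2 \<noteq> 0 \<and>
       (\<exists>r\<in>S. w 2 r \<noteq> 0 \<and> v (\<sigma> 2) = h r \<and> (\<forall>q\<in>S. w 2 q \<noteq> 0 \<longrightarrow> h r \<le> h q))"
    using Ai unfolding \<sigma>_def by simp
  obtain x where x: "\<sigma> 1 \<noteq> 0" "x \<in> S" "v (\<sigma> 1) = h x" "h x \<le> h r" using A1 rS by blast
  have \<sigma>1: "v (\<sigma> 1) = h s" using x s(2)[of x] r(3) by (auto simp: S_def)
  obtain y where y: "\<sigma> 2 \<noteq> 0" "y \<in> S" "w 2 y \<noteq> 0" "v (\<sigma> 2) = h y" "h y \<le> h t'" using A2 tS by blast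
  have "y \<in> off_class p n (s mod p)" using y by (auto simp: S_def w0 off_class_def)
  then have \<sigma>2: "v (\<sigma> 2) = h t" using y t(4,5) by fastforce
  define d :: 'k where "d = of_nat s - of_nat t"
  have d: "d \<noteq> 0" "v d = 0" using of_nat_diff_eq_0_iff[of s t] v_of_nat_diff[of s t] tn by (auto simp: d_def)
  \<comment> \<open>Solves the eliminated equations \<open>\<sigma> 1 + d * A' s = 0\<close> and
    \<open>\<sigma> 2 - d * A' t = 0\<close>.\<close>
  define A' where "A' x = (if x = s then - \<sigma> 1 / d else if x = t then \<sigma> 2 / d else A x)" for x
  have st: "s \<noteq> t" using tn by auto
  have split: "(\<Sum>x\<le>n. c x * A' x) = (\<Sum>x\<in>S. c x * A x) + c s * (- \<sigma> 1 / d) + c t * (\<sigma> 2 / d)" for c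
  proof -
    have "(\<Sum>x\<le>n. c x * A' x) = c s * A' s + (c t * A' t + (\<Sum>x\<in>{..n} - {s} - {t}. c x * A' x))"
      using s tn st by (subst sum.remove[of _ s], simp, simp, subst sum.remove[of _ t]) auto
    also have "{..n} - {s} - {t} = S" by (auto simp: S_def)
    also have "(\<Sum>x\<in>S. c x * A' x) = (\<Sum>x\<in>S. c x * A x)" by (rule sum.cong) (auto simp: S_def A'_def)
    finally show ?thesis using st by (simp add: A'_def algebra_simps)
  qed
  have s1: "\<sigma> 1 = (\<Sum>x\<in>S. of_nat x * A x) - of_nat t * (\<Sum>x\<in>S. A x)"
    by (simp add: \<sigma>_def w_def left_diff_distrib sum_subtractf sum_distrib_left)
  have s2: "\<sigma> 2 = (\<Sum>x\<in>S. of_nat x * A x) - of_nat s * (\<Sum>x\<in>S. A x)"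
    by (simp add: \<sigma>_def w_def left_diff_distrib sum_subtractf sum_distrib_left)
  show thesis
  proof (rule that[of A'])
    show "A' x \<noteq> 0 \<and> v (A' x) = h x" if xn: "x \<le> n" for x
    proof (cases "x \<in> S")
      case True
      then show ?thesis using A by (auto simp: A'_def S_def)
    next
      case False
      then consider "x = s" | "x = t" "x \<noteq> s" using xn by (auto simp: S_def)
      then show ?thesis
        by cases (use x(1) y(1) d \<sigma>1 \<sigma>2 in \<open>simp_all add: A'_def v_divide del: minus_divide_left\<close>)
    qed
    have "d * (\<Sum>x\<le>n. 1 * A' x) = d * (\<Sum>x\<in>S. A x) - \<sigma> 1 + \<sigma> 2"
      unfolding split using d by (simp add: algebra_simps)
    also have "\<dots> = 0" unfolding s1 s2 d_def by (simp add: algebra_simps)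
    finally show "(\<Sum>x\<le>n. A' x) = 0" using d by simp
    have "d * (\<Sum>x\<le>n. of_nat x * A' x) = d * (\<Sum>x\<in>S. of_nat x * A x) - of_nat s * \<sigma> 1 + of_nat t * \<sigma> 2"
      unfolding split using d by (simp add: algebra_simps)
    also have "\<dots> = 0" unfolding s1 s2 d_def by (simp add: algebra_simps)
    finally show "(\<Sum>x\<le>n. of_nat x * A' x) = 0" using d by simp
  qed
qed

lemma lift_double_root:
  assumes f: "f \<in> trop_polys n" and root: "is_root p n f a"
    and rat: "a \<in> value_group v" "\<And>r. r \<le> n \<Longrightarrow> ht f a r \<in> value_group v"
  shows "has_trop_double_root v n f a"
proof -
  obtain A where A: "\<And>r. r \<le> n \<Longrightarrow> A r \<noteq> 0 \<and> v (A r) = ht f a r"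
    "(\<Sum>r\<le>n. A r) = 0" "(\<Sum>r\<le>n. of_nat r * A r) = 0"
    using lift_heights[OF root rat(2)] by metis
  obtain B where B: "B \<noteq> 0" "v B = a" using rat(1) by (auto simp: value_group_def)
  define F where "F = (\<Sum>r\<le>n. monom (A r / B ^ r) r)"
  have coeff: "coeff F r = A r / B ^ r" if "r \<le> n" for r
    using that by (simp add: F_def coeff_sum)
  have "degree F \<le> n" unfolding F_def by (intro degree_sum_le) (auto intro: order_trans[OF degree_monom_le])
  moreover have "coeff F n \<noteq> 0" using coeff[of n] A(1)[of n] B by simp
  ultimately have deg: "degree F = n" by (intro antisym le_degree)
  have F0: "F \<noteq> 0" using \<open>coeff F n \<noteq> 0\<close> by auto
  have T: "coeff F r * B ^ r = A r" if "r \<le> n" for r using coeff[OF that] B by simp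
  have "poly F B = (\<Sum>r\<le>n. A r)" unfolding poly_altdef deg using T by (intro sum.cong) auto
  moreover have "B * poly (pderiv F) B = (\<Sum>r\<le>n. of_nat r * A r)"
    unfolding mult_poly_pderiv[OF eq_refl[OF deg]] using T by (intro sum.cong) auto
  ultimately have "2 \<le> order B F" unfolding order_ge_2_iff[OF F0] using A B by simp
  moreover have "coeff F r \<noteq> 0 \<and> v (coeff F r) = cf f r" if "r \<le> n" for r
    using coeff[OF that] A(1)[OF that] B by (simp add: v_divide v_power ht_def)
  ultimately show ?thesis unfolding has_trop_double_root_def using deg B by blast
qed

text \<open>Rounding acts on the heights and on the root, and the coefficients are recomputed from
  them; rounding the coefficients themselves could destroy ties. All heights become rational, hence
  values of the field.\<close>

lemma rational_approximation:
  assumes f: "f \<in> trop_polys n" and root: "is_root p n f a" and U: "open U" "f \<in> U"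
  obtains g b where "g \<in> trop_polys n" "g \<in> U" "has_trop_double_root v n g b" "a = 0 \<longrightarrow> b = 0"
proof -
  obtain e where e: "e > 0" "trop_polys n \<inter> coord_box n f e \<subseteq> U" using coord_box_basis[OF U f] .
  \<comment> \<open>Rounding errs by at most \<open>1 / m\<close>, so a coefficient moves by at most
    \<open>(n + 1) / m\<close>.\<close>
  obtain m :: nat where m: "(real n + 1) / e < real m" using reals_Archimedean2 by blast
  have "0 < (real n + 1) / e" using e(1) by simp
  then have m0: "real m > 0" using m by linarith
  \<comment> \<open>Rounding is monotone, so it keeps all ties and inequalities between the heights.\<close>
  define \<phi> where "\<phi> x = real_of_int \<lfloor>x * real m\<rfloor> / real m" for x :: real
  have mono: "\<phi> x \<le> \<phi> y" if "x \<le> y" for x y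
    using that m0 by (auto simp: \<phi>_def intro!: divide_right_mono floor_mono mult_right_mono)
  have near: "\<bar>\<phi> x - x\<bar> \<le> 1 / real m" for x
  proof -
    have "\<bar>real_of_int \<lfloor>x * real m\<rfloor> - x * real m\<bar> \<le> 1" by linarith
    then have "\<bar>real_of_int \<lfloor>x * real m\<rfloor> - x * real m\<bar> / real m \<le> 1 / real m" using m0 by (intro divide_right_mono) auto
    also have "\<bar>real_of_int \<lfloor>x * real m\<rfloor> - x * real m\<bar> / real m = \<bar>\<phi> x - x\<bar>"
      using m0 by (simp add: \<phi>_def diff_divide_distrib abs_divide[symmetric] del: abs_divide) (simp add: field_simps)
    finally show ?thesis .
  qed
  have rat: "\<phi> x \<in> value_group v" for x using rat_values by (auto simp: \<phi>_def)
  define g where "g = of_coords n (\<lambda>r. \<phi> (ht f a r) - real r * \<phi> a)"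
  have htg: "ht g (\<phi> a) r = \<phi> (ht f a r)" if "r \<le> n" for r using that by (simp add: g_def ht_def)
  have "root_heights p n (\<lambda>r. \<phi> (ht f a r))"
    unfolding root_heights_def
  proof
    fix c
    obtain r s where rs: "r \<in> off_class p n c" "s \<in> off_class p n c" "r \<noteq> s" "ht f a r = ht f a s"
      "\<forall>q\<in>off_class p n c. ht f a r \<le> ht f a q"
      using root unfolding root_heights_def min_twice_def by blast
    then show "min_twice (off_class p n c) (\<lambda>r. \<phi> (ht f a r))"
      unfolding min_twice_def by (intro bexI[of _ r] bexI[of _ s]) (auto intro: mono)
  qed
  then have "is_root p n g (\<phi> a)" using root_heights_cong[of n "ht g (\<phi> a)" "\<lambda>r. \<phi> (ht f a r)" p] htg by simp
  then have "has_trop_double_root v n g (\<phi> a)"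
    by (rule lift_double_root[rotated]) (simp_all only: htg rat, simp add: g_def)
  moreover have "g \<in> coord_box n f e"
  proof (rule coord_boxI)
    fix r assume r: "r \<le> n"
    have "cf g r - cf f r = (\<phi> (ht f a r) - ht f a r) - real r * (\<phi> a - a)"
      using r by (simp add: g_def ht_def algebra_simps)
    then have "\<bar>cf g r - cf f r\<bar> \<le> \<bar>\<phi> (ht f a r) - ht f a r\<bar> + \<bar>real r * (\<phi> a - a)\<bar>"
      using abs_triangle_ineq4 by simp
    also have "\<dots> \<le> 1 / real m + real n * (1 / real m)"
      unfolding abs_mult using near r by (intro add_mono mult_mono) auto
    also have "\<dots> = (real n + 1) / real m" by (simp add: add_divide_distrib)
    also have "\<dots> < e" using m m0 e(1) by (simp add: field_simps)
    finally show "\<bar>cf g r - cf f r\<bar> < e" .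
  qed
  moreover have "g \<in> trop_polys n" by (simp add: g_def)
  \<comment> \<open>Rounding fixes \<open>0\<close>, so the same approximation serves
    \<open>trop_H\<close>.\<close>
  moreover have "a = 0 \<longrightarrow> \<phi> a = 0" by (simp add: \<phi>_def)
  ultimately show thesis using that e(2) by blast
qed

text \<open>Instead of all real roots only finitely many slopes have to be tested, each continuous
  in the polynomial; this leaves a finite union of closed sets.\<close>

lemma closed_disc_set: "closed (disc_set p n)"
proof -
  have "disc_set p n = trop_polys n \<inter> (\<Union>r\<in>{..n}. \<Union>s\<in>{..n}. {g. root_heights p n (ht g (slope r s g))})"
  proof (intro equalityI subsetI)
    fix g assume "g \<in> disc_set p n"
    then obtain a where g: "g \<in> trop_polys n" "is_root p n g a" by (auto simp: disc_set_def)
    obtain r s where "r \<le> n" "s \<le> n" "a = slope r s g" using root_is_slope[OF g(2) p_pos] .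
    then show "g \<in> trop_polys n \<inter> (\<Union>r\<in>{..n}. \<Union>s\<in>{..n}. {g. root_heights p n (ht g (slope r s g))})"
      using g by auto
  qed (auto simp: disc_set_def)
  moreover have "closed (trop_polys n \<inter> (\<Union>r\<in>{..n}. \<Union>s\<in>{..n}. {g. root_heights p n (ht g (slope r s g))}))"
    by (intro closed_Int closed_trop_polys closed_UN ballI closed_root_heights continuous_intros) auto
  ultimately show ?thesis by simp
qed

lemma trop_discriminant_eq: "trop_discriminant v n = disc_set p n"
proof
  show "trop_discriminant v n \<subseteq> disc_set p n"
    unfolding trop_discriminant_def
    by (rule closure_minimal[OF _ closed_disc_set]) (auto simp: disc_set_def intro: double_root_is_root)
  show "disc_set p n \<subseteq> trop_discriminant v n"
    unfolding trop_discriminant_def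
  proof (rule subsetI, unfold closure_iff_nhds_not_empty, intro allI impI)
    fix f A U assume "f \<in> disc_set p n" and A: "U \<subseteq> A" "open U" "f \<in> U"
    then obtain a where "f \<in> trop_polys n" "is_root p n f a" by (auto simp: disc_set_def)
    from rational_approximation[OF this A(2,3)] obtain g b where
      "g \<in> trop_polys n" "g \<in> U" "has_trop_double_root v n g b" by metis
    then show "{f \<in> trop_polys n. \<exists>a. has_trop_double_root v n f a} \<inter> A \<noteq> {}" using A(1) by blast
  qed
qed

lemma trop_H_eq: "trop_H v n = {f \<in> trop_polys n. is_root p n f 0}"
proof
  have "closed ({f. f \<in> trop_polys n} \<inter> {f. is_root p n f 0})"
    by (intro closed_Int closed_root_heights) (auto simp: closed_trop_polys ht_def intro!: continuous_intros)
  then have "closed {f \<in> trop_polys n. is_root p n f 0}" by (simp only: Collect_conj_eq)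
  then show "trop_H v n \<subseteq> {f \<in> trop_polys n. is_root p n f 0}"
    unfolding trop_H_def by (rule closure_minimal[rotated]) (auto intro: double_root_is_root)
  show "{f \<in> trop_polys n. is_root p n f 0} \<subseteq> trop_H v n"
    unfolding trop_H_def
  proof (rule subsetI, unfold closure_iff_nhds_not_empty, intro allI impI)
    fix f A U assume "f \<in> {f \<in> trop_polys n. is_root p n f 0}" and A: "U \<subseteq> A" "open U" "f \<in> U"
    then have "f \<in> trop_polys n" "is_root p n f 0" by auto
    from rational_approximation[OF this A(2,3)] obtain g where
      "g \<in> trop_polys n" "g \<in> U" "has_trop_double_root v n g 0" by metis
    then show "{f \<in> trop_polys n. has_trop_double_root v n f 0} \<inter> A \<noteq> {}" using A(1) by blast
  qed
qed

lemma cf_translate: "r \<le> n \<Longrightarrow> cf (translate n a f) r = ht f a r"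
  by (simp add: translate_def lookup_add lookup_sum lookup_single when_def ht_def)

lemma translate_in: "f \<in> trop_polys n \<Longrightarrow> translate n a f \<in> trop_polys n"
  unfolding translate_def
  by (intro trop_polys_add subspace_sum[OF subspace_trop_polys]) (auto simp: trop_polys_iff lookup_single)

lemma trop_double_roots_eq:
  assumes "f \<in> trop_polys n"
  shows "trop_double_roots v n f = {a. is_root p n f a}"
proof -
  have "is_root p n (translate n a f) 0 = is_root p n f a" for a
  proof (rule root_heights_cong)
    show "ht (translate n a f) 0 r = ht f a r" if "r \<le> n" for r
      using cf_translate[OF that, of a f] by (simp add: ht_def)
  qed
  then show ?thesis
    using translate_in[OF assms] by (simp add: trop_double_roots_def trop_H_eq)
qed

end

section \<open>The maximal cones of the discriminant fan: labels, walls and counts\<close>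

section \<open>Maximal cones around a codimension-one cone\<close>

text \<open>The fans of all degrees are fixed together because the existence statements choose the
  degree.\<close>

locale discriminant_fans = valued_field v p
  for v :: "'k::alg_closed_field \<Rightarrow> real" and p :: nat +
  fixes Fan :: "nat \<Rightarrow> (nat \<Rightarrow>\<^sub>0 real) set set"
  assumes Fan: "\<And>n. coarsest_fan_on (trop_discriminant v n) (Fan n)"
begin

lemma fan_locale: "coarsest_fan n (disc_set p n) (Fan n)"
  using Fan[of n] disc_set_sub by (simp add: coarsest_fan_def trop_discriminant_eq)

text \<open>At a generic \<open>f\<close> the root is the slope through \<open>i\<close> and
  \<open>j\<close>, so membership in the cell makes the functional vanish; being a closed condition,
  this extends to all of \<open>C\<close>.\<close>

lemma has_label_relation:
  assumes C: "C \<in> Fan n" and lab: "has_label p v n C L" and g: "g \<in> C"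
  shows "pair n (label_relation L) g = 0"
proof -
  interpret coarsest_fan n "disc_set p n" "Fan n" by (rule fan_locale)
  have val: "valid_label p n L" using lab by (simp add: has_label_def)
  have "C \<subseteq> {g. pair n (label_relation L) g = 0}"
  proof (rule generic_on_imp_closed)
    show "generic_on C (\<lambda>f. \<exists>a. trop_double_roots v n f = {a} \<and> translate n a f \<in> label_cell p n L)"
      using lab by (simp add: has_label_def)
    show "closed {g. pair n (label_relation L) g = 0}" by (intro closed_Collect_eq continuous_intros)
    fix f assume "f \<in> C" and "\<exists>a. trop_double_roots v n f = {a} \<and> translate n a f \<in> label_cell p n L"
    then obtain a where t: "translate n a f \<in> label_cell p n L" by blast
    have "\<exists>i j q b. label_relation L = gap i j q b \<and> i \<le> n \<and> j \<le> n \<and> q \<le> n \<and> b \<le> n \<and> i \<noteq> j \<and>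
      ht f a i = ht f a j \<and> ht f a q = ht f a b"
    proof (cases L)
      case (LabelI i j k)
      have v: "i \<le> n" "j \<le> n" "k \<le> n" "j \<le> n" "i \<noteq> j" using val unfolding LabelI by auto
      have "cf (translate n a f) i = cf (translate n a f) j" "cf (translate n a f) k = cf (translate n a f) j" using t unfolding LabelI by (auto)
      then have "ht f a i = ht f a j" "ht f a k = ht f a j" using v by (simp_all add: cf_translate)
      then show ?thesis using v unfolding LabelI label_relation.simps by blast
    next
      case (LabelII i j k l)
      have v: "i \<le> n" "j \<le> n" "k \<le> n" "l \<le> n" "i \<noteq> j" using val unfolding LabelII by auto
      have "cf (translate n a f) i = cf (translate n a f) j" "cf (translate n a f) k = cf (translate n a f) l" using t unfolding LabelII by (auto simp: two_step_cell_def)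
      then have "ht f a i = ht f a j" "ht f a k = ht f a l" using v by (simp_all add: cf_translate)
      then show ?thesis using v unfolding LabelII label_relation.simps by blast
    next
      case (LabelIII i j k l)
      have v: "i \<le> n" "j \<le> n" "k \<le> n" "l \<le> n" "i \<noteq> j" using val unfolding LabelIII by auto
      have "cf (translate n a f) i = cf (translate n a f) j" "cf (translate n a f) k = cf (translate n a f) l" using t unfolding LabelIII by (auto simp: two_step_cell_def)
      then have "ht f a i = ht f a j" "ht f a k = ht f a l" using v by (simp_all add: cf_translate)
      then show ?thesis using v unfolding LabelIII label_relation.simps by blast
    qed
    then obtain i j q b where *: "label_relation L = gap i j q b" "i \<le> n" "j \<le> n" "q \<le> n" "b \<le> n" "i \<noteq> j"
      "ht f a i = ht f a j" "ht f a q = ht f a b" by blast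
    then have "a = slope i j f" using ht_eq_iff_slope by blast
    then show "f \<in> {g. pair n (label_relation L) g = 0}" using * by (simp add: pair_gap)
  qed
  then show ?thesis using g by blast
qed

lemma roots_of_corank_1:
  assumes "f \<in> disc_set p n" "relations_vanish p n C f" "indep_bound n C 1"
  obtains a where "{a. is_root p n f a} = {a}" "root_corank p n (ht f a) = 1"
proof -
  let ?A = "{a. is_root p n f a}"
  have fin: "finite ?A" by (rule finite_roots[OF p_pos])
  have le: "(\<Sum>a\<in>?A. root_corank p n (ht f a)) \<le> 1"
    using sum_root_corank_le[OF p_pos assms(2,3)] .
  obtain a where a: "a \<in> ?A" using assms(1) by (auto simp: disc_set_def)
  have pos: "1 \<le> root_corank p n (ht f b)" if "b \<in> ?A" for b using that root_corank_pos by blast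
  have "card ?A \<le> (\<Sum>a\<in>?A. root_corank p n (ht f a))"
    using sum_mono[of ?A "\<lambda>_. 1" "\<lambda>a. root_corank p n (ht f a)"] pos by simp
  then have "card ?A \<le> 1" using le by simp
  then have "card ?A = 1" using a fin by (metis One_nat_def card_0_eq empty_iff le_SucE le_zero_eq)
  then have A: "?A = {a}" using a by (metis card_1_singletonE singletonD)
  have "root_corank p n (ht f a) \<le> 1" using le unfolding A by simp
  then have "root_corank p n (ht f a) = 1" using pos[OF a] by simp
  then show thesis using A that by blast
qed

text \<open>A generic \<open>f\<close> of \<open>C\<close> has a single root of corank one and hence
  some label. Its equation and that of \<open>L\<close> both vanish on \<open>C\<close>, so the
  supports agree, and with them the cells.\<close>

lemma has_labelI:
  assumes C: "C \<in> Fan n" and ib: "indep_bound n C 1" and L: "valid_label p n L"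
    and van: "\<And>g. g \<in> C \<Longrightarrow> pair n (label_relation L) g = 0"
  shows "has_label p v n C L"
proof -
  interpret coarsest_fan n "disc_set p n" "Fan n" by (rule fan_locale)
  have "generic_on C (relations_vanish p n C)"
    by (rule generic_relations_vanish[OF cone_convex[OF C]])
  then have "generic_on C (\<lambda>f. \<exists>a. trop_double_roots v n f = {a} \<and> translate n a f \<in> label_cell p n L)"
  proof (rule generic_on_mono)
    fix f assume f: "f \<in> C" and rv: "relations_vanish p n C f"
    have fX: "f \<in> disc_set p n" using cone_sub[OF C] f by blast
    then have fV: "f \<in> trop_polys n" by (simp add: disc_set_def)
    obtain a where roots: "{a. is_root p n f a} = {a}" and co: "root_corank p n (ht f a) = 1"
      using roots_of_corank_1[OF fX rv ib] .
    have root: "is_root p n f a" using roots by blast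
    obtain L' i j q b where L': "valid_label p n L'" "label_relation L' = gap i j q b" "flat_root p n (ht f a) i j q b"
      and cell: "\<forall>f'\<in>trop_polys n. (\<forall>r\<le>n. cf f' r = ht f a r) \<longrightarrow> f' \<in> label_cell p n L'"
      using corank_1_root[OF root co] .
    have "pair n (label_relation L') g = 0" if "g \<in> C" for g
      using rv root flat_root_relation(1)[OF L'(3)] that unfolding relations_vanish_def L'(2) by blast
    then have "label_support L = label_support L'" using label_supports_eq[OF ib L L'(1) van] by blast
    then have "label_cell p n L = label_cell p n L'" by (rule label_cell_eq[OF L L'(1)])
    moreover have "translate n a f \<in> label_cell p n L'"
      using cell translate_in[OF fV] cf_translate by blast
    ultimately show "\<exists>a. trop_double_roots v n f = {a} \<and> translate n a f \<in> label_cell p n L"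
      using trop_double_roots_eq[OF fV] roots by (intro exI[of _ a]) simp
  qed
  then show ?thesis using L by (simp add: has_label_def)
qed

lemma has_type_unique:
  assumes "C \<in> Fan n" "indep_bound n C 1" "valid_label p n L" "\<And>g. g \<in> C \<Longrightarrow> pair n (label_relation L) g = 0"
    "has_type p v n C t"
  shows "t = label_type L"
proof -
  obtain L' where L': "has_label p v n C L'" "label_type L' = t" using assms(5) by (auto simp: has_type_def)
  have v': "valid_label p n L'" using L' by (simp add: has_label_def)
  have "label_support L = label_support L'"
    using label_supports_eq[OF assms(2,3) v' assms(4)] has_label_relation[OF assms(1) L'(1)] by blast
  then show ?thesis using label_type_eq[OF assms(3) v'] L'(2) by simp
qed

definition pages ::
  "nat \<Rightarrow> (nat \<Rightarrow>\<^sub>0 real) \<Rightarrow> (nat \<Rightarrow> real) \<Rightarrow> (nat \<Rightarrow> real) \<Rightarrow> (real \<times> real) set \<Rightarrow>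
     (real \<times> real \<Rightarrow> (nat \<Rightarrow>\<^sub>0 real) set) \<Rightarrow> bool" where
  "pages n f l m R K \<longleftrightarrow> (\<forall>u\<in>R. K u \<in> maximal_cones (Fan n)) \<and> (\<forall>u\<in>R. f \<in> K u) \<and> inj_on K R \<and>
     (\<forall>C. C \<in> maximal_cones (Fan n) \<longrightarrow> f \<in> C \<longrightarrow> (\<exists>u\<in>R. C = K u)) \<and>
     (\<forall>u\<in>R. \<forall>g\<in>K u. pair n (ray_normal l m u) g = 0) \<and>
     (\<forall>u\<in>R. \<forall>h. (\<forall>g\<in>K u. pair n h g = 0) \<longrightarrow> (\<exists>k. \<forall>r\<le>n. h r = k * ray_normal l m u r)) \<and>
     (\<exists>e>0. \<forall>u\<in>R. \<forall>g\<in>trop_polys n \<inter> coord_box n f e. pair n l g = 0 \<longrightarrow> pair n m g = 0 \<longrightarrow> g \<in> K u)"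

lemma book_pages:
  assumes "book_at n (disc_set p n) f l m R"
  obtains K where "pages n f l m R K"
proof -
  interpret coarsest_fan n "disc_set p n" "Fan n" by (rule fan_locale)
  show thesis
  proof (rule book_cones[OF assms])
    fix K
    assume K: "\<And>u. u \<in> R \<Longrightarrow> K u \<in> maximal_cones (Fan n)" "\<And>u. u \<in> R \<Longrightarrow> f \<in> K u" "inj_on K R"
      "\<And>C. C \<in> maximal_cones (Fan n) \<Longrightarrow> f \<in> C \<Longrightarrow> \<exists>u\<in>R. C = K u"
      "\<And>u g. u \<in> R \<Longrightarrow> g \<in> K u \<Longrightarrow> pair n (ray_normal l m u) g = 0"
      "\<And>u h. u \<in> R \<Longrightarrow> (\<And>g. g \<in> K u \<Longrightarrow> pair n h g = 0) \<Longrightarrow> \<exists>k. \<forall>r\<le>n. h r = k * ray_normal l m u r"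
      "\<exists>e>0. \<forall>u\<in>R. \<forall>g\<in>trop_polys n \<inter> coord_box n f e. pair n l g = 0 \<longrightarrow> pair n m g = 0 \<longrightarrow> g \<in> K u"
    have "pages n f l m R K"
      unfolding pages_def using K(1-5,7) by (intro conjI ballI allI impI) (simp_all add: K(6))
    then show thesis by (rule that)
  qed
qed

lemma pagesD:
  assumes "pages n f l m R K"
  shows "\<And>u. u \<in> R \<Longrightarrow> K u \<in> maximal_cones (Fan n)" "\<And>u. u \<in> R \<Longrightarrow> f \<in> K u" "inj_on K R"
    "\<And>C. C \<in> maximal_cones (Fan n) \<Longrightarrow> f \<in> C \<Longrightarrow> \<exists>u\<in>R. C = K u"
    "\<And>u g. u \<in> R \<Longrightarrow> g \<in> K u \<Longrightarrow> pair n (ray_normal l m u) g = 0"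
    "\<And>u h. u \<in> R \<Longrightarrow> \<forall>g\<in>K u. pair n h g = 0 \<Longrightarrow> \<exists>k. \<forall>r\<le>n. h r = k * ray_normal l m u r"
    "\<exists>e>0. \<forall>u\<in>R. \<forall>g\<in>trop_polys n \<inter> coord_box n f e. pair n l g = 0 \<longrightarrow> pair n m g = 0 \<longrightarrow> g \<in> K u"
  using assms unfolding pages_def by (elim conjE; simp)+

definition crossing_at :: "nat \<Rightarrow> (nat \<Rightarrow>\<^sub>0 real) \<Rightarrow> bool" where
  "crossing_at n f \<longleftrightarrow> (\<exists>a1 a2 l m. {a. is_root p n f a} = {a1, a2} \<and> a1 \<noteq> a2 \<and>
     book_at n (disc_set p n) f l m {(1, 0), (-1, 0), (0, 1), (0, -1)})"

definition tripod_at :: "nat \<Rightarrow> (nat \<Rightarrow>\<^sub>0 real) \<Rightarrow> bool" where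
  "tripod_at n f \<longleftrightarrow> (\<exists>a i j x y z L1 L2 L3. {a. is_root p n f a} = {a} \<and>
     tripod_root p n (ht f a) i j x y z \<and> tripod_labels p n i j x y z L1 L2 L3)"

definition tetrapod_at :: "nat \<Rightarrow> (nat \<Rightarrow>\<^sub>0 real) \<Rightarrow> bool" where
  "tetrapod_at n f \<longleftrightarrow> (\<exists>a i j x y. {a. is_root p n f a} = {a} \<and> tetrapod_root p n (ht f a) i j x y)"

text \<open>Coranks are positive and add up to at most two: there are two roots of corank one, or a
  single root. At a single root the flat configurations would make \<open>f\<close> regular.\<close>

lemma corank_2_cases:
  assumes f: "f \<in> disc_set p n" and rv: "relations_vanish p n D f" and ib: "indep_bound n D 2"
    and nr: "\<not> regular_point (disc_set p n) f"
  shows "crossing_at n f \<or> tripod_at n f \<or> tetrapod_at n f"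
proof -
  let ?A = "{a. is_root p n f a}"
  have fV: "f \<in> trop_polys n" using f by (simp add: disc_set_def)
  have fin: "finite ?A" by (rule finite_roots[OF p_pos])
  have le: "(\<Sum>a\<in>?A. root_corank p n (ht f a)) \<le> 2"
    using sum_root_corank_le[OF p_pos rv ib] .
  obtain a where a: "is_root p n f a" using f by (auto simp: disc_set_def)
  have pos: "1 \<le> root_corank p n (ht f b)" if "is_root p n f b" for b using that root_corank_pos by blast
  show ?thesis
  proof (cases "?A = {a}")
    case True
    have "root_corank p n (ht f a) \<le> 2" using le unfolding True by simp
    then consider "root_corank p n (ht f a) = 1" | "root_corank p n (ht f a) = 2" using pos[OF a] by linarith
    then show ?thesis
    proof cases
      case 1
      obtain L i j q b where "flat_root p n (ht f a) i j q b" by (rule corank_1_root[OF a 1], rule that, assumption)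
      then show ?thesis using regular_if_flat[OF p_pos fV True] nr by blast
    next
      case 2
      then show ?thesis
        using corank_2_root[OF a 2] regular_if_flat[OF p_pos fV True] nr True
        unfolding tripod_at_def tetrapod_at_def by blast
    qed
  next
    case False
    then obtain b where b: "is_root p n f b" "b \<noteq> a" using a by blast
    define T where "T = ?A - {a, b}"
    have finT: "finite T" using fin by (simp add: T_def)
    have AT: "?A = insert a (insert b T)" "a \<notin> insert b T" "b \<notin> T" using a b by (auto simp: T_def)
    have s: "root_corank p n (ht f a) + (root_corank p n (ht f b) + (\<Sum>a\<in>T. root_corank p n (ht f a))) \<le> 2"
      using le finT AT(2,3) unfolding AT(1) by simp
    have co: "root_corank p n (ht f a) = 1" "root_corank p n (ht f b) = 1"
      using s pos[OF a] pos[OF b(1)] by linarith+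
    have "card T \<le> (\<Sum>a\<in>T. root_corank p n (ht f a))"
      using sum_mono[of T "\<lambda>_. 1" "\<lambda>a. root_corank p n (ht f a)"] pos by (simp add: T_def)
    then have "card T = 0" using s co by linarith
    then have A2: "?A = {a, b}" using AT(1) finT by simp
    obtain L i j q c where 1: "flat_root p n (ht f a) i j q c" by (rule corank_1_root[OF a co(1)], rule that, assumption)
    obtain L i' j' q' c' where 2: "flat_root p n (ht f b) i' j' q' c'" by (rule corank_1_root[OF b(1) co(2)], rule that, assumption)
    show ?thesis
      using book_crossing[OF p_pos fV A2 not_sym[OF b(2)] 1 2] A2 b(2) unfolding crossing_at_def by metis
  qed
qed

text \<open>\<open>D\<close> has codimension two, which bounds the coranks; and \<open>f\<close>
  lies in two maximal cones, so it is not regular.\<close>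

lemma adjacent_generic:
  assumes adj: "adjacent_cones n (Fan n) C1 C2"
  shows "generic_on (C1 \<inter> C2) (\<lambda>f. (\<forall>C\<in>maximal_cones (Fan n). f \<in> C \<longrightarrow> C1 \<inter> C2 \<subseteq> C) \<and>
    (crossing_at n f \<or> tripod_at n f \<or> tetrapod_at n f))"
proof -
  interpret coarsest_fan n "disc_set p n" "Fan n" by (rule fan_locale)
  let ?D = "C1 \<inter> C2"
  have C: "C1 \<in> maximal_cones (Fan n)" "C2 \<in> maximal_cones (Fan n)" "C1 \<noteq> C2" "dim ?D + 1 = n"
    using adj by (auto simp: adjacent_cones_def)
  have C\<Sigma>: "C1 \<in> Fan n" "C2 \<in> Fan n" using C(1,2) by (auto intro: maximal_in_fan)
  have D: "?D \<in> Fan n" by (rule Int_in_fan[OF C\<Sigma>])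
  have ib: "indep_bound n ?D 2"
    using cone_sub[OF D] X_sub C(4) by (intro indep_bound_dim) auto
  have "generic_on ?D (\<lambda>f. (\<forall>C\<in>maximal_cones (Fan n). f \<in> C \<longrightarrow> ?D \<subseteq> C) \<and> relations_vanish p n ?D f)"
    using generic_in_every_cone[OF D] generic_relations_vanish[OF cone_convex[OF D]] by (rule generic_on_conj)
  then show ?thesis
  proof (rule generic_on_mono)
    fix f assume f: "f \<in> ?D" and g: "(\<forall>C\<in>maximal_cones (Fan n). f \<in> C \<longrightarrow> ?D \<subseteq> C) \<and> relations_vanish p n ?D f"
    have fX: "f \<in> disc_set p n" using f cone_sub[OF D] by blast
    have "\<not> regular_point (disc_set p n) f"
      using regular_cone_unique[of f C1 C2] C\<Sigma> C(3) f by blast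
    then show "(\<forall>C\<in>maximal_cones (Fan n). f \<in> C \<longrightarrow> ?D \<subseteq> C) \<and> (crossing_at n f \<or> tripod_at n f \<or> tetrapod_at n f)"
      using corank_2_cases[OF fX _ ib] g by blast
  qed
qed

text \<open>Coplanar cones on the two sides of \<open>D\<close> occur exactly when two hyperplanes cross along \<open>D\<close>. This
  makes the alternative between distinct and coincident roots independent of the generic point.\<close>

definition has_opposite_cones :: "nat \<Rightarrow> (nat \<Rightarrow>\<^sub>0 real) set \<Rightarrow> bool" where
  "has_opposite_cones n D \<longleftrightarrow> (\<exists>C\<in>maximal_cones (Fan n). \<exists>C'\<in>maximal_cones (Fan n). C \<noteq> C' \<and> D \<subseteq> C \<and> D \<subseteq> C' \<and>
     (\<exists>m. (\<exists>r\<le>n. m r \<noteq> 0) \<and> (\<forall>g\<in>C \<union> C'. pair n m g = 0)))"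

text \<open>The pages over \<open>(1, 0)\<close> and \<open>(-1, 0)\<close> lie in one hyperplane,
  the kernel of the second functional.\<close>

lemma crossing_has_opposite:
  assumes "crossing_at n f" and sub: "\<And>C. C \<in> maximal_cones (Fan n) \<Longrightarrow> f \<in> C \<Longrightarrow> D \<subseteq> C"
  shows "has_opposite_cones n D"
proof -
  interpret coarsest_fan n "disc_set p n" "Fan n" by (rule fan_locale)
  define R :: "(real \<times> real) set" where "R = {(1, 0), (-1, 0), (0, 1), (0, -1)}"
  obtain l m where book: "book_at n (disc_set p n) f l m R"
    using assms(1) unfolding crossing_at_def R_def by blast
  obtain K where "pages n f l m R K" using book_pages[OF book] .
  note K = pagesD[OF this]
  have R: "(1, 0) \<in> R" "(-1, 0) \<in> R" by (auto simp: R_def)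
  have ne: "K (1, 0) \<noteq> K (-1, 0)" using inj_onD[OF K(3) _ R] by auto
  obtain w where w: "pair n m w = 1" using book unfolding book_at_def by blast
  have "\<exists>r\<le>n. m r \<noteq> 0"
  proof (rule ccontr)
    assume "\<not> (\<exists>r\<le>n. m r \<noteq> 0)"
    then have "pair n m w = 0" by (simp add: pair_def)
    then show False using w by simp
  qed
  moreover have "\<forall>g\<in>K (1, 0) \<union> K (-1, 0). pair n m g = 0"
    using K(5)[OF R(1)] K(5)[OF R(2)] by (auto simp: pair_ray_normal)
  moreover have "D \<subseteq> K (1, 0)" "D \<subseteq> K (-1, 0)" using K(1,2) R by (auto intro: sub[THEN subsetD])
  ultimately show ?thesis
    unfolding has_opposite_cones_def using ne K(1)[OF R(1)] K(1)[OF R(2)] by blast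
qed

text \<open>A functional vanishing on two pages is a multiple of both ray normals; these are not
  proportional, so it is zero.\<close>

lemma transversal_book_no_opposite:
  assumes book: "book_at n (disc_set p n) f l m R" and tr: "\<And>u w. u \<in> R \<Longrightarrow> w \<in> R \<Longrightarrow> u \<noteq> w \<Longrightarrow> cross u w \<noteq> 0"
    and fD: "f \<in> D"
  shows "\<not> has_opposite_cones n D"
proof
  assume "has_opposite_cones n D"
  then obtain C C' h where C: "C \<in> maximal_cones (Fan n)" "C' \<in> maximal_cones (Fan n)" "C \<noteq> C'" "f \<in> C" "f \<in> C'"
    and h: "\<exists>r\<le>n. h r \<noteq> 0" "\<And>g. g \<in> C \<union> C' \<Longrightarrow> pair n h g = 0"
    unfolding has_opposite_cones_def using fD by blast
  interpret coarsest_fan n "disc_set p n" "Fan n" by (rule fan_locale)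
  obtain K where "pages n f l m R K" using book_pages[OF book] .
  note K = pagesD[OF this]
  obtain u where u: "u \<in> R" "C = K u" using K(4)[OF C(1,4)] by blast
  obtain w where w: "w \<in> R" "C' = K w" using K(4)[OF C(2,5)] by blast
  have uw: "cross u w \<noteq> 0" using tr[OF u(1) w(1)] C(3) u w by blast
  obtain k where k: "\<And>r. r \<le> n \<Longrightarrow> h r = k * ray_normal l m u r" using K(6)[OF u(1), of h] h(2) u(2) by blast
  obtain k' where k': "\<And>r. r \<le> n \<Longrightarrow> h r = k' * ray_normal l m w r" using K(6)[OF w(1), of h] h(2) w(2) by blast
  have hp: "pair n h g = k * pair n (ray_normal l m u) g" for g
    unfolding pair_def sum_distrib_left using k by (auto intro!: sum.cong simp: mult.assoc)
  have hp': "pair n h g = k' * pair n (ray_normal l m w) g" for g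
    unfolding pair_def sum_distrib_left using k' by (auto intro!: sum.cong simp: mult.assoc)
  obtain x y where xy: "pair n l x = 1" "pair n m x = 0" "pair n l y = 0" "pair n m y = 1"
    using book unfolding book_at_def by blast
  have "k * snd u = k' * snd w" "k * fst u = k' * fst w"
    using hp[of x] hp[of y] hp'[of x] hp'[of y] xy by (simp_all add: pair_ray_normal)
  then have "k * cross u w = 0" unfolding cross_def by algebra
  then have "k = 0" using uw by simp
  then show False using h(1) k by auto
qed

text \<open>Over \<open>(0, 1)\<close> the first coordinate vanishes, so \<open>x\<close> ties with
  \<open>z\<close>, the case of \<open>L1\<close>. Likewise \<open>y\<close> ties with
  \<open>z\<close> over \<open>(1, 0)\<close>, and \<open>x\<close> with \<open>y\<close> over
  \<open>(-1, -1)\<close>.\<close>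

definition tripod_label :: "cell_label \<Rightarrow> cell_label \<Rightarrow> cell_label \<Rightarrow> real \<times> real \<Rightarrow> cell_label" where
  "tripod_label L1 L2 L3 u = (if u = (0, 1) then L1 else if u = (1, 0) then L2 else L3)"

lemma tripod_label_relation:
  assumes tri: "tripod_root p n k i j x y z" and lab: "tripod_labels p n i j x y z L1 L2 L3"
    and u: "u \<in> {(1, 0), (0, 1), (-1, -1)}" and z: "pair n (ray_normal (gap i j x z) (gap i j y z) u) g = 0"
  shows "pair n (label_relation (tripod_label L1 L2 L3 u)) g = 0"
proof -
  have le: "i \<le> n" "j \<le> n" "x \<le> n" "y \<le> n" "z \<le> n" using tri by (auto simp: tripod_root_def)
  have L: "pair n (gap i j x z) g = 0 \<Longrightarrow> pair n (label_relation L1) g = 0"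
    "pair n (gap i j y z) g = 0 \<Longrightarrow> pair n (label_relation L2) g = 0"
    "pair n (gap i j x y) g = 0 \<Longrightarrow> pair n (label_relation L3) g = 0"
    using lab unfolding tripod_labels_def by blast+
  have xyz: "pair n (gap i j x y) g = pair n (gap i j x z) g - pair n (gap i j y z) g" using le by (simp add: pair_gap)
  show ?thesis
    using u
  proof (elim insertE emptyE)
    assume "u = (1, 0)" then show ?thesis using z L(2) by (simp add: tripod_label_def pair_ray_normal)
  next
    assume "u = (0, 1)" then show ?thesis using z L(1) by (simp add: tripod_label_def pair_ray_normal)
  next
    assume "u = (-1, -1)" then show ?thesis using z L(3) xyz by (simp add: tripod_label_def pair_ray_normal)
  qed
qed

lemma tripod_label_valid:
  assumes "tripod_labels p n i j x y z L1 L2 L3"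
  shows "valid_label p n (tripod_label L1 L2 L3 u)"
    "compatible_labels p (tripod_label L1 L2 L3 u) (tripod_label L1 L2 L3 w)"
  using assms unfolding tripod_labels_def tripod_label_def by simp_all

lemma tripod_book:
  assumes "tripod_at n f" and fV: "f \<in> trop_polys n"
  obtains a l m L where "{a. is_root p n f a} = {a}"
    "book_at n (disc_set p n) f l m {(1, 0), (0, 1), (-1, -1)}"
    "\<forall>u\<in>{(1, 0), (0, 1), (-1, -1)}. valid_label p n (L u)"
    "\<forall>u\<in>{(1, 0), (0, 1), (-1, -1)}. \<forall>w\<in>{(1, 0), (0, 1), (-1, -1)}. compatible_labels p (L u) (L w)"
    "\<forall>u\<in>{(1, 0), (0, 1), (-1, -1)}. \<forall>g. pair n (ray_normal l m u) g = 0 \<longrightarrow> pair n (label_relation (L u)) g = 0"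
proof -
  obtain a i j x y z L1 L2 L3 where roots: "{a. is_root p n f a} = {a}"
    and tri: "tripod_root p n (ht f a) i j x y z" and lab: "tripod_labels p n i j x y z L1 L2 L3"
    using assms unfolding tripod_at_def by blast
  show thesis
    by (rule that[OF roots book_tripod[OF p_pos fV roots tri], of "tripod_label L1 L2 L3"])
      (use tripod_label_valid[OF lab] tripod_label_relation[OF tri lab] in blast)+
qed

text \<open>Over the ray of \<open>w\<close> the three other exponents tie, so every gap formed from
  them vanishes. This removes the special role of \<open>i\<close> and \<open>j\<close> in the
  coordinates and makes the four exponents interchangeable.\<close>

lemma tetrapod_book:
  assumes "tetrapod_at n f" and fV: "f \<in> trop_polys n"
  obtains a l m W ray where "{a. is_root p n f a} = {a}" "book_at n (disc_set p n) f l m (ray ` W)"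
    "card W = 4" "W \<subseteq> {..n}" "inj_on (\<lambda>r. r mod p) W"
    "\<forall>w\<in>W. \<forall>w'\<in>W. w \<noteq> w' \<longrightarrow> cross (ray w) (ray w') \<noteq> 0"
    "\<forall>w\<in>W. \<forall>g r s t. pair n (ray_normal l m (ray w)) g = 0 \<longrightarrow> {r, s, t} \<subseteq> W - {w} \<longrightarrow> r \<noteq> s \<longrightarrow>
       pair n (gap r s t s) g = 0"
proof -
  obtain a i j x y where roots: "{a. is_root p n f a} = {a}" and tet: "tetrapod_root p n (ht f a) i j x y"
    using assms unfolding tetrapod_at_def by blast
  have m: "distinct [i mod p, j mod p, x mod p, y mod p]" and le: "i \<le> n" "j \<le> n" "x \<le> n" "y \<le> n"
    using tet by (auto simp: tetrapod_root_def)
  then have d: "i \<noteq> j" "i \<noteq> x" "i \<noteq> y" "j \<noteq> x" "j \<noteq> y" "x \<noteq> y" by auto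
  define W where "W = {i, j, x, y}"
  show thesis
  proof (rule that[of a "gap i j x j" "gap i j y j" "tetrapod_rays i j x y" W])
    show "{a. is_root p n f a} = {a}" by fact
    show "book_at n (disc_set p n) f (gap i j x j) (gap i j y j) (tetrapod_rays i j x y ` W)"
      unfolding W_def by (rule book_tetrapod[OF p_pos fV roots tet])
    show "card W = 4" using d by (simp add: W_def)
    show "W \<subseteq> {..n}" using le by (simp add: W_def)
    show "inj_on (\<lambda>r. r mod p) W" using m unfolding W_def by (auto simp: inj_on_def)
    have "cross (tetrapod_rays i j x y w) (tetrapod_rays i j x y w') \<noteq> 0" if "w \<in> W" "w' \<in> W" "w \<noteq> w'" for w w'
      using cross_tetrapod_rays[of i j x y w w'] d that by (simp add: W_def)
    then show "\<forall>w\<in>W. \<forall>w'\<in>W. w \<noteq> w' \<longrightarrow> cross (tetrapod_rays i j x y w) (tetrapod_rays i j x y w') \<noteq> 0" by blast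
    show "\<forall>w\<in>W. \<forall>g r s t. pair n (ray_normal (gap i j x j) (gap i j y j) (tetrapod_rays i j x y w)) g = 0 \<longrightarrow>
      {r, s, t} \<subseteq> W - {w} \<longrightarrow> r \<noteq> s \<longrightarrow> pair n (gap r s t s) g = 0"
    proof (intro ballI allI impI)
    fix w g r s t
    assume w: "w \<in> W" and z: "pair n (ray_normal (gap i j x j) (gap i j y j) (tetrapod_rays i j x y w)) g = 0"
      and rst: "{r, s, t} \<subseteq> W - {w}" and rs: "r \<noteq> s"
    define b0 where "b0 = slope i j g"
    define H where "H = ht g b0 j"
    define A where "A = pair n (gap i j x j) g"
    define B where "B = pair n (gap i j y j) g"
    have H: "ht g b0 i = H" "ht g b0 j = H" "ht g b0 x = H + A" "ht g b0 y = H + B"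
      using ht_eq_iff_slope[OF d(1), of g b0] by (auto simp: b0_def H_def A_def B_def pair_gap le)
    have sh: "ht g (b0 + t) r = ht g b0 r + real r * t" for t r by (simp add: ht_def algebra_simps)
    have z': "snd (tetrapod_rays i j x y w) * A = fst (tetrapod_rays i j x y w) * B"
      using z by (simp add: pair_ray_normal A_def B_def)
    have "\<exists>b h. \<forall>r\<in>W - {w}. ht g b r = h"
    proof -
      consider "w = y" | "w = x" | "w = j" | "w = i" using w by (auto simp: W_def)
      then show ?thesis
      proof cases
        case 1
        then have "A = 0" using z' by (simp add: tetrapod_rays_def)
        then have "\<forall>r\<in>W - {w}. ht g (b0) r = H" using 1 H
          by (auto simp: W_def)
        then show ?thesis by blast
      next
        case 2
        then have "B = 0" using z' d by (simp add: tetrapod_rays_def)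
        then have "\<forall>r\<in>W - {w}. ht g (b0) r = H" using 2 H
          by (auto simp: W_def)
        then show ?thesis by blast
      next
        case 3
        then have "(real i - real y) * A = (real i - real x) * B" using z' d by (simp add: tetrapod_rays_def field_simps)
        then have "A = (real i - real x) * (A / (real i - real x))" "B = (real i - real y) * (A / (real i - real x))"
          using d by (simp_all add: field_simps)
        \<comment> \<open>The shift of the root from \<open>b0\<close> at which \<open>i\<close>,
          \<open>x\<close> and \<open>y\<close> tie.\<close>
        then obtain \<tau> where \<tau>: "A = (real i - real x) * \<tau>" "B = (real i - real y) * \<tau>" by blast
        have "\<forall>r\<in>W - {w}. ht g (b0 + \<tau>) r = H + real i * \<tau>" using 3 H
          by (auto simp: W_def sh sh[unfolded add.commute[of b0]] \<tau> algebra_simps)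
        then show ?thesis by blast
      next
        case 4
        then have "(real j - real y) * A = (real j - real x) * B" using z' d by (simp add: tetrapod_rays_def field_simps)
        then have "A = (real j - real x) * (A / (real j - real x))" "B = (real j - real y) * (A / (real j - real x))"
          using d by (simp_all add: field_simps)
        then obtain \<tau> where \<tau>: "A = (real j - real x) * \<tau>" "B = (real j - real y) * \<tau>" by blast
        have "\<forall>r\<in>W - {w}. ht g (b0 + \<tau>) r = H + real j * \<tau>" using 4 H
          by (auto simp: W_def sh sh[unfolded add.commute[of b0]] \<tau> algebra_simps)
        then show ?thesis by blast
      qed
    qed
    then obtain b h where bh: "\<forall>r\<in>W - {w}. ht g b r = h" by blast
    then have e: "ht g b r = h" "ht g b s = h" "ht g b t = h" using rst by auto
    then have "b = slope r s g" using ht_eq_iff_slope[OF rs] by metis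
    moreover have "r \<le> n" "s \<le> n" "t \<le> n" using rst le by (auto simp: W_def)
    ultimately show "pair n (gap r s t s) g = 0" using e by (simp add: pair_gap)
    qed
  qed
qed

lemma coincident_no_opposite:
  assumes "tripod_at n f \<or> tetrapod_at n f" "f \<in> D" "f \<in> trop_polys n"
  shows "\<not> has_opposite_cones n D"
  using assms(1)
proof
  assume tri: "tripod_at n f"
  obtain a l m L where "{a. is_root p n f a} = {a}" and book: "book_at n (disc_set p n) f l m {(1, 0), (0, 1), (-1, -1)}"
    by (rule tripod_book[OF tri assms(3)], rule that, assumption+)
  show ?thesis
    by (rule transversal_book_no_opposite[OF book _ assms(2)]) (auto simp: cross_def)
next
  assume tet: "tetrapod_at n f"
  obtain a l m W ray where "{a. is_root p n f a} = {a}" and book: "book_at n (disc_set p n) f l m (ray ` W)"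
    and W: "card W = 4" "W \<subseteq> {..n}" "inj_on (\<lambda>r. r mod p) W"
    and cr: "\<forall>w\<in>W. \<forall>w'\<in>W. w \<noteq> w' \<longrightarrow> cross (ray w) (ray w') \<noteq> 0"
    and rel0: "\<forall>w\<in>W. \<forall>g r s t. pair n (ray_normal l m (ray w)) g = 0 \<longrightarrow> {r, s, t} \<subseteq> W - {w} \<longrightarrow> r \<noteq> s \<longrightarrow>
       pair n (gap r s t s) g = 0"
    by (rule tetrapod_book[OF tet assms(3)])
  show ?thesis
  proof (rule transversal_book_no_opposite[OF book _ assms(2)])
    fix u u' assume u: "u \<in> ray ` W" "u' \<in> ray ` W" "u \<noteq> u'"
    obtain w where w: "w \<in> W" "u = ray w" using u(1) by (rule imageE)
    obtain w' where w': "w' \<in> W" "u' = ray w'" using u(2) by (rule imageE)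
    have "w \<noteq> w'" using u(3) w w' by auto
    then show "cross u u' \<noteq> 0" using bspec[OF bspec[OF cr w(1)] w'(1)] w w' by simp
  qed
qed

lemma adjacent_subset:
  assumes "adjacent_cones n (Fan n) C1 C2"
  shows "C1 \<in> Fan n" "C2 \<in> Fan n" "C1 \<inter> C2 \<in> Fan n" "C1 \<inter> C2 \<noteq> {}" "C1 \<inter> C2 \<subseteq> trop_polys n"
proof -
  interpret coarsest_fan n "disc_set p n" "Fan n" by (rule fan_locale)
  have "C1 \<in> maximal_cones (Fan n)" "C2 \<in> maximal_cones (Fan n)" using assms by (simp_all add: adjacent_cones_def)
  then show C: "C1 \<in> Fan n" "C2 \<in> Fan n" using maximal_in_fan by blast+
  show D: "C1 \<inter> C2 \<in> Fan n" by (rule Int_in_fan[OF C])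
  show "C1 \<inter> C2 \<noteq> {}" using cone_0[OF D] by blast
  show "C1 \<inter> C2 \<subseteq> trop_polys n" using cone_sub[OF D] X_sub by blast
qed

text \<open>The criterion depends on \<open>D\<close> alone, so it excludes the single-root shapes
  at all generic points at once.\<close>

lemma distinct_if_opposite:
  assumes adj: "adjacent_cones n (Fan n) C1 C2" and op: "has_opposite_cones n (C1 \<inter> C2)"
  shows "distinct_double_roots v n (C1 \<inter> C2)"
  unfolding distinct_double_roots_def using adjacent_generic[OF adj]
proof (rule generic_on_mono)
  fix f assume f: "f \<in> C1 \<inter> C2" and h: "(\<forall>C\<in>maximal_cones (Fan n). f \<in> C \<longrightarrow> C1 \<inter> C2 \<subseteq> C) \<and>
    (crossing_at n f \<or> tripod_at n f \<or> tetrapod_at n f)"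
  have fV: "f \<in> trop_polys n" using adjacent_subset(5)[OF adj] f by blast
  have "crossing_at n f" using h coincident_no_opposite[OF _ f fV] op by blast
  then show "\<exists>a1 a2. trop_double_roots v n f = {a1, a2} \<and> a1 \<noteq> a2"
    unfolding crossing_at_def trop_double_roots_eq[OF fV] by blast
qed

lemma one_root:
  assumes "tripod_at n f \<or> tetrapod_at n f"
  obtains a where "{a. is_root p n f a} = {a}"
  using assms unfolding tripod_at_def tetrapod_at_def by blast

lemma coincident_if_not_opposite:
  assumes adj: "adjacent_cones n (Fan n) C1 C2" and op: "\<not> has_opposite_cones n (C1 \<inter> C2)"
  shows "coincident_double_roots v n (C1 \<inter> C2)"
  unfolding coincident_double_roots_def using adjacent_generic[OF adj]
proof (rule generic_on_mono)
  fix f assume f: "f \<in> C1 \<inter> C2" and h: "(\<forall>C\<in>maximal_cones (Fan n). f \<in> C \<longrightarrow> C1 \<inter> C2 \<subseteq> C) \<and>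
    (crossing_at n f \<or> tripod_at n f \<or> tetrapod_at n f)"
  have fV: "f \<in> trop_polys n" using adjacent_subset(5)[OF adj] f by blast
  have "tripod_at n f \<or> tetrapod_at n f" using h crossing_has_opposite[of n f "C1 \<inter> C2"] op by blast
  then obtain a where "{a. is_root p n f a} = {a}" by (rule one_root)
  then show "\<exists>a1 a2. trop_double_roots v n f = {a1, a2} \<and> a1 = a2"
    unfolding trop_double_roots_eq[OF fV] by (intro exI[of _ a]) simp
qed

text \<open>For such an \<open>f\<close>, having \<open>D\<close> as a face amounts to containing
  \<open>f\<close>, and the cones through \<open>f\<close> correspond to the rays.\<close>

lemma card_faces_of_book:
  assumes adj: "adjacent_cones n (Fan n) C1 C2" and f: "f \<in> C1 \<inter> C2"
    and sub: "\<forall>C\<in>maximal_cones (Fan n). f \<in> C \<longrightarrow> C1 \<inter> C2 \<subseteq> C"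
    and book: "book_at n (disc_set p n) f l m R"
  shows "num_maximal_cones_with_face (Fan n) (C1 \<inter> C2) = card R"
proof -
  interpret coarsest_fan n "disc_set p n" "Fan n" by (rule fan_locale)
  obtain K where "pages n f l m R K" using book_pages[OF book] .
  note K = pagesD[OF this]
  have "{C \<in> maximal_cones (Fan n). (C1 \<inter> C2) face_of C} = {C \<in> maximal_cones (Fan n). f \<in> C}"
    by (rule card_cones_with_face) (use adjacent_subset(3)[OF adj] sub f in blast)+
  also have "\<dots> = K ` R" using K by blast
  finally show ?thesis unfolding num_maximal_cones_with_face_def using card_image[OF K(3)] by simp
qed

lemma adjacent_book_cones:
  assumes adj: "adjacent_cones n (Fan n) C1 C2" and f: "f \<in> C1 \<inter> C2" and book: "book_at n (disc_set p n) f l m R"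
  obtains u w where "u \<in> R" "w \<in> R" "u \<noteq> w" "indep_bound n C1 1" "indep_bound n C2 1"
    "\<forall>g\<in>C1. pair n (ray_normal l m u) g = 0" "\<forall>g\<in>C2. pair n (ray_normal l m w) g = 0"
proof -
  interpret coarsest_fan n "disc_set p n" "Fan n" by (rule fan_locale)
  obtain K where "pages n f l m R K" using book_pages[OF book] .
  note K = pagesD[OF this]
  have C: "C1 \<in> maximal_cones (Fan n)" "C2 \<in> maximal_cones (Fan n)" "C1 \<noteq> C2"
    using adj by (auto simp: adjacent_cones_def)
  obtain u where u: "u \<in> R" "C1 = K u" using K(4)[OF C(1)] f by blast
  obtain w where w: "w \<in> R" "C2 = K w" using K(4)[OF C(2)] f by blast
  have ib: "indep_bound n (K u) 1" if "u \<in> R" for u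
    by (rule indep_bound_line) (rule K(6)[OF that], blast)
  show thesis
    by (rule that[OF u(1) w(1)]) (use C(3) u w ib K(5) in auto)
qed

lemma count_distinct:
  assumes adj: "adjacent_cones n (Fan n) C1 C2" and dist: "distinct_double_roots v n (C1 \<inter> C2)"
  shows "num_maximal_cones_with_face (Fan n) (C1 \<inter> C2) = 4"
proof -
  obtain f where f: "f \<in> C1 \<inter> C2" and h: "((\<forall>C\<in>maximal_cones (Fan n). f \<in> C \<longrightarrow> C1 \<inter> C2 \<subseteq> C) \<and>
      (crossing_at n f \<or> tripod_at n f \<or> tetrapod_at n f)) \<and> (\<exists>a1 a2. trop_double_roots v n f = {a1, a2} \<and> a1 \<noteq> a2)"
    by (rule generic_on_witness[OF generic_on_conj[OF adjacent_generic[OF adj] dist[unfolded distinct_double_roots_def]]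
        adjacent_subset(4)[OF adj]])
  note sub = h[THEN conjunct1, THEN conjunct1] and cs = h[THEN conjunct1, THEN conjunct2] and two = h[THEN conjunct2]
  have fV: "f \<in> trop_polys n" using adjacent_subset(5)[OF adj] f by blast
  have "\<not> (tripod_at n f \<or> tetrapod_at n f)"
  proof
    assume "tripod_at n f \<or> tetrapod_at n f"
    then obtain a where "{a. is_root p n f a} = {a}" by (rule one_root)
    then show False using two unfolding trop_double_roots_eq[OF fV] by auto
  qed
  then obtain l m where book: "book_at n (disc_set p n) f l m {(1, 0), (-1, 0), (0, 1), (0, -1)}"
    using cs unfolding crossing_at_def by blast
  show ?thesis using card_faces_of_book[OF adj f sub book] by simp
qed

lemma coincident_witness:
  assumes adj: "adjacent_cones n (Fan n) C1 C2" and co: "coincident_double_roots v n (C1 \<inter> C2)"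
  obtains f where "f \<in> C1 \<inter> C2" "\<forall>C\<in>maximal_cones (Fan n). f \<in> C \<longrightarrow> C1 \<inter> C2 \<subseteq> C" "f \<in> trop_polys n"
    "tripod_at n f \<or> tetrapod_at n f"
proof -
  obtain f where f: "f \<in> C1 \<inter> C2" and h: "((\<forall>C\<in>maximal_cones (Fan n). f \<in> C \<longrightarrow> C1 \<inter> C2 \<subseteq> C) \<and>
      (crossing_at n f \<or> tripod_at n f \<or> tetrapod_at n f)) \<and> (\<exists>a1 a2. trop_double_roots v n f = {a1, a2} \<and> a1 = a2)"
    by (rule generic_on_witness[OF generic_on_conj[OF adjacent_generic[OF adj] co[unfolded coincident_double_roots_def]]
        adjacent_subset(4)[OF adj]])
  note sub = h[THEN conjunct1, THEN conjunct1] and cs = h[THEN conjunct1, THEN conjunct2] and one = h[THEN conjunct2]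
  have fV: "f \<in> trop_polys n" using adjacent_subset(5)[OF adj] f by blast
  have "\<not> crossing_at n f"
    using one unfolding crossing_at_def trop_double_roots_eq[OF fV] by (auto simp: doubleton_eq_iff)
  then show thesis using that f sub cs fV by blast
qed

lemma tripod_adjacent_labels:
  assumes adj: "adjacent_cones n (Fan n) C1 C2" and f: "f \<in> C1 \<inter> C2" "f \<in> trop_polys n" and tri: "tripod_at n f"
  obtains L1 L2 where "valid_label p n L1" "valid_label p n L2" "compatible_labels p L1 L2"
    "indep_bound n C1 1" "indep_bound n C2 1"
    "\<forall>g\<in>C1. pair n (label_relation L1) g = 0" "\<forall>g\<in>C2. pair n (label_relation L2) g = 0"
proof -
  obtain a l m L where book: "book_at n (disc_set p n) f l m {(1, 0), (0, 1), (-1, -1)}"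
    and L: "\<forall>u\<in>{(1, 0), (0, 1), (-1, -1)}. valid_label p n (L u)"
    "\<forall>u\<in>{(1, 0), (0, 1), (-1, -1)}. \<forall>w\<in>{(1, 0), (0, 1), (-1, -1)}. compatible_labels p (L u) (L w)"
    "\<forall>u\<in>{(1, 0), (0, 1), (-1, -1)}. \<forall>g. pair n (ray_normal l m u) g = 0 \<longrightarrow> pair n (label_relation (L u)) g = 0"
    by (rule tripod_book[OF tri f(2)], rule that, assumption+)
  obtain u w where uw: "u \<in> {(1, 0), (0, 1), (-1, -1)}" "w \<in> {(1, 0), (0, 1), (-1, -1)}" "u \<noteq> w"
    "indep_bound n C1 1" "indep_bound n C2 1"
    "\<forall>g\<in>C1. pair n (ray_normal l m u) g = 0" "\<forall>g\<in>C2. pair n (ray_normal l m w) g = 0"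
    by (rule adjacent_book_cones[OF adj f(1) book])
  show thesis
  proof (rule that[of "L u" "L w"])
    show "valid_label p n (L u)" "valid_label p n (L w)" using bspec[OF L(1) uw(1)] bspec[OF L(1) uw(2)] .
    show "compatible_labels p (L u) (L w)" using bspec[OF bspec[OF L(2) uw(1)] uw(2)] .
    show "indep_bound n C1 1" "indep_bound n C2 1" by fact+
    show "\<forall>g\<in>C1. pair n (label_relation (L u)) g = 0" using bspec[OF L(3) uw(1)] uw(6) by simp
    show "\<forall>g\<in>C2. pair n (label_relation (L w)) g = 0" using bspec[OF L(3) uw(2)] uw(7) by simp
  qed
qed

text \<open>The page of an exponent is labelled by the three others. So the cone over
  \<open>w1\<close> involves \<open>w2\<close> and conversely, and \<open>i\<close>,
  \<open>j\<close> are the two exponents common to both.\<close>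

lemma tetrapod_adjacent_labels:
  assumes adj: "adjacent_cones n (Fan n) C1 C2" and f: "f \<in> C1 \<inter> C2" "f \<in> trop_polys n" and tet: "tetrapod_at n f"
  obtains i j k l where "has_label p v n C1 (LabelI i j k)" "has_label p v n C2 (LabelI i j l)"
    "distinct [i mod p, j mod p, k mod p, l mod p]" "indep_bound n C1 1" "indep_bound n C2 1"
proof -
  obtain a l m W ray where "{a. is_root p n f a} = {a}" and book: "book_at n (disc_set p n) f l m (ray ` W)"
    and W: "card W = 4" "W \<subseteq> {..n}" "inj_on (\<lambda>r. r mod p) W"
    and cr: "\<forall>w\<in>W. \<forall>w'\<in>W. w \<noteq> w' \<longrightarrow> cross (ray w) (ray w') \<noteq> 0"
    and rel0: "\<forall>w\<in>W. \<forall>g r s t. pair n (ray_normal l m (ray w)) g = 0 \<longrightarrow> {r, s, t} \<subseteq> W - {w} \<longrightarrow> r \<noteq> s \<longrightarrow>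
       pair n (gap r s t s) g = 0"
    by (rule tetrapod_book[OF tet f(2)])
  have rel: "pair n (gap r s t s) g = 0"
    if "w \<in> W" "pair n (ray_normal l m (ray w)) g = 0" "{r, s, t} \<subseteq> W - {w}" "r \<noteq> s" for w g r s t
    using rel0 that by blast
  obtain u1 u2 where u12: "u1 \<in> ray ` W" "u2 \<in> ray ` W" "u1 \<noteq> u2" and ib: "indep_bound n C1 1" "indep_bound n C2 1"
    and van: "\<forall>g\<in>C1. pair n (ray_normal l m u1) g = 0" "\<forall>g\<in>C2. pair n (ray_normal l m u2) g = 0"
    by (rule adjacent_book_cones[OF adj f(1) book])
  obtain w1 w2 where w: "w1 \<in> W" "w2 \<in> W" "w1 \<noteq> w2" "u1 = ray w1" "u2 = ray w2" using u12 by blast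
  have "card (W - {w1, w2}) = 2" using W(1) w by (simp add: card_Diff_subset)
  then obtain i j where ij: "W - {w1, w2} = {i, j}" "i \<noteq> j" by (auto simp: card_2_iff)
  have mem: "i \<in> W" "j \<in> W" "i \<noteq> w1" "i \<noteq> w2" "j \<noteq> w1" "j \<noteq> w2" using ij by auto
  have dm: "distinct [i mod p, j mod p, w2 mod p, w1 mod p]"
    using inj_on_eq_iff[OF W(3)] mem w ij(2) by simp
  have le: "i \<le> n" "j \<le> n" "w1 \<le> n" "w2 \<le> n" using mem w W(2) by auto
  have C: "C1 \<in> Fan n" "C2 \<in> Fan n" using adjacent_subset[OF adj] by auto
  have "has_label p v n C1 (LabelI i j w2)"
  proof (rule has_labelI[OF C(1) ib(1)])
    show "valid_label p n (LabelI i j w2)" using dm le by auto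
    show "pair n (label_relation (LabelI i j w2)) g = 0" if "g \<in> C1" for g
      using rel[OF w(1), of g i j w2] bspec[OF van(1) that] w mem ij(2) by simp
  qed
  moreover have "has_label p v n C2 (LabelI i j w1)"
  proof (rule has_labelI[OF C(2) ib(2)])
    show "valid_label p n (LabelI i j w1)" using dm le by auto
    show "pair n (label_relation (LabelI i j w1)) g = 0" if "g \<in> C2" for g
      using rel[OF w(2), of g i j w1] bspec[OF van(2) that] w mem ij(2) by simp
  qed
  ultimately show thesis using that dm ib by blast
qed

text \<open>The type of a cone is unique, so labels at one generic point decide: compatible ones at
  a tripod, two of type I at a tetrapod.\<close>

lemma coincident_types:
  assumes adj: "adjacent_cones n (Fan n) C1 C2" and co: "coincident_double_roots v n (C1 \<inter> C2)"
    and t: "has_type p v n C1 t1" "has_type p v n C2 t2"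
  shows "{t1, t2} \<noteq> {TypeI, TypeIII}"
proof -
  have C: "C1 \<in> Fan n" "C2 \<in> Fan n" using adjacent_subset[OF adj] by auto
  obtain f where f: "f \<in> C1 \<inter> C2" "f \<in> trop_polys n" and cs: "tripod_at n f \<or> tetrapod_at n f"
    using coincident_witness[OF adj co] by metis
  from cs show ?thesis
  proof
    assume tri: "tripod_at n f"
    obtain L1 L2 where L: "valid_label p n L1" "valid_label p n L2"
      "compatible_labels p L1 L2" "indep_bound n C1 1" "indep_bound n C2 1"
      "\<forall>g\<in>C1. pair n (label_relation L1) g = 0" "\<forall>g\<in>C2. pair n (label_relation L2) g = 0"
      by (rule tripod_adjacent_labels[OF adj f tri])
    have "t1 = label_type L1" "t2 = label_type L2"
      using has_type_unique[OF C(1) L(4,1) bspec[OF L(6)] t(1)] has_type_unique[OF C(2) L(5,2) bspec[OF L(7)] t(2)] by auto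
    then show ?thesis using L(3) by (simp add: compatible_labels_def)
  next
    assume tet: "tetrapod_at n f"
    obtain i j k l where
      L: "has_label p v n C1 (LabelI i j k)" "has_label p v n C2 (LabelI i j l)" "indep_bound n C1 1" "indep_bound n C2 1"
      by (rule tetrapod_adjacent_labels[OF adj f tet], rule that, assumption+)
    have "t1 = TypeI"
      using has_type_unique[OF C(1) L(3) _ has_label_relation[OF C(1) L(1)] t(1)] L(1) by (simp add: has_label_def)
    moreover have "t2 = TypeI"
      using has_type_unique[OF C(2) L(4) _ has_label_relation[OF C(2) L(2)] t(2)] L(2) by (simp add: has_label_def)
    ultimately show ?thesis by simp
  qed
qed

text \<open>The shape at one point decides both the count and the condition. At a tripod, labels as
  in the condition would have the supports of the page labels, which
  \<open>compatible_labels\<close> forbids; at a tetrapod they exist.\<close>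

lemma count_coincident:
  assumes adj: "adjacent_cones n (Fan n) C1 C2" and co: "coincident_double_roots v n (C1 \<inter> C2)"
  shows "num_maximal_cones_with_face (Fan n) (C1 \<inter> C2) =
          (if \<exists>i j k l. has_label p v n C1 (LabelI i j k) \<and> has_label p v n C2 (LabelI i j l) \<and>
                        distinct [i mod p, j mod p, k mod p, l mod p]
           then 4 else 3)"
proof -
  have C: "C1 \<in> Fan n" "C2 \<in> Fan n" using adjacent_subset[OF adj] by auto
  obtain f where f: "f \<in> C1 \<inter> C2" "f \<in> trop_polys n" and cs: "tripod_at n f \<or> tetrapod_at n f"
    and sub: "\<forall>C\<in>maximal_cones (Fan n). f \<in> C \<longrightarrow> C1 \<inter> C2 \<subseteq> C"
    using coincident_witness[OF adj co] by metis
  from cs show ?thesis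
  proof
    assume tri: "tripod_at n f"
    obtain a l m L where book: "book_at n (disc_set p n) f l m {(1, 0), (0, 1), (-1, -1)}"
      by (rule tripod_book[OF tri f(2)], rule that, assumption+)
    have num: "num_maximal_cones_with_face (Fan n) (C1 \<inter> C2) = 3"
      using card_faces_of_book[OF adj f(1) sub book] by simp
    have "\<not> (has_label p v n C1 (LabelI i j k) \<and> has_label p v n C2 (LabelI i j l) \<and>
                        distinct [i mod p, j mod p, k mod p, l mod p])" for i j k l
    proof
      assume h: "has_label p v n C1 (LabelI i j k) \<and> has_label p v n C2 (LabelI i j l) \<and>
                        distinct [i mod p, j mod p, k mod p, l mod p]"
      obtain L1 L2 where L: "valid_label p n L1" "valid_label p n L2"
        "compatible_labels p L1 L2" "indep_bound n C1 1" "indep_bound n C2 1"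
        "\<forall>g\<in>C1. pair n (label_relation L1) g = 0" "\<forall>g\<in>C2. pair n (label_relation L2) g = 0"
        by (rule tripod_adjacent_labels[OF adj f tri])
      have v: "valid_label p n (LabelI i j k)" "valid_label p n (LabelI i j l)" using h by (auto simp: has_label_def)
      have "label_support L1 = {i, j, k}"
        using label_supports_eq[OF L(4,1) v(1) bspec[OF L(6)] has_label_relation[OF C(1)]] h by simp
      moreover have "label_support L2 = {i, j, l}"
        using label_supports_eq[OF L(5,2) v(2) bspec[OF L(7)] has_label_relation[OF C(2)]] h by simp
      ultimately have U: "label_support L1 \<union> label_support L2 = {i, j, k, l}" by auto
      have "inj_on (\<lambda>r. r mod p) {i, j, k, l}" "card {i, j, k, l} = 4"
      proof -
        have d: "i mod p \<noteq> j mod p" "i mod p \<noteq> k mod p" "i mod p \<noteq> l mod p" "j mod p \<noteq> k mod p"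
          "j mod p \<noteq> l mod p" "k mod p \<noteq> l mod p" using h by auto
        then show "inj_on (\<lambda>r. r mod p) {i, j, k, l}" by (auto simp: inj_on_def)
        have "i \<noteq> j" "i \<noteq> k" "i \<noteq> l" "j \<noteq> k" "j \<noteq> l" "k \<noteq> l" using d by auto
        then show "card {i, j, k, l} = 4" by simp
      qed
      then show False using L(3) unfolding compatible_labels_def U by blast
    qed
    then show ?thesis using num by simp
  next
    assume tet: "tetrapod_at n f"
    obtain a l m W ray where "{a. is_root p n f a} = {a}" and book: "book_at n (disc_set p n) f l m (ray ` W)"
    and W: "card W = 4" "W \<subseteq> {..n}" "inj_on (\<lambda>r. r mod p) W"
    and cr: "\<forall>w\<in>W. \<forall>w'\<in>W. w \<noteq> w' \<longrightarrow> cross (ray w) (ray w') \<noteq> 0"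
    and rel0: "\<forall>w\<in>W. \<forall>g r s t. pair n (ray_normal l m (ray w)) g = 0 \<longrightarrow> {r, s, t} \<subseteq> W - {w} \<longrightarrow> r \<noteq> s \<longrightarrow>
       pair n (gap r s t s) g = 0"
    by (rule tetrapod_book[OF tet f(2)])
    have c0: "cross u u = 0" for u by (simp add: cross_def)
    have "inj_on ray W"
    proof (rule inj_onI, rule ccontr)
      fix w w' assume "w \<in> W" "w' \<in> W" "ray w = ray w'" "w \<noteq> w'"
      then show False using cr c0[of "ray w"] by metis
    qed
    then have num: "num_maximal_cones_with_face (Fan n) (C1 \<inter> C2) = 4"
      using card_faces_of_book[OF adj f(1) sub book] W(1) by (simp add: card_image)
    have "\<exists>i j k l. has_label p v n C1 (LabelI i j k) \<and> has_label p v n C2 (LabelI i j l) \<and>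
                        distinct [i mod p, j mod p, k mod p, l mod p]"
    proof -
      obtain i j k l where "has_label p v n C1 (LabelI i j k)" "has_label p v n C2 (LabelI i j l)"
        "distinct [i mod p, j mod p, k mod p, l mod p]" "indep_bound n C1 1" "indep_bound n C2 1"
        by (rule tetrapod_adjacent_labels[OF adj f tet])
      then show ?thesis by (intro exI conjI)
    qed
    then show ?thesis using num by simp
  qed
qed

text \<open>The hyperplanes of two transversal pages meet in the spine, of dimension
  \<open>n - 1\<close>, and near \<open>f\<close> both cones contain it. A single polynomial thus
  produces a pair of adjacent cones.\<close>

lemma book_adjacent:
  assumes book: "book_at n (disc_set p n) f l m R" and uw: "u \<in> R" "w \<in> R" "cross u w \<noteq> 0"
  obtains C1 C2 where "adjacent_cones n (Fan n) C1 C2" "f \<in> C1 \<inter> C2"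
    "\<forall>C\<in>maximal_cones (Fan n). f \<in> C \<longrightarrow> C1 \<inter> C2 \<subseteq> C"
    "indep_bound n C1 1" "indep_bound n C2 1"
    "\<forall>g\<in>C1. pair n (ray_normal l m u) g = 0" "\<forall>g\<in>C2. pair n (ray_normal l m w) g = 0"
proof -
  interpret coarsest_fan n "disc_set p n" "Fan n" by (rule fan_locale)
  obtain K where "pages n f l m R K" using book_pages[OF book] .
  note K = pagesD[OF this]
  obtain e where e: "e > 0" and spine: "\<And>u g. u \<in> R \<Longrightarrow> g \<in> trop_polys n \<Longrightarrow> g \<in> coord_box n f e \<Longrightarrow>
      pair n l g = 0 \<Longrightarrow> pair n m g = 0 \<Longrightarrow> g \<in> K u" using K(7) by blast
  have fV: "f \<in> trop_polys n" and f0: "pair n l f = 0" "pair n m f = 0" using book unfolding book_at_def by blast+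
  obtain x y where xy: "x \<in> trop_polys n" "y \<in> trop_polys n"
    "pair n l x = 1" "pair n m x = 0" "pair n l y = 0" "pair n m y = 1"
    using book unfolding book_at_def by blast
  let ?D = "K u \<inter> K w"
  have KF: "K u \<in> Fan n" "K w \<in> Fan n"
    using maximal_in_fan[OF K(1)[OF uw(1)]] maximal_in_fan[OF K(1)[OF uw(2)]] .
  have D: "?D \<in> Fan n" by (rule Int_in_fan[OF KF])
  have DV: "?D \<subseteq> trop_polys n" using cone_sub[OF D] X_sub by blast
  have ker: "pair n l g = 0 \<and> pair n m g = 0" if "g \<in> ?D" for g
  proof -
    have "snd u * pair n l g = fst u * pair n m g" "snd w * pair n l g = fst w * pair n m g"
      using K(5)[OF uw(1), of g] K(5)[OF uw(2), of g] that by (auto simp: pair_ray_normal)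
    then have "cross u w * pair n l g = 0" "cross u w * pair n m g = 0" unfolding cross_def by algebra+
    then show ?thesis using uw(3) by simp
  qed
  have fD: "f \<in> ?D" using K(2) uw by blast
  have dim: "dim ?D + 1 = n"
    by (rule dim_kernel_of_two[OF DV fD e xy ker]) (use spine uw in auto)
  have "cross u u = 0" by (simp add: cross_def)
  then have "u \<noteq> w" using uw(3) by auto
  then have ne: "K u \<noteq> K w" using K(3) uw by (auto dest: inj_onD)
  have adj: "adjacent_cones n (Fan n) (K u) (K w)"
    using K(1) uw ne dim by (simp add: adjacent_cones_def)
  \<comment> \<open>The intersection contains a neighbourhood of \<open>f\<close> in the spine, so
    every segment in it that ends at \<open>f\<close> can be prolonged: a face through
    \<open>f\<close> is everything.\<close>
  have sub: "?D \<subseteq> C" if C: "C \<in> maximal_cones (Fan n)" "f \<in> C" for C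
  proof
    fix g assume g: "g \<in> ?D"
    obtain d where d: "d > 0" "\<And>t. \<bar>t\<bar> \<le> d \<Longrightarrow> f + t *\<^sub>R (f - g) \<in> coord_box n f e"
      using coord_box_segment[OF fV e] by metis
    have gV: "g \<in> trop_polys n" using g DV by blast
    have "f + d *\<^sub>R (f - g) \<in> ?D"
      using d ker[OF g] f0 fV gV uw
      by (intro IntI spine) (auto simp: pair_simps trop_polys_add trop_polys_diff trop_polys_scale)
    moreover have "(?D \<inter> C) face_of ?D" by (rule Int_face[OF D maximal_in_fan[OF C(1)]])
    ultimately have "g \<in> ?D \<inter> C" using face_of_core[of "?D \<inter> C" ?D f d g] fD C(2) d(1) g by blast
    then show "g \<in> C" by blast
  qed
  have ib: "indep_bound n (K u) 1" if "u \<in> R" for u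
    by (rule indep_bound_line) (rule K(6)[OF that], blast)
  show thesis
    by (rule that[OF adj fD _ ib[OF uw(1)] ib[OF uw(2)]]) (use sub uw K(5) in blast)+
qed

lemma has_typeI:
  assumes "C \<in> Fan n" "indep_bound n C 1" "valid_label p n L" "\<And>g. g \<in> C \<Longrightarrow> pair n (label_relation L) g = 0"
  shows "has_type p v n C (label_type L)"
  using has_labelI[OF assms] by (auto simp: has_type_def)

lemma book_types:
  assumes book: "book_at n (disc_set p n) f l m R" and uw: "u \<in> R" "w \<in> R" "cross u w \<noteq> 0"
    and L: "valid_label p n L" "\<And>g. pair n (ray_normal l m u) g = 0 \<Longrightarrow> pair n (label_relation L) g = 0"
    and L': "valid_label p n L'" "\<And>g. pair n (ray_normal l m w) g = 0 \<Longrightarrow> pair n (label_relation L') g = 0"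
  obtains C1 C2 where "adjacent_cones n (Fan n) C1 C2" "f \<in> C1 \<inter> C2"
    "\<forall>C\<in>maximal_cones (Fan n). f \<in> C \<longrightarrow> C1 \<inter> C2 \<subseteq> C"
    "has_type p v n C1 (label_type L)" "has_type p v n C2 (label_type L')"
proof -
  obtain C1 C2 where C: "adjacent_cones n (Fan n) C1 C2" "f \<in> C1 \<inter> C2"
    "\<forall>C\<in>maximal_cones (Fan n). f \<in> C \<longrightarrow> C1 \<inter> C2 \<subseteq> C" "indep_bound n C1 1" "indep_bound n C2 1"
    "\<forall>g\<in>C1. pair n (ray_normal l m u) g = 0" "\<forall>g\<in>C2. pair n (ray_normal l m w) g = 0"
    by (rule book_adjacent[OF book uw])
  note F = adjacent_subset(1,2)[OF C(1)]
  have "has_type p v n C1 (label_type L)"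
    using C(6) L(2) by (intro has_typeI[OF F(1) C(4) L(1)]) blast
  moreover have "has_type p v n C2 (label_type L')"
    using C(7) L'(2) by (intro has_typeI[OF F(2) C(5) L'(1)]) blast
  ultimately show thesis using that C(1,2,3) by blast
qed

lemma tripod_types:
  assumes fV: "f \<in> trop_polys n" and roots: "{a. is_root p n f a} = {a}"
    and tri: "tripod_root p n (ht f a) i j x y z" and lab: "tripod_labels p n i j x y z L1 L2 L3"
    and uw: "u \<in> {(1, 0), (0, 1), (-1, -1)}" "w \<in> {(1, 0), (0, 1), (-1, -1)}" "u \<noteq> w"
  shows "\<exists>C1 C2. adjacent_cones n (Fan n) C1 C2 \<and> coincident_double_roots v n (C1 \<inter> C2) \<and>
    has_type p v n C1 (label_type (tripod_label L1 L2 L3 u)) \<and> has_type p v n C2 (label_type (tripod_label L1 L2 L3 w))"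
proof -
  have cr: "cross u w \<noteq> 0" using uw by (auto simp: cross_def)
  obtain C1 C2 where C: "adjacent_cones n (Fan n) C1 C2" "f \<in> C1 \<inter> C2"
    "\<forall>C\<in>maximal_cones (Fan n). f \<in> C \<longrightarrow> C1 \<inter> C2 \<subseteq> C"
    "has_type p v n C1 (label_type (tripod_label L1 L2 L3 u))" "has_type p v n C2 (label_type (tripod_label L1 L2 L3 w))"
    by (rule book_types[OF book_tripod[OF p_pos fV roots tri] uw(1,2) cr tripod_label_valid(1)[OF lab]
          tripod_label_relation[OF tri lab uw(1)] tripod_label_valid(1)[OF lab] tripod_label_relation[OF tri lab uw(2)]])
  have "tripod_at n f" unfolding tripod_at_def using roots tri lab by blast
  then have "\<not> has_opposite_cones n (C1 \<inter> C2)" using coincident_no_opposite[OF _ C(2) fV] by blast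
  then have "coincident_double_roots v n (C1 \<inter> C2)" by (rule coincident_if_not_opposite[OF C(1)])
  then show ?thesis using C(1,4,5) by blast
qed

lemma crossing_types:
  assumes fV: "f \<in> trop_polys n" and roots: "{a. is_root p n f a} = {a1, a2}" "a1 \<noteq> a2"
    and flat1: "flat_root p n (ht f a1) i j q b" and L1: "valid_label p n L1" "label_relation L1 = gap i j q b"
    and flat2: "flat_root p n (ht f a2) i' j' q' b'" and L2: "valid_label p n L2" "label_relation L2 = gap i' j' q' b'"
  shows "\<exists>C1 C2. adjacent_cones n (Fan n) C1 C2 \<and> distinct_double_roots v n (C1 \<inter> C2) \<and>
    has_type p v n C1 (label_type L1) \<and> has_type p v n C2 (label_type L2)"
proof -
  have book: "book_at n (disc_set p n) f (gap i j q b) (gap i' j' q' b') {(1, 0), (-1, 0), (0, 1), (0, -1)}"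
    by (rule book_crossing[OF p_pos fV roots flat1 flat2])
  \<comment> \<open>The page over \<open>(0, 1)\<close> is the one in the hyperplane of the first
    root, hence the order of the two rays.\<close>
  have in4: "(0, 1) \<in> {(1, 0), (-1, 0), (0, 1), (0 :: real, -1 :: real)}" "(1, 0) \<in> {(1, 0), (-1, 0), (0, 1), (0 :: real, -1 :: real)}"
    by auto
  have cr: "cross (0, 1) (1, 0) \<noteq> 0" by (simp add: cross_def)
  obtain C1 C2 where C: "adjacent_cones n (Fan n) C1 C2" "f \<in> C1 \<inter> C2"
    "\<forall>C\<in>maximal_cones (Fan n). f \<in> C \<longrightarrow> C1 \<inter> C2 \<subseteq> C"
    "has_type p v n C1 (label_type L1)" "has_type p v n C2 (label_type L2)"
  proof (rule book_types[OF book in4 cr L1(1) _ L2(1)])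
    show "pair n (label_relation L1) g = 0" if "pair n (ray_normal (gap i j q b) (gap i' j' q' b') (0, 1)) g = 0" for g
      using that by (simp add: pair_ray_normal L1)
    show "pair n (label_relation L2) g = 0" if "pair n (ray_normal (gap i j q b) (gap i' j' q' b') (1, 0)) g = 0" for g
      using that by (simp add: pair_ray_normal L2)
  qed
  have "crossing_at n f" unfolding crossing_at_def using roots book by blast
  then have "has_opposite_cones n (C1 \<inter> C2)" using crossing_has_opposite[of n f "C1 \<inter> C2"] C(3) by blast
  then have "distinct_double_roots v n (C1 \<inter> C2)" by (rule distinct_if_opposite[OF C(1)])
  then show ?thesis using C(1,4,5) by blast
qed

end

section \<open>Explicit polynomials for the pairs of types that occur\<close>

section \<open>Realisation of the pairs of types\<close>

lemma argmin_set_eqI: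
  assumes "S \<subseteq> T" "S \<noteq> {}" "\<And>r. r \<in> S \<Longrightarrow> k r = K" "\<And>r. r \<in> T \<Longrightarrow> r \<notin> S \<Longrightarrow> K < k r"
  shows "argmin_set T k = S"
proof
  obtain s where s: "s \<in> S" using assms(2) by blast
  show "argmin_set T k \<subseteq> S"
  proof (rule subsetI, rule ccontr)
    fix r assume "r \<in> argmin_set T k" "r \<notin> S"
    then have "k r \<le> k s" "K < k r" using assms(1,4) s by (auto simp: argmin_set_def)
    then show False using assms(3)[OF s] by simp
  qed
  show "S \<subseteq> argmin_set T k"
  proof
    fix r assume r: "r \<in> S"
    have "k r \<le> k q" if "q \<in> T" for q
      using assms(3)[OF r] assms(3)[of q] assms(4)[OF that] by (cases "q \<in> S") auto
    then show "r \<in> argmin_set T k" using r assms(1) by (auto simp: argmin_set_def)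
  qed
qed

text \<open>A block is an interval of exponents realising one type at one root: the zeros are
  lowest, the halves lie 1/2 higher and all others at least 1 higher. Type III has length
  \<open>2 * p\<close> because an interval of length \<open>p\<close> has no congruent pair strictly
  inside.\<close>

fun block_length :: "nat \<Rightarrow> cone_type \<Rightarrow> nat" where
  "block_length p TypeI = 2"
| "block_length p TypeII = p"
| "block_length p TypeIII = 2 * p"

fun block_zeros :: "nat \<Rightarrow> cone_type \<Rightarrow> nat set" where
  "block_zeros p TypeI = {0, 1, 2}"
| "block_zeros p TypeII = {0, p}"
| "block_zeros p TypeIII = {0, 2 * p}"

fun block_halves :: "nat \<Rightarrow> cone_type \<Rightarrow> nat set" where
  "block_halves p TypeI = {}"
| "block_halves p TypeII = {1, 2}"
| "block_halves p TypeIII = {1, p + 1}"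

lemma add_mod_cancel: "(m + a) mod p = (m + b) mod p \<longleftrightarrow> a mod p = b mod (p::nat)"
  using cong_add_lcancel_nat[of m a b p] by (simp add: cong_def)

text \<open>A shift by \<open>m\<close> preserves congruences between exponents, so one verification
  serves blocks at every position.\<close>

lemma flat_root_block:
  assumes p: "p > 2"
    and Z: "\<And>z. z \<in> block_zeros p t \<Longrightarrow> m + z \<le> n \<and> k (m + z) = K"
    and H: "\<And>z. z \<in> block_halves p t \<Longrightarrow> m + z \<le> n \<and> k (m + z) = K + 1 / 2"
    and O: "\<And>r. r \<le> n \<Longrightarrow> r \<notin> (+) m ` (block_zeros p t \<union> block_halves p t) \<Longrightarrow> K + 1 \<le> k r"
  shows "\<exists>L i j q b. valid_label p n L \<and> label_type L = t \<and> label_relation L = gap i j q b \<and> flat_root p n k i j q b"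
proof -
  have md: "1 mod p = 1" "2 mod p = 2" "(p + 1) mod p = 1" using p by (simp_all add: mod_Suc)
  have "block_zeros p t \<noteq> {}" by (cases t) auto
  moreover have "K < k r" if "r \<in> {..n}" "r \<notin> (+) m ` block_zeros p t" for r
  proof (cases "r \<in> (+) m ` block_halves p t")
    case True
    then show ?thesis using H by fastforce
  next
    case False
    then have "K + 1 \<le> k r" using that by (intro O) auto
    then show ?thesis by simp
  qed
  ultimately have M: "min_set n k = (+) m ` block_zeros p t"
    using Z by (intro argmin_set_eqI[of _ _ _ K]) auto
  show ?thesis
  proof (cases t)
    case TypeI
    have M3: "min_set n k = {m, m + 1, m + 2}" using M TypeI by auto
    have r: "m mod p \<noteq> (m + 1) mod p" "m mod p \<noteq> (m + 2) mod p" "(m + 1) mod p \<noteq> (m + 2) mod p"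
      using add_mod_cancel[of m 0 p 1] add_mod_cancel[of m 0 p 2] add_mod_cancel[of m 1 p 2] md by auto
    have "m + 0 \<le> n" "m + 1 \<le> n" "m + 2 \<le> n" using Z[of 0] Z[of 1] Z[of 2] TypeI by simp_all
    then have "valid_label p n (LabelI m (m + 1) (m + 2))" using r by simp
    then show ?thesis using flat_root_I[OF M3 r] TypeI
      by (intro exI[of _ "LabelI m (m + 1) (m + 2)"] exI[of _ m] exI[of _ "m + 1"] exI[of _ "m + 2"] exI[of _ "m + 1"]) simp
  next
    case TypeII
    have M2: "min_set n k = {m, m + p}" using M TypeII by auto
    have r: "(m + p) mod p = m mod p" "(m + 1) mod p \<noteq> m mod p" "(m + 2) mod p \<noteq> m mod p" "(m + 1) mod p \<noteq> (m + 2) mod p"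
      using add_mod_cancel[of m 1 p 0] add_mod_cancel[of m 2 p 0] add_mod_cancel[of m 1 p 2] md by auto
    have H2: "m + 1 \<le> n" "m + 2 \<le> n" "k (m + 1) = K + 1 / 2" "k (m + 2) = K + 1 / 2" using H[of 1] H[of 2] TypeII by simp_all
    have Z2: "m + 0 \<le> n" "m + p \<le> n" using Z[of 0] Z[of p] TypeII by simp_all
    have N: "argmin_set (off_class p n (m mod p)) k = {m + 1, m + 2}"
    proof (rule argmin_set_eqI)
      show "{m + 1, m + 2} \<subseteq> off_class p n (m mod p)" using r H2 by (auto simp: off_class_def)
      show "k s = K + 1 / 2" if "s \<in> {m + 1, m + 2}" for s using that H2 by auto
      fix s assume s: "s \<in> off_class p n (m mod p)" "s \<notin> {m + 1, m + 2}"
      then have "s \<noteq> m" "s \<noteq> m + p" "s \<le> n" using r by (auto simp: off_class_def)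
      then have "K + 1 \<le> k s" using s(2) TypeII by (intro O) auto
      then show "K + 1 / 2 < k s" by simp
    qed simp
    have f: "flat_root p n k m (m + p) (m + 1) (m + 2)"
      using M2 N r p by (intro flat_root_two_step) auto
    have "valid_label p n (LabelII m (m + p) (m + 1) (m + 2))" using r H2 Z2 p by simp
    then show ?thesis using f TypeII
      by (intro exI[of _ "LabelII m (m + p) (m + 1) (m + 2)"] exI[of _ m] exI[of _ "m + p"] exI[of _ "m + 1"] exI[of _ "m + 2"]) simp
  next
    case TypeIII
    have M2: "min_set n k = {m, m + 2 * p}" using M TypeIII by auto
    have r: "(m + 2 * p) mod p = m mod p" "(m + 1) mod p \<noteq> m mod p" "(m + (p + 1)) mod p = (m + 1) mod p"
      using add_mod_cancel[of m 1 p 0] add_mod_cancel[of m "p + 1" p 1] md by auto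
    have H2: "m + 1 \<le> n" "m + (p + 1) \<le> n" "k (m + 1) = K + 1 / 2" "k (m + (p + 1)) = K + 1 / 2"
      using H[of 1] H[of "p + 1"] TypeIII by simp_all
    have Z2: "m + 0 \<le> n" "m + 2 * p \<le> n" using Z[of 0] Z[of "2 * p"] TypeIII by simp_all
    have N: "argmin_set (off_class p n (m mod p)) k = {m + 1, m + (p + 1)}"
    proof (rule argmin_set_eqI)
      show "{m + 1, m + (p + 1)} \<subseteq> off_class p n (m mod p)" using r H2 by (simp add: off_class_def)
      show "k s = K + 1 / 2" if "s \<in> {m + 1, m + (p + 1)}" for s using that H2 by blast
      fix s assume s: "s \<in> off_class p n (m mod p)" "s \<notin> {m + 1, m + (p + 1)}"
      then have "s \<noteq> m" "s \<noteq> m + 2 * p" "s \<le> n" using r by (auto simp: off_class_def)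
      then have "K + 1 \<le> k s" using s(2) TypeIII by (intro O) auto
      then show "K + 1 / 2 < k s" by simp
    qed simp
    have f: "flat_root p n k m (m + 2 * p) (m + 1) (m + (p + 1))"
      using M2 N r p by (intro flat_root_two_step) simp_all
    have "valid_label p n (LabelIII m (m + 2 * p) (m + 1) (m + (p + 1)))" using r H2 Z2 p by simp
    then show ?thesis using f TypeIII
      by (intro exI[of _ "LabelIII m (m + 2 * p) (m + 1) (m + (p + 1))"] exI[of _ m] exI[of _ "m + 2 * p"]
          exI[of _ "m + 1"] exI[of _ "m + (p + 1)"]) simp
  qed
qed

lemma root_heights_if_local_root: "local_root p n k k \<Longrightarrow> root_heights p n k"
proof -
  assume l: "local_root p n k k"
  have "min_twice (off_class p n c) k" for c
  proof -
    have t: "min_twice (argmin_set (off_class p n c) k) k" using l by (simp add: local_root_def)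
    then have "argmin_set (off_class p n c) k \<noteq> {}" unfolding min_twice_def by blast
    then show ?thesis using min_twice_refine[of "off_class p n c" k k] t by blast
  qed
  then show ?thesis by (simp add: root_heights_def)
qed

lemma root_min_twice:
  assumes "p > 0" "root_heights p n k" shows "min_twice {..n} k"
proof -
  have "r mod p \<noteq> p" for r using mod_less_divisor[OF assms(1), of r] by linarith
  then have "off_class p n p = {..n}" by (auto simp: off_class_def)
  then show ?thesis using assms(2) by (metis root_heights_def)
qed

lemma no_root_if_strict_min:
  assumes "p > 0" "s \<le> n" "\<And>r. r \<le> n \<Longrightarrow> r \<noteq> s \<Longrightarrow> k s < k r"
  shows "\<not> root_heights p n k"
proof
  assume "root_heights p n k"
  then have "min_twice {..n} k" by (rule root_min_twice[OF assms(1)])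
  then obtain r r' where "r \<in> {..n}" "r' \<in> {..n}" and ne: "r \<noteq> r'" "k r = k r'" and "\<forall>q\<in>{..n}. k r \<le> k q"
    unfolding min_twice_def by blast
  then have r: "r \<le> n" "r' \<le> n" "r \<noteq> r'" "k r = k r'" "\<forall>q\<le>n. k r \<le> k q" by simp_all
  then have "k r \<le> k s" "k r' \<le> k s" using assms(2) by auto
  then show False using assms(3)[of r] assms(3)[of r'] r by (metis leD)
qed

lemma block_bounds:
  assumes "p > 2"
  shows "0 \<in> block_zeros p t" "block_length p t \<in> block_zeros p t"
    "\<And>z. z \<in> block_zeros p t \<Longrightarrow> z \<le> block_length p t"
    "\<And>z. z \<in> block_halves p t \<Longrightarrow> 0 < z \<and> z < block_length p t"
    "block_zeros p t \<inter> block_halves p t = {}"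
  using assms by (cases t; auto)+

text \<open>The Newton polygon has two edges, of slopes 0 and 1, meeting at \<open>m\<close>; they
  carry the two blocks and give the roots 0 and -1. The perturbation \<open>e\<close> vanishes at
  the vertices \<open>0\<close>, \<open>m\<close>, \<open>n\<close> and shapes the edges to the
  wanted types.\<close>

lemma two_block_polynomial:
  assumes p: "p > 2"
  obtains n f i j q b L i' j' q' b' L' where "f \<in> trop_polys n" "{a. is_root p n f a} = {0, -1}"
    "flat_root p n (ht f 0) i j q b" "valid_label p n L" "label_relation L = gap i j q b" "label_type L = t"
    "flat_root p n (ht f (-1)) i' j' q' b'" "valid_label p n L'" "label_relation L' = gap i' j' q' b'" "label_type L' = t'"
proof -
  let ?Z = "block_zeros p t" and ?Z' = "block_zeros p t'" and ?H = "block_halves p t" and ?H' = "block_halves p t'"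
  define m where "m = block_length p t"
  define n where "n = m + block_length p t'"
  note B = block_bounds[OF p, where t = t, folded m_def] and B' = block_bounds[OF p, where t = t']
  define e :: "nat \<Rightarrow> real" where
    "e r = (if r \<in> ?Z \<union> (+) m ` ?Z' then 0 else if r \<in> ?H \<union> (+) m ` ?H' then 1 / 2 else 1)" for r
  \<comment> \<open>\<open>r - m\<close> is truncated subtraction: zero up to \<open>m\<close>,
    slope one beyond.\<close>
  define f where "f = of_coords n (\<lambda>r. real (r - m) + e r)"
  have fV: "f \<in> trop_polys n" by (simp add: f_def)
  have ht: "ht f a r = real (r - m) + e r + real r * a" if "r \<le> n" for r a using that by (simp add: f_def ht_def)
  have e0: "0 \<le> e r" for r by (simp add: e_def)
  have ev: "e 0 = 0" "e m = 0" "e n = 0" using B(1,2) B'(2) by (auto simp: e_def n_def)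
  have mn: "m \<le> n" by (simp add: n_def)
  have roots: "a \<in> {0, -1}" if root: "is_root p n f a" for a
  proof (rule ccontr)
    assume "a \<notin> {0, -1}"
    \<comment> \<open>In these three ranges the vertex \<open>0\<close>, \<open>m\<close> or
      \<open>n\<close>, respectively, is the unique lowest exponent.\<close>
    then consider "a > 0" | "-1 < a" "a < 0" | "a < -1" by force
    then show False
    proof cases
      case 1
      have "ht f a 0 < ht f a r" if "r \<le> n" "r \<noteq> 0" for r
      proof -
        have "0 < real r * a" using that 1 by simp
        then show ?thesis using that e0[of r] ev by (simp add: ht)
      qed
      then show False using no_root_if_strict_min[of p 0 n "ht f a"] root p by auto
    next
      case 2
      have "ht f a m < ht f a r" if "r \<le> n" "r \<noteq> m" for r
      proof (cases "r < m")
        case True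
        then have "real m * a < real r * a" using 2 by (simp add: mult_strict_right_mono_neg)
        then show ?thesis using that mn e0[of r] ev True by (simp add: ht)
      next
        case False
        then have "0 < (real r - real m) * (1 + a)" using 2 that by simp
        moreover have "real (r - m) = real r - real m" using False by simp
        ultimately show ?thesis using that mn e0[of r] ev by (simp add: ht algebra_simps)
      qed
      then show False using no_root_if_strict_min[of p m n "ht f a"] root p mn by auto
    next
      case 3
      have nm: "real (n - m) = real n - real m" using mn by simp
      have "ht f a n < ht f a r" if "r \<le> n" "r \<noteq> n" for r
      proof -
        have "(real n - real r) * (1 + a) < 0" using that 3 by (intro mult_pos_neg) auto
        then have *: "real n + real n * a < real r + real r * a" by (simp add: algebra_simps)
        have "real r - real m \<le> real (r - m)" by linarith
        then show ?thesis using * that e0[of r] ev nm by (simp add: ht)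
      qed
      then show False using no_root_if_strict_min[of p n n "ht f a"] root p by auto
    qed
  qed
  have "\<exists>L i j q b. valid_label p n L \<and> label_type L = t \<and> label_relation L = gap i j q b \<and> flat_root p n (ht f 0) i j q b"
  proof (rule flat_root_block[OF p, where m = 0 and K = 0])
    fix z assume z: "z \<in> ?Z"
    then show "0 + z \<le> n \<and> ht f 0 (0 + z) = 0" using B(3)[OF z] mn by (simp add: ht e_def)
  next
    fix z assume z: "z \<in> ?H"
    then have "z \<notin> ?Z" "z < m" using B(4,5) by auto
    then have "e z = 1 / 2" using z by (auto simp: e_def)
    then show "0 + z \<le> n \<and> ht f 0 (0 + z) = 0 + 1 / 2" using B(4)[OF z] mn by (simp add: ht)
  next
    fix r assume r: "r \<le> n" "r \<notin> (+) 0 ` (?Z \<union> ?H)"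
    then have r': "r \<notin> ?Z" "r \<notin> ?H" by auto
    show "0 + 1 \<le> ht f 0 r"
    proof (cases "r \<le> m")
      case True
      have "r \<noteq> m" using r'(1) B(2) by auto
      then have "r \<notin> (+) m ` (?Z' \<union> ?H')" using True by auto
      then have "e r = 1" using r' by (auto simp: e_def)
      then show ?thesis using r(1) by (simp add: ht)
    next
      case False
      then have "1 \<le> real (r - m)" by simp
      then show ?thesis using r(1) e0[of r] by (simp add: ht)
    qed
  qed
  then obtain L i j q b where 1: "valid_label p n L" "label_type L = t" "label_relation L = gap i j q b"
    "flat_root p n (ht f 0) i j q b" by blast
  have "\<exists>L i j q b. valid_label p n L \<and> label_type L = t' \<and> label_relation L = gap i j q b \<and> flat_root p n (ht f (-1)) i j q b"
  proof (rule flat_root_block[OF p, where m = m and K = "- real m"])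
    fix z assume z: "z \<in> ?Z'"
    then show "m + z \<le> n \<and> ht f (-1) (m + z) = - real m" using B'(3)[OF z] by (simp add: ht e_def n_def)
  next
    fix z assume z: "z \<in> ?H'"
    have zb: "0 < z" "z < block_length p t'" using B'(4)[OF z] by auto
    have "m + z \<notin> ?Z" using B(3)[of "m + z"] zb by auto
    moreover have "m + z \<notin> (+) m ` ?Z'" using B'(5) z by auto
    ultimately have "e (m + z) = 1 / 2" using z by (auto simp: e_def)
    then show "m + z \<le> n \<and> ht f (-1) (m + z) = - real m + 1 / 2" using zb by (simp add: ht n_def)
  next
    fix r assume r: "r \<le> n" "r \<notin> (+) m ` (?Z' \<union> ?H')"
    then have r': "r \<notin> (+) m ` ?Z'" "r \<notin> (+) m ` ?H'" by auto
    have "r \<noteq> m" using r'(1) B'(1) by (metis add_0_right imageI)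
    then consider "r < m" | "m < r" by linarith
    then show "- real m + 1 \<le> ht f (-1) r"
    proof cases
      case 1
      then have "real r + 1 \<le> real m" by simp
      then show ?thesis using r(1) e0[of r] 1 by (simp add: ht)
    next
      case 2
      then have "r \<notin> ?Z \<union> ?H" using B(3)[of r] B(4)[of r] by auto
      then have "e r = 1" using r' by (auto simp: e_def)
      then show ?thesis using r(1) 2 by (simp add: ht)
    qed
  qed
  then obtain L' i' j' q' b' where 2: "valid_label p n L'" "label_type L' = t'" "label_relation L' = gap i' j' q' b'"
    "flat_root p n (ht f (-1)) i' j' q' b'" by blast
  have "is_root p n f 0" "is_root p n f (-1)"
    using 1(4) 2(4) by (auto intro!: root_heights_if_local_root simp: flat_root_def)
  then have "{a. is_root p n f a} = {0, -1}" using roots by auto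
  then show thesis using that fV 1 2 by blast
qed

text \<open>Away from \<open>a = 0\<close> the minimum is attained only at one end of the exponent
  range.\<close>

lemma single_root_at_0:
  assumes p: "p > 0" and n: "f \<in> trop_polys n" "n > 0" and nonneg: "\<And>r. r \<le> n \<Longrightarrow> 0 \<le> cf f r"
    and ends: "cf f 0 = 0" "cf f n = 0" and root: "is_root p n f 0"
  shows "{a. is_root p n f a} = {0}"
proof -
  have "a = 0" if r: "is_root p n f a" for a
  proof (rule ccontr)
    assume "a \<noteq> 0"
    then consider "a > 0" | "a < 0" by linarith
    then show False
    proof cases
      case 1
      have "ht f a 0 < ht f a r" if "r \<le> n" "r \<noteq> 0" for r
      proof -
        have "0 < real r * a" using that 1 by simp
        then show ?thesis using nonneg[OF that(1)] ends by (simp add: ht_def)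
      qed
      then show False using no_root_if_strict_min[of p 0 n "ht f a"] r p by auto
    next
      case 2
      have "ht f a n < ht f a r" if "r \<le> n" "r \<noteq> n" for r
      proof -
        have "real n * a < real r * a" using that 2 by (simp add: mult_strict_right_mono_neg)
        then show ?thesis using nonneg[OF that(1)] ends by (simp add: ht_def)
      qed
      then show False using no_root_if_strict_min[of p n n "ht f a"] r p by auto
    qed
  qed
  then show ?thesis using root by auto
qed

lemma root_if_tripod: "tripod_root p n k i j x y z \<Longrightarrow> root_heights p n k"
  by (rule root_heights_if_local_root) (auto simp: tripod_root_def min_twice_three)

context discriminant_fans
begin

lemma distinct_types_exist:
  "\<exists>n C1 C2. adjacent_cones n (Fan n) C1 C2 \<and> distinct_double_roots v n (C1 \<inter> C2) \<and>
    has_type p v n C1 t \<and> has_type p v n C2 t'"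
proof -
  obtain n f i j q b L i' j' q' b' L' where f: "f \<in> trop_polys n" "{a. is_root p n f a} = {0, -1}"
    "flat_root p n (ht f 0) i j q b" "valid_label p n L" "label_relation L = gap i j q b" "label_type L = t"
    "flat_root p n (ht f (-1)) i' j' q' b'" "valid_label p n L'" "label_relation L' = gap i' j' q' b'" "label_type L' = t'"
    by (rule two_block_polynomial[OF p_gt_2])
  have ne: "(0 :: real) \<noteq> -1" by simp
  from crossing_types[OF f(1,2) ne f(3-5) f(7-9)] show ?thesis unfolding f(6,10) by blast
qed

text \<open>Three tripods cover the seven ordered pairs. The exponents \<open>0, p, 1, 2\<close> on
  one level give I, I, II; the pair \<open>0, 2 * p\<close> with \<open>1, p + 1, 2\<close> above
  gives II, II, III; the pair \<open>0, 3 * p\<close> with \<open>1, p + 1, 2 * p + 1\<close> above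
  gives only III.\<close>

lemma coincident_types_exist:
  assumes t: "{t, t'} \<noteq> {TypeI, TypeIII}"
  shows "\<exists>n C1 C2. adjacent_cones n (Fan n) C1 C2 \<and> coincident_double_roots v n (C1 \<inter> C2) \<and>
    has_type p v n C1 t \<and> has_type p v n C2 t'"
proof -
  have md: "1 mod p = 1" "2 mod p = 2" "(p + 1) mod p = 1" using p_gt_2 by (simp_all add: mod_Suc)
  have ht0: "ht f 0 = cf f" for f by (simp add: ht_def fun_eq_iff)
  have R: "(1, 0) \<in> {(1, 0), (0, 1), (-1, -1)}" "(0, 1) \<in> {(1, 0), (0, 1), (-1, -1)}"
    "(-1, -1) \<in> {(1, 0), (0, 1), (-1 :: real, -1 :: real)}" by auto
  have D: "(1, 0) \<noteq> (0, 1 :: real)" "(0 :: real, 1 :: real) \<noteq> (1, 0)" "(1 :: real, 0 :: real) \<noteq> (-1, -1)"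
    "(-1 :: real, -1 :: real) \<noteq> (1, 0)" "(0 :: real, 1 :: real) \<noteq> (-1, -1)" "(-1 :: real, -1 :: real) \<noteq> (0, 1)" by auto
  have T: "tripod_label L1 L2 L3 (0, 1) = L1" "tripod_label L1 L2 L3 (1, 0) = L2" "tripod_label L1 L2 L3 (-1, -1) = L3"
    for L1 L2 L3 by (simp_all add: tripod_label_def)
  define f where "f = of_coords p (\<lambda>r. if r \<in> {0, p, 1, 2} then 0 else 1)"
  have fM: "min_set p (ht f 0) = {0, p, 1, 2}"
    unfolding ht0 using p_gt_2 by (intro argmin_set_eqI[of _ _ _ 0]) (auto simp: f_def)
  note f1 = tripod_root_one_level[OF fM, unfolded mod_self mod_0 md]
  have f2: "tripod_root p p (ht f 0) 1 2 0 p 2"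
    "tripod_labels p p 1 2 0 p 2 (LabelI 1 2 0) (LabelI 1 2 p) (LabelII 0 p 1 2)"
    using p_gt_2 by (intro f1; simp)+
  have fr: "{a. is_root p p f a} = {0}"
    using root_if_tripod[OF f2(1)] p_gt_2 by (intro single_root_at_0) (auto simp: f_def)
  note fT = tripod_types[OF _ fr f2, unfolded T]
  have fV: "f \<in> trop_polys p" by (simp add: f_def)
  define g where "g = of_coords (2 * p) (\<lambda>r. if r \<in> {0, 2 * p} then 0 else if r \<in> {1, p + 1, 2} then 1 / 2 else 1)"
  have gV: "g \<in> trop_polys (2 * p)" by (simp add: g_def)
  have gM: "min_set (2 * p) (ht g 0) = {0, 2 * p}"
    unfolding ht0 using p_gt_2 by (intro argmin_set_eqI[of _ _ _ 0]) (auto simp: g_def)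
  have gN: "argmin_set (off_class p (2 * p) (0 mod p)) (ht g 0) = {1, p + 1, 2}"
  proof (rule argmin_set_eqI)
    show "{1, p + 1, 2} \<subseteq> off_class p (2 * p) (0 mod p)" using p_gt_2 md by (simp add: off_class_def)
    show "ht g 0 s = 1 / 2" if "s \<in> {1, p + 1, 2}" for s
      using that p_gt_2 by (simp add: ht0 g_def) auto
    fix s assume s: "s \<in> off_class p (2 * p) (0 mod p)" "s \<notin> {1, p + 1, 2}"
    then have "s \<le> 2 * p" "s mod p \<noteq> 0" by (simp_all add: off_class_def)
    then have "s \<le> 2 * p" "s \<noteq> 0" "s \<noteq> 2 * p" by (simp, metis mod_0, metis mod_mult_self2_is_0)
    then show "1 / 2 < ht g 0 s" using s(2) by (simp add: ht0 g_def)
  qed simp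
  have "0 \<noteq> 2 * p" "0 mod p = 2 * p mod p" "1 \<noteq> p + 1" "(1::nat) \<noteq> 2" "p + 1 \<noteq> 2" using p_gt_2 by auto
  note g2 = tripod_root_above[OF gM this(1,2) gN this(3,4,5)]
  have gr: "{a. is_root p (2 * p) g a} = {0}"
    using root_if_tripod[OF g2(1)] p_gt_2 by (intro single_root_at_0) (auto simp: g_def)
  have gl: "label_type (two_step_label p 0 (2 * p) 1 2) = TypeII" "label_type (two_step_label p 0 (2 * p) (p + 1) 2) = TypeII"
    "label_type (two_step_label p 0 (2 * p) 1 (p + 1)) = TypeIII"
    using md by (simp_all add: two_step_label_def del: mod_add_self1)
  note gT = tripod_types[OF gV gr g2, unfolded T gl]
  define h where "h = of_coords (3 * p) (\<lambda>r. if r \<in> {0, 3 * p} then 0 else if r \<in> {1, p + 1, 2 * p + 1} then 1 / 2 else 1)"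
  have hV: "h \<in> trop_polys (3 * p)" by (simp add: h_def)
  have md3: "(2 * p + 1) mod p = 1" using md(1) by (metis mod_mult_self3)
  have hM: "min_set (3 * p) (ht h 0) = {0, 3 * p}"
    unfolding ht0 using p_gt_2 by (intro argmin_set_eqI[of _ _ _ 0]) (auto simp: h_def)
  have hN: "argmin_set (off_class p (3 * p) (0 mod p)) (ht h 0) = {1, p + 1, 2 * p + 1}"
  proof (rule argmin_set_eqI)
    show "{1, p + 1, 2 * p + 1} \<subseteq> off_class p (3 * p) (0 mod p)" using p_gt_2 md md3 by (simp add: off_class_def)
    show "ht h 0 s = 1 / 2" if "s \<in> {1, p + 1, 2 * p + 1}" for s
      using that p_gt_2 by (simp add: ht0 h_def) auto
    fix s assume s: "s \<in> off_class p (3 * p) (0 mod p)" "s \<notin> {1, p + 1, 2 * p + 1}"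
    then have "s \<le> 3 * p" "s mod p \<noteq> 0" by (simp_all add: off_class_def)
    then have "s \<le> 3 * p" "s \<noteq> 0" "s \<noteq> 3 * p" by (simp, metis mod_0, metis mod_mult_self2_is_0)
    then show "1 / 2 < ht h 0 s" using s(2) by (simp add: ht0 h_def)
  qed simp
  have "0 \<noteq> 3 * p" "0 mod p = 3 * p mod p" "1 \<noteq> p + 1" "1 \<noteq> 2 * p + 1" "p + 1 \<noteq> 2 * p + 1" using p_gt_2 by auto
  note h2 = tripod_root_above[OF hM this(1,2) hN this(3,4,5)]
  have hr: "{a. is_root p (3 * p) h a} = {0}"
    using root_if_tripod[OF h2(1)] p_gt_2 by (intro single_root_at_0) (auto simp: h_def)
  have hl: "label_type (two_step_label p 0 (3 * p) 1 (2 * p + 1)) = TypeIII"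
    "label_type (two_step_label p 0 (3 * p) (p + 1) (2 * p + 1)) = TypeIII"
    using md md3 by (simp_all add: two_step_label_def del: mod_add_self1)
  note hT = tripod_types[OF hV hr h2, unfolded T]
  show ?thesis
  proof (cases t; cases t')
    assume "t = TypeI" "t' = TypeI"
    then show ?thesis using fT[OF fV R(2,1) D(2)] unfolding T by (intro exI[of _ p]) simp
  next
    assume "t = TypeI" "t' = TypeII"
    then show ?thesis using fT[OF fV R(2,3) D(5)] unfolding T by (intro exI[of _ p]) simp
  next
    assume "t = TypeII" "t' = TypeI"
    then show ?thesis using fT[OF fV R(3,2) D(6)] unfolding T by (intro exI[of _ p]) simp
  next
    assume "t = TypeII" "t' = TypeII"
    then show ?thesis using gT[OF R(2,1) D(2)] unfolding T gl by (intro exI[of _ "2 * p"]) simp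
  next
    assume "t = TypeII" "t' = TypeIII"
    then show ?thesis using gT[OF R(2,3) D(5)] unfolding T gl by (intro exI[of _ "2 * p"]) simp
  next
    assume "t = TypeIII" "t' = TypeII"
    then show ?thesis using gT[OF R(3,2) D(6)] unfolding T gl by (intro exI[of _ "2 * p"]) simp
  next
    assume "t = TypeIII" "t' = TypeIII"
    then show ?thesis using hT[OF R(2,1) D(2)] unfolding T hl by (intro exI[of _ "3 * p"]) simp
  qed (use t in auto)
qed

end

theorem mainTheorem8:
  fixes p :: nat
    and v :: "'k::alg_closed_field \<Rightarrow> real"
    and Fan :: "nat \<Rightarrow> (nat \<Rightarrow>\<^sub>0 real) set set"
  assumes "prime p" and "p > 2"
    and "CHAR('k) = p"
    and "valuation v" and "\<rat> \<subseteq> value_group v"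
    and "\<And>n. coarsest_fan_on (trop_discriminant v n) (Fan n)"
  shows
    "(\<forall>n C1 C2. adjacent_cones n (Fan n) C1 C2 \<longrightarrow>
        distinct_double_roots v n (C1 \<inter> C2) \<or> coincident_double_roots v n (C1 \<inter> C2)) \<and>
     (\<forall>t1 t2. \<exists>n C1 C2. adjacent_cones n (Fan n) C1 C2 \<and>
        distinct_double_roots v n (C1 \<inter> C2) \<and>
        has_type p v n C1 t1 \<and> has_type p v n C2 t2) \<and>
     (\<forall>n C1 C2. adjacent_cones n (Fan n) C1 C2 \<longrightarrow>
        distinct_double_roots v n (C1 \<inter> C2) \<longrightarrow>
        num_maximal_cones_with_face (Fan n) (C1 \<inter> C2) = 4) \<and>
     (\<forall>t1 t2. (\<exists>n C1 C2. adjacent_cones n (Fan n) C1 C2 \<and>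
        coincident_double_roots v n (C1 \<inter> C2) \<and>
        has_type p v n C1 t1 \<and> has_type p v n C2 t2) \<longleftrightarrow>
        {t1, t2} \<noteq> {TypeI, TypeIII}) \<and>
     (\<forall>n C1 C2. adjacent_cones n (Fan n) C1 C2 \<longrightarrow>
        coincident_double_roots v n (C1 \<inter> C2) \<longrightarrow>
        num_maximal_cones_with_face (Fan n) (C1 \<inter> C2) =
          (if \<exists>i j k l. has_label p v n C1 (LabelI i j k) \<and> has_label p v n C2 (LabelI i j l) \<and>
                        distinct [i mod p, j mod p, k mod p, l mod p]
           then 4 else 3))"
proof -
  interpret discriminant_fans v p Fan
    using assms by unfold_locales
  show ?thesis
  proof (intro conjI allI impI)
    fix n C1 C2
    assume adj: "adjacent_cones n (Fan n) C1 C2"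
    then show "distinct_double_roots v n (C1 \<inter> C2) \<or> coincident_double_roots v n (C1 \<inter> C2)"
      using distinct_if_opposite coincident_if_not_opposite by blast
  next
    fix t1 t2
    show "\<exists>n C1 C2. adjacent_cones n (Fan n) C1 C2 \<and> distinct_double_roots v n (C1 \<inter> C2) \<and>
        has_type p v n C1 t1 \<and> has_type p v n C2 t2"
      by (rule distinct_types_exist)
  next
    fix n C1 C2
    assume "adjacent_cones n (Fan n) C1 C2" "distinct_double_roots v n (C1 \<inter> C2)"
    then show "num_maximal_cones_with_face (Fan n) (C1 \<inter> C2) = 4" by (rule count_distinct)
  next
    fix t1 t2
    show "(\<exists>n C1 C2. adjacent_cones n (Fan n) C1 C2 \<and> coincident_double_roots v n (C1 \<inter> C2) \<and>
        has_type p v n C1 t1 \<and> has_type p v n C2 t2) \<longleftrightarrow> {t1, t2} \<noteq> {TypeI, TypeIII}"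
      using coincident_types coincident_types_exist by meson
  next
    fix n C1 C2
    assume "adjacent_cones n (Fan n) C1 C2" "coincident_double_roots v n (C1 \<inter> C2)"
    then show "num_maximal_cones_with_face (Fan n) (C1 \<inter> C2) =
          (if \<exists>i j k l. has_label p v n C1 (LabelI i j k) \<and> has_label p v n C2 (LabelI i j l) \<and>
                        distinct [i mod p, j mod p, k mod p, l mod p]
           then 4 else 3)"
      by (rule count_coincident)
  qed
qed

end
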